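(* Let $F(z)\in\mathbb{Z}[[z]]$ be the power series with $F(0)=1$ satisfying $F(z)=(1+z+z^2)F(z^4)-z^4F(z^{16})$. For each non-zero algebraic number $\alpha$ with $|\alpha|<1$, the numbers $F(\alpha)$, $F(\alpha^4)$, $F'(\alpha)$, and $F'(\alpha^4)$ are algebraically independent over $\mathbb{Q}$.
   Context: The functional equation together with $F(0)=1$ determines the power series $F(z)=1+z+z^2+z^5+z^6+\cdots$ uniquely; it converges in the open unit disc. *)

theory Defs
  imports "HOL-Analysis.Analysis" "HOL-Library.Poly_Mapping"
begin

text \<open>
  Polynomials in the variables $X_0, X_1, \ldots$ with rational coefficients are finitely supported
  maps from monomials (finitely supported exponent functions) to coefficients.
\<close>

type_synonym rat_mpoly = "(nat \<Rightarrow>\<^sub>0 nat) \<Rightarrow>\<^sub>0 rat"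

definition rat_mpoly_vars :: "rat_mpoly \<Rightarrow> nat set" where
  "rat_mpoly_vars P = (\<Union>m\<in>Poly_Mapping.keys P. Poly_Mapping.keys m)"

definition rat_mpoly_eval :: "rat_mpoly \<Rightarrow> (nat \<Rightarrow> 'a :: field_char_0) \<Rightarrow> 'a" where
  "rat_mpoly_eval P x =
     (\<Sum>m\<in>Poly_Mapping.keys P. of_rat (Poly_Mapping.lookup P m) *
        (\<Prod>i\<in>Poly_Mapping.keys m. x i ^ Poly_Mapping.lookup m i))"

text \<open>
  Numbers are collected in a list rather than a set, so that a repeated entry makes the
  list algebraically dependent (via $X_i - X_j$).
\<close>

definition algebraically_independent_over_rat :: "'a :: field_char_0 list \<Rightarrow> bool" where
  "algebraically_independent_over_rat xs \<longleftrightarrow>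
     (\<forall>P :: rat_mpoly. rat_mpoly_vars P \<subseteq> {..<length xs} \<longrightarrow>
        rat_mpoly_eval P (\<lambda>i. xs ! i) = 0 \<longrightarrow> P = 0)"

definition complex_fps_of_int_fps :: "int fps \<Rightarrow> complex fps" where
  "complex_fps_of_int_fps F = Abs_fps (\<lambda>n. of_int (fps_nth F n))"

text \<open>
  The remaining facts show that exactly one power series is meant and that it converges in the
  open unit disc, so that \<^const>\<open>eval_fps\<close> (an infinite sum) is meaningful there.
\<close>

lemma fps_compose_X_power_nth:
  fixes F :: "int fps"
  assumes "k > 0"
  shows "fps_nth (F oo fps_X ^ k) n = (if k dvd n then fps_nth F (n div k) else 0)"
proof -
  have "fps_nth (F oo fps_X ^ k) n = (\<Sum>i=0..n. if n = k * i then fps_nth F i else 0)"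
    unfolding fps_compose_nth by (intro sum.cong refl) (simp flip: power_mult)
  also have "\<dots> = (\<Sum>i=0..n. if i = n div k then (if k dvd n then fps_nth F (n div k) else 0) else 0)"
    using assms by (intro sum.cong refl) auto
  also have "\<dots> = (if k dvd n then fps_nth F (n div k) else 0)"
    by simp
  finally show ?thesis .
qed

lemma functional_equation_iff_nth:
  fixes F :: "int fps"
  shows "F = (1 + fps_X + fps_X ^ 2) * (F oo fps_X ^ 4) - fps_X ^ 4 * (F oo fps_X ^ 16) \<longleftrightarrow>
     (\<forall>n. fps_nth F n = (if n mod 4 = 3 then 0 else fps_nth F (n div 4)) -
                        (if n mod 16 = 4 then fps_nth F (n div 16) else 0))"
proof -
  have "fps_nth ((1 + fps_X + fps_X ^ 2) * (F oo fps_X ^ 4) - fps_X ^ 4 * (F oo fps_X ^ 16)) n =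
        (if n mod 4 = 3 then 0 else fps_nth F (n div 4)) -
        (if n mod 16 = 4 then fps_nth F (n div 16) else 0)" for n
  proof -
    define q where "q = n div 4"
    have "n mod 4 < 4" by simp
    hence "n mod 4 \<in> {0, 1, 2, 3}" by auto
    moreover have "n = 4 * q + n mod 4" by (simp add: q_def)
    ultimately consider "n = 4 * q" | "n = 4 * q + 1" | "n = 4 * q + 2" | "n = 4 * q + 3" by auto
    hence 1: "fps_nth ((1 + fps_X + fps_X ^ 2) * (F oo fps_X ^ 4)) n =
          (if n mod 4 = 3 then 0 else fps_nth F (n div 4))"
    proof cases
      case 1
      moreover have "\<not> 4 dvd 4 * q - 1 \<or> q = 0" "\<not> 4 dvd 4 * q - 2 \<or> q = 0" by presburger+
      ultimately show ?thesis
        by (auto simp: distrib_right fps_X_power_mult_nth fps_compose_X_power_nth)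
    next
      case 2
      moreover have "\<not> 4 dvd 4 * q + 1" "\<not> 4 dvd 4 * q + 1 - 2 \<or> q = 0" by presburger+
      moreover have "(4 * q + 1) mod 4 = 1" "(4 * q + 1) div 4 = q" by presburger+
      ultimately show ?thesis
        by (auto simp: distrib_right fps_X_power_mult_nth fps_compose_X_power_nth)
    next
      case 3
      moreover have "\<not> 4 dvd 4 * q + 2" "\<not> 4 dvd 4 * q + 2 - 1" by presburger+
      moreover have "(4 * q + 2) mod 4 = 2" "(4 * q + 2) div 4 = q" by presburger+
      ultimately show ?thesis
        by (auto simp: distrib_right fps_X_power_mult_nth fps_compose_X_power_nth)
    next
      case 4
      moreover have "\<not> 4 dvd 4 * q + 3" "\<not> 4 dvd 4 * q + 3 - 1" "\<not> 4 dvd 4 * q + 3 - 2"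
        by presburger+
      moreover have "(4 * q + 3) mod 4 = 3" by presburger+
      ultimately show ?thesis
        by (auto simp: distrib_right fps_X_power_mult_nth fps_compose_X_power_nth)
    qed
    have "(n \<ge> 4 \<and> 16 dvd n - 4) \<longleftrightarrow> n mod 16 = 4"
    proof
      assume "n \<ge> 4 \<and> 16 dvd n - 4"
      then obtain k where "n - 4 = 16 * k" "n \<ge> 4" by auto
      hence "n = 16 * k + 4" by simp
      thus "n mod 16 = 4" by simp
    next
      assume "n mod 16 = 4"
      thus "n \<ge> 4 \<and> 16 dvd n - 4" by (metis dvd_minus_mod mod_less_eq_dividend)
    qed
    moreover have "(n - 4) div 16 = n div 16" if "n mod 16 = 4"
    proof -
      have "n = 16 * (n div 16) + 4" using that mult_div_mod_eq[of 16 n] by simp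
      hence "n - 4 = 16 * (n div 16)" by simp
      thus ?thesis by simp
    qed
    ultimately have 2: "fps_nth (fps_X ^ 4 * (F oo fps_X ^ 16)) n =
        (if n mod 16 = 4 then fps_nth F (n div 16) else 0)"
      by (auto simp: fps_X_power_mult_nth fps_compose_X_power_nth)
    show ?thesis by (simp only: fps_sub_nth 1 2)
  qed
  thus ?thesis
    unfolding fps_eq_iff by (simp only:)
qed

fun functional_equation_coeff :: "nat \<Rightarrow> int" where
  "functional_equation_coeff n =
     (if n = 0 then 1 else
        (if n mod 4 = 3 then 0 else functional_equation_coeff (n div 4)) -
        (if n mod 16 = 4 then functional_equation_coeff (n div 16) else 0))"

declare functional_equation_coeff.simps [simp del]

lemma ex1_functional_equation:
  "\<exists>!F :: int fps. fps_nth F 0 = 1 \<and>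
     F = (1 + fps_X + fps_X ^ 2) * (F oo fps_X ^ 4) - fps_X ^ 4 * (F oo fps_X ^ 16)"
proof (rule ex1I)
  let ?F = "Abs_fps functional_equation_coeff"
  show "fps_nth ?F 0 = 1 \<and>
        ?F = (1 + fps_X + fps_X ^ 2) * (?F oo fps_X ^ 4) - fps_X ^ 4 * (?F oo fps_X ^ 16)"
    unfolding functional_equation_iff_nth fps_nth_Abs_fps
  proof (intro conjI allI)
    show 0: "functional_equation_coeff 0 = 1"
      by (simp add: functional_equation_coeff.simps[of 0])
    fix n
    show "functional_equation_coeff n =
            (if n mod 4 = 3 then 0 else functional_equation_coeff (n div 4)) -
            (if n mod 16 = 4 then functional_equation_coeff (n div 16) else 0)"
      using 0 by (cases "n = 0") (simp_all add: functional_equation_coeff.simps[of n])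
  qed
next
  fix F :: "int fps"
  assume F: "fps_nth F 0 = 1 \<and>
     F = (1 + fps_X + fps_X ^ 2) * (F oo fps_X ^ 4) - fps_X ^ 4 * (F oo fps_X ^ 16)"
  have "fps_nth F n = functional_equation_coeff n" for n
  proof (induction n rule: less_induct)
    case (less n)
    show ?case
    proof (cases "n = 0")
      case False
      have "fps_nth F n = (if n mod 4 = 3 then 0 else fps_nth F (n div 4)) -
                          (if n mod 16 = 4 then fps_nth F (n div 16) else 0)"
        using F[THEN conjunct2, THEN functional_equation_iff_nth[THEN iffD1]] by blast
      with False less.IH[of "n div 4"] less.IH[of "n div 16"] show ?thesis
        by (simp add: functional_equation_coeff.simps[of n])
    qed (use F[THEN conjunct1] in \<open>simp add: functional_equation_coeff.simps[of 0]\<close>)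
  qed
  thus "F = Abs_fps functional_equation_coeff"
    by (simp add: fps_eq_iff)
qed

lemma functional_equation_conv_radius:
  fixes F :: "int fps"
  assumes "fps_nth F 0 = 1"
    and "F = (1 + fps_X + fps_X ^ 2) * (F oo fps_X ^ 4) - fps_X ^ 4 * (F oo fps_X ^ 16)"
  shows "fps_conv_radius (complex_fps_of_int_fps F) \<ge> 1"
proof -
  have bound: "\<bar>fps_nth F n\<bar> \<le> int n + 1" for n
  proof (induction n rule: less_induct)
    case (less n)
    show ?case
    proof (cases "n = 0")
      case False
      have *: "fps_nth F n = (if n mod 4 = 3 then 0 else fps_nth F (n div 4)) -
                          (if n mod 16 = 4 then fps_nth F (n div 16) else 0)"
        using assms(2)[THEN functional_equation_iff_nth[THEN iffD1]] by blast
      have "\<bar>fps_nth F (n div 4)\<bar> \<le> int (n div 4) + 1" "\<bar>fps_nth F (n div 16)\<bar> \<le> int (n div 16) + 1"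
        using less.IH False by auto
      moreover have "int (n div 4) + int (n div 16) + 1 \<le> int n" using False by linarith
      moreover have "\<bar>(if A then 0 else a) - (if B then b else 0)\<bar> \<le> m + 1"
        if "\<bar>a\<bar> \<le> p + 1" "\<bar>b\<bar> \<le> q + 1" "p + q + 1 \<le> m" "p \<ge> 0" "q \<ge> 0"
        for A B and a b p q m :: int
        using that by auto
      ultimately show ?thesis unfolding * using of_nat_0_le_iff by blast
    qed (use assms(1) in simp)
  qed
  show ?thesis
    unfolding fps_conv_radius_def
  proof (rule conv_radius_geI_ex')
    fix r :: real assume r: "0 < r" "ereal r < 1"
    have "summable (\<lambda>n. of_nat (Suc n) * r ^ n)"
      using geometric_deriv_sums[of r] r by (auto simp: sums_iff)
    thus "summable (\<lambda>n. fps_nth (complex_fps_of_int_fps F) n * of_real r ^ n)"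
    proof (rule summable_comparison_test'[where N = 0], goal_cases)
      case (1 n)
      have "real_of_int \<bar>fps_nth F n\<bar> \<le> real (Suc n)" using bound[of n] by linarith
      thus ?case using r
        by (simp add: complex_fps_of_int_fps_def norm_mult norm_power mult_right_mono)
    qed
  qed
qed

end

theory Submission
  imports Defs "HOL-Computational_Algebra.Formal_Laurent_Series"
begin

text \<open>
  Write \<open>m = 1 + z + z\<^sup>2\<close>, let \<open>\<sigma>\<close> be the substitution \<open>z \<mapsto> z\<^sup>4\<close> and \<open>\<theta> = z d/dz\<close>.

  \<^bold>\<open>Values.\<close> The vector \<open>(F, \<sigma>F, F', \<sigma>F')\<close> solves a linear system \<open>f(z) = A(z) f(z\<^sup>4)\<close> with
  \<open>A\<close> invertible off \<open>0\<close>. If \<open>P(f(\<alpha>)) = 0\<close>, iterate the system to \<open>P(Y\<^sub>k f(\<zeta>\<^sub>k)) = 0\<close> with \<open>\<zeta>\<^sub>k = \<alpha>\<^bsup>4^k\<^esup>\<close>, and write the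
  polynomials \<open>P(Y\<^sub>k x)\<^sup>j b\<close>, for monomials \<open>b\<close> in the entries of \<open>Y\<^sub>k\<close>, in terms of a maximal set
  of monomials independent over \<open>\<rat>[\<zeta>\<^sub>k]\<close>. An auxiliary combination of these polynomials that vanishes to
  high order at \<open>f\<close> yields algebraic numbers which are nonzero for infinitely many \<open>k\<close> but smaller
  than Liouville's inequality permits. This reduces the theorem to the algebraic independence of the
  four functions over \<open>\<rat>(z)\<close>.

  \<^bold>\<open>Functions.\<close> With \<open>W = \<sigma>F\<close> and \<open>\<kappa> = F/W\<close> the functional equation becomes the Riccati equation
  \<open>\<kappa> = m - z\<^sup>4/\<sigma>\<kappa>\<close>, and \<open>W = \<sigma>\<kappa> \<sigma>W\<close>. An algebraic relation for \<open>\<kappa>\<close> gives a binary form that is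
  semi-invariant under this Moebius transformation; specialising \<open>z\<close> to \<open>4\<^sup>n\<close>-th roots of unity shows
  that such a form is essentially a power of a quadratic one, and quadratic ones are excluded by
  degrees. The elements \<open>\<theta>\<kappa>\<close>, \<open>\<theta>W/W\<close> and \<open>W\<close> satisfy first order difference equations over the fields
  generated so far, so taking traces and norms shows that each is transcendental over the
  previous field unless the equation is solvable in it, which is refuted by comparing poles and degrees.
\<close>

section \<open>Ring homomorphisms and evaluation of polynomials\<close>

text \<open>Nothing is known about the algebraic relations among the 16 entries of
  \<open>Y k\<close>, and this shapes the first half. Only the polynomial growth of a maximal
  independent set of monomials enters: for arbitrarily large \<open>d\<close> its size at
  \<open>4 * d\<close> is at most \<open>4 ^ 17\<close> times its size at \<open>d\<close>, whereas
  the powers \<open>P ^ j\<close>, with \<open>j\<close> up to about \<open>d / \<delta>\<close>,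
  multiply the number of unknowns by an arbitrarily large factor. Independence also takes the place
  of a zero estimate: where \<open>P\<close> vanishes, all but the lowest power of \<open>P\<close>
  that occurs disappear, and the surviving combination of independent monomials cannot be zero for
  all large \<open>k\<close>. In the second half the point \<open>z = 1\<close> is special because
  it is fixed by the substitution of \<open>z^4\<close> for \<open>z\<close>: a semi-invariant form
  is there an eigenvector of a single Moebius map. Extracting fourth roots carries the resulting
  shape to infinitely many points, which is enough to determine polynomials in
  \<open>z\<close>.\<close>

definition rhom :: "('a::comm_ring_1 \<Rightarrow> 'b::comm_ring_1) \<Rightarrow> bool" where
  "rhom h \<longleftrightarrow> h 1 = 1 \<and> (\<forall>a b. h (a + b) = h a + h b) \<and> (\<forall>a b. h (a * b) = h a * h b)"

lemma rhomI:
  "h 1 = 1 \<Longrightarrow> (\<And>a b. h (a + b) = h a + h b) \<Longrightarrow> (\<And>a b. h (a * b) = h a * h b) \<Longrightarrow> rhom h"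
  by (simp add: rhom_def)

lemma rhom_1: "rhom h \<Longrightarrow> h 1 = 1"
  and rhom_add: "rhom h \<Longrightarrow> h (a + b) = h a + h b"
  and rhom_mult: "rhom h \<Longrightarrow> h (a * b) = h a * h b"
  by (simp_all add: rhom_def)

lemma rhom_0: assumes "rhom h" shows "h 0 = 0"
  using rhom_add[OF assms, of 0 0] by simp

lemma rhom_uminus: assumes "rhom h" shows "h (- a) = - h a"
  using rhom_add[OF assms, of a "-a"] rhom_0[OF assms] by (simp add: eq_neg_iff_add_eq_0 add.commute)

lemma rhom_diff: assumes "rhom h" shows "h (a - b) = h a - h b"
  using rhom_add[OF assms, of a "-b"] rhom_uminus[OF assms] by simp

lemma rhom_power: assumes "rhom h" shows "h (a ^ n) = h a ^ n"
  by (induction n) (simp_all add: rhom_1[OF assms] rhom_mult[OF assms])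

lemma rhom_sum: assumes "rhom h" shows "h (sum f A) = (\<Sum>a\<in>A. h (f a))"
  by (induction A rule: infinite_finite_induct) (simp_all add: rhom_0[OF assms] rhom_add[OF assms])

lemma rhom_prod: assumes "rhom h" shows "h (prod f A) = (\<Prod>a\<in>A. h (f a))"
  by (induction A rule: infinite_finite_induct) (simp_all add: rhom_1[OF assms] rhom_mult[OF assms])

lemma rhom_of_nat: assumes "rhom h" shows "h (of_nat n) = of_nat n"
  by (induction n) (simp_all add: rhom_0[OF assms] rhom_1[OF assms] rhom_add[OF assms])

lemma rhom_numeral: assumes "rhom h" shows "h (numeral n) = numeral n"
  using rhom_of_nat[OF assms, of "numeral n"] by simp

lemmas rhom_simps = rhom_0 rhom_1 rhom_add rhom_mult rhom_uminus rhom_diff rhom_power rhom_sum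
  rhom_prod rhom_of_nat rhom_numeral

lemma rhom_inverse:
  fixes h :: "'a::field \<Rightarrow> 'b::field"
  assumes "rhom h" shows "h (inverse a) = inverse (h a)"
proof (cases "a = 0")
  case False
  have "h a * h (inverse a) = 1" using False by (simp add: rhom_1[OF assms] flip: rhom_mult[OF assms])
  thus ?thesis by (metis inverse_unique)
qed (simp add: rhom_0[OF assms])

lemma rhom_divide:
  fixes h :: "'a::field \<Rightarrow> 'b::field"
  assumes "rhom h" shows "h (a / b) = h a / h b"
  by (simp add: divide_inverse rhom_mult[OF assms] rhom_inverse[OF assms])

lemma rhom_eq_0_iff:
  fixes h :: "'a::field \<Rightarrow> 'b::field"
  assumes "rhom h" shows "h a = 0 \<longleftrightarrow> a = 0"
proof
  assume "h a = 0"
  show "a = 0"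
  proof (rule ccontr)
    assume "a \<noteq> 0"
    hence "1 = h (a * inverse a)" by (simp add: rhom_1[OF assms])
    also have "\<dots> = 0" using \<open>h a = 0\<close> by (simp add: rhom_mult[OF assms])
    finally show False by simp
  qed
qed (simp add: rhom_0[OF assms])

lemma rhom_id: "rhom (\<lambda>x. x)"
  by (simp add: rhom_def)

lemma rhom_comp: "rhom g \<Longrightarrow> rhom h \<Longrightarrow> rhom (\<lambda>x. g (h x))"
  by (simp add: rhom_def)

lemma rhom_of_int: "rhom of_int"
  by (simp add: rhom_def)

lemma rhom_of_rat: "rhom (of_rat :: rat \<Rightarrow> 'a::field_char_0)"
  by (simp add: rhom_def of_rat_add of_rat_mult)

lemma rhom_fps_const: "rhom fps_const"
  by (simp add: rhom_def)

lemma rhom_pCons: "rhom (\<lambda>c. [:c:])"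
  by (simp add: rhom_def one_pCons)

lemma rhom_poly: "rhom (\<lambda>p. poly p x)"
  by (simp add: rhom_def)

text \<open>One evaluation map serves rational and integer coefficients and values in the complex
  numbers, power series and Laurent series; iterated, it evaluates polynomials in several
  variables.\<close>

definition pev :: "('a::comm_ring_1 \<Rightarrow> 'b::comm_ring_1) \<Rightarrow> 'b \<Rightarrow> 'a poly \<Rightarrow> 'b" where
  "pev h x p = poly (map_poly h p) x"

lemma pev_0 [simp]: "pev h x 0 = 0"
  by (simp add: pev_def)

lemma pev_pCons: "h 0 = 0 \<Longrightarrow> pev h x (pCons a p) = h a + x * pev h x p"
  by (simp add: pev_def map_poly_pCons)

lemma pev_const: "h 0 = 0 \<Longrightarrow> pev h x [:a:] = h a"
  by (simp add: pev_pCons)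

lemma pev_X: "rhom h \<Longrightarrow> pev h x [:0, 1:] = x"
  by (simp add: pev_pCons rhom_0 rhom_1)

lemma pev_sum:
  assumes h: "rhom h" and "degree p \<le> n"
  shows "pev h x p = (\<Sum>i\<le>n. h (coeff p i) * x ^ i)"
proof -
  have "degree (map_poly h p) \<le> n"
    using assms by (intro degree_le) (auto simp: coeff_map_poly coeff_eq_0 rhom_0)
  then have "poly (map_poly h p) x = (\<Sum>i\<le>n. coeff (map_poly h p) i * x ^ i)"
    unfolding poly_altdef by (intro sum.mono_neutral_left) (auto simp: coeff_eq_0)
  then show ?thesis using h by (simp add: pev_def coeff_map_poly rhom_0)
qed

lemma map_poly_rhom:
  assumes "rhom h" shows "rhom (map_poly h)"
proof (rule rhomI)
  note h0 = rhom_0[OF assms]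
  show "map_poly h 1 = 1" using assms by (simp add: h0 rhom_1 map_poly_1)
  show "map_poly h (p + q) = map_poly h p + map_poly h q" for p q
    by (rule poly_eqI) (simp add: coeff_map_poly h0 rhom_add[OF assms])
  show "map_poly h (p * q) = map_poly h p * map_poly h q" for p q
    by (rule poly_eqI) (simp add: coeff_map_poly h0 coeff_mult rhom_sum[OF assms] rhom_mult[OF assms])
qed

lemma rhom_pev: assumes "rhom h" shows "rhom (pev h x)"
  unfolding pev_def using rhom_comp[OF rhom_poly map_poly_rhom[OF assms]] .

lemma pev_rhom:
  assumes "rhom g" "h 0 = 0"
  shows "g (pev h x p) = pev (\<lambda>a. g (h a)) (g x) p"
  by (induction p) (simp_all add: pev_pCons rhom_simps[OF assms(1)] assms(2))

lemma pev_map_poly: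
  assumes "g 0 = 0" "h 0 = 0"
  shows "pev g x (map_poly h p) = pev (\<lambda>a. g (h a)) x p"
  by (simp add: pev_def map_poly_map_poly assms o_def)

section \<open>A Liouville inequality\<close>

text \<open>The length is the measure of height because it is submultiplicative and bounds values in
  the closed unit disc, so that no binomial factors enter the estimates.\<close>

definition poly_len :: "int poly \<Rightarrow> int" where
  "poly_len p = (\<Sum>i\<le>degree p. \<bar>coeff p i\<bar>)"

lemma poly_len_eq: "degree p \<le> n \<Longrightarrow> poly_len p = (\<Sum>i\<le>n. \<bar>coeff p i\<bar>)"
  unfolding poly_len_def by (rule sum.mono_neutral_left) (auto simp: coeff_eq_0)

lemma poly_len_nonneg: "poly_len p \<ge> 0"
  by (simp add: poly_len_def sum_nonneg)

lemma poly_len_ge_1: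
  assumes "p \<noteq> 0" shows "poly_len p \<ge> 1"
proof -
  have "\<bar>lead_coeff p\<bar> \<le> poly_len p"
    unfolding poly_len_def by (rule member_le_sum) auto
  moreover have "\<bar>lead_coeff p\<bar> \<ge> 1" using assms leading_coeff_0_iff[of p] by linarith
  ultimately show ?thesis by linarith
qed

lemma poly_len_0 [simp]: "poly_len 0 = 0" and poly_len_1 [simp]: "poly_len 1 = 1"
  by (simp_all add: poly_len_def)

lemma poly_len_add: "poly_len (p + q) \<le> poly_len p + poly_len q"
proof -
  define n where "n = max (degree p) (degree q)"
  have "poly_len (p + q) = (\<Sum>i\<le>n. \<bar>coeff p i + coeff q i\<bar>)"
    by (subst poly_len_eq[of _ n]) (auto simp: n_def degree_add_le)
  also have "\<dots> \<le> (\<Sum>i\<le>n. \<bar>coeff p i\<bar> + \<bar>coeff q i\<bar>)" by (intro sum_mono) auto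
  also have "\<dots> = poly_len p + poly_len q"
    by (simp add: poly_len_eq[of p n] poly_len_eq[of q n] n_def sum.distrib)
  finally show ?thesis .
qed

lemma poly_len_smult: "poly_len (smult c p) = \<bar>c\<bar> * poly_len p"
  by (cases "c = 0") (simp_all add: poly_len_def abs_mult sum_distrib_left)

lemma poly_len_pCons: "poly_len (pCons a p) = \<bar>a\<bar> + poly_len p"
proof -
  have "poly_len (pCons a p) = (\<Sum>i\<le>Suc (degree p). \<bar>coeff (pCons a p) i\<bar>)"
    by (rule poly_len_eq) (rule degree_pCons_le)
  also have "\<dots> = \<bar>a\<bar> + poly_len p"
    by (subst sum.atMost_Suc_shift) (simp add: poly_len_def)
  finally show ?thesis .
qed

lemma poly_len_mult: "poly_len (p * q) \<le> poly_len p * poly_len q"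
proof (induction p)
  case (pCons a p)
  have "poly_len (pCons a p * q) \<le> poly_len (smult a q) + poly_len (pCons 0 (p * q))"
    by (simp add: poly_len_add)
  also have "\<dots> \<le> \<bar>a\<bar> * poly_len q + poly_len p * poly_len q"
    using pCons.IH by (simp add: poly_len_smult poly_len_pCons)
  finally show ?case by (simp add: poly_len_pCons algebra_simps)
qed simp

lemma poly_len_power: "poly_len (p ^ n) \<le> poly_len p ^ n"
proof (induction n)
  case (Suc n)
  have "poly_len (p ^ Suc n) \<le> poly_len p * poly_len (p ^ n)"
    by (simp add: poly_len_mult)
  also have "\<dots> \<le> poly_len p ^ Suc n"
    using Suc by (simp add: mult_left_mono poly_len_nonneg)
  finally show ?case .
qed simp

lemma poly_len_sum: "poly_len (sum f A) \<le> (\<Sum>a\<in>A. poly_len (f a))"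
proof (cases "finite A")
  case True
  then show ?thesis
    by induction (auto intro: order_trans[OF poly_len_add])
qed simp

lemma norm_of_int_poly_le:
  fixes x :: complex
  assumes "norm x \<le> 1"
  shows "norm (pev of_int x p) \<le> of_int (poly_len p)"
proof -
  have "norm (pev of_int x p) \<le> (\<Sum>i\<le>degree p. norm (of_int (coeff p i) * x ^ i))"
    by (subst pev_sum[OF rhom_of_int order_refl]) (rule norm_sum)
  also have "\<dots> \<le> (\<Sum>i\<le>degree p. of_int \<bar>coeff p i\<bar> * 1)"
    unfolding norm_mult norm_power
    by (intro sum_mono mult_mono) (auto intro: power_le_one assms)
  finally show ?thesis by (simp add: poly_len_def)
qed

text \<open>Siegel's lemma by the box principle: the vectors with entries in \<open>{0..E}\<close>
  outnumber their possible images, and two vectors with the same image differ by the required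
  relation.\<close>

lemma small_integer_relation:
  fixes N :: "nat \<Rightarrow> nat \<Rightarrow> int"
  assumes N: "\<And>i j. i \<le> d \<Longrightarrow> j < d \<Longrightarrow> \<bar>N i j\<bar> \<le> int H"
  obtains e :: "nat \<Rightarrow> int" where "\<exists>i\<le>d. e i \<noteq> 0" "\<And>i. i \<le> d \<Longrightarrow> \<bar>e i\<bar> \<le> int ((2 * (d + 1) * H + 1) ^ d)"
    "\<And>j. j < d \<Longrightarrow> (\<Sum>i\<le>d. e i * N i j) = 0"
proof -
  \<comment> \<open>\<open>Q\<close> is chosen to give \<open>2 * R + 1 \<le> Q * (E + 1)\<close>;
    with \<open>E = Q ^ d\<close> there are then at most \<open>E * (E + 1) ^ d\<close>
    images.\<close>
  define Q where "Q = 2 * (d + 1) * H + 1"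
  define E where "E = Q ^ d"
  define R where "R = (d + 1) * E * H"
  define X where "X = PiE {..d} (\<lambda>_. {0..int E})"
  define V where "V = PiE {..<d} (\<lambda>_. {- int R..int R})"
  define \<phi> where "\<phi> = (\<lambda>x::nat \<Rightarrow> int. restrict (\<lambda>j. \<Sum>i\<le>d. x i * N i j) {..<d})"
  have fin: "finite V" unfolding V_def by (intro finite_PiE) auto
  have img: "\<phi> ` X \<subseteq> V"
  proof (rule image_subsetI)
    fix x assume "x \<in> X"
    hence x: "\<And>i. i \<le> d \<Longrightarrow> 0 \<le> x i \<and> x i \<le> int E" by (auto simp: X_def PiE_iff)
    have "\<bar>\<Sum>i\<le>d. x i * N i j\<bar> \<le> int R" if "j < d" for j
    proof -
      have "\<bar>\<Sum>i\<le>d. x i * N i j\<bar> \<le> (\<Sum>i\<le>d. \<bar>x i * N i j\<bar>)" by (rule sum_abs)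
      also have "\<dots> \<le> (\<Sum>i\<le>d. int E * int H)"
        using x N that by (intro sum_mono) (auto simp: abs_mult intro!: mult_mono)
      also have "\<dots> = int R" by (simp add: R_def algebra_simps)
      finally show ?thesis .
    qed
    thus "\<phi> x \<in> V" unfolding V_def \<phi>_def by (auto simp: abs_le_iff minus_le_iff)
  qed
  have "card V = (2 * R + 1) ^ d"
    by (simp add: V_def card_PiE prod_constant nat_add_distrib nat_mult_distrib)
  moreover have "card X = (E + 1) ^ (d + 1)"
    by (simp add: X_def card_PiE prod_constant nat_add_distrib del: power_Suc)
  moreover have "2 * R + 1 \<le> Q * (E + 1)"
    by (simp add: R_def Q_def algebra_simps)
  hence "(2 * R + 1) ^ d \<le> E * (E + 1) ^ d"
    using power_mono[of "2 * R + 1" "Q * (E + 1)" d] by (simp only: E_def power_mult_distrib)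
  hence "(2 * R + 1) ^ d < (E + 1) ^ (d + 1)"
    by (rule order_le_less_trans) simp
  ultimately have "card V < card X" by simp
  hence "\<not> inj_on \<phi> X" using img fin card_inj_on_le by (meson leD)
  then obtain x y where xy: "x \<in> X" "y \<in> X" "\<phi> x = \<phi> y" "x \<noteq> y" by (auto simp: inj_on_def)
  show ?thesis
  proof (rule that[of "\<lambda>i. x i - y i"])
    show "\<exists>i\<le>d. x i - y i \<noteq> 0"
    proof (rule ccontr)
      assume "\<not> ?thesis"
      hence "\<And>i. i \<in> {..d} \<Longrightarrow> x i = y i" by auto
      hence "x = y" using xy(1,2) unfolding X_def by (intro PiE_ext)
      thus False using xy by simp
    qed
    show "\<bar>x i - y i\<bar> \<le> int ((2 * (d + 1) * H + 1) ^ d)" if "i \<le> d" for i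
      using xy(1,2) that by (force simp: X_def PiE_iff E_def Q_def)
    show "(\<Sum>i\<le>d. (x i - y i) * N i j) = 0" if "j < d" for j
      using fun_cong[OF xy(3), of j] that by (simp add: \<phi>_def left_diff_distrib sum_subtractf)
  qed
qed

text \<open>One factor \<open>lead_coeff p\<close> per power of \<open>\<alpha>\<close> clears the
  denominator of reduction modulo \<open>p\<close>. A new coefficient combines two old ones,
  multiplied by the leading and by one further coefficient of \<open>p\<close>, so the growth per
  step is at most the length.\<close>

lemma power_reduction:
  fixes \<alpha> :: complex and p :: "int poly"
  assumes root: "pev of_int \<alpha> p = 0" and deg: "degree p > 0"
  shows "\<exists>c :: nat \<Rightarrow> int. (\<forall>j. \<bar>c j\<bar> \<le> poly_len p ^ i) \<and>
     of_int (lead_coeff p ^ i) * \<alpha> ^ i = (\<Sum>j<degree p. of_int (c j) * \<alpha> ^ j)"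
proof (induction i)
  case 0
  have "(\<Sum>j<degree p. of_int (if j = 0 then 1 else 0) * \<alpha> ^ j) = (1::complex)"
  proof -
    have "(\<Sum>j<degree p. of_int (if j = 0 then 1 else 0) * \<alpha> ^ j) = (\<Sum>j<degree p. if j = 0 then 1 else 0)"
      by (intro sum.cong) auto
    thus ?thesis using deg by simp
  qed
  thus ?case by (intro exI[of _ "\<lambda>j. if j = 0 then 1 else 0"]) auto
next
  case (Suc i)
  then obtain c where c: "\<And>j. \<bar>c j\<bar> \<le> poly_len p ^ i"
    "of_int (lead_coeff p ^ i) * \<alpha> ^ i = (\<Sum>j<degree p. of_int (c j) * \<alpha> ^ j)" by auto
  define a where "a = lead_coeff p"
  obtain n where n: "degree p = Suc n" using deg by (cases "degree p") auto
  \<comment> \<open>The coefficients after multiplication by \<open>a * \<alpha>\<close>: a shift,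
    and the top term rewritten by \<open>rt\<close>. They are 0 beyond \<open>n\<close>, so that the
    bound holds for all \<open>j\<close>.\<close>
  define c' where "c' = (\<lambda>j. if j \<le> n then (if j = 0 then 0 else a * c (j - 1)) - c n * coeff p j else 0)"
  have rt: "of_int a * \<alpha> ^ Suc n = - (\<Sum>j<Suc n. of_int (coeff p j) * \<alpha> ^ j)"
  proof -
    have "0 = (\<Sum>j\<le>Suc n. of_int (coeff p j) * \<alpha> ^ j)"
      using root pev_sum[OF rhom_of_int, of p "Suc n" \<alpha>] n by simp
    also have "{..Suc n} = insert (Suc n) {..<Suc n}" by auto
    finally show ?thesis by (simp add: a_def n eq_neg_iff_add_eq_0 add.commute del: sum.lessThan_Suc)
  qed
  have "of_int (lead_coeff p ^ Suc i) * \<alpha> ^ Suc i = (of_int a * \<alpha>) * (of_int (a ^ i) * \<alpha> ^ i)"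
    by (simp add: a_def algebra_simps)
  also have "of_int (a ^ i) * \<alpha> ^ i = (\<Sum>j<Suc n. of_int (c j) * \<alpha> ^ j)"
    using c(2) by (simp only: a_def n)
  also have "(of_int a * \<alpha>) * \<dots> = (\<Sum>j<n. of_int (a * c j) * \<alpha> ^ Suc j) + of_int (c n) * (of_int a * \<alpha> ^ Suc n)"
    by (simp add: algebra_simps sum_distrib_left)
  also have "(\<Sum>j<n. of_int (a * c j) * \<alpha> ^ Suc j) = (\<Sum>j<Suc n. of_int (if j = 0 then 0 else a * c (j - 1)) * \<alpha> ^ j)"
    by (subst sum.lessThan_Suc_shift) simp
  also have "\<dots> + of_int (c n) * (of_int a * \<alpha> ^ Suc n) = (\<Sum>j<Suc n. of_int (c' j) * \<alpha> ^ j)"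
    unfolding rt by (simp add: c'_def sum_subtractf left_diff_distrib sum_distrib_left mult.assoc flip: sum_negf
        del: sum.lessThan_Suc)
  finally have eq: "of_int (lead_coeff p ^ Suc i) * \<alpha> ^ Suc i = (\<Sum>j<degree p. of_int (c' j) * \<alpha> ^ j)"
    by (simp only: n)
  have "\<bar>c' j\<bar> \<le> poly_len p ^ Suc i" for j
  proof (cases "j \<le> n")
    case True
    have "\<bar>c' j\<bar> \<le> \<bar>a\<bar> * poly_len p ^ i + poly_len p ^ i * \<bar>coeff p j\<bar>"
    proof -
      have "\<bar>if j = 0 then 0 else a * c (j - 1)\<bar> \<le> \<bar>a\<bar> * poly_len p ^ i"
        using c(1) by (auto simp: abs_mult poly_len_nonneg intro!: mult_left_mono)
      moreover have "\<bar>c n * coeff p j\<bar> \<le> poly_len p ^ i * \<bar>coeff p j\<bar>"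
        using c(1) by (auto simp: abs_mult intro!: mult_right_mono)
      moreover have "c' j = (if j = 0 then 0 else a * c (j - 1)) - c n * coeff p j" using True by (simp add: c'_def)
      ultimately show ?thesis by linarith
    qed
    also have "\<dots> = (\<bar>a\<bar> + \<bar>coeff p j\<bar>) * poly_len p ^ i" by (simp add: algebra_simps)
    also have "\<bar>a\<bar> + \<bar>coeff p j\<bar> \<le> poly_len p"
    proof -
      have "(\<Sum>k\<in>{Suc n, j}. \<bar>coeff p k\<bar>) \<le> poly_len p"
        unfolding poly_len_def n using True by (intro sum_mono2) auto
      thus ?thesis using True by (simp add: a_def n)
    qed
    finally show ?thesis by (simp add: mult_right_mono poly_len_nonneg)
  qed (simp add: c'_def poly_len_nonneg)
  with eq show ?case by blast
qed

lemma poly_reduction: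
  fixes \<alpha> :: complex and p T :: "int poly"
  assumes root: "pev of_int \<alpha> p = 0" and deg: "degree p > 0" and T: "degree T \<le> n"
  shows "\<exists>c :: nat \<Rightarrow> int. (\<forall>j. \<bar>c j\<bar> \<le> poly_len p ^ n * poly_len T) \<and>
     of_int (lead_coeff p ^ n) * pev of_int \<alpha> T = (\<Sum>j<degree p. of_int (c j) * \<alpha> ^ j)"
proof -
  define a where "a = lead_coeff p"
  have "\<forall>i. \<exists>c :: nat \<Rightarrow> int. (\<forall>j. \<bar>c j\<bar> \<le> poly_len p ^ i) \<and>
     of_int (a ^ i) * \<alpha> ^ i = (\<Sum>j<degree p. of_int (c j) * \<alpha> ^ j)"
    using power_reduction[OF root deg] by (auto simp: a_def)
  then obtain c where c: "\<And>i j. \<bar>c i j\<bar> \<le> poly_len p ^ i"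
    "\<And>i. of_int (a ^ i) * \<alpha> ^ i = (\<Sum>j<degree p. of_int (c i j) * \<alpha> ^ j)" by metis
  define C where "C = (\<lambda>j. \<Sum>i\<le>n. coeff T i * a ^ (n - i) * c i j)"
  have a_le: "\<bar>a\<bar> \<le> poly_len p" unfolding poly_len_def a_def by (rule member_le_sum) auto
  have "\<bar>C j\<bar> \<le> poly_len p ^ n * poly_len T" for j
  proof -
    have "\<bar>C j\<bar> \<le> (\<Sum>i\<le>n. \<bar>coeff T i * a ^ (n - i) * c i j\<bar>)" unfolding C_def by (rule sum_abs)
    also have "\<dots> \<le> (\<Sum>i\<le>n. \<bar>coeff T i\<bar> * (poly_len p ^ (n - i) * poly_len p ^ i))"
      unfolding abs_mult power_abs mult.assoc
      by (intro sum_mono mult_mono mult_nonneg_nonneg power_mono c a_le) (auto simp: poly_len_nonneg)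
    also have "\<dots> = (\<Sum>i\<le>n. \<bar>coeff T i\<bar> * poly_len p ^ n)"
      by (intro sum.cong refl) (simp flip: power_add)
    also have "\<dots> = poly_len p ^ n * poly_len T"
      using T by (simp add: poly_len_eq mult.commute flip: sum_distrib_right)
    finally show ?thesis .
  qed
  moreover have "of_int (a ^ n) * pev of_int \<alpha> T = (\<Sum>j<degree p. of_int (C j) * \<alpha> ^ j)"
  proof -
    have "of_int (a ^ n) * pev of_int \<alpha> T = (\<Sum>i\<le>n. of_int (coeff T i * a ^ (n - i)) * (of_int (a ^ i) * \<alpha> ^ i))"
      unfolding pev_sum[OF rhom_of_int T] sum_distrib_left
    proof (intro sum.cong refl)
      fix i assume "i \<in> {..n}"
      hence "a ^ n = a ^ (n - i) * a ^ i" by (simp flip: power_add)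
      thus "of_int (a ^ n) * (of_int (coeff T i) * \<alpha> ^ i) = of_int (coeff T i * a ^ (n - i)) * (of_int (a ^ i) * \<alpha> ^ i)"
        by (simp add: algebra_simps)
    qed
    also have "\<dots> = (\<Sum>i\<le>n. \<Sum>j<degree p. of_int (coeff T i * a ^ (n - i) * c i j) * \<alpha> ^ j)"
      unfolding c(2) by (simp add: sum_distrib_left mult.assoc)
    also have "\<dots> = (\<Sum>j<degree p. of_int (C j) * \<alpha> ^ j)"
      unfolding C_def by (subst sum.swap) (simp add: sum_distrib_right)
    finally show ?thesis .
  qed
  ultimately show ?thesis by (auto simp: a_def)
qed

text \<open>No conjugates are used. For \<open>\<mu> = a ^ n * t\<close>, where \<open>a\<close> is
  the leading coefficient of \<open>p\<close>, the d + 1 numbers \<open>\<mu> ^ i\<close> are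
  integer combinations of d powers of \<open>\<alpha>\<close> and hence satisfy a small integer
  relation. Dividing by its lowest power of \<open>\<mu>\<close> exhibits a nonzero integer as a
  multiple of \<open>\<mu>\<close>, so \<open>\<mu>\<close> cannot be too small. \<open>C\<close>
  and \<open>K\<close> depend on \<open>\<alpha>\<close> only.\<close>

lemma liouville_inequality:
  fixes \<alpha> :: complex
  assumes "algebraic \<alpha>"
  obtains C :: real and K :: nat where "C \<ge> 1"
    "\<And>T n. degree T \<le> n \<Longrightarrow> pev of_int \<alpha> T \<noteq> 0 \<Longrightarrow>
       1 \<le> norm (pev of_int \<alpha> T) * (C ^ Suc n * of_int (poly_len T)) ^ K"
proof -
  obtain p :: "int poly" where p: "p \<noteq> 0" "pev of_int \<alpha> p = 0"
    using assms unfolding pev_def by (elim algebraicE') auto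
  define d where "d = degree p"
  have d: "d > 0"
  proof (rule ccontr)
    assume "\<not> d > 0"
    then obtain c where "p = [:c:]" by (auto simp: d_def elim: degree_eq_zeroE)
    with p show False by (auto simp: pev_const)
  qed
  define h where "h = poly_len p"
  have h: "h \<ge> 1" using p by (simp add: h_def poly_len_ge_1)
  define a where "a = lead_coeff p"
  have a0: "a \<noteq> 0" using p by (simp add: a_def)
  have a_le: "\<bar>a\<bar> \<le> h" unfolding h_def poly_len_def a_def by (rule member_le_sum) auto
  \<comment> \<open>This absorbs the constants in \<open>(d + 1) * E\<close>, since \<open>E\<close>
    is at most \<open>(4 * (d + 1) * H) ^ d\<close>.\<close>
  define W where "W = (4 * (d + 1)) ^ (d + 1)"
  define C where "C = real W * of_int h"
  have W1: "real W \<ge> 1" unfolding W_def of_nat_power by (rule one_le_power) simp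
  have h1: "real_of_int h \<ge> 1" using h by linarith
  have C: "C \<ge> 1" unfolding C_def using mult_mono[OF W1 h1] by simp
  show ?thesis
  \<comment> \<open>One factor pays for \<open>\<bar>a\<bar> ^ n * real W\<close>, the other
    \<open>d * d\<close> for the power of \<open>B\<close> contained in \<open>E\<close>.\<close>
  proof (rule that[of C "d * d + 1", OF C])
    fix T :: "int poly" and n
    assume T: "degree T \<le> n" and nz: "pev of_int \<alpha> T \<noteq> 0"
    define t where "t = pev of_int \<alpha> T"
    have T0: "T \<noteq> 0" using nz by auto
    define l where "l = poly_len T"
    have l: "l \<ge> 1" using T0 by (simp add: l_def poly_len_ge_1)
    define \<mu> where "\<mu> = of_int (a ^ n) * t"
    have mu: "\<mu> \<noteq> 0" using a0 nz by (simp add: \<mu>_def t_def)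
    have "\<forall>i. \<exists>c :: nat \<Rightarrow> int. (\<forall>j. \<bar>c j\<bar> \<le> (h ^ n * l) ^ i) \<and> \<mu> ^ i = (\<Sum>j<d. of_int (c j) * \<alpha> ^ j)"
    proof
      fix i
      have "degree (T ^ i) \<le> n * i" using T by (metis degree_power_le le_trans mult_le_mono1)
      from poly_reduction[OF p(2) d[unfolded d_def] this] obtain c where
        c: "\<And>j. \<bar>c j\<bar> \<le> h ^ (n * i) * poly_len (T ^ i)"
        "of_int (a ^ (n * i)) * pev of_int \<alpha> (T ^ i) = (\<Sum>j<d. of_int (c j) * \<alpha> ^ j)"
        by (auto simp: h_def a_def d_def)
      have "pev of_int \<alpha> (T ^ i) = t ^ i"
        by (simp add: t_def rhom_power[OF rhom_pev[OF rhom_of_int]])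
      hence "\<mu> ^ i = (\<Sum>j<d. of_int (c j) * \<alpha> ^ j)"
        using c(2) by (simp add: \<mu>_def power_mult_distrib power_mult)
      moreover have "\<bar>c j\<bar> \<le> (h ^ n * l) ^ i" for j
      proof -
        have "h ^ (n * i) * poly_len (T ^ i) \<le> h ^ (n * i) * l ^ i"
          using h by (intro mult_left_mono) (auto simp: l_def poly_len_power)
        thus ?thesis using c(1)[of j] by (simp add: power_mult_distrib power_mult)
      qed
      ultimately show "\<exists>c :: nat \<Rightarrow> int. (\<forall>j. \<bar>c j\<bar> \<le> (h ^ n * l) ^ i) \<and> \<mu> ^ i = (\<Sum>j<d. of_int (c j) * \<alpha> ^ j)"
        by blast
    qed
    then obtain N :: "nat \<Rightarrow> nat \<Rightarrow> int" where N: "\<And>i j. \<bar>N i j\<bar> \<le> (h ^ n * l) ^ i"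
      "\<And>i. \<mu> ^ i = (\<Sum>j<d. of_int (N i j) * \<alpha> ^ j)" by metis
    define B where "B = h ^ n * l"
    have B: "B \<ge> 1" using h l mult_mono[of 1 "h ^ n" 1 l] by (simp add: B_def)
    define H where "H = nat (B ^ d)"
    have H: "int H = B ^ d" using B by (simp add: H_def)
    have H1: "H \<ge> 1" using H B by (metis of_nat_1 of_nat_le_iff one_le_power)
    have "\<bar>N i j\<bar> \<le> int H" if "i \<le> d" "j < d" for i j
      using N(1)[of i j] power_increasing[OF that(1) B] H by (simp add: B_def)
    from small_integer_relation[of d N H, OF this] obtain e where
      e: "\<exists>i\<le>d. e i \<noteq> 0" "\<And>i. i \<le> d \<Longrightarrow> \<bar>e i\<bar> \<le> int ((2 * (d + 1) * H + 1) ^ d)"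
      "\<And>j. j < d \<Longrightarrow> (\<Sum>i\<le>d. e i * N i j) = 0" by blast
    define E where "E = (2 * (d + 1) * H + 1) ^ d"
    have rel: "(\<Sum>i\<le>d. of_int (e i) * \<mu> ^ i) = 0"
    proof -
      have "(\<Sum>i\<le>d. of_int (e i) * \<mu> ^ i) = (\<Sum>i\<le>d. \<Sum>j<d. of_int (e i * N i j) * \<alpha> ^ j)"
        unfolding N(2) by (simp add: sum_distrib_left mult.assoc)
      also have "\<dots> = (\<Sum>j<d. of_int (\<Sum>i\<le>d. e i * N i j) * \<alpha> ^ j)"
        by (subst sum.swap) (simp add: sum_distrib_right)
      also have "\<dots> = 0" using e(3) by simp
      finally show ?thesis .
    qed
    have small: "1 \<le> norm \<mu> * (real (d + 1) * real E)" if "norm \<mu> < 1"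
    proof -
      define i0 where "i0 = (LEAST i. i \<le> d \<and> e i \<noteq> 0)"
      have i0: "i0 \<le> d" "e i0 \<noteq> 0" using LeastI_ex[of "\<lambda>i. i \<le> d \<and> e i \<noteq> 0"] e(1) by (auto simp: i0_def)
      have less: "e i = 0" if "i < i0" for i
        using not_less_Least[of i "\<lambda>i. i \<le> d \<and> e i \<noteq> 0"] that i0 by (auto simp: i0_def)
      have "0 = (\<Sum>i\<in>{i0..d}. of_int (e i) * \<mu> ^ i)"
        unfolding rel[symmetric] using less by (intro sum.mono_neutral_right) force+
      also have "\<dots> = (\<Sum>i\<in>{i0..d}. \<mu> ^ i0 * (of_int (e i) * \<mu> ^ (i - i0)))"
        by (intro sum.cong) (auto simp: mult_ac simp flip: power_add)
      also have "\<dots> = \<mu> ^ i0 * (\<Sum>i\<in>{i0..d}. of_int (e i) * \<mu> ^ (i - i0))" by (simp add: sum_distrib_left)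
      finally have "0 = (\<Sum>i\<in>{i0..d}. of_int (e i) * \<mu> ^ (i - i0))" using mu by simp
      also have "\<dots> = of_int (e i0) + (\<Sum>i\<in>{Suc i0..d}. of_int (e i) * \<mu> ^ (i - i0))"
        using i0 by (subst sum.atLeast_Suc_atMost) auto
      finally have "of_int (e i0) = - (\<Sum>i\<in>{Suc i0..d}. of_int (e i) * \<mu> ^ (i - i0))"
        by (simp add: eq_neg_iff_add_eq_0)
      hence "norm (of_int (e i0) :: complex) \<le> (\<Sum>i\<in>{Suc i0..d}. norm (of_int (e i) * \<mu> ^ (i - i0)))"
        by (simp add: norm_sum)
      also have "\<dots> \<le> (\<Sum>i\<in>{Suc i0..d}. real E * norm \<mu>)"
      proof (intro sum_mono)
        fix i assume i: "i \<in> {Suc i0..d}"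
        have "\<bar>e i\<bar> \<le> int E" using e(2)[of i] i by (simp add: E_def)
        hence "\<bar>real_of_int (e i)\<bar> \<le> real E" by linarith
        moreover have "norm \<mu> ^ (i - i0) \<le> norm \<mu> ^ 1"
          using that i by (intro power_decreasing) auto
        ultimately show "norm (of_int (e i) * \<mu> ^ (i - i0)) \<le> real E * norm \<mu>"
          unfolding norm_mult norm_power by (intro mult_mono) auto
      qed
      also have "\<dots> \<le> real (d + 1) * (real E * norm \<mu>)"
        by (simp add: mult_right_mono)
      finally have "norm (of_int (e i0) :: complex) \<le> norm \<mu> * (real (d + 1) * real E)" by (simp add: mult_ac)
      moreover have "norm (of_int (e i0) :: complex) \<ge> 1"
        using i0 by (simp add: norm_of_int)
      ultimately show ?thesis by linarith
    qed
    have main: "1 \<le> norm \<mu> * (real (d + 1) * real E)"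
    proof (cases "norm \<mu> < 1")
      case False
      have "real (d + 1) * real E \<ge> 1"
        using mult_mono[of 1 "real (d + 1)" 1 "real E"] by (simp add: E_def)
      with False show ?thesis using mult_mono[of 1 "norm \<mu>" 1] by auto
    qed (rule small)
    have "real (d + 1) * real E \<le> real W * of_int B ^ (d * d)"
    proof -
      have "2 * (d + 1) * H + 1 \<le> 4 * (d + 1) * H" using H1 by (simp add: algebra_simps)
      hence "E \<le> (4 * (d + 1) * H) ^ d" unfolding E_def by (rule power_mono) simp
      also have "\<dots> = (4 * (d + 1)) ^ d * H ^ d" by (simp only: power_mult_distrib)
      finally have "(d + 1) * E \<le> (4 * (d + 1)) * ((4 * (d + 1)) ^ d * H ^ d)"
        by (intro mult_mono) auto
      hence "(d + 1) * E \<le> W * H ^ d" by (simp add: W_def mult_ac)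
      hence "real ((d + 1) * E) \<le> real (W * H ^ d)" by (simp only: of_nat_le_iff)
      moreover have "real (H ^ d) = of_int B ^ (d * d)"
        using H by (metis of_int_of_nat_eq of_int_power of_nat_power power_mult)
      ultimately show ?thesis by (simp add: algebra_simps)
    qed
    hence "1 \<le> norm \<mu> * (real W * of_int B ^ (d * d))"
      using main by (meson mult_left_mono norm_ge_zero order_trans)
    also have "norm \<mu> = of_int (\<bar>a\<bar> ^ n) * norm t" by (simp add: \<mu>_def norm_mult norm_power)
    also have "\<dots> * (real W * of_int B ^ (d * d)) = norm t * (of_int (\<bar>a\<bar> ^ n) * (real W * of_int B ^ (d * d)))"
      by (simp add: mult_ac)
    also have "\<dots> \<le> norm t * ((C ^ Suc n * of_int l) * (C ^ Suc n * of_int l) ^ (d * d))"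
    proof (intro mult_left_mono)
      have hn: "real_of_int h ^ n \<ge> 1" using h1 by simp
      have l1: "real_of_int l \<ge> 1" using l by linarith
      have W0: "real W ^ n \<ge> 1" using W1 by simp
      have CC: "C ^ Suc n * of_int l = (real W * of_int h ^ n) * (real W ^ n * of_int h * of_int l)"
        by (simp add: C_def power_mult_distrib mult_ac)
      have x: "1 \<le> real W ^ n * of_int h * of_int l"
        using mult_mono[OF mult_mono[OF W0 h1] l1] h1 W0 by simp
      have 1: "of_int (\<bar>a\<bar> ^ n) * real W \<le> C ^ Suc n * of_int l"
      proof -
        have "real_of_int \<bar>a\<bar> ^ n \<le> of_int h ^ n" using a_le by (intro power_mono) (auto simp: of_int_le_iff simp flip: of_int_abs)
        hence "of_int (\<bar>a\<bar> ^ n) * real W \<le> (real W * of_int h ^ n) * 1"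
          by (simp add: mult.commute mult_left_mono)
        also have "\<dots> \<le> (real W * of_int h ^ n) * (real W ^ n * of_int h * of_int l)"
          using x hn by (intro mult_left_mono) auto
        finally show ?thesis by (simp only: CC)
      qed
      have 2: "real_of_int B \<le> C ^ Suc n * of_int l"
      proof -
        have "real_of_int B = of_int h ^ n * of_int l" by (simp add: B_def)
        also have "\<dots> \<le> (real W ^ Suc n * of_int h) * (of_int h ^ n * of_int l)"
        proof -
          have "1 \<le> real W ^ Suc n * of_int h"
            using mult_mono[OF one_le_power[OF W1, of "Suc n"] h1] W1 by simp
          moreover have "0 \<le> of_int h ^ n * real_of_int l" using hn l1 by simp
          ultimately show ?thesis using mult_right_mono[of 1] by fastforce
        qed
        also have "\<dots> = C ^ Suc n * of_int l" by (simp add: C_def power_mult_distrib mult_ac)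
        finally show ?thesis .
      qed
      have "of_int (\<bar>a\<bar> ^ n) * real W * of_int B ^ (d * d) \<le> (C ^ Suc n * of_int l) * (C ^ Suc n * of_int l) ^ (d * d)"
        by (rule mult_mono[OF 1 power_mono[OF 2]]) (use B C l1 in auto)
      thus "of_int (\<bar>a\<bar> ^ n) * (real W * of_int B ^ (d * d)) \<le> (C ^ Suc n * of_int l) * (C ^ Suc n * of_int l) ^ (d * d)"
        by (simp only: mult.assoc)
    qed auto
    finally show "1 \<le> norm (pev of_int \<alpha> T) * (C ^ Suc n * of_int (poly_len T)) ^ (d * d + 1)"
      by (simp add: t_def l_def)
  qed
qed

section \<open>Linear systems and polynomials in four variables\<close>

text \<open>Elimination without fractions, one column at a time. The lemma is applied over the
  polynomial ring \<open>zpoly4\<close>, where \<open>e\<close> cannot be divided away.\<close>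

lemma matrix_left_inverse:
  fixes M :: "'j \<Rightarrow> 'i \<Rightarrow> 'a::idom"
  assumes "finite I" "finite J"
    and "\<And>H. (\<And>j. j \<in> J \<Longrightarrow> (\<Sum>i\<in>I. M j i * H i) = 0) \<Longrightarrow> \<forall>i\<in>I. H i = 0"
  shows "\<exists>K e. e \<noteq> 0 \<and> (\<forall>i\<in>I. \<forall>i'\<in>I. (\<Sum>j\<in>J. K i j * M j i') = (if i = i' then e else 0))"
  using assms(1,3)
proof (induction I)
  case empty
  show ?case by (intro exI[of _ "\<lambda>_ _. 0"] exI[of _ 1]) simp
next
  case (insert i0 I)
  have "\<forall>i\<in>I. H i = 0" if "\<And>j. j \<in> J \<Longrightarrow> (\<Sum>i\<in>I. M j i * H i) = 0" for H
  proof -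
    have "\<forall>i\<in>insert i0 I. (H(i0 := 0)) i = 0"
    proof (rule insert.prems)
      fix j assume "j \<in> J"
      have "(\<Sum>i\<in>insert i0 I. M j i * (H(i0 := 0)) i) = (\<Sum>i\<in>I. M j i * H i)"
        using insert.hyps by (auto intro!: sum.cong)
      thus "(\<Sum>i\<in>insert i0 I. M j i * (H(i0 := 0)) i) = 0" using that \<open>j \<in> J\<close> by simp
    qed
    thus ?thesis using insert.hyps by (metis fun_upd_apply insertCI)
  qed
  from insert.IH[OF this] obtain K e where e: "e \<noteq> 0" and
    K: "\<And>i i'. i \<in> I \<Longrightarrow> i' \<in> I \<Longrightarrow> (\<Sum>j\<in>J. K i j * M j i') = (if i = i' then e else 0)" by blast
  \<comment> \<open>\<open>H\<close> is the new column scaled by \<open>e\<close> and corrected by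
    the old ones. Its image is nonzero by injectivity, and a row \<open>j0\<close> with nonzero
    entry \<open>v\<close> becomes the pivot: the row combination \<open>f\<close> below kills the
    old columns and takes the value \<open>v\<close> on the new one.\<close>
  define H where "H = (\<lambda>i. if i = i0 then e else - (\<Sum>j\<in>J. K i j * M j i0))"
  have "\<exists>j\<in>J. (\<Sum>i\<in>insert i0 I. M j i * H i) \<noteq> 0"
    using insert.prems[of H] e by (auto simp: H_def)
  then obtain j0 where j0: "j0 \<in> J" "(\<Sum>i\<in>insert i0 I. M j0 i * H i) \<noteq> 0" by blast
  define v where "v = (\<Sum>i\<in>insert i0 I. M j0 i * H i)"
  define f where "f = (\<lambda>j. (if j = j0 then e else 0) - (\<Sum>i\<in>I. M j0 i * K i j))"
  have f_sum: "(\<Sum>j\<in>J. f j * M j i') = e * M j0 i' - (\<Sum>i\<in>I. M j0 i * (\<Sum>j\<in>J. K i j * M j i'))" for i'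
  proof -
    have "(\<Sum>j\<in>J. f j * M j i') = (\<Sum>j\<in>J. (if j = j0 then e * M j i' else 0) - (\<Sum>i\<in>I. M j0 i * K i j * M j i'))"
      by (intro sum.cong refl) (simp add: f_def left_diff_distrib sum_distrib_right)
    also have "\<dots> = e * M j0 i' - (\<Sum>j\<in>J. \<Sum>i\<in>I. M j0 i * K i j * M j i')"
      using assms(2) j0 by (simp add: sum_subtractf)
    also have "(\<Sum>j\<in>J. \<Sum>i\<in>I. M j0 i * K i j * M j i') = (\<Sum>i\<in>I. M j0 i * (\<Sum>j\<in>J. K i j * M j i'))"
      by (subst sum.swap) (simp add: sum_distrib_left mult.assoc)
    finally show ?thesis .
  qed
  have f1: "(\<Sum>j\<in>J. f j * M j i') = 0" if "i' \<in> I" for i'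
  proof -
    have "(\<Sum>i\<in>I. M j0 i * (\<Sum>j\<in>J. K i j * M j i')) = (\<Sum>i\<in>I. if i = i' then M j0 i * e else 0)"
      using K that by (intro sum.cong) auto
    thus ?thesis unfolding f_sum using insert.hyps that by simp
  qed
  have f2: "(\<Sum>j\<in>J. f j * M j i0) = v"
  proof -
    have "(\<Sum>i\<in>I. M j0 i * H i) = (\<Sum>i\<in>I. - (M j0 i * (\<Sum>j\<in>J. K i j * M j i0)))"
      using insert.hyps by (intro sum.cong) (auto simp: H_def)
    thus ?thesis
      unfolding f_sum v_def using insert.hyps by (simp add: H_def sum_negf)
  qed
  define K' where "K' = (\<lambda>i j. if i = i0 then e * f j else v * K i j - (\<Sum>j'\<in>J. K i j' * M j' i0) * f j)"
  have "(\<Sum>j\<in>J. K' i j * M j i') = (if i = i' then e * v else 0)"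
    if ii: "i \<in> insert i0 I" "i' \<in> insert i0 I" for i i'
  proof (cases "i = i0")
    case True
    hence "(\<Sum>j\<in>J. K' i j * M j i') = e * (\<Sum>j\<in>J. f j * M j i')"
      by (simp add: K'_def sum_distrib_left mult.assoc)
    thus ?thesis using True ii f1 f2 by auto
  next
    case False
    define s where "s = (\<Sum>j'\<in>J. K i j' * M j' i0)"
    have "(\<Sum>j\<in>J. K' i j * M j i') = v * (\<Sum>j\<in>J. K i j * M j i') - s * (\<Sum>j\<in>J. f j * M j i')"
      using False by (simp add: K'_def s_def[symmetric] left_diff_distrib sum_subtractf sum_distrib_left mult.assoc)
    thus ?thesis using False ii f1 f2 K[of i i'] by (auto simp: s_def[symmetric])
  qed
  thus ?case using e j0 by (intro exI[of _ K'] exI[of _ "e * v"]) (auto simp: v_def)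
qed

lemma underdetermined_system:
  fixes a :: "'v \<Rightarrow> 'u \<Rightarrow> 'a::field"
  assumes "finite V" "finite U" "card V < card U"
  shows "\<exists>x. (\<exists>u\<in>U. x u \<noteq> 0) \<and> (\<forall>v\<in>V. (\<Sum>u\<in>U. a v u * x u) = 0)"
  using assms
proof (induction V arbitrary: U a)
  case empty
  then obtain u where "u \<in> U" by fastforce
  thus ?case by (intro exI[of _ "\<lambda>_. 1"]) auto
next
  case (insert v0 V)
  show ?case
  proof (cases "\<exists>u0\<in>U. a v0 u0 \<noteq> 0")
    case False
    obtain x where "\<exists>u\<in>U. x u \<noteq> 0" "\<forall>v\<in>V. (\<Sum>u\<in>U. a v u * x u) = 0"
      using insert.IH[of U a] insert.prems insert.hyps by auto
    thus ?thesis using False by (intro exI[of _ x]) auto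
  next
    case True
    then obtain u0 where u0: "u0 \<in> U" "a v0 u0 \<noteq> 0" by blast
    define U' where "U' = U - {u0}"
    define b where "b = (\<lambda>v u. a v u - a v u0 * a v0 u / a v0 u0)"
    have U: "U = insert u0 U'" "u0 \<notin> U'" "finite U'" using u0 insert.prems by (auto simp: U'_def)
    have "card V < card U'" using insert.prems insert.hyps U by simp
    from insert.IH[OF U(3) this, of b] obtain x where
      x: "\<exists>u\<in>U'. x u \<noteq> 0" "\<And>v. v \<in> V \<Longrightarrow> (\<Sum>u\<in>U'. b v u * x u) = 0" by blast
    define s where "s = (\<Sum>u\<in>U'. a v0 u * x u)"
    define y where "y = x(u0 := - s / a v0 u0)"
    have y: "(\<Sum>u\<in>U. a v u * y u) = (\<Sum>u\<in>U'. a v u * x u) - a v u0 * s / a v0 u0" for v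
    proof -
      have "(\<Sum>u\<in>U'. a v u * y u) = (\<Sum>u\<in>U'. a v u * x u)"
        using U(2) by (intro sum.cong) (auto simp: y_def)
      thus ?thesis using U by (simp add: y_def)
    qed
    have "(\<Sum>u\<in>U. a v u * y u) = 0" if "v \<in> insert v0 V" for v
    proof (cases "v = v0")
      case True thus ?thesis unfolding y s_def[symmetric] using u0 by (simp add: s_def)
    next
      case False
      have "(\<Sum>u\<in>U'. b v u * x u) = (\<Sum>u\<in>U'. a v u * x u) - a v u0 * s / a v0 u0"
        by (simp add: b_def s_def algebra_simps sum_subtractf sum_distrib_left sum_divide_distrib)
      thus ?thesis unfolding y using x(2)[of v] False that by simp
    qed
    moreover have "\<exists>u\<in>U. y u \<noteq> 0" using x(1) U by (auto simp: y_def)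
    ultimately show ?thesis by blast
  qed
qed

text \<open>The ring \<open>\<rat>[z][X\<^sub>0][X\<^sub>1][X\<^sub>2][X\<^sub>3]\<close>.\<close>

type_synonym zpoly4 = "rat poly poly poly poly poly"

definition ev4 :: "(rat \<Rightarrow> 'b::comm_ring_1) \<Rightarrow> 'b \<Rightarrow> (nat \<Rightarrow> 'b) \<Rightarrow> zpoly4 \<Rightarrow> 'b" where
  "ev4 h z x = pev (pev (pev (pev (pev h z) (x 0)) (x 1)) (x 2)) (x 3)"

definition zconst :: "rat poly \<Rightarrow> zpoly4" where
  "zconst p = [:[:[:[:p:]:]:]:]"

definition zvar :: "nat \<Rightarrow> zpoly4" where
  "zvar i = (if i = 0 then [:[:[:[:0, 1:]:]:]:] else if i = 1 then [:[:[:0, 1:]:]:]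
     else if i = 2 then [:[:0, 1:]:] else [:0, 1:])"

lemma rhom_ev4: "rhom h \<Longrightarrow> rhom (ev4 h z x)"
  unfolding ev4_def by (intro rhom_pev)

lemma ev4_zconst: "rhom h \<Longrightarrow> ev4 h z x (zconst p) = pev h z p"
  by (simp add: ev4_def zconst_def pev_const)

lemma ev4_zvar:
  assumes h: "rhom h" and i: "i < 4"
  shows "ev4 h z x (zvar i) = x i"
proof -
  have "i = 0 \<or> i = 1 \<or> i = 2 \<or> i = 3" using i by auto
  thus ?thesis using rhom_pev[OF h]
    by (auto simp: ev4_def zvar_def pev_const pev_X rhom_pev h)
qed

lemma ev4_rhom:
  assumes "rhom g" "rhom h"
  shows "g (ev4 h z x p) = ev4 (\<lambda>c. g (h c)) (g z) (\<lambda>i. g (x i)) p"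
  unfolding ev4_def by (simp add: pev_rhom[OF assms(1)] rhom_0[OF assms(2)])

text \<open>Evaluating a power series at a point is a homomorphism only on convergent series, so the
  laws are required on a closed set \<open>S\<close>. With the identity as \<open>e\<close> this
  also expresses closure of \<open>S\<close> under polynomial expressions.\<close>

lemma pev_partial_rhom:
  assumes "\<And>a b. a \<in> S \<Longrightarrow> b \<in> S \<Longrightarrow> a + b \<in> S \<and> a * b \<in> S \<and> e (a + b) = e a + e b \<and> e (a * b) = e a * e b"
    and "\<And>c. h c \<in> S \<and> e (h c) = h' c" "h 0 = 0" "h' 0 = 0" "x \<in> S" "0 \<in> S" "e 0 = 0"
  shows "pev h x p \<in> S \<and> e (pev h x p) = pev h' (e x) p"
  by (induction p) (use assms in \<open>simp_all add: pev_pCons\<close>)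

lemma ev4_partial_rhom:
  assumes S: "\<And>a b. a \<in> S \<Longrightarrow> b \<in> S \<Longrightarrow> a + b \<in> S \<and> a * b \<in> S \<and> e (a + b) = e a + e b \<and> e (a * b) = e a * e b"
    and h: "\<And>c. h c \<in> S \<and> e (h c) = h' c" "rhom h" "rhom h'" and z: "z \<in> S" and x: "\<And>i. i < 4 \<Longrightarrow> x i \<in> S"
  shows "ev4 h z x p \<in> S \<and> e (ev4 h z x p) = ev4 h' (e z) (\<lambda>i. e (x i)) p"
proof -
  have 0: "0 \<in> S" "e 0 = 0" using h(1)[of 0] h(2,3) by (simp_all add: rhom_0)
  show ?thesis unfolding ev4_def
    by (intro pev_partial_rhom[of S e] S h(1) x z 0 pev_0) (use h(2,3) in \<open>auto simp: rhom_0 S\<close>)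
qed

lemma ex_rat_pev_nonzero:
  fixes H :: "'a::comm_ring_1 \<Rightarrow> rat poly"
  assumes "H 0 = 0" "H (coeff p n) \<noteq> 0"
  shows "\<exists>c. pev H [:c:] p \<noteq> 0"
proof -
  have "map_poly H p \<noteq> 0" using assms by (metis coeff_map_poly coeff_0)
  hence "finite {x. poly (map_poly H p) x = 0}" by (rule poly_roots_finite)
  moreover have "infinite (range (\<lambda>c::rat. [:c:]))"
    using infinite_UNIV_char_0 by (subst finite_image_iff) (auto simp: inj_on_def)
  ultimately obtain c where "poly (map_poly H p) [:c:] \<noteq> 0"
    by (metis (mono_tags, lifting) finite_subset image_subsetI mem_Collect_eq)
  thus ?thesis by (auto simp: pev_def)
qed

definition spec4 :: "(nat \<Rightarrow> rat) \<Rightarrow> zpoly4 \<Rightarrow> rat poly" where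
  "spec4 x = ev4 (\<lambda>c. [:c:]) [:0, 1:] (\<lambda>i. [:x i:])"

lemma pev_pCons_X: "pev (\<lambda>c. [:c:]) [:0, 1:] p = (p :: 'a::comm_ring_1 poly)"
  by (induction p) (simp_all add: pev_pCons)

text \<open>One variable at a time, passing to leading coefficients: a nonzero polynomial has
  finitely many roots among the infinitely many rational constants. This reduces questions on
  coefficients in \<open>zpoly4\<close> to coefficients in \<open>rat poly\<close>.\<close>

lemma ex_spec4_nonzero:
  assumes "r \<noteq> 0"
  shows "\<exists>x. spec4 x r \<noteq> 0"
proof -
  define H0 where "H0 = pev (\<lambda>c::rat. [:c:]) [:0, 1:]"
  have r0: "rhom H0" unfolding H0_def by (intro rhom_pev rhom_pCons)
  have "\<exists>c0. pev H0 [:c0:] p \<noteq> 0" if "p \<noteq> 0" for p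
    using that by (intro ex_rat_pev_nonzero[where n = "degree p"]) (auto simp: H0_def pev_pCons_X)
  hence "\<exists>c0. pev H0 [:c0:] (lead_coeff p) \<noteq> 0" if "p \<noteq> 0" for p using that by auto
  hence "\<exists>c0 c1. pev (pev H0 [:c0:]) [:c1:] p \<noteq> 0" if "p \<noteq> 0" for p
    using that by (meson ex_rat_pev_nonzero pev_0)
  hence "\<exists>c0 c1. pev (pev H0 [:c0:]) [:c1:] (lead_coeff p) \<noteq> 0" if "p \<noteq> 0" for p using that by auto
  hence "\<exists>c0 c1 c2. pev (pev (pev H0 [:c0:]) [:c1:]) [:c2:] p \<noteq> 0" if "p \<noteq> 0" for p
    using that by (meson ex_rat_pev_nonzero pev_0)
  hence "\<exists>c0 c1 c2. pev (pev (pev H0 [:c0:]) [:c1:]) [:c2:] (lead_coeff p) \<noteq> 0" if "p \<noteq> 0" for p using that by auto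
  hence "\<exists>c0 c1 c2 c3. pev (pev (pev (pev H0 [:c0:]) [:c1:]) [:c2:]) [:c3:] r \<noteq> 0"
    using assms by (meson ex_rat_pev_nonzero pev_0)
  then obtain c0 c1 c2 c3 where "pev (pev (pev (pev H0 [:c0:]) [:c1:]) [:c2:]) [:c3:] r \<noteq> 0" by blast
  hence "spec4 (\<lambda>i. if i = 0 then c0 else if i = 1 then c1 else if i = 2 then c2 else c3) r \<noteq> 0"
    by (simp add: spec4_def ev4_def H0_def)
  thus ?thesis by blast
qed

lemma pev_spec4:
  fixes \<zeta> :: "'a::field_char_0"
  shows "pev of_rat \<zeta> (spec4 x r) = ev4 of_rat \<zeta> (\<lambda>i. of_rat (x i)) r"
  unfolding spec4_def
  by (subst ev4_rhom[OF rhom_pev[OF rhom_of_rat] rhom_pCons])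
     (simp add: pev_const pev_X rhom_of_rat)

lemma ev4_line:
  fixes \<zeta> :: "'a::field_char_0"
  shows "ev4 of_rat \<zeta> (\<lambda>i. a i + t * b i) r = poly (ev4 (\<lambda>c. [:of_rat c:]) [:\<zeta>:] (\<lambda>i. [:a i, b i:]) r) t"
proof -
  have "rhom (\<lambda>c. [:of_rat c:] :: 'a poly)" by (rule rhom_comp[OF rhom_pCons rhom_of_rat])
  from ev4_rhom[OF rhom_poly this] show ?thesis by simp
qed

section \<open>Evaluation of power series in the unit disc\<close>

definition cfps :: "rat fps \<Rightarrow> complex fps" where
  "cfps g = Abs_fps (\<lambda>n. of_rat (fps_nth g n))"

definition conv1 :: "rat fps \<Rightarrow> bool" where
  "conv1 g \<longleftrightarrow> fps_conv_radius (cfps g) \<ge> 1"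

definition fev :: "rat fps \<Rightarrow> complex \<Rightarrow> complex" where
  "fev g z = eval_fps (cfps g) z"

lemma cfps_nth [simp]: "fps_nth (cfps g) n = of_rat (fps_nth g n)"
  by (simp add: cfps_def)

lemma cfps_add: "cfps (a + b) = cfps a + cfps b"
  by (simp add: fps_eq_iff of_rat_add)

lemma cfps_mult: "cfps (a * b) = cfps a * cfps b"
  by (simp add: fps_eq_iff fps_mult_nth of_rat_mult of_rat_sum)

lemma cfps_const: "cfps (fps_const c) = fps_const (of_rat c)"
  by (simp add: fps_eq_iff fps_const_def)

lemma cfps_X: "cfps fps_X = fps_X"
  by (simp add: fps_eq_iff fps_X_def)

lemma conv1_ring:
  assumes "conv1 a" "conv1 b" and z: "norm z < 1"
  shows "conv1 (a + b)" "conv1 (a * b)" "fev (a + b) z = fev a z + fev b z" "fev (a * b) z = fev a z * fev b z"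
proof -
  have *: "1 \<le> min (fps_conv_radius (cfps a)) (fps_conv_radius (cfps b))"
    using assms by (simp add: conv1_def)
  show "conv1 (a + b)" unfolding conv1_def cfps_add by (rule order_trans[OF * fps_conv_radius_add])
  show "conv1 (a * b)" unfolding conv1_def cfps_mult by (rule order_trans[OF * fps_conv_radius_mult])
  have "ereal (norm z) < 1" using z by simp
  from less_le_trans[OF this] have "ereal (norm z) < fps_conv_radius (cfps a)" "ereal (norm z) < fps_conv_radius (cfps b)"
    using assms by (simp_all only: conv1_def)
  thus "fev (a + b) z = fev a z + fev b z" "fev (a * b) z = fev a z * fev b z"
    by (simp_all add: fev_def cfps_add cfps_mult eval_fps_add eval_fps_mult)
qed

lemma conv1_const: "conv1 (fps_const c)" and conv1_X: "conv1 fps_X"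
  and fev_const: "fev (fps_const c) z = of_rat c"
  by (simp_all add: conv1_def fev_def cfps_const cfps_X)

lemma conv1_ev4:
  assumes "norm z < 1" "\<And>i. i < 4 \<Longrightarrow> conv1 (f i)"
  shows "conv1 (ev4 fps_const fps_X f p) \<and> fev (ev4 fps_const fps_X f p) z = ev4 of_rat z (\<lambda>i. fev (f i) z) p"
proof -
  have "ev4 fps_const fps_X f p \<in> Collect conv1 \<and>
        fev (ev4 fps_const fps_X f p) z = ev4 of_rat (fev fps_X z) (\<lambda>i. fev (f i) z) p"
    by (rule ev4_partial_rhom[where e = "\<lambda>g. fev g z"])
       (use assms in \<open>simp_all add: conv1_ring rhom_fps_const rhom_of_rat conv1_const conv1_X fev_const\<close>)
  thus ?thesis by (simp add: fev_def cfps_X)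
qed

text \<open>\<open>fps_X ^ p\<close> splits off and the cofactor is bounded on a compact disc. This
  turns order of vanishing at 0 into smallness at the points \<open>\<zeta> k\<close>.\<close>

lemma fev_bound:
  assumes g: "conv1 g" and v: "\<And>n. n < p \<Longrightarrow> fps_nth g n = 0" and a: "a < 1"
  obtains C where "C \<ge> 0" "\<And>z. norm z \<le> a \<Longrightarrow> norm (fev g z) \<le> C * norm z ^ p"
proof -
  define g' where "g' = fps_shift p (cfps g)"
  have eq: "cfps g = fps_X ^ p * g'"
    using v by (auto simp: fps_eq_iff g'_def fps_X_power_mult_nth)
  have r: "fps_conv_radius g' \<ge> 1" using g by (simp add: g'_def conv1_def)
  have "cball (0::complex) a \<subseteq> eball 0 (fps_conv_radius g')"
  proof
    fix x :: complex assume "x \<in> cball 0 a"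
    hence "ereal (norm x) < 1" using a by auto
    from less_le_trans[OF this r] show "x \<in> eball 0 (fps_conv_radius g')" by simp
  qed
  hence "compact (eval_fps g' ` cball 0 a)"
    by (intro compact_continuous_image continuous_on_eval_fps[THEN continuous_on_subset]) auto
  then obtain C where C: "\<And>z. norm z \<le> a \<Longrightarrow> norm (eval_fps g' z) \<le> C"
    by (fastforce dest!: compact_imp_bounded simp: bounded_iff)
  show ?thesis
  proof (rule that[of "max C 0"])
    fix z :: complex assume z: "norm z \<le> a"
    have "ereal (norm z) < 1" using z a by simp
    from less_le_trans[OF this r] have "ereal (norm z) < fps_conv_radius g'" .
    hence eq': "fev g z = z ^ p * eval_fps g' z"
      unfolding fev_def eq by (subst eval_fps_mult) auto
    have "norm z ^ p * norm (eval_fps g' z) \<le> norm z ^ p * max C 0"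
      using C[OF z] by (intro mult_left_mono) auto
    thus "norm (fev g z) \<le> max C 0 * norm z ^ p"
      unfolding eq' norm_mult norm_power by (simp only: mult.commute)
  qed simp
qed

lemma pev_pcompose_monom:
  fixes x :: "'a::comm_ring_1"
  shows "pev of_int x (p \<circ>\<^sub>p monom 1 n) = pev of_int (x ^ n) p"
proof (induction p)
  case (pCons a p)
  have "pev of_int x (monom 1 n) = x ^ n"
    by (simp add: pev_def map_poly_monom poly_monom)
  with pCons show ?case
    by (simp add: pcompose_pCons pev_pCons rhom_simps[OF rhom_pev[OF rhom_of_int]] pev_const)
qed simp

lemma poly_len_pcompose_monom: "poly_len (p \<circ>\<^sub>p monom 1 n) \<le> poly_len p"
proof (induction p)
  case (pCons a p)
  have m: "poly_len (monom 1 n) = 1"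
    by (simp add: poly_len_def degree_monom_eq coeff_monom if_distrib[where f = abs] cong: if_cong)
  have "poly_len (pCons a p \<circ>\<^sub>p monom 1 n) \<le> poly_len [:a:] + poly_len (monom 1 n * (p \<circ>\<^sub>p monom 1 n))"
    by (simp add: pcompose_pCons poly_len_add)
  also have "\<dots> \<le> \<bar>a\<bar> + poly_len p"
    using pCons poly_len_mult[of "monom 1 n" "p \<circ>\<^sub>p monom 1 n"] by (simp add: poly_len_pCons m)
  finally show ?case by (simp add: poly_len_pCons)
qed simp

lemma poly_len_prod: "poly_len (prod f A) \<le> (\<Prod>a\<in>A. poly_len (f a))"
proof (induction A rule: infinite_finite_induct)
  case (insert x F)
  have "poly_len (prod f (insert x F)) \<le> poly_len (f x) * poly_len (prod f F)"
    using insert by (simp add: poly_len_mult)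
  also have "\<dots> \<le> poly_len (f x) * (\<Prod>a\<in>F. poly_len (f a))"
    using insert by (intro mult_left_mono) (auto simp: poly_len_nonneg)
  finally show ?case using insert by simp
qed auto

text \<open>Kronecker's substitution: \<open>N\<close> exceeds every exponent, so on the curve
  \<open>t ^ (N ^ i)\<close> distinct monomials become distinct powers of \<open>t\<close>, by
  uniqueness of digits in base \<open>N\<close>.\<close>

lemma ex_rat_mpoly_eval_nonzero:
  assumes P: "P \<noteq> 0" and vars: "rat_mpoly_vars P \<subseteq> {..<4}"
  shows "\<exists>x :: nat \<Rightarrow> complex. rat_mpoly_eval P x \<noteq> 0"
proof -
  define N where "N = Suc (\<Sum>m\<in>Poly_Mapping.keys P. \<Sum>i<4. Poly_Mapping.lookup m i)"
  define E where "E = (\<lambda>m::nat \<Rightarrow>\<^sub>0 nat. \<Sum>i<4. Poly_Mapping.lookup m i * N ^ i)"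
  have keys: "Poly_Mapping.keys m \<subseteq> {..<4}" if "m \<in> Poly_Mapping.keys P" for m
    using vars that by (auto simp: rat_mpoly_vars_def)
  have lt: "Poly_Mapping.lookup m i < N" if "m \<in> Poly_Mapping.keys P" "i < 4" for m i
  proof -
    have "Poly_Mapping.lookup m i \<le> (\<Sum>i<4. Poly_Mapping.lookup m i)"
      using that by (intro member_le_sum) auto
    also have "\<dots> \<le> (\<Sum>m\<in>Poly_Mapping.keys P. \<Sum>i<4. Poly_Mapping.lookup m i)"
      using that by (intro member_le_sum[of m _ "\<lambda>m. \<Sum>i<4. Poly_Mapping.lookup m i"]) auto
    finally show ?thesis by (simp add: N_def)
  qed
  have inj: "inj_on E (Poly_Mapping.keys P)"
  proof (rule inj_onI)
    fix m m' assume mm: "m \<in> Poly_Mapping.keys P" "m' \<in> Poly_Mapping.keys P" "E m = E m'"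
    let ?a = "Poly_Mapping.lookup m" and ?b = "Poly_Mapping.lookup m'"
    have N: "N > 0" by (simp add: N_def)
    have exp: "(\<Sum>i<4. g i * N ^ i) = g 0 + N * (g 1 + N * (g 2 + N * g 3))" for g :: "nat \<Rightarrow> nat"
      by (simp add: eval_nat_numeral algebra_simps)
    have digit: "a = b \<and> c = d" if "a + N * c = b + N * d" "a < N" "b < N" for a b c d :: nat
      using arg_cong[OF that(1), of "\<lambda>x. x mod N"] arg_cong[OF that(1), of "\<lambda>x. x div N"] that(2,3) by simp
    have l: "?a 0 < N" "?b 0 < N" "?a 1 < N" "?b 1 < N" "?a 2 < N" "?b 2 < N"
      using lt mm by auto
    have "?a 0 + N * (?a 1 + N * (?a 2 + N * ?a 3)) = ?b 0 + N * (?b 1 + N * (?b 2 + N * ?b 3))"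
      using mm(3) unfolding E_def exp .
    from digit[OF this l(1,2)] have 0: "?a 0 = ?b 0"
      and "?a 1 + N * (?a 2 + N * ?a 3) = ?b 1 + N * (?b 2 + N * ?b 3)" by auto
    from digit[OF this(2) l(3,4)] have 1: "?a 1 = ?b 1"
      and "?a 2 + N * ?a 3 = ?b 2 + N * ?b 3" by auto
    from digit[OF this(2) l(5,6)] have 2: "?a 2 = ?b 2" "?a 3 = ?b 3" by auto
    show "m = m'"
    proof (rule poly_mapping_eqI)
      fix i
      show "?a i = ?b i"
      proof (cases "i < 4")
        case True
        hence "i = 0 \<or> i = 1 \<or> i = 2 \<or> i = 3" by auto
        thus ?thesis using 0 1 2 by auto
      next
        case False
        thus ?thesis using keys[OF mm(1)] keys[OF mm(2)] by (metis in_keys_iff lessThan_iff subset_eq)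
      qed
    qed
  qed
  define p :: "complex poly" where
    "p = (\<Sum>m\<in>Poly_Mapping.keys P. monom (of_rat (Poly_Mapping.lookup P m)) (E m))"
  obtain m0 where m0: "m0 \<in> Poly_Mapping.keys P" using P by fastforce
  have "coeff p (E m0) = (\<Sum>m\<in>Poly_Mapping.keys P. if m = m0 then of_rat (Poly_Mapping.lookup P m) else 0)"
    unfolding p_def coeff_sum using inj m0
    by (intro sum.cong) (auto simp: coeff_monom inj_on_def)
  hence "coeff p (E m0) \<noteq> 0" using m0 by (simp add: in_keys_iff)
  hence "p \<noteq> 0" by auto
  then obtain t where t: "poly p t \<noteq> 0" using poly_all_0_iff_0 by blast
  have "rat_mpoly_eval P (\<lambda>i. t ^ (N ^ i)) = poly p t"
    unfolding rat_mpoly_eval_def p_def poly_sum poly_monom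
  proof (intro sum.cong refl)
    fix m assume m: "m \<in> Poly_Mapping.keys P"
    have "(\<Prod>i\<in>Poly_Mapping.keys m. (t ^ N ^ i) ^ Poly_Mapping.lookup m i) = (\<Prod>i<4. (t ^ N ^ i) ^ Poly_Mapping.lookup m i)"
      using keys[OF m] by (intro prod.mono_neutral_left) (auto simp: in_keys_iff)
    also have "\<dots> = t ^ E m" by (simp add: E_def power_sum mult.commute flip: power_mult)
    finally show "of_rat (Poly_Mapping.lookup P m) * (\<Prod>i\<in>Poly_Mapping.keys m. (t ^ N ^ i) ^ Poly_Mapping.lookup m i) =
       of_rat (Poly_Mapping.lookup P m) * t ^ E m" by simp
  qed
  with t show ?thesis by metis
qed

lemma rat_mpoly_eval_cong:
  assumes "rat_mpoly_vars P \<subseteq> I" "\<And>i. i \<in> I \<Longrightarrow> x i = y i"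
  shows "rat_mpoly_eval P x = rat_mpoly_eval P y"
  unfolding rat_mpoly_eval_def using assms
  by (intro sum.cong refl arg_cong2[of _ _ _ _ times] prod.cong) (auto simp: rat_mpoly_vars_def)

text \<open>Since \<open>4 ^ k \<ge> k * k\<close>, the product is at most the k-th power of
  \<open>W * t ^ k\<close>, which is eventually below 1/2.\<close>

lemma power_tower_decay:
  fixes W t :: real
  assumes "W \<ge> 0" "0 \<le> t" "t < 1"
  shows "(\<lambda>k. W ^ k * t ^ (4 ^ k)) \<longlonglongrightarrow> 0"
proof -
  have "(\<lambda>k. W * t ^ k) \<longlonglongrightarrow> W * 0" using assms by (intro tendsto_mult LIMSEQ_realpow_zero) auto
  hence "\<forall>\<^sub>F k in sequentially. W * t ^ k < 1 / 2" by (rule order_tendstoD) simp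
  hence "\<forall>\<^sub>F k in sequentially. norm (W ^ k * t ^ (4 ^ k)) \<le> (1 / 2) ^ k"
  proof eventually_elim
    case (elim k)
    have "k < 2 ^ k" by (rule less_exp)
    hence "k * k \<le> 2 ^ k * 2 ^ k" by (intro mult_mono) auto
    also have "\<dots> = (4::nat) ^ k" by (simp flip: power_mult_distrib)
    finally have "t ^ (4 ^ k) \<le> t ^ (k * k)" using assms by (intro power_decreasing) auto
    hence "W ^ k * t ^ (4 ^ k) \<le> (W * t ^ k) ^ k"
      using assms by (simp add: power_mult_distrib power_mult mult_left_mono)
    also have "\<dots> \<le> (1 / 2) ^ k" using elim assms by (intro power_mono) auto
    finally show ?case using assms by simp
  qed
  thus ?thesis by (rule Lim_null_comparison) (intro LIMSEQ_realpow_zero; simp)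
qed

section \<open>Mahler systems\<close>

text \<open>Integer entries in \<open>A\<close> make all iterates integer polynomials in
  \<open>\<alpha>\<close>, as Liouville's inequality requires. \<open>surj\<close> is invertibility
  of the matrix at nonzero points, in the form in which it is applied; \<open>indep\<close> is
  algebraic independence of the functions over the rational functions.\<close>

locale mahler_system =
  fixes \<alpha> :: complex and A :: "nat \<Rightarrow> nat \<Rightarrow> int poly" and f :: "nat \<Rightarrow> rat fps"
  assumes alg: "algebraic \<alpha>" and alpha_nz: "\<alpha> \<noteq> 0" and alpha_lt_1: "norm \<alpha> < 1"
    and conv: "\<And>i. i < 4 \<Longrightarrow> conv1 (f i)"
    and feq: "\<And>i z. i < 4 \<Longrightarrow> norm z < 1 \<Longrightarrow>
      fev (f i) z = (\<Sum>j<4. pev of_int z (A i j) * fev (f j) (z ^ 4))"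
    and surj: "\<And>z t. z \<noteq> 0 \<Longrightarrow> \<exists>x. \<forall>i<4. (\<Sum>j<4. pev of_int z (A i j) * x j) = (t i :: complex)"
    and indep: "\<And>p. ev4 fps_const fps_X f p = 0 \<Longrightarrow> p = 0"
begin

definition \<zeta> :: "nat \<Rightarrow> complex" where "\<zeta> k = \<alpha> ^ (4 ^ k)"

text \<open>The product of \<open>A\<close> at \<open>z\<close>, \<open>z^4\<close>, and so on up to
  \<open>z^(4^(k-1))\<close>. It is kept as a matrix of polynomials, not only of values at
  \<open>\<alpha>\<close>, because degrees and lengths have to be estimated.\<close>

primrec AA :: "nat \<Rightarrow> nat \<Rightarrow> nat \<Rightarrow> int poly" where
  "AA 0 = (\<lambda>i j. if i = j then 1 else 0)"
| "AA (Suc k) = (\<lambda>i j. \<Sum>l<4. AA k i l * (A l j \<circ>\<^sub>p monom 1 (4 ^ k)))"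

definition Y :: "nat \<Rightarrow> nat \<Rightarrow> nat \<Rightarrow> complex" where "Y k i j = pev of_int \<alpha> (AA k i j)"

lemma Y_0: "Y 0 i j = (if i = j then 1 else 0)"
  by (simp add: Y_def rhom_simps[OF rhom_pev[OF rhom_of_int]])

lemma Y_Suc: "Y (Suc k) i j = (\<Sum>l<4. Y k i l * pev of_int (\<zeta> k) (A l j))"
  by (simp add: Y_def \<zeta>_def rhom_simps[OF rhom_pev[OF rhom_of_int]] pev_pcompose_monom)

lemma zeta_nz: "\<zeta> k \<noteq> 0"
  using alpha_nz by (simp add: \<zeta>_def)

lemma norm_zeta: "norm (\<zeta> k) = norm \<alpha> ^ (4 ^ k)"
  by (simp add: \<zeta>_def norm_power)

lemma norm_zeta_le: "norm (\<zeta> k) \<le> norm \<alpha>"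
  unfolding norm_zeta using alpha_lt_1 power_decreasing[of 1 "4 ^ k" "norm \<alpha>"] by simp

lemma norm_zeta_lt_1: "norm (\<zeta> k) < 1"
  using norm_zeta_le[of k] alpha_lt_1 by linarith

lemma zeta_Suc: "\<zeta> (Suc k) = \<zeta> k ^ 4"
  by (simp add: \<zeta>_def mult.commute flip: power_mult)

text \<open>Distinctness leaves a nonzero polynomial only finitely many zeros among these points;
  for this reason relations valid for large \<open>k\<close> can be read as relations over
  \<open>rat poly\<close>.\<close>

lemma inj_zeta: "inj \<zeta>"
proof (rule injI)
  fix k l assume "\<zeta> k = \<zeta> l"
  hence "norm \<alpha> ^ (4 ^ k) = norm \<alpha> ^ (4 ^ l)" by (metis norm_zeta)
  hence "(4::nat) ^ k = 4 ^ l"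
    using alpha_lt_1 alpha_nz power_strict_decreasing_iff[of "norm \<alpha>" "4 ^ k" "4 ^ l"]
      power_strict_decreasing_iff[of "norm \<alpha>" "4 ^ l" "4 ^ k"] by auto
  thus "k = l" by simp
qed

lemma fev_alpha: "i < 4 \<Longrightarrow> fev (f i) \<alpha> = (\<Sum>j<4. Y k i j * fev (f j) (\<zeta> k))"
proof (induction k)
  case 0
  have "(\<Sum>j<4. Y 0 i j * fev (f j) (\<zeta> 0)) = (\<Sum>j<4. if j = i then fev (f j) \<alpha> else 0)"
    by (intro sum.cong) (auto simp: Y_0 \<zeta>_def)
  thus ?case using 0 by simp
next
  case (Suc k)
  have "fev (f i) \<alpha> = (\<Sum>l<4. Y k i l * fev (f l) (\<zeta> k))" using Suc by simp
  also have "\<dots> = (\<Sum>l<4. \<Sum>j<4. Y k i l * pev of_int (\<zeta> k) (A l j) * fev (f j) (\<zeta> (Suc k)))"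
    by (intro sum.cong refl) (simp add: feq norm_zeta_lt_1 zeta_Suc sum_distrib_left mult.assoc)
  also have "\<dots> = (\<Sum>j<4. Y (Suc k) i j * fev (f j) (\<zeta> (Suc k)))"
    by (subst sum.swap) (simp add: Y_Suc sum_distrib_right)
  finally show ?case .
qed

lemma Y_surj: "\<exists>x. \<forall>i<4. (\<Sum>j<4. Y k i j * x j) = t i"
proof (induction k arbitrary: t)
  case 0
  have "(\<Sum>j<4. Y 0 i j * t j) = t i" if "i < 4" for i
  proof -
    have "(\<Sum>j<4. Y 0 i j * t j) = (\<Sum>j<4. if j = i then t j else 0)"
      by (intro sum.cong) (auto simp: Y_0)
    thus ?thesis using that by simp
  qed
  thus ?case by blast
next
  case (Suc k)
  obtain x where x: "\<forall>i<4. (\<Sum>j<4. Y k i j * x j) = t i" using Suc by blast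
  obtain y where y: "\<forall>i<4. (\<Sum>j<4. pev of_int (\<zeta> k) (A i j) * y j) = x i" using surj[OF zeta_nz] by blast
  have "(\<Sum>j<4. Y (Suc k) i j * y j) = t i" if "i < 4" for i
  proof -
    have "(\<Sum>j<4. Y (Suc k) i j * y j) = (\<Sum>l<4. \<Sum>j<4. Y k i l * pev of_int (\<zeta> k) (A l j) * y j)"
      by (subst sum.swap) (simp add: Y_Suc sum_distrib_right)
    also have "\<dots> = (\<Sum>l<4. Y k i l * x l)"
      using y by (intro sum.cong refl) (simp add: mult.assoc flip: sum_distrib_left)
    finally show ?thesis using x that by simp
  qed
  thus ?case by blast
qed

text \<open>Composition with \<open>monom 1 (4 ^ k)\<close> multiplies degrees but does not increase
  lengths, so degrees grow like \<open>4 ^ k\<close> and lengths only like \<open>LA ^ k\<close>.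
  The final comparison rests on this gap. The factor 4 in \<open>LA\<close> counts the summands of
  an entry of a matrix product.\<close>

definition dA :: nat where "dA = (\<Sum>i<4. \<Sum>j<4. degree (A i j))"
definition LA :: int where "LA = 4 * (1 + (\<Sum>i<4. \<Sum>j<4. poly_len (A i j)))"

lemma dA: "i < 4 \<Longrightarrow> j < 4 \<Longrightarrow> degree (A i j) \<le> dA"
proof -
  assume ij: "i < 4" "j < 4"
  have "degree (A i j) \<le> (\<Sum>j<4. degree (A i j))" using ij by (intro member_le_sum) auto
  also have "\<dots> \<le> dA" unfolding dA_def using ij by (intro member_le_sum[of i _ "\<lambda>i. \<Sum>j<4. degree (A i j)"]) auto
  finally show ?thesis .
qed

lemma LA: assumes ij: "i < 4" "j < 4" shows "4 * poly_len (A i j) \<le> LA" and LA_ge_1: "1 \<le> LA"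
proof -
  have "poly_len (A i j) \<le> (\<Sum>j<4. poly_len (A i j))" using ij by (intro member_le_sum) (auto simp: poly_len_nonneg)
  also have "\<dots> \<le> (\<Sum>i<4. \<Sum>j<4. poly_len (A i j))"
    using ij by (intro member_le_sum[of i _ "\<lambda>i. \<Sum>j<4. poly_len (A i j)"]) (auto simp: poly_len_nonneg sum_nonneg)
  finally show "4 * poly_len (A i j) \<le> LA" by (simp add: LA_def)
  have "(\<Sum>i<4. \<Sum>j<4. poly_len (A i j)) \<ge> 0" by (intro sum_nonneg) (auto simp: poly_len_nonneg)
  thus "1 \<le> LA" by (simp add: LA_def)
qed

lemma degree_AA: "i < 4 \<Longrightarrow> j < 4 \<Longrightarrow> degree (AA k i j) \<le> dA * 4 ^ k"
proof (induction k arbitrary: j)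
  case (Suc k)
  have "degree (AA k i l * (A l j \<circ>\<^sub>p monom 1 (4 ^ k))) \<le> dA * 4 ^ Suc k" if "l < 4" for l
  proof -
    have "degree (AA k i l * (A l j \<circ>\<^sub>p monom 1 (4 ^ k))) \<le> degree (AA k i l) + degree (A l j \<circ>\<^sub>p monom 1 (4 ^ k))"
      by (rule degree_mult_le)
    also have "\<dots> \<le> dA * 4 ^ k + dA * 4 ^ k"
      using Suc that dA[of l j] by (intro add_mono) (auto simp: degree_pcompose degree_monom_eq)
    also have "\<dots> \<le> dA * 4 ^ Suc k" by simp
    finally show ?thesis .
  qed
  thus ?case by (simp del: power_Suc) (intro degree_sum_le; simp)
qed auto

lemma poly_len_AA: "i < 4 \<Longrightarrow> j < 4 \<Longrightarrow> poly_len (AA k i j) \<le> LA ^ k"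
proof (induction k arbitrary: j)
  case (Suc k)
  have "poly_len (AA (Suc k) i j) \<le> (\<Sum>l<4. poly_len (AA k i l * (A l j \<circ>\<^sub>p monom 1 (4 ^ k))))"
    by (simp only: AA.simps poly_len_sum)
  also have "\<dots> \<le> (\<Sum>l<4. LA ^ k * poly_len (A l j))"
  proof (intro sum_mono)
    fix l :: nat assume "l \<in> {..<4}"
    thus "poly_len (AA k i l * (A l j \<circ>\<^sub>p monom 1 (4 ^ k))) \<le> LA ^ k * poly_len (A l j)"
      using Suc LA_ge_1[of 0 0]
      by (intro order_trans[OF poly_len_mult] mult_mono) (auto simp: poly_len_pcompose_monom poly_len_nonneg)
  qed
  also have "4 * \<dots> \<le> (\<Sum>l::nat<4. LA ^ k * LA)"
    unfolding sum_distrib_left using LA Suc.prems LA_ge_1[of 0 0]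
    by (intro sum_mono) (auto simp: mult.left_commute intro!: mult_left_mono)
  hence "(\<Sum>l<4. LA ^ k * poly_len (A l j)) \<le> LA ^ Suc k" by (simp add: mult.commute[of LA])
  finally show ?case .
qed simp

section \<open>Monomials in the entries of the iterated matrix\<close>

definition IJ :: "(nat \<times> nat) set" where "IJ = {..<4} \<times> {..<4}"

definition mon :: "(nat \<times> nat \<Rightarrow> nat) \<Rightarrow> nat \<Rightarrow> complex" where
  "mon b k = (\<Prod>ij\<in>IJ. Y k (fst ij) (snd ij) ^ b ij)"

text \<open>Monomials are taken as sequences in \<open>k\<close>, so different exponents may give
  the same element; an upper bound for their number suffices.\<close>

definition G :: "nat \<Rightarrow> (nat \<Rightarrow> complex) set" where
  "G d = {mon b | b. sum b IJ \<le> d}"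

lemma finite_IJ: "finite IJ" by (simp add: IJ_def)

lemma G_subset: "G d \<subseteq> mon ` PiE IJ (\<lambda>_. {0..d})"
proof
  fix s assume "s \<in> G d"
  then obtain b where b: "s = mon b" "sum b IJ \<le> d" by (auto simp: G_def)
  have "b ij \<le> d" if "ij \<in> IJ" for ij
    using member_le_sum[of ij IJ b] that b finite_IJ by auto
  hence "restrict b IJ \<in> PiE IJ (\<lambda>_. {0..d})" by auto
  moreover have "mon b = mon (restrict b IJ)" by (intro ext) (simp add: mon_def)
  ultimately show "s \<in> mon ` PiE IJ (\<lambda>_. {0..d})" using b by blast
qed

lemma finite_G: "finite (G d)"
  by (rule finite_subset[OF G_subset]) (auto intro!: finite_PiE simp: finite_IJ)

lemma card_G: "card (G d) \<le> (d + 1) ^ 16"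
proof -
  have "card (G d) \<le> card (mon ` PiE IJ (\<lambda>_. {0..d}))"
    by (rule card_mono[OF _ G_subset]) (auto intro!: finite_PiE simp: finite_IJ)
  also have "\<dots> \<le> card (PiE IJ (\<lambda>_. {0..d}))" by (rule card_image_le) (auto intro!: finite_PiE simp: finite_IJ)
  also have "\<dots> = (d + 1) ^ 16" by (simp add: card_PiE finite_IJ) (simp add: IJ_def)
  finally show ?thesis .
qed

lemma G_mono: "d \<le> e \<Longrightarrow> G d \<subseteq> G e"
  by (auto simp: G_def)

lemma one_in_G: "(\<lambda>_. 1) \<in> G d"
  unfolding G_def by (rule CollectI, intro exI[of _ "\<lambda>_. 0"]) (auto simp: mon_def)

lemma Y_in_G: assumes "i < 4" "j < 4" shows "(\<lambda>k. Y k i j) \<in> G 1"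
proof -
  define b where "b = (\<lambda>ij. if ij = (i, j) then 1 else 0 :: nat)"
  have ij: "(i, j) \<in> IJ" using assms by (simp add: IJ_def)
  have "mon b k = Y k i j" for k
  proof -
    have "mon b k = (\<Prod>ij\<in>IJ. if ij = (i, j) then Y k (fst ij) (snd ij) else 1)"
      unfolding mon_def by (intro prod.cong) (auto simp: b_def)
    thus ?thesis using ij finite_IJ by simp
  qed
  moreover have "sum b IJ = 1" using ij finite_IJ by (simp add: b_def)
  ultimately show ?thesis unfolding G_def by (rule_tac CollectI, intro exI[of _ b]) auto
qed

lemma G_mult: assumes "s \<in> G d" "t \<in> G e" shows "(\<lambda>k. s k * t k) \<in> G (d + e)"
proof -
  obtain b c where b: "s = mon b" "sum b IJ \<le> d" and c: "t = mon c" "sum c IJ \<le> e"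
    using assms by (auto simp: G_def)
  have "(\<lambda>k. s k * t k) = mon (\<lambda>ij. b ij + c ij)"
    by (intro ext) (simp add: b c mon_def power_add prod.distrib)
  moreover have "(\<Sum>ij\<in>IJ. b ij + c ij) \<le> d + e" using b c by (simp add: sum.distrib)
  ultimately show ?thesis unfolding G_def by blast
qed

lemma G_int_poly:
  assumes "s \<in> G d"
  obtains T where "\<And>k. s k = pev of_int \<alpha> (T k)" "\<And>k. degree (T k) \<le> dA * 4 ^ k * d"
    "\<And>k. poly_len (T k) \<le> LA ^ (k * d)"
proof -
  obtain b where b: "s = mon b" "sum b IJ \<le> d" using assms by (auto simp: G_def)
  define T where "T = (\<lambda>k. \<Prod>ij\<in>IJ. AA k (fst ij) (snd ij) ^ b ij)"
  show ?thesis
  proof (rule that[of T])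
    fix k
    show "s k = pev of_int \<alpha> (T k)"
      by (simp add: T_def b mon_def Y_def rhom_simps[OF rhom_pev[OF rhom_of_int]])
    have "degree (T k) \<le> (\<Sum>ij\<in>IJ. degree (AA k (fst ij) (snd ij) ^ b ij))"
      unfolding T_def using degree_prod_sum_le[OF finite_IJ] by (simp add: o_def)
    also have "\<dots> \<le> (\<Sum>ij\<in>IJ. dA * 4 ^ k * b ij)"
      by (intro sum_mono order_trans[OF degree_power_le] mult_mono degree_AA) (auto simp: IJ_def)
    also have "\<dots> = dA * 4 ^ k * sum b IJ" by (simp add: sum_distrib_left)
    also have "\<dots> \<le> dA * 4 ^ k * d" using b by (intro mult_left_mono) auto
    finally show "degree (T k) \<le> dA * 4 ^ k * d" .
    have "poly_len (T k) \<le> (\<Prod>ij\<in>IJ. poly_len (AA k (fst ij) (snd ij) ^ b ij))"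
      unfolding T_def by (rule poly_len_prod)
    also have "\<dots> \<le> (\<Prod>ij\<in>IJ. (LA ^ k) ^ b ij)"
      by (intro prod_mono conjI poly_len_nonneg order_trans[OF poly_len_power] power_mono poly_len_AA)
         (auto simp: IJ_def)
    also have "\<dots> = LA ^ (k * sum b IJ)" by (simp add: power_mult power_sum flip: prod_power_distrib)
    also have "\<dots> \<le> LA ^ (k * d)" using b LA_ge_1[of 0 0] by (intro power_increasing) auto
    finally show "poly_len (T k) \<le> LA ^ (k * d)" .
  qed
qed

section \<open>Linear independence over the rational polynomials along the points
  \<open>\<zeta> k\<close>\<close>

lemma eventually_pev_nz:
  assumes "q \<noteq> 0"
  shows "\<forall>\<^sub>F k in sequentially. pev of_rat (\<zeta> k) q \<noteq> 0"
proof -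
  have "map_poly of_rat q \<noteq> (0 :: complex poly)" using assms by (subst map_poly_eq_0_iff) auto
  hence "finite {x. poly (map_poly of_rat q :: complex poly) x = 0}" by (rule poly_roots_finite)
  hence "finite (\<zeta> -` {x. poly (map_poly of_rat q) x = 0})" by (rule finite_vimageI[OF _ inj_zeta])
  hence "\<forall>\<^sub>F k in cofinite. k \<notin> \<zeta> -` {x. poly (map_poly of_rat q) x = 0}" by (simp add: eventually_cofinite)
  thus ?thesis by (simp add: cofinite_eq_sequentially pev_def)
qed

text \<open>Independence over \<open>rat poly\<close> of germs of sequences at infinity, with
  \<open>z\<close> acting as multiplication by \<open>\<zeta> k\<close>. Looking at large
  \<open>k\<close> only allows denominators to be cancelled, and the negation supplies infinitely
  many \<open>k\<close> with a nonzero value in the end.\<close>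

definition zindep :: "(nat \<Rightarrow> complex) set \<Rightarrow> bool" where
  "zindep S \<longleftrightarrow> (\<forall>r :: (nat \<Rightarrow> complex) \<Rightarrow> rat poly.
     (\<forall>\<^sub>F k in sequentially. (\<Sum>s\<in>S. pev of_rat (\<zeta> k) (r s) * s k) = 0) \<longrightarrow> (\<forall>s\<in>S. r s = 0))"

lemma zindepD:
  assumes "zindep S" "\<forall>\<^sub>F k in sequentially. (\<Sum>s\<in>S. pev of_rat (\<zeta> k) (r s) * s k) = 0" "s \<in> S"
  shows "r s = 0"
  using assms(1)[unfolded zindep_def, rule_format, OF assms(2,3)] .

definition is_basis :: "nat \<Rightarrow> (nat \<Rightarrow> complex) set \<Rightarrow> bool" where
  "is_basis d B \<longleftrightarrow> B \<subseteq> G d \<and> zindep B \<and> (\<forall>S\<subseteq>G d. zindep S \<longrightarrow> card S \<le> card B)"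

definition Bs :: "nat \<Rightarrow> (nat \<Rightarrow> complex) set" where "Bs d = (SOME B. is_basis d B)"

lemma is_basis_Bs: "is_basis d (Bs d)"
proof -
  have e: "zindep {}" by (simp add: zindep_def)
  have "finite (card ` {S. S \<subseteq> G d \<and> zindep S})" using finite_G by simp
  moreover have "card ` {S. S \<subseteq> G d \<and> zindep S} \<noteq> {}" using e by blast
  ultimately have "Max (card ` {S. S \<subseteq> G d \<and> zindep S}) \<in> card ` {S. S \<subseteq> G d \<and> zindep S}"
    by (rule Max_in)
  then obtain B where B: "B \<subseteq> G d" "zindep B" "card B = Max (card ` {S. S \<subseteq> G d \<and> zindep S})" by auto
  have "card S \<le> card B" if "S \<subseteq> G d" "zindep S" for S
    unfolding B(3) using finite_G that by (intro Max_ge) auto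
  with B have "is_basis d B" unfolding is_basis_def by blast
  thus ?thesis unfolding Bs_def by (rule someI)
qed

lemma Bs_subset: "Bs d \<subseteq> G d" and zindep_Bs: "zindep (Bs d)"
  and Bs_max: "S \<subseteq> G d \<Longrightarrow> zindep S \<Longrightarrow> card S \<le> card (Bs d)"
  using is_basis_Bs[of d] by (auto simp: is_basis_def)

lemma finite_Bs: "finite (Bs d)"
  using Bs_subset finite_G finite_subset by blast

lemma card_Bs_le: "card (Bs d) \<le> (d + 1) ^ 16"
  using card_mono[OF finite_G Bs_subset] card_G order_trans by blast

lemma card_Bs_ge_1: "card (Bs d) \<ge> 1"
proof -
  have "zindep {\<lambda>_. 1}"
    unfolding zindep_def
  proof (intro allI impI ballI)
    fix r :: "(nat \<Rightarrow> complex) \<Rightarrow> rat poly" and s :: "nat \<Rightarrow> complex"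
    assume "\<forall>\<^sub>F k in sequentially. (\<Sum>s\<in>{\<lambda>_. 1}. pev of_rat (\<zeta> k) (r s) * s k) = 0" "s \<in> {\<lambda>_. 1}"
    hence *: "\<forall>\<^sub>F k in sequentially. pev of_rat (\<zeta> k) (r s) = 0" by simp
    show "r s = 0"
    proof (rule ccontr)
      assume "r s \<noteq> 0"
      from eventually_conj[OF * eventually_pev_nz[OF this]] show False by simp
    qed
  qed
  thus ?thesis using Bs_max[of "{\<lambda>_. 1}" d] one_in_G[of d] by simp
qed

definition spans :: "nat \<Rightarrow> (nat \<Rightarrow> complex) \<Rightarrow> rat poly \<Rightarrow> ((nat \<Rightarrow> complex) \<Rightarrow> rat poly) \<Rightarrow> bool" where
  "spans d s q r \<longleftrightarrow> (\<forall>\<^sub>F k in sequentially.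
     pev of_rat (\<zeta> k) q * s k = (\<Sum>l\<in>Bs d. pev of_rat (\<zeta> k) (r l) * l k))"

lemma Bs_span1:
  assumes s: "s \<in> G d"
  shows "\<exists>q r. q \<noteq> 0 \<and> spans d s q r"
proof (cases "s \<in> Bs d")
  case True
  have "(\<Sum>l\<in>Bs d. pev of_rat (\<zeta> k) (if l = s then 1 else 0) * l k) = pev of_rat (\<zeta> k) 1 * s k" for k
  proof -
    have "(\<Sum>l\<in>Bs d. pev of_rat (\<zeta> k) (if l = s then 1 else 0) * l k) = (\<Sum>l\<in>Bs d. if l = s then l k else 0)"
      by (intro sum.cong) (auto simp: rhom_1[OF rhom_pev[OF rhom_of_rat]])
    thus ?thesis using True finite_Bs by (simp add: rhom_1[OF rhom_pev[OF rhom_of_rat]])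
  qed
  hence "spans d s 1 (\<lambda>l. if l = s then 1 else 0)"
    unfolding spans_def by (intro always_eventually allI) (rule sym)
  moreover have "(1 :: rat poly) \<noteq> 0" by simp
  ultimately show ?thesis by blast
next
  case False
  have "\<not> zindep (insert s (Bs d))"
  proof
    assume "zindep (insert s (Bs d))"
    moreover have "insert s (Bs d) \<subseteq> G d" using s Bs_subset[of d] by simp
    ultimately have "card (insert s (Bs d)) \<le> card (Bs d)" by (rule Bs_max[rotated])
    thus False using False finite_Bs[of d] by simp
  qed
  then obtain r where r: "\<forall>\<^sub>F k in sequentially. (\<Sum>l\<in>insert s (Bs d). pev of_rat (\<zeta> k) (r l) * l k) = 0"
    "\<exists>l\<in>insert s (Bs d). r l \<noteq> 0" by (auto simp only: zindep_def not_all not_imp ball_simps)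
  have r': "\<forall>\<^sub>F k in sequentially. pev of_rat (\<zeta> k) (r s) * s k + (\<Sum>l\<in>Bs d. pev of_rat (\<zeta> k) (r l) * l k) = 0"
    using r(1) by (simp only: sum.insert[OF finite_Bs False])
  have "r s \<noteq> 0"
  proof
    assume "r s = 0"
    hence "\<forall>\<^sub>F k in sequentially. (\<Sum>l\<in>Bs d. pev of_rat (\<zeta> k) (r l) * l k) = 0" using r' by simp
    hence "\<forall>l\<in>Bs d. r l = 0" using zindepD[OF zindep_Bs] by blast
    thus False using r(2) \<open>r s = 0\<close> by auto
  qed
  moreover have "spans d s (r s) (\<lambda>l. - r l)"
    unfolding spans_def using r'
  proof eventually_elim
    case (elim k)
    thus ?case by (simp only: rhom_uminus[OF rhom_pev[OF rhom_of_rat]] mult_minus_left sum_negf eq_neg_iff_add_eq_0)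
  qed
  ultimately show ?thesis by blast
qed

lemma Bs_span: "\<exists>q R. q \<noteq> 0 \<and> (\<forall>s\<in>G d. spans d s q (R s))"
proof -
  have "\<forall>s\<in>G d. \<exists>q r. q \<noteq> 0 \<and> spans d s q r"
    using Bs_span1 by blast
  then obtain q r where qr: "\<And>s. s \<in> G d \<Longrightarrow> q s \<noteq> 0" "\<And>s. s \<in> G d \<Longrightarrow> spans d s (q s) (r s)"
    by metis
  define Q where "Q = prod q (G d)"
  define R where "R = (\<lambda>s l. prod q (G d - {s}) * r s l)"
  note hom = rhom_mult[OF rhom_pev[OF rhom_of_rat]]
  have "Q \<noteq> 0" unfolding Q_def using qr(1) by (subst prod_zero_iff[OF finite_G]) blast
  moreover have "\<forall>s\<in>G d. spans d s Q (R s)"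
  proof
    fix s assume s: "s \<in> G d"
    show "spans d s Q (R s)"
      unfolding spans_def
      using qr(2)[OF s, unfolded spans_def]
    proof eventually_elim
      case (elim k)
      have "Q = prod q (G d - {s}) * q s" using prod.remove[OF finite_G s, of q] by (simp only: Q_def mult.commute)
      hence "pev of_rat (\<zeta> k) Q * s k = pev of_rat (\<zeta> k) (prod q (G d - {s})) * (pev of_rat (\<zeta> k) (q s) * s k)"
        by (simp only: hom mult.assoc)
      also have "\<dots> = (\<Sum>l\<in>Bs d. pev of_rat (\<zeta> k) (R s l) * l k)"
        unfolding elim by (simp only: R_def hom sum_distrib_left mult.assoc)
      finally show ?case .
    qed
  qed
  ultimately show ?thesis by blast
qed

text \<open>One common denominator for the whole of \<open>G d\<close>. As it depends on
  \<open>d\<close> alone, its degree may enter the choice of parameters before the auxiliary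
  polynomials exist.\<close>

definition qq :: "nat \<Rightarrow> rat poly" where
  "qq d = (SOME q. q \<noteq> 0 \<and> (\<exists>R. \<forall>s\<in>G d. spans d s q (R s)))"

lemma qq: "qq d \<noteq> 0" "\<exists>R. \<forall>s\<in>G d. spans d s (qq d) (R s)"
proof -
  have "\<exists>q. q \<noteq> 0 \<and> (\<exists>R. \<forall>s\<in>G d. spans d s q (R s))" using Bs_span[of d] by blast
  from someI_ex[OF this, folded qq_def] show "qq d \<noteq> 0" "\<exists>R. \<forall>s\<in>G d. spans d s (qq d) (R s)" by blast+
qed

abbreviation ev :: "nat \<Rightarrow> (nat \<Rightarrow> complex) \<Rightarrow> zpoly4 \<Rightarrow> complex" where
  "ev k x r \<equiv> ev4 of_rat (\<zeta> k) x r"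

lemmas ev_hom = rhom_simps[OF rhom_ev4[OF rhom_of_rat]]

section \<open>Polynomial functions whose coefficients are spanned by such monomials\<close>

definition lsum :: "((nat \<Rightarrow> complex) \<times> zpoly4) list \<Rightarrow> nat \<Rightarrow> (nat \<Rightarrow> complex) \<Rightarrow> complex" where
  "lsum xs = (\<lambda>k x. \<Sum>(s, r)\<leftarrow>xs. s k * ev k x r)"

lemma lsum_Nil: "lsum [] = (\<lambda>k x. 0)"
  and lsum_Cons: "lsum ((s, r) # xs) = (\<lambda>k x. s k * ev k x r + lsum xs k x)"
  and lsum_append: "lsum (xs @ ys) = (\<lambda>k x. lsum xs k x + lsum ys k x)"
  by (simp_all add: lsum_def)

text \<open>A filtered algebra: \<open>d\<close> bounds only the degree in the entries of
  \<open>Y k\<close>, while the degrees in \<open>x\<close> and \<open>\<zeta> k\<close> are free.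
  The bounds add under products.\<close>

definition inA :: "nat \<Rightarrow> (nat \<Rightarrow> (nat \<Rightarrow> complex) \<Rightarrow> complex) \<Rightarrow> bool" where
  "inA d \<phi> \<longleftrightarrow> (\<exists>xs. fst ` set xs \<subseteq> G d \<and> \<phi> = lsum xs)"

lemma inA_lsum: "fst ` set xs \<subseteq> G d \<Longrightarrow> inA d (lsum xs)"
  by (auto simp: inA_def)

lemma inA_mono: "inA d \<phi> \<Longrightarrow> d \<le> e \<Longrightarrow> inA e \<phi>"
  unfolding inA_def using G_mono[of d e] by blast

lemma inA_term: assumes "s \<in> G d" shows "inA d (\<lambda>k x. s k * ev k x r)"
  using inA_lsum[of "[(s, r)]" d] assms by (simp add: lsum_Cons lsum_Nil)

lemma inA_ev: "inA d (\<lambda>k x. ev k x r)"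
  using inA_term[OF one_in_G, of d r] by simp

lemma inA_G: "s \<in> G d \<Longrightarrow> inA d (\<lambda>k x. s k)"
  using inA_term[of s d 1] by (simp add: ev_hom)

lemma inA_add: assumes "inA d \<phi>" "inA d \<psi>" shows "inA d (\<lambda>k x. \<phi> k x + \<psi> k x)"
proof -
  obtain xs ys where "fst ` set xs \<subseteq> G d" "\<phi> = lsum xs" "fst ` set ys \<subseteq> G d" "\<psi> = lsum ys"
    using assms unfolding inA_def by blast
  thus ?thesis using inA_lsum[of "xs @ ys" d] by (simp add: lsum_append image_Un)
qed

lemma inA_0: "inA d (\<lambda>k x. 0)"
  using inA_lsum[of "[]" d] by (simp add: lsum_Nil)

lemma inA_sum: "(\<And>a. a \<in> S \<Longrightarrow> inA d (\<phi> a)) \<Longrightarrow> inA d (\<lambda>k x. \<Sum>a\<in>S. \<phi> a k x)"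
  by (induction S rule: infinite_finite_induct) (auto simp: inA_0 inA_add)

lemma inA_mult: assumes "inA d \<phi>" "inA e \<psi>" shows "inA (d + e) (\<lambda>k x. \<phi> k x * \<psi> k x)"
proof -
  obtain xs ys where xs: "fst ` set xs \<subseteq> G d" "\<phi> = lsum xs" and ys: "fst ` set ys \<subseteq> G e" "\<psi> = lsum ys"
    using assms unfolding inA_def by blast
  from xs(1) have "inA (d + e) (\<lambda>k x. lsum xs k x * lsum ys k x)"
  proof (induction xs)
    case Nil thus ?case by (simp add: inA_0 lsum_Nil)
  next
    case (Cons sr xs)
    obtain s r where sr: "sr = (s, r)" by fastforce
    hence s: "s \<in> G d" using Cons.prems by simp
    from ys(1) have "inA (d + e) (\<lambda>k x. (s k * ev k x r) * lsum ys k x)"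
    proof (induction ys)
      case Nil thus ?case by (simp add: inA_0 lsum_Nil)
    next
      case (Cons tu ys)
      obtain t u where tu: "tu = (t, u)" by fastforce
      hence t: "t \<in> G e" using Cons.prems by simp
      have "inA (d + e) (\<lambda>k x. (s k * t k) * ev k x (r * u))"
        using inA_term[OF G_mult[OF s t], of "r * u"] .
      moreover have "(\<lambda>k x. (s k * t k) * ev k x (r * u)) = (\<lambda>k x. (s k * ev k x r) * (t k * ev k x u))"
        by (intro ext) (simp add: ev_hom)
      ultimately have "inA (d + e) (\<lambda>k x. (s k * ev k x r) * (t k * ev k x u))" by simp
      from inA_add[OF this Cons.IH] Cons.prems show ?case by (simp add: tu lsum_Cons distrib_left)
    qed
    from inA_add[OF this Cons.IH] Cons.prems show ?case by (simp add: sr lsum_Cons distrib_right)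
  qed
  thus ?thesis by (simp add: xs(2) ys(2))
qed

lemma inA_power: assumes "inA d \<phi>" shows "inA (n * d) (\<lambda>k x. \<phi> k x ^ n)"
proof (induction n)
  case 0 thus ?case using inA_ev[of 0 1] by (simp add: ev_hom)
next
  case (Suc n) thus ?case using inA_mult[OF assms Suc] by simp
qed

lemma inA_prod: "finite S \<Longrightarrow> (\<And>a. a \<in> S \<Longrightarrow> inA (d a) (\<phi> a)) \<Longrightarrow> inA (sum d S) (\<lambda>k x. \<Prod>a\<in>S. \<phi> a k x)"
proof (induction S rule: finite_induct)
  case empty thus ?case using inA_ev[of 0 1] by (simp add: ev_hom)
qed (auto intro!: inA_mult)

text \<open>The threshold for \<open>k\<close> is independent of \<open>x\<close>. Hence arguments
  that vary with \<open>k\<close>, such as the values of the functions at \<open>\<zeta> k\<close>,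
  may be inserted later.\<close>

definition rep :: "nat \<Rightarrow> (nat \<Rightarrow> (nat \<Rightarrow> complex) \<Rightarrow> complex) \<Rightarrow> ((nat \<Rightarrow> complex) \<Rightarrow> zpoly4) \<Rightarrow> bool" where
  "rep d \<phi> T \<longleftrightarrow> (\<forall>\<^sub>F k in sequentially. \<forall>x. pev of_rat (\<zeta> k) (qq d) * \<phi> k x = (\<Sum>l\<in>Bs d. ev k x (T l) * l k))"

lemma inA_rep:
  assumes "inA d \<phi>"
  shows "\<exists>T. rep d \<phi> T"
proof -
  obtain xs where xs: "fst ` set xs \<subseteq> G d" "\<phi> = lsum xs"
    using assms unfolding inA_def by blast
  obtain R where R0: "\<And>s. s \<in> G d \<Longrightarrow> spans d s (qq d) (R s)" using qq(2) by blast
  note R = R0[unfolded spans_def]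
  from xs(1) have "\<exists>T. rep d (lsum xs) T"
  proof (induction xs)
    case Nil
    have "rep d (lsum []) (\<lambda>_. 0)" by (simp add: rep_def ev_hom lsum_Nil)
    thus ?case by blast
  next
    case (Cons sr xs)
    obtain s r where sr: "sr = (s, r)" by fastforce
    hence s: "s \<in> G d" using Cons.prems by simp
    from Cons obtain T where T: "rep d (lsum xs) T" by auto
    have "rep d (lsum (sr # xs)) (\<lambda>l. r * zconst (R s l) + T l)"
      unfolding rep_def using T[unfolded rep_def] R[OF s]
    proof eventually_elim
      case (elim k)
      show ?case
      proof
        fix x
        have "pev of_rat (\<zeta> k) (qq d) * lsum (sr # xs) k x =
          ev k x r * (pev of_rat (\<zeta> k) (qq d) * s k) + pev of_rat (\<zeta> k) (qq d) * lsum xs k x"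
          by (simp add: sr lsum_Cons algebra_simps)
        also have "\<dots> = (\<Sum>l\<in>Bs d. ev k x (r * zconst (R s l) + T l) * l k)"
          unfolding elim(2) elim(1)[rule_format]
          by (simp add: ev_hom ev4_zconst rhom_of_rat sum_distrib_left distrib_right sum.distrib mult.assoc)
        finally show "pev of_rat (\<zeta> k) (qq d) * lsum (sr # xs) k x =
          (\<Sum>l\<in>Bs d. ev k x (r * zconst (R s l) + T l) * l k)" .
      qed
    qed
    thus ?case by blast
  qed
  thus ?thesis by (simp add: xs(2))
qed

lemma Bs_unique:
  assumes "\<forall>\<^sub>F k in sequentially. \<forall>x. (\<Sum>l\<in>Bs d. ev k x (T l) * l k) = 0" and l: "l \<in> Bs d"
  shows "T l = 0"
proof (rule ccontr)
  assume "T l \<noteq> 0"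
  then obtain x where x: "spec4 x (T l) \<noteq> 0" using ex_spec4_nonzero by blast
  have "\<forall>\<^sub>F k in sequentially. (\<Sum>l\<in>Bs d. pev of_rat (\<zeta> k) (spec4 x (T l)) * l k) = 0"
    using assms(1) by eventually_elim (simp add: pev_spec4)
  from zindepD[OF zindep_Bs this l] x show False by blast
qed

text \<open>For a fixed \<open>k\<close>, restriction to lines reduces cancellation in four complex
  variables to cancellation in the domain of polynomials in one.\<close>

lemma inA_line:
  assumes "inA d \<phi>"
  shows "\<exists>p :: complex poly. \<forall>t. \<phi> k (\<lambda>i. a i + t * b i) = poly p t"
proof -
  obtain xs where xs: "\<phi> = lsum xs" using assms unfolding inA_def by blast
  have "\<exists>p :: complex poly. \<forall>t. lsum xs k (\<lambda>i. a i + t * b i) = poly p t"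
  proof (induction xs)
    case Nil show ?case by (intro exI[of _ 0]) (simp add: lsum_Nil)
  next
    case (Cons sr xs)
    then obtain p where p: "\<And>t. lsum xs k (\<lambda>i. a i + t * b i) = poly p t" by blast
    obtain s r where sr: "sr = (s, r)" by fastforce
    show ?case
      by (intro exI[of _ "smult (s k) (ev4 (\<lambda>c. [:of_rat c:]) [:\<zeta> k:] (\<lambda>i. [:a i, b i:]) r) + p"])
         (simp add: sr lsum_Cons p, simp add: ev4_line)
  qed
  thus ?thesis by (simp add: xs)
qed

text \<open>
  By \<open>card_Bs_le\<close> the cardinality grows at most like \<open>d\<^sup>1\<^sup>6\<close>, hence not by the factor \<open>4\<^sup>1\<^sup>7\<close> at every quadrupling.
\<close>

lemma card_Bs_growth: "\<exists>d\<ge>d0. card (Bs (4 * d)) \<le> 4 ^ 17 * card (Bs d)"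
proof (rule ccontr)
  assume "\<not> ?thesis"
  hence lt: "4 ^ 17 * card (Bs d) < card (Bs (4 * d))" if "d \<ge> d0" for d using that by force
  define D where "D = Suc d0"
  have ge: "card (Bs (4 ^ i * D)) \<ge> 4 ^ (17 * i)" for i
  proof (induction i)
    case 0 thus ?case using card_Bs_ge_1 by simp
  next
    case (Suc i)
    have "D \<le> 4 ^ i * D" by simp
    hence "d0 \<le> 4 ^ i * D" by (simp add: D_def)
    from lt[OF this] have "4 ^ 17 * card (Bs (4 ^ i * D)) \<le> card (Bs (4 ^ Suc i * D))" by (simp add: mult.assoc)
    moreover have "(4::nat) ^ (17 * Suc i) = 4 ^ 17 * 4 ^ (17 * i)" by (simp add: power_add)
    ultimately show ?case using mult_left_mono[OF Suc, of "4 ^ 17"] by linarith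
  qed
  \<comment> \<open>With this choice the constant \<open>(2 * D) ^ 16\<close> is \<open>i\<close>
    itself, and the absurd \<open>4 ^ i \<le> i\<close> remains.\<close>
  define i where "i = (2 * D) ^ 16"
  have "4 ^ (17 * i) \<le> (4 ^ i * D + 1) ^ 16" using ge[of i] card_Bs_le order_trans by blast
  also have "\<dots> \<le> (4 ^ i * (2 * D)) ^ 16"
  proof (intro power_mono)
    have "0 < 4 ^ i * D" by (simp add: D_def)
    hence "1 \<le> 4 ^ i * D" by linarith
    thus "4 ^ i * D + 1 \<le> 4 ^ i * (2 * D)" by simp
  qed simp
  also have "\<dots> = 4 ^ (16 * i) * i" by (simp add: power_mult_distrib i_def mult.commute flip: power_mult)
  also have "(4::nat) ^ (17 * i) = 4 ^ (16 * i) * 4 ^ i" by (simp flip: power_add)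
  finally have "(4::nat) ^ i \<le> i" by simp
  moreover have "i < 2 ^ i" "(2::nat) ^ i \<le> 4 ^ i" by (auto simp: less_exp power_mono)
  ultimately show False by linarith
qed

end

context mahler_system
begin

lemma sum_Y_inA: "i < 4 \<Longrightarrow> inA 1 (\<lambda>k x. \<Sum>j<4. Y k i j * x j)"
proof (rule inA_sum)
  fix j :: nat assume ij: "i < 4" "j \<in> {..<4}"
  have "inA 1 (\<lambda>k x. Y k i j * ev k x (zvar j))" using ij by (intro inA_term Y_in_G) auto
  thus "inA 1 (\<lambda>k x. Y k i j * x j)" using ij by (simp add: ev4_zvar rhom_of_rat)
qed

section \<open>The transformed relation and multiplication by its powers\<close>

definition Phi :: "rat_mpoly \<Rightarrow> nat \<Rightarrow> (nat \<Rightarrow> complex) \<Rightarrow> complex" where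
  "Phi P k x = rat_mpoly_eval P (\<lambda>i. \<Sum>j<4. Y k i j * x j)"

lemma Phi_inA:
  assumes vars: "rat_mpoly_vars P \<subseteq> {..<4}"
  shows "\<exists>\<delta>\<ge>1. inA \<delta> (Phi P)"
proof -
  define \<delta> where "\<delta> = Suc (\<Sum>m\<in>Poly_Mapping.keys P. \<Sum>i\<in>Poly_Mapping.keys m. Poly_Mapping.lookup m i * 1)"
  have "inA \<delta> (\<lambda>k x. \<Sum>m\<in>Poly_Mapping.keys P. of_rat (Poly_Mapping.lookup P m) *
        (\<Prod>i\<in>Poly_Mapping.keys m. (\<Sum>j<4. Y k i j * x j) ^ Poly_Mapping.lookup m i))"
  proof (rule inA_sum)
    fix m assume m: "m \<in> Poly_Mapping.keys P"
    have "inA (\<Sum>i\<in>Poly_Mapping.keys m. Poly_Mapping.lookup m i * 1) (\<lambda>k x. \<Prod>i\<in>Poly_Mapping.keys m. (\<Sum>j<4. Y k i j * x j) ^ Poly_Mapping.lookup m i)"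
      using vars m by (intro inA_prod inA_power sum_Y_inA) (auto simp: rat_mpoly_vars_def)
    from inA_mult[OF inA_ev[of 0 "zconst [:Poly_Mapping.lookup P m:]"] this]
    have "inA (\<Sum>i\<in>Poly_Mapping.keys m. Poly_Mapping.lookup m i * 1) (\<lambda>k x. of_rat (Poly_Mapping.lookup P m) * (\<Prod>i\<in>Poly_Mapping.keys m. (\<Sum>j<4. Y k i j * x j) ^ Poly_Mapping.lookup m i))"
      by (simp add: ev4_zconst rhom_of_rat pev_const)
    moreover have "(\<Sum>i\<in>Poly_Mapping.keys m. Poly_Mapping.lookup m i * 1) \<le> \<delta>"
      unfolding \<delta>_def using m
      by (intro le_SucI member_le_sum[of m _ "\<lambda>m. \<Sum>i\<in>Poly_Mapping.keys m. Poly_Mapping.lookup m i * 1"]) auto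
    ultimately show "inA \<delta> (\<lambda>k x. of_rat (Poly_Mapping.lookup P m) * (\<Prod>i\<in>Poly_Mapping.keys m. (\<Sum>j<4. Y k i j * x j) ^ Poly_Mapping.lookup m i))"
      by (rule inA_mono)
  qed
  moreover have "Phi P = (\<lambda>k x. \<Sum>m\<in>Poly_Mapping.keys P. of_rat (Poly_Mapping.lookup P m) *
        (\<Prod>i\<in>Poly_Mapping.keys m. (\<Sum>j<4. Y k i j * x j) ^ Poly_Mapping.lookup m i))"
    by (intro ext) (simp add: Phi_def rat_mpoly_eval_def)
  ultimately have "inA \<delta> (Phi P)" by (simp only:)
  moreover have "\<delta> \<ge> 1" by (simp add: \<delta>_def)
  ultimately show ?thesis by blast
qed

lemma Phi_nonzero:
  assumes "P \<noteq> 0" "rat_mpoly_vars P \<subseteq> {..<4}"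
  shows "\<exists>x. Phi P k x \<noteq> 0"
proof -
  obtain t :: "nat \<Rightarrow> complex" where t: "rat_mpoly_eval P t \<noteq> 0"
    using ex_rat_mpoly_eval_nonzero[OF assms] by blast
  obtain x where x: "\<forall>i<4. (\<Sum>j<4. Y k i j * x j) = t i" using Y_surj by blast
  have "Phi P k x = rat_mpoly_eval P t"
    unfolding Phi_def by (rule rat_mpoly_eval_cong[OF assms(2)]) (use x in auto)
  thus ?thesis using t by metis
qed

lemma Phi_zeta: "rat_mpoly_vars P \<subseteq> {..<4} \<Longrightarrow>
   Phi P k (\<lambda>i. fev (f i) (\<zeta> k)) = rat_mpoly_eval P (\<lambda>i. fev (f i) \<alpha>)"
  unfolding Phi_def by (rule rat_mpoly_eval_cong) (use fev_alpha in auto)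

text \<open>For each large \<open>k\<close> a kernel vector gives a function of \<open>x\<close>
  annihilated by a power of \<open>Phi P k x\<close>. The latter is not identically zero because
  \<open>Y k\<close> is surjective, so cancellation on lines through a point where it is nonzero
  makes the function vanish.\<close>

lemma mult_injective:
  assumes P: "P \<noteq> 0" "rat_mpoly_vars P \<subseteq> {..<4}"
    and \<delta>: "inA \<delta> (Phi P)"
    and M: "\<And>l. l \<in> Bs d \<Longrightarrow> rep d' (\<lambda>k x. Phi P k x ^ h * l k) (M l)"
    and H: "\<And>l'. l' \<in> Bs d' \<Longrightarrow> (\<Sum>l\<in>Bs d. M l l' * H l) = 0"
    and l: "l \<in> Bs d"
  shows "H l = 0"
proof -
  define \<Psi> where "\<Psi> = (\<lambda>k x. \<Sum>l\<in>Bs d. l k * ev k x (H l))"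
  have Psi: "inA d \<Psi>" unfolding \<Psi>_def using Bs_subset by (intro inA_sum inA_term) blast
  have all: "\<forall>\<^sub>F k in sequentially. \<forall>l\<in>Bs d. \<forall>x. pev of_rat (\<zeta> k) (qq d') * (Phi P k x ^ h * l k) = (\<Sum>l'\<in>Bs d'. ev k x (M l l') * l' k)"
    using M unfolding rep_def by (intro eventually_ball_finite finite_Bs ballI)
  have "\<forall>\<^sub>F k in sequentially. \<forall>x. (\<Sum>l\<in>Bs d. ev k x (H l) * l k) = 0"
    using all eventually_pev_nz[OF qq(1)[of d']]
  proof eventually_elim
    case (elim k)
    have zero: "Phi P k x ^ h * \<Psi> k x = 0" for x
    proof -
      have "pev of_rat (\<zeta> k) (qq d') * (Phi P k x ^ h * \<Psi> k x) =
         (\<Sum>l\<in>Bs d. ev k x (H l) * (pev of_rat (\<zeta> k) (qq d') * (Phi P k x ^ h * l k)))"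
        by (simp add: \<Psi>_def sum_distrib_left mult_ac)
      also have "\<dots> = (\<Sum>l\<in>Bs d. ev k x (H l) * (\<Sum>l'\<in>Bs d'. ev k x (M l l') * l' k))"
        using elim(1) by (intro sum.cong refl) simp
      also have "\<dots> = (\<Sum>l\<in>Bs d. \<Sum>l'\<in>Bs d'. ev k x (M l l' * H l) * l' k)"
        by (simp add: sum_distrib_left ev_hom mult_ac)
      also have "\<dots> = (\<Sum>l'\<in>Bs d'. ev k x (\<Sum>l\<in>Bs d. M l l' * H l) * l' k)"
        by (subst sum.swap) (simp add: ev_hom sum_distrib_right)
      also have "\<dots> = 0" using H by (simp add: ev_hom)
      finally show ?thesis using elim(2) by simp
    qed
    have "\<Psi> k x = 0" for x
    proof -
      obtain y where y: "Phi P k y \<noteq> 0" using Phi_nonzero[OF P] by blast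
      obtain p1 where p1: "\<And>t. Phi P k (\<lambda>i. y i + t * (x i - y i)) = poly p1 t"
        using inA_line[OF \<delta>, of k y "\<lambda>i. x i - y i"] by blast
      obtain p2 where p2: "\<And>t. \<Psi> k (\<lambda>i. y i + t * (x i - y i)) = poly p2 t"
        using inA_line[OF Psi, of k y "\<lambda>i. x i - y i"] by blast
      have "poly (p1 ^ h * p2) t = 0" for t
        using zero[of "\<lambda>i. y i + t * (x i - y i)"] by (simp add: p1 p2)
      hence "p1 ^ h * p2 = 0" using poly_all_0_iff_0 by blast
      moreover have "poly p1 0 \<noteq> 0" using y p1[of 0] by simp
      ultimately have "p2 = 0" by auto
      thus ?thesis using p2[of 1] by simp
    qed
    thus ?case by (simp add: \<Psi>_def mult.commute)
  qed
  from Bs_unique[OF this l] show ?thesis .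
qed

text \<open>The product can be expanded directly, or first its part with exponent \<open>j\<close>
  and then \<open>Phi P k x ^ h\<close> times each basis element; uniqueness of coordinates compares
  the two. The factor \<open>qq d\<close> is the denominator of the intermediate expansion.\<close>

lemma rep_mult_compose:
  assumes M: "\<And>l. l \<in> Bs d \<Longrightarrow> rep d' (\<lambda>k x. Phi P k x ^ h * l k) (M l)"
    and T: "rep d (\<lambda>k x. Phi P k x ^ j * b k) T"
    and U: "rep d' (\<lambda>k x. Phi P k x ^ (h + j) * b k) U"
    and l': "l' \<in> Bs d'"
  shows "(\<Sum>l\<in>Bs d. M l l' * T l) = zconst (qq d) * U l'"
proof -
  have all: "\<forall>\<^sub>F k in sequentially. \<forall>l\<in>Bs d. \<forall>x. pev of_rat (\<zeta> k) (qq d') * (Phi P k x ^ h * l k) = (\<Sum>l'\<in>Bs d'. ev k x (M l l') * l' k)"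
    using M unfolding rep_def by (intro eventually_ball_finite finite_Bs ballI)
  have "\<forall>\<^sub>F k in sequentially. \<forall>x. (\<Sum>l'\<in>Bs d'. ev k x ((\<Sum>l\<in>Bs d. M l l' * T l) - zconst (qq d) * U l') * l' k) = 0"
    using all T[unfolded rep_def] U[unfolded rep_def]
  proof eventually_elim
    case (elim k)
    show ?case
    proof
      fix x
      have "(\<Sum>l'\<in>Bs d'. ev k x (\<Sum>l\<in>Bs d. M l l' * T l) * l' k) = (\<Sum>l\<in>Bs d. ev k x (T l) * (\<Sum>l'\<in>Bs d'. ev k x (M l l') * l' k))"
        by (simp add: ev_hom sum_distrib_left sum_distrib_right, subst sum.swap) (simp add: mult_ac)
      also have "\<dots> = (\<Sum>l\<in>Bs d. ev k x (T l) * (pev of_rat (\<zeta> k) (qq d') * (Phi P k x ^ h * l k)))"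
        using elim(1) by (intro sum.cong refl) simp
      also have "\<dots> = pev of_rat (\<zeta> k) (qq d') * Phi P k x ^ h * (\<Sum>l\<in>Bs d. ev k x (T l) * l k)"
        by (simp add: sum_distrib_left mult_ac)
      also have "\<dots> = pev of_rat (\<zeta> k) (qq d') * Phi P k x ^ h * (pev of_rat (\<zeta> k) (qq d) * (Phi P k x ^ j * b k))"
        using elim(2) by simp
      also have "\<dots> = pev of_rat (\<zeta> k) (qq d) * (pev of_rat (\<zeta> k) (qq d') * (Phi P k x ^ (h + j) * b k))"
        by (simp add: power_add mult_ac)
      also have "\<dots> = pev of_rat (\<zeta> k) (qq d) * (\<Sum>l'\<in>Bs d'. ev k x (U l') * l' k)"
        using elim(3) by simp
      also have "\<dots> = (\<Sum>l'\<in>Bs d'. ev k x (zconst (qq d) * U l') * l' k)"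
        by (simp add: ev_hom ev4_zconst rhom_of_rat sum_distrib_left mult_ac)
      finally show "(\<Sum>l'\<in>Bs d'. ev k x ((\<Sum>l\<in>Bs d. M l l' * T l) - zconst (qq d) * U l') * l' k) = 0"
        by (simp add: ev_hom left_diff_distrib sum_subtractf)
    qed
  qed
  from Bs_unique[OF this l'] show ?thesis by simp
qed

section \<open>Upper and lower bounds for the auxiliary values\<close>

lemma upper_bound:
  assumes W: "\<And>l n. l \<in> Bs d \<Longrightarrow> n < p \<Longrightarrow> fps_nth (ev4 fps_const fps_X f (W l)) n = 0"
  obtains C where "C \<ge> 0"
    "\<And>k. norm (\<Sum>l\<in>Bs d. ev k (\<lambda>i. fev (f i) (\<zeta> k)) (W l) * l k) \<le> C * of_int LA ^ (k * d) * norm \<alpha> ^ (4 ^ k * p)"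
proof -
  have "\<exists>C\<ge>0. \<forall>z. norm z \<le> norm \<alpha> \<longrightarrow> norm (fev (ev4 fps_const fps_X f (W l)) z) \<le> C * norm z ^ p" if "l \<in> Bs d" for l
    using fev_bound[OF conjunct1[OF conv1_ev4[of 0 f "W l"]], of p "norm \<alpha>"] conv W[OF that] alpha_lt_1 by (metis norm_zero zero_less_one)
  then obtain C where C: "\<And>l. l \<in> Bs d \<Longrightarrow> C l \<ge> 0"
    "\<And>l z. l \<in> Bs d \<Longrightarrow> norm z \<le> norm \<alpha> \<Longrightarrow> norm (fev (ev4 fps_const fps_X f (W l)) z) \<le> C l * norm z ^ p" by metis
  show ?thesis
  proof (rule that[of "sum C (Bs d)"])
    show "sum C (Bs d) \<ge> 0" using C by (intro sum_nonneg) auto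
    fix k
    have "norm (\<Sum>l\<in>Bs d. ev k (\<lambda>i. fev (f i) (\<zeta> k)) (W l) * l k) \<le> (\<Sum>l\<in>Bs d. norm (ev k (\<lambda>i. fev (f i) (\<zeta> k)) (W l) * l k))"
      by (rule norm_sum)
    also have "\<dots> \<le> (\<Sum>l\<in>Bs d. (C l * norm \<alpha> ^ (4 ^ k * p)) * of_int LA ^ (k * d))"
      unfolding norm_mult
    proof (intro sum_mono mult_mono)
      fix l assume l: "l \<in> Bs d"
      have "norm (ev k (\<lambda>i. fev (f i) (\<zeta> k)) (W l)) = norm (fev (ev4 fps_const fps_X f (W l)) (\<zeta> k))"
        using conv1_ev4[of "\<zeta> k" f "W l"] norm_zeta_lt_1 conv by simp
      also have "\<dots> \<le> C l * norm (\<zeta> k) ^ p" by (rule C(2)[OF l norm_zeta_le])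
      finally show "norm (ev k (\<lambda>i. fev (f i) (\<zeta> k)) (W l)) \<le> C l * norm \<alpha> ^ (4 ^ k * p)"
        by (simp add: norm_zeta power_mult)
      obtain T where T: "l k = pev of_int \<alpha> (T k)" "poly_len (T k) \<le> LA ^ (k * d)"
        using G_int_poly[of l d] l Bs_subset by (metis subsetD)
      have "norm (l k) \<le> of_int (poly_len (T k))"
        unfolding T(1) using alpha_lt_1 by (intro norm_of_int_poly_le) simp
      also have "\<dots> \<le> of_int LA ^ (k * d)" using T(2) by (metis of_int_le_iff of_int_power)
      finally show "norm (l k) \<le> of_int LA ^ (k * d)" .
      show "0 \<le> C l * norm \<alpha> ^ (4 ^ k * p)" using C(1)[OF l] by simp
    qed auto
    also have "\<dots> = sum C (Bs d) * of_int LA ^ (k * d) * norm \<alpha> ^ (4 ^ k * p)"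
      by (simp add: sum_distrib_right sum_distrib_left mult_ac)
    finally show "norm (\<Sum>l\<in>Bs d. ev k (\<lambda>i. fev (f i) (\<zeta> k)) (W l) * l k) \<le> sum C (Bs d) * of_int LA ^ (k * d) * norm \<alpha> ^ (4 ^ k * p)" .
  qed
qed

lemma rat_poly_clear_denominators:
  fixes p :: "rat poly"
  shows "\<exists>D > 0. \<exists>q :: int poly. map_poly of_int q = smult (of_nat D) p \<and> degree q \<le> degree p"
proof (induction p)
  case 0
  show ?case by (intro exI[of _ 1] conjI exI[of _ 0]) auto
next
  case (pCons a p)
  then obtain D and q :: "int poly" where D: "D > 0" "map_poly of_int q = smult (of_nat D) p" "degree q \<le> degree p" by blast
  obtain n m where nm: "quotient_of a = (n, m)" by fastforce
  have m: "m > 0" using quotient_of_denom_pos[OF nm] .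
  have a: "a = of_int n / of_int m" using quotient_of_div[OF nm] .
  define E where "E = D * nat m"
  have "E > 0" using D m by (simp add: E_def)
  moreover have "map_poly of_int (pCons (int D * n) (smult m q)) = smult (of_nat E) (pCons a p)"
  proof -
    have "map_poly of_int (smult m q) = smult (of_int m) (map_poly of_int q :: rat poly)"
      by (rule poly_eqI) (simp add: coeff_map_poly)
    thus ?thesis using D m by (simp add: map_poly_pCons E_def a mult.commute)
  qed
  moreover have "degree (pCons (int D * n) (smult m q)) \<le> degree (pCons a p)"
  proof (cases "p = 0")
    case True
    hence "map_poly of_int q = (0 :: rat poly)" using D by simp
    hence "q = 0" by (simp add: map_poly_eq_0_iff)
    thus ?thesis by simp
  next
    case False
    have "degree (pCons (int D * n) (smult m q)) \<le> Suc (degree (smult m q))" by (rule degree_pCons_le)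
    also have "\<dots> \<le> Suc (degree p)" using D(3) by simp
    finally show ?thesis using False by simp
  qed
  ultimately show ?case by blast
qed

lemma rat_polys_clear_denominators:
  fixes r :: "'a \<Rightarrow> rat poly"
  assumes "finite S"
  shows "\<exists>D > 0. \<exists>q :: 'a \<Rightarrow> int poly. \<forall>s\<in>S. map_poly of_int (q s) = smult (of_nat D) (r s) \<and> degree (q s) \<le> degree (r s)"
  using assms
proof (induction S)
  case empty show ?case by (intro exI[of _ 1]) auto
next
  case (insert a S)
  then obtain D q where D: "D > 0" "\<And>s. s \<in> S \<Longrightarrow> map_poly of_int (q s) = smult (of_nat D) (r s) \<and> degree (q s :: int poly) \<le> degree (r s)"
    by blast
  obtain E and p :: "int poly" where E: "E > 0" "map_poly of_int p = smult (of_nat E) (r a)" "degree p \<le> degree (r a)"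
    using rat_poly_clear_denominators by blast
  have sm: "map_poly of_int (smult c u) = smult (of_int c) (map_poly of_int u :: rat poly)" for c and u :: "int poly"
    by (rule poly_eqI) (simp add: coeff_map_poly)
  have "\<forall>s\<in>insert a S. map_poly of_int (if s = a then smult (int D) p else smult (int E) (q s)) = smult (of_nat (D * E)) (r s) \<and>
     degree (if s = a then smult (int D) p else smult (int E) (q s)) \<le> degree (r s)"
  proof
    fix s assume s: "s \<in> insert a S"
    show "map_poly of_int (if s = a then smult (int D) p else smult (int E) (q s)) = smult (of_nat (D * E)) (r s) \<and>
     degree (if s = a then smult (int D) p else smult (int E) (q s)) \<le> degree (r s)"
      using s D(2)[of s] E D(1) by (auto simp: sm mult.commute order_trans[OF degree_smult_le])
  qed
  moreover have "D * E > 0" using D E by simp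
  ultimately show ?case by (intro exI[of _ "D * E"] conjI exI[of _ "\<lambda>s. if s = a then smult (int D) p else smult (int E) (q s)"])
qed

text \<open>After clearing rational denominators the value is an integer polynomial in
  \<open>\<alpha>\<close>, of degree proportional to \<open>4 ^ k\<close> and of length exponential
  in \<open>k\<close>, to which Liouville's inequality \<open>L\<close> applies.\<close>

lemma lower_bound:
  assumes L: "C \<ge> 1" "\<And>T n. degree T \<le> n \<Longrightarrow> pev of_int \<alpha> T \<noteq> 0 \<Longrightarrow>
       1 \<le> norm (pev of_int \<alpha> T) * (C ^ Suc n * of_int (poly_len T)) ^ K"
    and r: "\<And>b. b \<in> Bs d \<Longrightarrow> degree (r b) \<le> e"
  obtains C' where "C' \<ge> 0" "\<And>k. (\<Sum>b\<in>Bs d. pev of_rat (\<zeta> k) (r b) * b k) \<noteq> 0 \<Longrightarrow>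
     1 \<le> norm (\<Sum>b\<in>Bs d. pev of_rat (\<zeta> k) (r b) * b k) * C' * of_int LA ^ (k * d * K) * C ^ (4 ^ k * (e + dA * d) * K)"
proof -
  obtain D and q :: "(nat \<Rightarrow> complex) \<Rightarrow> int poly" where D: "D > 0"
    "\<And>b. b \<in> Bs d \<Longrightarrow> map_poly of_int (q b) = smult (of_nat D) (r b)" "\<And>b. b \<in> Bs d \<Longrightarrow> degree (q b) \<le> degree (r b)"
    using rat_polys_clear_denominators[OF finite_Bs, of d r] by blast
  have "\<forall>b\<in>Bs d. \<exists>T. \<forall>k. b k = pev of_int \<alpha> (T k) \<and> degree (T k) \<le> dA * 4 ^ k * d \<and> poly_len (T k) \<le> LA ^ (k * d)"
  proof
    fix b assume "b \<in> Bs d"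
    hence "b \<in> G d" using Bs_subset by blast
    from G_int_poly[OF this] show "\<exists>T. \<forall>k. b k = pev of_int \<alpha> (T k) \<and> degree (T k) \<le> dA * 4 ^ k * d \<and> poly_len (T k) \<le> LA ^ (k * d)"
      by metis
  qed
  from bchoice[OF this] obtain T where T0: "\<forall>b\<in>Bs d. \<forall>k. b k = pev of_int \<alpha> (T b k) \<and> degree (T b k) \<le> dA * 4 ^ k * d \<and> poly_len (T b k) \<le> LA ^ (k * d)"
    by blast
  define len where "len = (\<Sum>b\<in>Bs d. poly_len (q b))"
  define S where "S = (\<lambda>k. \<Sum>b\<in>Bs d. (q b \<circ>\<^sub>p monom 1 (4 ^ k)) * T b k)"
  define X where "X = (\<lambda>k. \<Sum>b\<in>Bs d. pev of_rat (\<zeta> k) (r b) * b k)"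
  have SX: "pev of_int \<alpha> (S k) = of_nat D * X k" for k
  proof -
    have "pev of_int \<alpha> (S k) = (\<Sum>b\<in>Bs d. pev of_int (\<zeta> k) (q b) * b k)"
      using T0 by (simp add: S_def rhom_simps[OF rhom_pev[OF rhom_of_int]] pev_pcompose_monom \<zeta>_def)
    also have "\<dots> = (\<Sum>b\<in>Bs d. of_nat D * (pev of_rat (\<zeta> k) (r b) * b k))"
    proof (intro sum.cong refl)
      fix b assume b: "b \<in> Bs d"
      have "pev of_int (\<zeta> k) (q b) = pev of_rat (\<zeta> k) (map_poly of_int (q b))"
        by (subst pev_map_poly) auto
      also have "\<dots> = pev of_rat (\<zeta> k) ([:of_nat D:] * r b)" using D(2)[OF b] by simp
      also have "\<dots> = of_nat D * pev of_rat (\<zeta> k) (r b)"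
        unfolding rhom_mult[OF rhom_pev[OF rhom_of_rat]] by (simp add: pev_const)
      finally show "pev of_int (\<zeta> k) (q b) * b k = of_nat D * (pev of_rat (\<zeta> k) (r b) * b k)" by simp
    qed
    finally show ?thesis by (simp add: X_def sum_distrib_left)
  qed
  have deg: "degree (S k) \<le> 4 ^ k * (e + dA * d)" for k
    unfolding S_def
  proof (rule degree_sum_le[OF finite_Bs])
    fix b assume b: "b \<in> Bs d"
    have "degree ((q b \<circ>\<^sub>p monom 1 (4 ^ k)) * T b k) \<le> degree (q b) * 4 ^ k + dA * 4 ^ k * d"
      using T0 b by (intro order_trans[OF degree_mult_le] add_mono) (auto simp: degree_pcompose degree_monom_eq)
    also have "\<dots> \<le> e * 4 ^ k + dA * 4 ^ k * d" using D(3)[OF b] r[OF b] by simp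
    also have "\<dots> = 4 ^ k * (e + dA * d)" by (simp add: algebra_simps)
    finally show "degree ((q b \<circ>\<^sub>p monom 1 (4 ^ k)) * T b k) \<le> 4 ^ k * (e + dA * d)" .
  qed
  have len: "poly_len (S k) \<le> len * LA ^ (k * d)" for k
  proof -
    have "poly_len (S k) \<le> (\<Sum>b\<in>Bs d. poly_len ((q b \<circ>\<^sub>p monom 1 (4 ^ k)) * T b k))"
      unfolding S_def by (rule poly_len_sum)
    also have "\<dots> \<le> (\<Sum>b\<in>Bs d. poly_len (q b) * LA ^ (k * d))"
      using T0 by (intro sum_mono order_trans[OF poly_len_mult] mult_mono) (auto simp: poly_len_pcompose_monom poly_len_nonneg)
    finally show ?thesis by (simp add: len_def sum_distrib_right)
  qed
  have len0: "len \<ge> 0" by (simp add: len_def sum_nonneg poly_len_nonneg)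
  show ?thesis
  proof (rule that[of "real D * (C * of_int len) ^ K"])
    show "real D * (C * of_int len) ^ K \<ge> 0" using L(1) len0 by simp
    fix k assume nz: "(\<Sum>b\<in>Bs d. pev of_rat (\<zeta> k) (r b) * b k) \<noteq> 0"
    define n where "n = 4 ^ k * (e + dA * d)"
    have "pev of_int \<alpha> (S k) \<noteq> 0" using nz D(1) by (simp add: SX X_def)
    from L(2)[OF deg this] have "1 \<le> norm (pev of_int \<alpha> (S k)) * (C ^ Suc n * of_int (poly_len (S k))) ^ K"
      by (simp only: n_def)
    also have "\<dots> \<le> norm (pev of_int \<alpha> (S k)) * (C ^ Suc n * of_int (len * LA ^ (k * d))) ^ K"
      using L(1) len[of k] by (intro mult_left_mono power_mono) (auto simp: poly_len_nonneg simp flip: of_int_power of_int_mult)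
    also have "norm (pev of_int \<alpha> (S k)) = real D * norm (X k)" by (simp add: SX norm_mult)
    also have "real D * norm (X k) * (C ^ Suc n * of_int (len * LA ^ (k * d))) ^ K =
      norm (X k) * (real D * (C * of_int len) ^ K) * of_int LA ^ (k * d * K) * C ^ (n * K)"
      by (simp add: power_mult_distrib mult_ac flip: power_mult)
    finally show "1 \<le> norm (\<Sum>b\<in>Bs d. pev of_rat (\<zeta> k) (r b) * b k) * (real D * (C * of_int len) ^ K) * of_int LA ^ (k * d * K) * C ^ (4 ^ k * (e + dA * d) * K)"
      by (simp only: X_def n_def)
  qed
qed

end

context mahler_system
begin

text \<open>The auxiliary combination is the sum over \<open>j \<le> J\<close> and \<open>b\<close>
  in \<open>Bs d\<close> of \<open>R j b\<close> times \<open>Phi P k x ^ j * b k\<close>; its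
  coordinates over \<open>Bs (4 * d)\<close> are made to vanish to order \<open>p\<close> at the
  functions. Let \<open>h\<close> be the least \<open>j\<close> that occurs. After division by the
  power with exponent \<open>h\<close> the coordinates over \<open>Bs (2 * d)\<close> are
  \<open>W\<close>, and they vanish to almost the same order because multiplication by that power is
  injective. At the values of the functions only the term \<open>j = h\<close> remains; it no longer
  involves these values and is nonzero infinitely often by independence.\<close>

lemma auxiliary_value_contradiction:
  assumes P: "P \<noteq> 0" "rat_mpoly_vars P \<subseteq> {..<4}"
    and ev0: "rat_mpoly_eval P (\<lambda>i. fev (f i) \<alpha>) = 0"
    and del: "\<delta> \<ge> 1" "inA \<delta> (Phi P)"
    and L: "C \<ge> 1" "\<And>T n. degree T \<le> n \<Longrightarrow> pev of_int \<alpha> T \<noteq> 0 \<Longrightarrow>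
       1 \<le> norm (pev of_int \<alpha> T) * (C ^ Suc n * of_int (poly_len T)) ^ K"
    and tau: "C ^ K * norm \<alpha> ^ \<tau> < 1"
    and d: "card (Bs (4 * d)) \<le> 4 ^ 17 * card (Bs d)" "d div \<delta> + 1 > 4 ^ 17 * (\<tau> + 1)"
  shows False
proof -
  \<comment> \<open>As \<open>J * \<delta> \<le> d\<close>, powers of \<open>Phi\<close> times
    \<open>Bs d\<close> stay within degree \<open>2 * d\<close>, and times \<open>Bs (2 * d)\<close>
    within \<open>3 * d\<close>, hence within \<open>4 * d\<close>.\<close>
  define J where "J = d div \<delta>"
  have J: "j * \<delta> \<le> d" if "j \<le> J" for j
    using mult_le_mono1[OF that, of \<delta>] unfolding J_def by (meson div_times_less_eq_dividend le_trans)
  define \<Psi> where "\<Psi> = ev4 fps_const fps_X f"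
  have hPsi: "rhom \<Psi>" unfolding \<Psi>_def by (rule rhom_ev4[OF rhom_fps_const])
  have PsiD: "r = 0" if "\<Psi> r = 0" for r using indep that by (simp add: \<Psi>_def)
  have inA2: "inA (2 * d) (\<lambda>k x. Phi P k x ^ j * b k)" if "j \<le> J" "b \<in> Bs d" for j b
  proof -
    have "b \<in> G d" using that(2) Bs_subset by blast
    from inA_mult[OF inA_power[OF del(2)] inA_G[OF this]]
    have "inA (j * \<delta> + d) (\<lambda>k x. Phi P k x ^ j * b k)" .
    thus ?thesis by (rule inA_mono) (use J[OF that(1)] in simp)
  qed
  have inA4: "inA (4 * d) (\<lambda>k x. Phi P k x ^ j * l k)" if "j \<le> J" "l \<in> Bs (2 * d)" for j l
  proof -
    have "l \<in> G (2 * d)" using that(2) Bs_subset by blast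
    from inA_mult[OF inA_power[OF del(2)] inA_G[OF this]]
    have "inA (j * \<delta> + 2 * d) (\<lambda>k x. Phi P k x ^ j * l k)" .
    thus ?thesis by (rule inA_mono) (use J[OF that(1)] in simp)
  qed
  define T where "T = (\<lambda>j b. SOME T. rep (2 * d) (\<lambda>k x. Phi P k x ^ j * b k) T)"
  have T: "rep (2 * d) (\<lambda>k x. Phi P k x ^ j * b k) (T j b)" if "j \<le> J" "b \<in> Bs d" for j b
    unfolding T_def by (rule someI_ex[OF inA_rep[OF inA2[OF that]]])
  define U where "U = (\<lambda>j b. SOME T. rep (4 * d) (\<lambda>k x. Phi P k x ^ j * b k) T)"
  have U: "rep (4 * d) (\<lambda>k x. Phi P k x ^ j * b k) (U j b)" if "j \<le> J" "b \<in> Bs d" for j b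
    unfolding U_def by (rule someI_ex[OF inA_rep[OF inA_mono[OF inA2[OF that]]]]) simp
  define M where "M = (\<lambda>h l. SOME T. rep (4 * d) (\<lambda>k x. Phi P k x ^ h * l k) T)"
  have M: "rep (4 * d) (\<lambda>k x. Phi P k x ^ h * l k) (M h l)" if "h \<le> J" "l \<in> Bs (2 * d)" for h l
    unfolding M_def by (rule someI_ex[OF inA_rep[OF inA4[OF that]]])
  define linv where "linv = (\<lambda>h Km e. e \<noteq> 0 \<and> (\<forall>l\<in>Bs (2 * d). \<forall>l1\<in>Bs (2 * d).
     (\<Sum>l'\<in>Bs (4 * d). Km l l' * M h l1 l') = (if l = l1 then e else 0)))"
  have "\<exists>Km e. linv h Km e" if "h \<le> J" for h
    unfolding linv_def
  proof (rule matrix_left_inverse[where M = "\<lambda>l' l. M h l l'", OF finite_Bs finite_Bs])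
    fix H assume "\<And>j. j \<in> Bs (4 * d) \<Longrightarrow> (\<Sum>i\<in>Bs (2 * d). M h i j * H i) = 0"
    thus "\<forall>i\<in>Bs (2 * d). H i = 0"
      by (intro ballI) (rule mult_injective[OF P del(2) M[OF that]])
  qed
  then obtain Km e0 where linv: "\<And>h. h \<le> J \<Longrightarrow> linv h (Km h) (e0 h)" by metis
  have e0: "e0 h \<noteq> 0" if "h \<le> J" for h using linv[OF that] unfolding linv_def by (rule conjunct1)
  have Km: "(\<Sum>l'\<in>Bs (4 * d). Km h l l' * M h l1 l') = (if l = l1 then e0 h else 0)"
    if "h \<le> J" "l \<in> Bs (2 * d)" "l1 \<in> Bs (2 * d)" for h l l1
    using linv[OF that(1)] that(2,3) by (simp only: linv_def)
  \<comment> \<open>The order of vanishing lost through the left inverse. It is summed over all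
    \<open>h\<close>, since the relevant \<open>h\<close> is known only after the unknowns have been
    solved for.\<close>
  define s where "s = (\<Sum>h\<le>J. subdegree (\<Psi> (e0 h)))"
  define Q where "Q = degree (qq (2 * d))"
  \<comment> \<open>The degree allowed for each \<open>R j b\<close>. It is so large that
    \<open>p\<close>, which is \<open>\<tau> + 1\<close> times the number of coefficients of one
    \<open>R j b\<close>, still exceeds \<open>s + \<tau> * m0\<close>; here \<open>m0\<close> is
    above the degree \<open>Q + e + dA * d\<close> of the lower bound.\<close>
  define e where "e = \<tau> * (Q + dA * d) + s"
  define p where "p = (\<tau> + 1) * (e + 1)"
  define m0 where "m0 = e + 1 + Q + dA * d"
  have ps: "p \<ge> s + \<tau> * m0" by (simp add: p_def m0_def e_def algebra_simps)
  define UU where "UU = {..J} \<times> Bs d \<times> {..e}"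
  define VV where "VV = Bs (4 * d) \<times> {..<p}"
  define co where "co = (\<lambda>(l', n) (j, b, i). fps_nth (\<Psi> (zconst (monom 1 i) * U j b l')) n)"
  \<comment> \<open>The excess of conditions is a factor \<open>4 ^ 17\<close> from the growth of
    the basis and a factor \<open>\<tau> + 1\<close> from \<open>p\<close>; the \<open>J + 1\<close>
    available exponents outweigh both.\<close>
  have "card VV < card UU"
  proof -
    have "card VV = card (Bs (4 * d)) * p" by (simp add: VV_def card_cartesian_product)
    also have "\<dots> \<le> 4 ^ 17 * card (Bs d) * p" using d(1) by (rule mult_right_mono) simp
    also have "\<dots> = (4 ^ 17 * (\<tau> + 1)) * (card (Bs d) * (e + 1))" by (simp only: p_def mult_ac)
    also have "\<dots> < (J + 1) * (card (Bs d) * (e + 1))"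
      using d(2) card_Bs_ge_1[of d] unfolding J_def by (intro mult_strict_right_mono) auto
    also have "\<dots> = card UU" by (simp add: UU_def card_cartesian_product)
    finally show ?thesis .
  qed
  from underdetermined_system[OF _ _ this, of co] obtain x where
    x: "\<exists>u\<in>UU. x u \<noteq> 0" "\<And>v. v \<in> VV \<Longrightarrow> (\<Sum>u\<in>UU. co v u * x u) = 0"
    by (auto simp: UU_def VV_def finite_Bs)
  define R where "R = (\<lambda>j b. \<Sum>i\<le>e. monom (x (j, b, i)) i)"
  have degR: "degree (R j b) \<le> e" for j b
    unfolding R_def by (intro degree_sum_le) (auto intro: order_trans[OF degree_monom_le])
  have zR: "\<Psi> (zconst (R j b) * r) = (\<Sum>i\<le>e. fps_const (x (j, b, i)) * \<Psi> (zconst (monom 1 i) * r))" for j b r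
  proof -
    have "\<Psi> (zconst (R j b) * r) = pev fps_const fps_X (R j b) * \<Psi> r"
      by (simp add: rhom_mult[OF hPsi]) (simp add: \<Psi>_def ev4_zconst rhom_fps_const)
    also have "pev fps_const fps_X (R j b) = (\<Sum>i\<le>e. fps_const (x (j, b, i)) * pev fps_const fps_X (monom 1 i))"
      unfolding R_def rhom_sum[OF rhom_pev[OF rhom_fps_const]]
      by (intro sum.cong refl) (simp add: pev_def map_poly_monom poly_monom)
    also have "\<dots> * \<Psi> r = (\<Sum>i\<le>e. fps_const (x (j, b, i)) * \<Psi> (zconst (monom 1 i) * r))"
      by (simp add: rhom_mult[OF hPsi] sum_distrib_right mult.assoc) (simp add: \<Psi>_def ev4_zconst rhom_fps_const)
    finally show ?thesis .
  qed
  have vanish: "fps_nth (\<Sum>j\<le>J. \<Sum>b\<in>Bs d. \<Psi> (zconst (R j b) * U j b l')) n = 0" if "l' \<in> Bs (4 * d)" "n < p" for l' n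
  proof -
    have "(\<Sum>u\<in>UU. co (l', n) u * x u) = 0" using x(2)[of "(l', n)"] that by (simp add: VV_def)
    moreover have "(\<Sum>u\<in>UU. co (l', n) u * x u) = (\<Sum>j\<le>J. \<Sum>b\<in>Bs d. \<Sum>i\<le>e. co (l', n) (j, b, i) * x (j, b, i))"
      unfolding UU_def by (simp add: sum.cartesian_product')
    moreover have "fps_nth (\<Sum>j\<le>J. \<Sum>b\<in>Bs d. \<Psi> (zconst (R j b) * U j b l')) n = (\<Sum>j\<le>J. \<Sum>b\<in>Bs d. \<Sum>i\<le>e. co (l', n) (j, b, i) * x (j, b, i))"
      by (simp add: zR co_def fps_sum_nth mult.commute)
    ultimately show ?thesis by simp
  qed
  have exR: "\<exists>j. j \<le> J \<and> (\<exists>b\<in>Bs d. R j b \<noteq> 0)"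
  proof -
    obtain j b i where u: "j \<le> J" "b \<in> Bs d" "i \<le> e" "x (j, b, i) \<noteq> 0" using x(1) by (auto simp: UU_def)
    have "coeff (R j b) i = x (j, b, i)" using u(3) by (simp add: R_def coeff_sum coeff_monom)
    hence "R j b \<noteq> 0" using u(4) by auto
    thus ?thesis using u by blast
  qed
  define h where "h = (LEAST j. j \<le> J \<and> (\<exists>b\<in>Bs d. R j b \<noteq> 0))"
  have h: "h \<le> J" "\<exists>b\<in>Bs d. R h b \<noteq> 0" using LeastI_ex[OF exR] by (auto simp: h_def)
  have less_h: "R j b = 0" if "j < h" "b \<in> Bs d" for j b
    using not_less_Least[of j "\<lambda>j. j \<le> J \<and> (\<exists>b\<in>Bs d. R j b \<noteq> 0)"] that h by (auto simp: h_def)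
  define W where "W = (\<lambda>l. \<Sum>j\<in>{h..J}. \<Sum>b\<in>Bs d. zconst (R j b) * T (j - h) b l)"
  have MW: "(\<Sum>l\<in>Bs (2 * d). M h l l' * W l) = zconst (qq (2 * d)) * (\<Sum>j\<le>J. \<Sum>b\<in>Bs d. zconst (R j b) * U j b l')" if l': "l' \<in> Bs (4 * d)" for l'
  proof -
    have "(\<Sum>l\<in>Bs (2 * d). M h l l' * W l) = (\<Sum>j\<in>{h..J}. \<Sum>b\<in>Bs d. zconst (R j b) * (\<Sum>l\<in>Bs (2 * d). M h l l' * T (j - h) b l))"
    proof -
      have "(\<Sum>l\<in>Bs (2 * d). M h l l' * W l) = (\<Sum>l\<in>Bs (2 * d). \<Sum>j\<in>{h..J}. \<Sum>b\<in>Bs d. zconst (R j b) * (M h l l' * T (j - h) b l))"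
        by (simp add: W_def sum_distrib_left mult.left_commute)
      also have "\<dots> = (\<Sum>j\<in>{h..J}. \<Sum>l\<in>Bs (2 * d). \<Sum>b\<in>Bs d. zconst (R j b) * (M h l l' * T (j - h) b l))"
        by (rule sum.swap)
      also have "\<dots> = (\<Sum>j\<in>{h..J}. \<Sum>b\<in>Bs d. \<Sum>l\<in>Bs (2 * d). zconst (R j b) * (M h l l' * T (j - h) b l))"
        by (rule sum.cong[OF refl], rule sum.swap)
      finally show ?thesis by (simp only: sum_distrib_left)
    qed
    also have "\<dots> = (\<Sum>j\<in>{h..J}. \<Sum>b\<in>Bs d. zconst (R j b) * (zconst (qq (2 * d)) * U j b l'))"
    proof (intro sum.cong refl arg_cong2[of _ _ _ _ times])
      fix j b assume jb: "j \<in> {h..J}" "b \<in> Bs d"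
      show "(\<Sum>l\<in>Bs (2 * d). M h l l' * T (j - h) b l) = zconst (qq (2 * d)) * U j b l'"
        by (rule rep_mult_compose[where P = P and h = h and j = "j - h" and b = b])
           (use jb M[OF h(1)] T[of "j - h" b] U[of j b] l' in auto)
    qed
    also have "\<dots> = (\<Sum>j\<le>J. \<Sum>b\<in>Bs d. zconst (R j b) * (zconst (qq (2 * d)) * U j b l'))"
      by (rule sum.mono_neutral_left) (auto simp: less_h zconst_def)
    finally show ?thesis by (simp add: sum_distrib_left mult_ac)
  qed
  \<comment> \<open>The left inverse applied to \<open>MW\<close> writes \<open>e0 h * W l\<close>
    in terms of series vanishing to order \<open>p\<close>, and \<open>e0 h\<close> accounts for at
    most \<open>s\<close> of that order.\<close>
  have Wv: "fps_nth (\<Psi> (W l)) n = 0" if l: "l \<in> Bs (2 * d)" and n: "n < \<tau> * m0" for l n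
  proof (cases "\<Psi> (W l) = 0")
    case False
    have "e0 h * W l = (\<Sum>l1\<in>Bs (2 * d). (if l = l1 then e0 h else 0) * W l1)"
      using l finite_Bs by (simp add: if_distrib[where f = "\<lambda>x. x * _"] cong: if_cong)
    also have "\<dots> = (\<Sum>l1\<in>Bs (2 * d). (\<Sum>l'\<in>Bs (4 * d). Km h l l' * M h l1 l') * W l1)"
      using Km[OF h(1) l] by (intro sum.cong refl) simp
    also have "\<dots> = (\<Sum>l'\<in>Bs (4 * d). Km h l l' * (\<Sum>l1\<in>Bs (2 * d). M h l1 l' * W l1))"
      unfolding sum_distrib_left sum_distrib_right by (subst sum.swap) (simp add: mult_ac)
    also have "\<dots> = (\<Sum>l'\<in>Bs (4 * d). Km h l l' * zconst (qq (2 * d)) * (\<Sum>j\<le>J. \<Sum>b\<in>Bs d. zconst (R j b) * U j b l'))"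
      using MW by (intro sum.cong refl) (simp add: mult.assoc)
    finally have eq: "\<Psi> (e0 h) * \<Psi> (W l) = (\<Sum>l'\<in>Bs (4 * d). \<Psi> (Km h l l' * zconst (qq (2 * d))) * (\<Sum>j\<le>J. \<Sum>b\<in>Bs d. \<Psi> (zconst (R j b) * U j b l')))"
      by (drule_tac arg_cong[of _ _ \<Psi>]) (simp only: rhom_mult[OF hPsi] rhom_sum[OF hPsi])
    have "fps_nth (\<Psi> (e0 h) * \<Psi> (W l)) n = 0" if "n < p" for n
    proof -
      have "fps_nth (g * (\<Sum>j\<le>J. \<Sum>b\<in>Bs d. \<Psi> (zconst (R j b) * U j b l'))) n = 0" if "l' \<in> Bs (4 * d)" for g l'
        unfolding fps_mult_nth using vanish[OF that] \<open>n < p\<close> by (intro sum.neutral) auto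
      thus ?thesis unfolding eq fps_sum_nth by (intro sum.neutral) auto
    qed
    moreover have nz: "\<Psi> (e0 h) \<noteq> 0" using e0[OF h(1)] PsiD by blast
    ultimately have "p \<le> subdegree (\<Psi> (e0 h) * \<Psi> (W l))"
      using False by (intro subdegree_geI) auto
    also have "\<dots> = subdegree (\<Psi> (e0 h)) + subdegree (\<Psi> (W l))" using False nz by simp
    also have "subdegree (\<Psi> (e0 h)) \<le> s" unfolding s_def using h(1) by (intro member_le_sum) auto
    finally have "\<tau> * m0 \<le> subdegree (\<Psi> (W l))" using ps by linarith
    thus ?thesis using n by (intro nth_less_subdegree_zero) linarith
  qed simp
  define X where "X = (\<lambda>k. \<Sum>b\<in>Bs d. pev of_rat (\<zeta> k) (qq (2 * d) * R h b) * b k)"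
  have evT: "\<forall>\<^sub>F k in sequentially. \<forall>jb\<in>{..J} \<times> Bs d. \<forall>x. pev of_rat (\<zeta> k) (qq (2 * d)) * (Phi P k x ^ fst jb * snd jb k) = (\<Sum>l\<in>Bs (2 * d). ev k x (T (fst jb) (snd jb) l) * l k)"
    using T unfolding rep_def by (intro eventually_ball_finite finite_cartesian_product finite_Bs ballI) auto
  have Xeq: "\<forall>\<^sub>F k in sequentially. (\<Sum>l\<in>Bs (2 * d). ev k (\<lambda>i. fev (f i) (\<zeta> k)) (W l) * l k) = X k"
    using evT
  proof eventually_elim
    case (elim k)
    define y where "y = (\<lambda>i. fev (f i) (\<zeta> k))"
    have Phi0: "Phi P k y = 0" unfolding y_def Phi_zeta[OF P(2)] by (rule ev0)
    have "(\<Sum>l\<in>Bs (2 * d). ev k y (W l) * l k) = (\<Sum>j\<in>{h..J}. \<Sum>b\<in>Bs d. pev of_rat (\<zeta> k) (R j b) * (\<Sum>l\<in>Bs (2 * d). ev k y (T (j - h) b l) * l k))"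
    proof -
      have "(\<Sum>l\<in>Bs (2 * d). ev k y (W l) * l k) = (\<Sum>l\<in>Bs (2 * d). \<Sum>j\<in>{h..J}. \<Sum>b\<in>Bs d. pev of_rat (\<zeta> k) (R j b) * (ev k y (T (j - h) b l) * l k))"
        by (simp add: W_def ev_hom ev4_zconst[OF rhom_of_rat] sum_distrib_right mult.assoc)
      also have "\<dots> = (\<Sum>j\<in>{h..J}. \<Sum>l\<in>Bs (2 * d). \<Sum>b\<in>Bs d. pev of_rat (\<zeta> k) (R j b) * (ev k y (T (j - h) b l) * l k))"
        by (rule sum.swap)
      also have "\<dots> = (\<Sum>j\<in>{h..J}. \<Sum>b\<in>Bs d. \<Sum>l\<in>Bs (2 * d). pev of_rat (\<zeta> k) (R j b) * (ev k y (T (j - h) b l) * l k))"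
        by (rule sum.cong[OF refl], rule sum.swap)
      finally show ?thesis by (simp only: sum_distrib_left)
    qed
    also have "\<dots> = (\<Sum>j\<in>{h..J}. \<Sum>b\<in>Bs d. pev of_rat (\<zeta> k) (R j b) * (pev of_rat (\<zeta> k) (qq (2 * d)) * (Phi P k y ^ (j - h) * b k)))"
    proof (intro sum.cong refl arg_cong2[of _ _ _ _ times])
      fix j b assume "j \<in> {h..J}" "b \<in> Bs d"
      hence "(j - h, b) \<in> {..J} \<times> Bs d" by auto
      from elim[rule_format, OF this] show "(\<Sum>l\<in>Bs (2 * d). ev k y (T (j - h) b l) * l k) = pev of_rat (\<zeta> k) (qq (2 * d)) * (Phi P k y ^ (j - h) * b k)"
        by simp
    qed
    also have "\<dots> = (\<Sum>j\<in>{h..J}. if j = h then X k else 0)"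
      by (intro sum.cong refl) (auto simp: Phi0 X_def rhom_mult[OF rhom_pev[OF rhom_of_rat]] mult_ac power_0_left)
    also have "\<dots> = X k" using h(1) by simp
    finally show ?case by (simp only: y_def)
  qed
  have Xnz: "\<exists>\<^sub>F k in sequentially. X k \<noteq> 0"
  proof (rule ccontr)
    assume "\<not> ?thesis"
    hence "\<forall>\<^sub>F k in sequentially. X k = 0" by (simp add: frequently_def)
    hence "\<forall>\<^sub>F k in sequentially. (\<Sum>b\<in>Bs d. pev of_rat (\<zeta> k) (qq (2 * d) * R h b) * b k) = 0" by (simp only: X_def)
    from zindepD[OF zindep_Bs this] have "qq (2 * d) * R h b = 0" if "b \<in> Bs d" for b using that .
    thus False using h(2) qq(1)[of "2 * d"] by auto
  qed
  obtain C1 where C1: "C1 \<ge> 0" "\<And>k. norm (\<Sum>l\<in>Bs (2 * d). ev k (\<lambda>i. fev (f i) (\<zeta> k)) (W l) * l k) \<le> C1 * of_int LA ^ (k * (2 * d)) * norm \<alpha> ^ (4 ^ k * (\<tau> * m0))"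
    by (rule upper_bound[of "2 * d" "\<tau> * m0" W]) (use Wv in \<open>simp_all add: \<Psi>_def\<close>)
  have degqR: "degree (qq (2 * d) * R h b) \<le> Q + e" for b
    unfolding Q_def using degR[of h b] by (intro order_trans[OF degree_mult_le] add_mono) auto
  obtain C2 where C2: "C2 \<ge> 0" "\<And>k. X k \<noteq> 0 \<Longrightarrow>
     1 \<le> norm (X k) * C2 * of_int LA ^ (k * d * K) * C ^ (4 ^ k * (Q + e + dA * d) * K)"
    unfolding X_def by (rule lower_bound[OF L, of d "\<lambda>b. qq (2 * d) * R h b" "Q + e"]) (use degqR in simp_all)
  define V where "V = real_of_int LA ^ (2 * d + d * K)"
  \<comment> \<open>Both bounds contain powers with exponent proportional to
    \<open>4 ^ k * m0\<close>; together these give \<open>t ^ (4 ^ k)\<close>, where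
    \<open>t < 1\<close> by the choice of \<open>\<tau>\<close>. The factors exponential in
    \<open>k\<close> are collected in \<open>V\<close>.\<close>
  define t where "t = (C ^ K * norm \<alpha> ^ \<tau>) ^ m0"
  have LA1: "real_of_int LA \<ge> 1" using LA_ge_1[of 0 0] by simp
  have "0 < C ^ K * norm \<alpha> ^ \<tau>" using L(1) alpha_nz by (intro mult_pos_pos zero_less_power) auto
  hence t: "0 \<le> t" "t < 1"
    using tau L(1) unfolding t_def m0_def by (auto intro!: power_Suc_less_one[of _ "e + Q + dA * d", simplified])
  have "(\<lambda>k. (C1 * C2) * (V ^ k * t ^ (4 ^ k))) \<longlonglongrightarrow> (C1 * C2) * 0"
    using LA1 t by (intro tendsto_mult tendsto_const power_tower_decay) (auto simp: V_def)
  hence "\<forall>\<^sub>F k in sequentially. (C1 * C2) * (V ^ k * t ^ (4 ^ k)) < 1" by (rule order_tendstoD) simp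
  with Xeq have "\<forall>\<^sub>F k in sequentially. X k = 0"
  proof eventually_elim
    case (elim k)
    show ?case
    proof (rule ccontr)
      assume "X k \<noteq> 0"
      have "1 \<le> norm (X k) * C2 * of_int LA ^ (k * d * K) * C ^ (4 ^ k * (Q + e + dA * d) * K)"
        using C2(2)[OF \<open>X k \<noteq> 0\<close>] .
      also have "\<dots> \<le> (C1 * of_int LA ^ (k * (2 * d)) * norm \<alpha> ^ (4 ^ k * (\<tau> * m0))) * C2 * of_int LA ^ (k * d * K) * C ^ (4 ^ k * m0 * K)"
        using C1(2)[of k] C2(1) L(1) LA1 unfolding elim(1)
        by (intro mult_mono power_increasing mult_nonneg_nonneg) (auto simp: m0_def intro!: mult_nonneg_nonneg C1(1))
      also have "\<dots> = (C1 * C2) * (V ^ k * t ^ (4 ^ k))"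
      proof -
        have "V ^ k = of_int LA ^ (k * (2 * d)) * of_int LA ^ (k * d * K)"
          by (simp add: V_def algebra_simps flip: power_mult power_add)
        moreover have "t ^ (4 ^ k) = norm \<alpha> ^ (4 ^ k * (\<tau> * m0)) * C ^ (4 ^ k * m0 * K)"
          by (simp add: t_def power_mult_distrib mult_ac flip: power_mult)
        ultimately show ?thesis by (simp add: mult_ac)
      qed
      finally show False using elim(2) by linarith
    qed
  qed
  thus False using Xnz by (simp add: frequently_def)
qed

theorem values_algebraically_independent:
  assumes "rat_mpoly_vars P \<subseteq> {..<4}" "rat_mpoly_eval P (\<lambda>i. fev (f i) \<alpha>) = 0"
  shows "P = 0"
proof (rule ccontr)
  assume P: "P \<noteq> 0"
  obtain \<delta> where del: "\<delta> \<ge> 1" "inA \<delta> (Phi P)" using Phi_inA[OF assms(1)] by blast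
  obtain C K where L: "C \<ge> 1" "\<And>T n. degree T \<le> n \<Longrightarrow> pev of_int \<alpha> T \<noteq> 0 \<Longrightarrow>
       1 \<le> norm (pev of_int \<alpha> T) * (C ^ Suc n * of_int (poly_len T)) ^ K"
    using liouville_inequality[OF alg] by metis
  have "(\<lambda>\<tau>. C ^ K * norm \<alpha> ^ \<tau>) \<longlonglongrightarrow> C ^ K * 0"
    using alpha_lt_1 by (intro tendsto_mult tendsto_const LIMSEQ_realpow_zero) auto
  hence "\<forall>\<^sub>F \<tau> in sequentially. C ^ K * norm \<alpha> ^ \<tau> < 1" by (rule order_tendstoD) simp
  then obtain \<tau> where tau: "C ^ K * norm \<alpha> ^ \<tau> < 1" by (auto simp: eventually_sequentially)
  obtain d where d: "d \<ge> \<delta> * (4 ^ 17 * (\<tau> + 1))" "card (Bs (4 * d)) \<le> 4 ^ 17 * card (Bs d)"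
    using card_Bs_growth by blast
  have "4 ^ 17 * (\<tau> + 1) \<le> d div \<delta>" using del(1) d(1) by (simp add: less_eq_div_iff_mult_less_eq mult.commute)
  hence "d div \<delta> + 1 > 4 ^ 17 * (\<tau> + 1)" by linarith
  from auxiliary_value_contradiction[OF P assms del L tau d(2) this] show False .
qed

end

section \<open>Subfields and affine difference equations\<close>

text \<open>Fields are subsets of one ambient field, so that a single map acts on all levels of the
  tower. As \<open>inverse 0 = 0\<close>, closure under \<open>inverse\<close> has no
  exception.\<close>

definition subfld :: "'a::field set \<Rightarrow> bool" where
  "subfld K \<longleftrightarrow> 0 \<in> K \<and> 1 \<in> K \<and> (\<forall>x\<in>K. \<forall>y\<in>K. x + y \<in> K \<and> x * y \<in> K) \<and> (\<forall>x\<in>K. - x \<in> K \<and> inverse x \<in> K)"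

lemma subfld_UNIV: "subfld UNIV"
  by (simp add: subfld_def)

lemma subfld_0: "subfld K \<Longrightarrow> 0 \<in> K" and subfld_1: "subfld K \<Longrightarrow> 1 \<in> K"
  and subfld_add: "subfld K \<Longrightarrow> x \<in> K \<Longrightarrow> y \<in> K \<Longrightarrow> x + y \<in> K"
  and subfld_mult: "subfld K \<Longrightarrow> x \<in> K \<Longrightarrow> y \<in> K \<Longrightarrow> x * y \<in> K"
  and subfld_uminus: "subfld K \<Longrightarrow> x \<in> K \<Longrightarrow> - x \<in> K"
  and subfld_inverse: "subfld K \<Longrightarrow> x \<in> K \<Longrightarrow> inverse x \<in> K"
  by (auto simp: subfld_def)

lemma subfld_diff: "subfld K \<Longrightarrow> x \<in> K \<Longrightarrow> y \<in> K \<Longrightarrow> x - y \<in> K"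
  using subfld_add[of K x "-y"] subfld_uminus[of K y] by simp

lemma subfld_divide: "subfld K \<Longrightarrow> x \<in> K \<Longrightarrow> y \<in> K \<Longrightarrow> x / y \<in> K"
  by (simp add: divide_inverse subfld_mult subfld_inverse)

lemma subfld_power: "subfld K \<Longrightarrow> x \<in> K \<Longrightarrow> x ^ n \<in> K"
  by (induction n) (auto simp: subfld_1 subfld_mult)

lemma subfld_sum: "subfld K \<Longrightarrow> (\<And>i. i \<in> I \<Longrightarrow> g i \<in> K) \<Longrightarrow> sum g I \<in> K"
  by (induction I rule: infinite_finite_induct) (auto simp: subfld_0 subfld_add)

lemma subfld_of_nat: "subfld K \<Longrightarrow> of_nat n \<in> K"
  by (induction n) (auto simp: subfld_0 subfld_1 subfld_add)

lemma subfld_numeral: "subfld K \<Longrightarrow> numeral n \<in> K"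
  using subfld_of_nat[of K "numeral n"] by simp

lemmas subfld_intros = subfld_0 subfld_1 subfld_add subfld_mult subfld_uminus subfld_inverse
  subfld_diff subfld_divide subfld_power subfld_sum subfld_of_nat subfld_numeral

definition polyover :: "'a::field set \<Rightarrow> 'a poly \<Rightarrow> bool" where
  "polyover K p \<longleftrightarrow> (\<forall>i. coeff p i \<in> K)"

lemma polyoverD: "polyover K p \<Longrightarrow> coeff p i \<in> K"
  by (simp add: polyover_def)

lemma polyover_0: "subfld K \<Longrightarrow> polyover K 0"
  and polyover_1: "subfld K \<Longrightarrow> polyover K 1"
  and polyover_add: "subfld K \<Longrightarrow> polyover K p \<Longrightarrow> polyover K q \<Longrightarrow> polyover K (p + q)"
  and polyover_uminus: "subfld K \<Longrightarrow> polyover K p \<Longrightarrow> polyover K (- p)"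
  and polyover_diff: "subfld K \<Longrightarrow> polyover K p \<Longrightarrow> polyover K q \<Longrightarrow> polyover K (p - q)"
  and polyover_mult: "subfld K \<Longrightarrow> polyover K p \<Longrightarrow> polyover K q \<Longrightarrow> polyover K (p * q)"
  and polyover_smult: "subfld K \<Longrightarrow> c \<in> K \<Longrightarrow> polyover K p \<Longrightarrow> polyover K (smult c p)"
  and polyover_pCons: "c \<in> K \<Longrightarrow> polyover K p \<Longrightarrow> polyover K (pCons c p)"
  and polyover_monom: "subfld K \<Longrightarrow> c \<in> K \<Longrightarrow> polyover K (monom c n)"
  by (auto simp: polyover_def subfld_intros coeff_mult coeff_pCons coeff_monom coeff_1 split: nat.split)

lemma polyover_power: "subfld K \<Longrightarrow> polyover K p \<Longrightarrow> polyover K (p ^ n)"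
  by (induction n) (auto simp: polyover_1 polyover_mult)

lemma polyover_sum: "subfld K \<Longrightarrow> (\<And>i. i \<in> I \<Longrightarrow> polyover K (g i)) \<Longrightarrow> polyover K (sum g I)"
  by (induction I rule: infinite_finite_induct) (auto simp: polyover_0 polyover_add)

lemma polyover_pcompose: "subfld K \<Longrightarrow> polyover K p \<Longrightarrow> polyover K q \<Longrightarrow> polyover K (p \<circ>\<^sub>p q)"
proof (induction p)
  case (pCons a p)
  have "a \<in> K" using polyoverD[OF pCons.prems(2), of 0] by simp
  moreover have "polyover K p" unfolding polyover_def
    using polyoverD[OF pCons.prems(2), of "Suc _"] by (simp add: coeff_pCons)
  ultimately show ?case using pCons
    by (simp add: pcompose_pCons polyover_add polyover_mult polyover_pCons polyover_0)
qed (simp add: polyover_0)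

lemma polyover_map: "(\<And>x. x \<in> K \<Longrightarrow> s x \<in> K) \<Longrightarrow> s 0 = 0 \<Longrightarrow> polyover K p \<Longrightarrow> polyover K (map_poly s p)"
  by (simp add: polyover_def coeff_map_poly)

lemmas polyover_intros = polyover_0 polyover_1 polyover_add polyover_uminus polyover_diff polyover_mult
  polyover_smult polyover_pCons polyover_monom polyover_power polyover_sum polyover_pcompose

lemma polyover_division:
  assumes K: "subfld K" and q: "polyover K q" "q \<noteq> 0" and p: "polyover K p"
  shows "\<exists>a r. polyover K a \<and> polyover K r \<and> p = q * a + r \<and> (r = 0 \<or> degree r < degree q)"
  using p
proof (induction "if p = 0 then 0 else Suc (degree p)" arbitrary: p rule: less_induct)
  case less
  show ?case
  proof (cases "p = 0 \<or> degree p < degree q")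
    case True
    thus ?thesis using less.prems K by (intro exI[of _ 0] exI[of _ p]) (auto simp: polyover_0)
  next
    case False
    define m where "m = monom (lead_coeff p / lead_coeff q) (degree p - degree q)"
    have m: "polyover K m" unfolding m_def
      by (intro polyover_monom subfld_divide K polyoverD[OF less.prems] polyoverD[OF q(1)])
    have lc: "lead_coeff p / lead_coeff q \<noteq> 0" using False q by simp
    have degm: "degree m = degree p - degree q" unfolding m_def by (rule degree_monom_eq[OF lc])
    have m0: "m \<noteq> 0" using lc by (simp add: m_def)
    have deg: "degree (q * m) = degree p" using False q degm m0 by (simp add: degree_mult_eq)
    have lead: "lead_coeff (q * m) = lead_coeff p"
    proof -
      have "lead_coeff m = lead_coeff p / lead_coeff q" unfolding degm by (simp add: m_def)
      thus ?thesis using q by (simp add: lead_coeff_mult)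
    qed
    define p' where "p' = p - q * m"
    have "polyover K p'" unfolding p'_def using K less.prems q m by (intro polyover_intros)
    moreover have "p' = 0 \<or> degree p' < degree p"
    proof (cases "degree p = 0")
      case True
      then obtain c d where "p = [:c:]" "q * m = [:d:]" using deg degree_eq_zeroE by metis
      thus ?thesis using lead by (auto simp: p'_def)
    next
      case F: False
      have "degree p' \<le> degree p" unfolding p'_def using deg by (intro degree_diff_le) auto
      moreover have "coeff p' (degree p) = 0" using lead deg by (simp add: p'_def)
      ultimately show ?thesis using F by (metis eq_zero_or_degree_less)
    qed
    ultimately have p': "polyover K p'" "(if p' = 0 then 0 else Suc (degree p')) < (if p = 0 then 0 else Suc (degree p))"
      using False by auto
    obtain a r where ar: "polyover K a" "polyover K r" "p' = q * a + r" "r = 0 \<or> degree r < degree q"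
      using less.hyps[OF p'(2,1)] by blast
    hence "p = q * (m + a) + r" by (simp add: p'_def algebra_simps)
    thus ?thesis using ar m K by (intro exI[of _ "m + a"] exI[of _ r]) (auto simp: polyover_add)
  qed
qed

text \<open>A nonzero combination of least degree divides all members, and dividing it out leaves
  cofactors that generate the unit ideal. With \<open>K = UNIV\<close> this removes the content of a
  polynomial over \<open>rat poly\<close>.\<close>

lemma polyover_bezout:
  assumes K: "subfld K" and I: "finite I" and p: "\<And>i. i \<in> I \<Longrightarrow> polyover K (p i)" and nz: "\<exists>i\<in>I. p i \<noteq> 0"
  obtains g a q where "g \<noteq> 0" "polyover K g" "\<And>i. i \<in> I \<Longrightarrow> polyover K (a i)" "\<And>i. i \<in> I \<Longrightarrow> polyover K (q i)"
    "\<And>i. i \<in> I \<Longrightarrow> p i = g * q i" "(\<Sum>i\<in>I. a i * q i) = 1"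
proof -
  define S where "S = {g. g \<noteq> 0 \<and> (\<exists>a. (\<forall>i\<in>I. polyover K (a i)) \<and> g = (\<Sum>i\<in>I. a i * p i))}"
  obtain i0 where i0: "i0 \<in> I" "p i0 \<noteq> 0" using nz by blast
  have "p i0 \<in> S"
  proof -
    have "(\<Sum>i\<in>I. (if i = i0 then 1 else 0) * p i) = (\<Sum>i\<in>I. if i = i0 then p i else 0)" by (intro sum.cong) auto
    also have "\<dots> = p i0" using i0 I by simp
    finally show ?thesis unfolding S_def using i0 K
      by (intro CollectI conjI exI[of _ "\<lambda>i. if i = i0 then 1 else 0"]) (auto simp: polyover_0 polyover_1)
  qed
  then obtain g where g: "g \<in> S" "\<And>g'. g' \<in> S \<Longrightarrow> degree g \<le> degree g'"
    using arg_min_natI[of "\<lambda>g. g \<in> S" "p i0" degree] arg_min_nat_le[of "\<lambda>g. g \<in> S" _ degree] by blast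
  then obtain a where a: "g \<noteq> 0" "\<And>i. i \<in> I \<Longrightarrow> polyover K (a i)" "g = (\<Sum>i\<in>I. a i * p i)" by (auto simp: S_def)
  have pg: "polyover K g" unfolding a(3) using a(2) p K by (intro polyover_intros) auto
  have "\<exists>q. polyover K q \<and> p i = g * q" if i: "i \<in> I" for i
  proof -
    obtain q r where qr: "polyover K q" "polyover K r" "p i = g * q + r" "r = 0 \<or> degree r < degree g"
      using polyover_division[OF K pg a(1) p[OF i]] by blast
    have "r = 0"
    proof (rule ccontr)
      assume r: "r \<noteq> 0"
      have "r = (\<Sum>j\<in>I. (if j = i then p j else 0)) - q * (\<Sum>j\<in>I. a j * p j)"
        using qr(3) I i a(3) by (simp add: algebra_simps)
      also have "\<dots> = (\<Sum>j\<in>I. ((if j = i then 1 else 0) - q * a j) * p j)"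
        unfolding sum_distrib_left sum_subtractf[symmetric] by (intro sum.cong) (auto simp: algebra_simps)
      finally have "r \<in> S" unfolding S_def using r K a(2) qr(1)
        by (intro CollectI conjI exI[of _ "\<lambda>j. (if j = i then 1 else 0) - q * a j"]) (auto intro!: polyover_intros)
      hence "degree g \<le> degree r" by (rule g(2))
      thus False using qr(4) r by simp
    qed
    thus ?thesis using qr by auto
  qed
  then obtain q where q: "\<And>i. i \<in> I \<Longrightarrow> polyover K (q i)" "\<And>i. i \<in> I \<Longrightarrow> p i = g * q i" by metis
  have "g = (\<Sum>i\<in>I. a i * (g * q i))" using a(3) q(2) by (simp cong: sum.cong)
  also have "\<dots> = g * (\<Sum>i\<in>I. a i * q i)" by (simp add: sum_distrib_left mult_ac)
  finally have "g * ((\<Sum>i\<in>I. a i * q i) - 1) = 0" by (simp add: algebra_simps)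
  hence "(\<Sum>i\<in>I. a i * q i) = 1" using a(1) by simp
  with that[of g a q] a(1,2) pg q show ?thesis by blast
qed

section \<open>Transcendental elements and simple extensions\<close>

definition transc :: "'a::field set \<Rightarrow> 'a \<Rightarrow> bool" where
  "transc K t \<longleftrightarrow> (\<forall>p. polyover K p \<longrightarrow> poly p t = 0 \<longrightarrow> p = 0)"

definition adjoin :: "'a::field set \<Rightarrow> 'a \<Rightarrow> 'a set" where
  "adjoin K t = {poly p t / poly q t | p q. polyover K p \<and> polyover K q \<and> poly q t \<noteq> 0}"

lemma adjoinI: "polyover K p \<Longrightarrow> polyover K q \<Longrightarrow> poly q t \<noteq> 0 \<Longrightarrow> poly p t / poly q t \<in> adjoin K t"
  by (auto simp: adjoin_def)

lemma adjoinE: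
  assumes "r \<in> adjoin K t"
  obtains p q where "polyover K p" "polyover K q" "poly q t \<noteq> 0" "r = poly p t / poly q t"
  using assms by (auto simp: adjoin_def)

lemma poly_in_adjoin: "subfld K \<Longrightarrow> polyover K p \<Longrightarrow> poly p t \<in> adjoin K t"
  using adjoinI[of K p 1 t] by (simp add: polyover_1)

lemma subset_adjoin: assumes "subfld K" shows "K \<subseteq> adjoin K t"
proof
  fix x assume "x \<in> K"
  hence "polyover K [:x:]" using assms by (simp add: polyover_intros)
  from poly_in_adjoin[OF assms this, of t] show "x \<in> adjoin K t" by simp
qed

lemma self_in_adjoin: assumes "subfld K" shows "t \<in> adjoin K t"
proof -
  have "polyover K [:0, 1:]" by (intro polyover_pCons subfld_0 subfld_1 polyover_0 assms)
  from poly_in_adjoin[OF assms this, of t] show ?thesis by simp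
qed

lemma subfld_adjoin: assumes K: "subfld K" shows "subfld (adjoin K t)"
  unfolding subfld_def
proof (intro conjI ballI)
  show "0 \<in> adjoin K t" "1 \<in> adjoin K t" using subset_adjoin[OF K, of t] subfld_0[OF K] subfld_1[OF K] by blast+
  fix x assume "x \<in> adjoin K t"
  then obtain p q where x: "polyover K p" "polyover K q" "poly q t \<noteq> 0" "x = poly p t / poly q t" by (rule adjoinE)
  have "- x = poly (- p) t / poly q t" using x by simp
  thus "- x \<in> adjoin K t" using x adjoinI[of K "- p" q t] K by (simp add: polyover_intros)
  show "inverse x \<in> adjoin K t"
  proof (cases "x = 0")
    case True thus ?thesis using subset_adjoin[OF K, of t] subfld_0[OF K] by auto
  next
    case False
    thus ?thesis using x adjoinI[of K q p t] by simp
  qed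
  fix y assume "y \<in> adjoin K t"
  then obtain p' q' where y: "polyover K p'" "polyover K q'" "poly q' t \<noteq> 0" "y = poly p' t / poly q' t" by (rule adjoinE)
  have "x + y = poly (p * q' + p' * q) t / poly (q * q') t" unfolding x(4) y(4) using x(3) y(3) by (simp add: add_frac_eq)
  thus "x + y \<in> adjoin K t" using x y adjoinI[of K "p * q' + p' * q" "q * q'" t] K by (simp add: polyover_intros)
  have "x * y = poly (p * p') t / poly (q * q') t" using x y by simp
  thus "x * y \<in> adjoin K t" using x y adjoinI[of K "p * p'" "q * q'" t] K by (simp add: polyover_intros)
qed

lemma rhom_adjoin_closed:
  assumes K: "subfld K" and s: "rhom s" and sK: "\<And>x. x \<in> K \<Longrightarrow> s x \<in> K" and st: "s t \<in> adjoin K t"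
    and r: "r \<in> adjoin K t"
  shows "s r \<in> adjoin K t"
proof -
  obtain p q where x: "polyover K p" "polyover K q" "poly q t \<noteq> 0" "r = poly p t / poly q t" using r by (rule adjoinE)
  note F = subfld_adjoin[OF K, of t]
  have "s (poly u t) \<in> adjoin K t" if "polyover K u" for u
    unfolding poly_altdef rhom_sum[OF s] rhom_mult[OF s] rhom_power[OF s]
    using sK[OF polyoverD[OF that]] subset_adjoin[OF K, of t]
    by (intro subfld_sum[OF F] subfld_mult[OF F] subfld_power[OF F] st) blast
  thus ?thesis using x F by (simp add: rhom_divide[OF s] subfld_divide)
qed

lemma coprime_representation:
  assumes K: "subfld K" and r: "r \<in> adjoin K t"
  obtains N D a b where "polyover K N" "polyover K D" "polyover K a" "polyover K b"
    "a * D + b * N = 1" "poly D t \<noteq> 0" "poly D t * r = poly N t"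
proof -
  obtain p q where x: "polyover K p" "polyover K q" "poly q t \<noteq> 0" "r = poly p t / poly q t" using r by (rule adjoinE)
  define P where "P = (\<lambda>i::nat. if i = 0 then q else p)"
  have nz: "\<exists>i\<in>{0, 1}. P i \<noteq> 0" using x by (auto simp: P_def)
  have polyP: "polyover K (P i)" if "i \<in> {0, 1}" for i using x by (simp add: P_def)
  have fin: "finite {0, 1::nat}" by simp
  obtain g a u where
    g: "g \<noteq> 0" "polyover K g" "\<And>i. i \<in> {0, 1} \<Longrightarrow> polyover K (a i)" "\<And>i. i \<in> {0, 1} \<Longrightarrow> polyover K (u i)"
      "\<And>i. i \<in> {0, 1} \<Longrightarrow> P i = g * u i" "(\<Sum>i\<in>{0, 1}. a i * u i) = 1"
    by (rule polyover_bezout[OF K fin polyP nz]) (assumption | rule that)+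
  have q: "q = g * u 0" and p: "p = g * u 1" using g(5)[of 0] g(5)[of 1] by (auto simp: P_def)
  show ?thesis
    by (rule that[of "u 1" "u 0" "a 0" "a 1"]) (use g x in \<open>auto simp: p q field_simps\<close>)
qed

section \<open>Polynomials under affine substitutions\<close>

lemma coeff_linear_power: "coeff ([:b, a:] ^ n) n = (a::'a::comm_ring_1) ^ n"
proof (induction n)
  case (Suc n)
  have "degree ([:b, a:] ^ n) < Suc n"
    using degree_power_le[of "[:b, a:]" n] degree_pCons_le[of b "[:a:]"] by (simp add: le_less_trans)
  hence "coeff ([:b, a:] ^ n) (Suc n) = 0" by (rule coeff_eq_0)
  with Suc show ?case by (simp add: coeff_pCons)
qed simp

lemma coeff_linear_power': "coeff ([:b, a:] ^ Suc n) n = of_nat (Suc n) * b * (a::'a::comm_ring_1) ^ n"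
proof (induction n)
  case (Suc n)
  have "coeff ([:b, a:] ^ Suc (Suc n)) (Suc n) = b * coeff ([:b, a:] ^ Suc n) (Suc n) + a * coeff ([:b, a:] ^ Suc n) n"
    by (subst power_Suc) (simp add: coeff_pCons del: power_Suc)
  also have "\<dots> = of_nat (Suc (Suc n)) * b * a ^ Suc n"
    unfolding coeff_linear_power Suc by (simp add: algebra_simps)
  finally show ?case .
qed simp

lemma degree_linear_power_le: "degree ([:b, a:] ^ n) \<le> n"
  using degree_power_le[of "[:b, a:]" n] by (simp add: le_trans mult_le_mono1)

lemma pcompose_eq_sum: "degree p \<le> n \<Longrightarrow> p \<circ>\<^sub>p q = (\<Sum>i\<le>n. smult (coeff p i) (q ^ i))"
  for p :: "'a::comm_ring_1 poly"
proof -
  assume "degree p \<le> n"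
  moreover have "pev (\<lambda>c. [:c:]) q p = p \<circ>\<^sub>p q"
    by (induction p) (simp_all add: pev_pCons pcompose_pCons)
  ultimately show ?thesis using pev_sum[OF rhom_pCons, of p n q] by simp
qed

lemma coeff_pcompose_linear_top:
  fixes p :: "'a::field poly"
  assumes "degree p = Suc n"
  shows "coeff (p \<circ>\<^sub>p [:b, a:]) (Suc n) = coeff p (Suc n) * a ^ Suc n"
    "coeff (p \<circ>\<^sub>p [:b, a:]) n = coeff p n * a ^ n + coeff p (Suc n) * (of_nat (Suc n) * b * a ^ n)"
proof -
  have 0: "coeff ([:b, a:] ^ i) j = 0" if "i < j" for i j
    using degree_linear_power_le[of b a i] that by (intro coeff_eq_0) simp
  have *: "p \<circ>\<^sub>p [:b, a:] = (\<Sum>i\<le>Suc n. smult (coeff p i) ([:b, a:] ^ i))"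
    using assms by (intro pcompose_eq_sum) simp
  have "coeff (p \<circ>\<^sub>p [:b, a:]) (Suc n) = (\<Sum>i\<le>Suc n. coeff p i * coeff ([:b, a:] ^ i) (Suc n))"
    unfolding * by (simp add: coeff_sum del: power_Suc)
  also have "\<dots> = (\<Sum>i\<le>n. coeff p i * coeff ([:b, a:] ^ i) (Suc n)) + coeff p (Suc n) * a ^ Suc n"
    by (simp only: sum.atMost_Suc coeff_linear_power)
  also have "(\<Sum>i\<le>n. coeff p i * coeff ([:b, a:] ^ i) (Suc n)) = 0" by (intro sum.neutral) (auto simp: 0)
  finally show "coeff (p \<circ>\<^sub>p [:b, a:]) (Suc n) = coeff p (Suc n) * a ^ Suc n" by simp
  have "coeff (p \<circ>\<^sub>p [:b, a:]) n = (\<Sum>i\<le>Suc n. coeff p i * coeff ([:b, a:] ^ i) n)"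
    unfolding * by (simp add: coeff_sum del: power_Suc)
  also have "\<dots> = (\<Sum>i<n. coeff p i * coeff ([:b, a:] ^ i) n) + coeff p n * a ^ n + coeff p (Suc n) * (of_nat (Suc n) * b * a ^ n)"
    by (simp only: sum.atMost_Suc coeff_linear_power coeff_linear_power' lessThan_Suc_atMost[symmetric] sum.lessThan_Suc)
  also have "(\<Sum>i<n. coeff p i * coeff ([:b, a:] ^ i) n) = 0" by (intro sum.neutral) (auto simp: 0)
  finally show "coeff (p \<circ>\<^sub>p [:b, a:]) n = coeff p n * a ^ n + coeff p (Suc n) * (of_nat (Suc n) * b * a ^ n)" by simp
qed

text \<open>By \<open>eq\<close> the affine map sends the roots of the twisted polynomial to those
  of \<open>p\<close>, hence the mean of the former to the mean of the latter. The mean is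
  \<open>b\<close>; it is read off from the second coefficient and so lies in
  \<open>K\<close>.\<close>

lemma affine_average:
  fixes p :: "'a::field_char_0 poly"
  assumes K: "subfld K" and p: "polyover K p" "lead_coeff p = 1" "degree p \<noteq> 0" and s: "rhom s" and A: "A \<noteq> 0"
    and eq: "p \<circ>\<^sub>p [:B, A:] = smult (A ^ degree p) (map_poly s p)"
  shows "\<exists>b\<in>K. b = A * s b + B"
proof -
  obtain n where n: "degree p = Suc n" using p(3) by (cases "degree p") auto
  define a where "a = coeff p n"
  have "a * A ^ n + of_nat (Suc n) * B * A ^ n = A ^ Suc n * s a"
    using arg_cong[OF eq, of "\<lambda>q. coeff q n"] coeff_pcompose_linear_top(2)[OF n, of B A] p(2)
    by (simp add: n a_def coeff_map_poly rhom_0[OF s])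
  hence "A ^ n * (a + of_nat (Suc n) * B - A * s a) = 0" by (simp add: algebra_simps)
  hence e: "a + of_nat (Suc n) * B = A * s a" using A by simp
  define b where "b = - a / of_nat (Suc n)"
  have sb: "s b = - s a / of_nat (Suc n)"
    by (simp only: b_def rhom_divide[OF s] rhom_uminus[OF s] rhom_of_nat[OF s])
  have N: "(of_nat (Suc n) :: 'a) \<noteq> 0" by (rule of_nat_neq_0)
  have "A * s b + B = (- (A * s a) + of_nat (Suc n) * B) / of_nat (Suc n)"
    unfolding sb using N by (simp add: field_simps del: of_nat_Suc)
  also have "\<dots> = b" unfolding e[symmetric] b_def by simp
  finally have "b = A * s b + B" by simp
  moreover have "b \<in> K" unfolding b_def a_def by (intro subfld_intros K polyoverD p)
  ultimately show ?thesis by blast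
qed

lemma pcompose_linear_inverse:
  fixes p :: "'a::field poly"
  assumes "A \<noteq> 0"
  shows "(p \<circ>\<^sub>p [:- B / A, 1 / A:]) \<circ>\<^sub>p [:B, A:] = p"
proof -
  have "[:- B / A, 1 / A:] \<circ>\<^sub>p [:B, A:] = [:0, 1:]" using assms by (simp add: pcompose_pCons)
  thus ?thesis by (simp flip: pcompose_assoc)
qed

lemma degree_pcompose_linear: "A \<noteq> 0 \<Longrightarrow> degree (p \<circ>\<^sub>p [:B, A:]) = degree (p :: 'a::field poly)"
  by (simp add: degree_pcompose)

lemma transc_affine:
  assumes K: "subfld K" and t: "transc K t" and A: "A \<in> K" "A \<noteq> 0" "B \<in> K" and eq: "t = A * y + B"
  shows "transc K y"
  unfolding transc_def
proof (intro allI impI)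
  fix p assume p: "polyover K p" "poly p y = 0"
  have "y = poly [:- B / A, 1 / A:] t" using A eq by (simp add: field_simps)
  hence "poly (p \<circ>\<^sub>p [:- B / A, 1 / A:]) t = 0" using p(2) by (simp add: poly_pcompose)
  moreover have "polyover K (p \<circ>\<^sub>p [:- B / A, 1 / A:])" using K A p by (intro polyover_intros subfld_intros)
  ultimately have "p \<circ>\<^sub>p [:- B / A, 1 / A:] = 0" using t by (auto simp: transc_def)
  thus "p = 0" using pcompose_linear_inverse[OF A(2), of p B] by (metis pcompose_0)
qed

text \<open>A predicate \<open>Q\<close> closed under scaling covers both annihilating polynomials
  and denominators.\<close>

lemma minimal_monic:
  assumes K: "subfld K" and ex: "\<exists>p. p \<noteq> 0 \<and> polyover K p \<and> Q p" and sm: "\<And>c p. Q p \<Longrightarrow> c \<in> K \<Longrightarrow> Q (smult c p)"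
  obtains p where "polyover K p" "Q p" "lead_coeff p = 1"
    "\<And>q. polyover K q \<Longrightarrow> Q q \<Longrightarrow> degree q < degree p \<Longrightarrow> q = 0"
proof -
  define R where "R = (\<lambda>p. p \<noteq> 0 \<and> polyover K p \<and> Q p)"
  obtain p where p: "R p" "\<And>q. R q \<Longrightarrow> degree p \<le> degree q"
    using ex arg_min_natI[of R _ degree] arg_min_nat_le[of R _ degree] unfolding R_def by blast
  define p' where "p' = smult (inverse (lead_coeff p)) p"
  show ?thesis
  proof (rule that[of p'])
    have lc: "inverse (lead_coeff p) \<in> K" using p(1) K by (auto simp: R_def intro: subfld_inverse polyoverD)
    show "polyover K p'" "Q p'" using p(1) lc sm K by (auto simp: R_def p'_def polyover_smult)
    show "lead_coeff p' = 1" using p(1) by (simp add: p'_def R_def)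
    fix q assume "polyover K q" "Q q" "degree q < degree p'"
    thus "q = 0" using p(2)[of q] p(1) by (auto simp: R_def p'_def)
  qed
qed

text \<open>Both sides of the last equation annihilate \<open>s t\<close> and have the same leading
  coefficient. Their difference, pulled back by the inverse affine map, annihilates \<open>t\<close>
  and has degree below the minimal one.\<close>

lemma algebraic_affine_minpoly:
  fixes t :: "'a::field_char_0"
  assumes K: "subfld K" and s: "rhom s" "\<And>x. x \<in> K \<Longrightarrow> s x \<in> K"
    and A: "A \<in> K" "A \<noteq> 0" "B \<in> K" and t: "t = A * s t + B" and alg: "\<not> transc K t"
  obtains p where "polyover K p" "poly p t = 0" "lead_coeff p = 1" "degree p \<noteq> 0"
    "\<And>q. polyover K q \<Longrightarrow> poly q t = 0 \<Longrightarrow> degree q < degree p \<Longrightarrow> q = 0"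
    "p \<circ>\<^sub>p [:B, A:] = smult (A ^ degree p) (map_poly s p)"
proof -
  have "\<exists>p. p \<noteq> 0 \<and> polyover K p \<and> poly p t = 0" using alg by (auto simp: transc_def)
  from minimal_monic[OF K this] obtain p where p: "polyover K p" "poly p t = 0" "lead_coeff p = 1"
    "\<And>q. polyover K q \<Longrightarrow> poly q t = 0 \<Longrightarrow> degree q < degree p \<Longrightarrow> q = 0" by auto
  have d0: "degree p \<noteq> 0"
  proof
    assume "degree p = 0"
    then obtain c where "p = [:c:]" by (rule degree_eq_zeroE)
    thus False using p(2,3) by simp
  qed
  define n where "n = degree p"
  define S where "S = p \<circ>\<^sub>p [:B, A:] - smult (A ^ n) (map_poly s p)"
  have sp: "polyover K (map_poly s p)" using s p by (intro polyover_map) (auto simp: rhom_0)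
  have pS: "polyover K S" unfolding S_def using K A p sp by (intro polyover_intros subfld_intros)
  have "poly (map_poly s p) (s t) = s (poly p t)"
    using pev_rhom[OF s(1), of "\<lambda>x. x" t p] by (simp add: pev_def)
  hence St: "poly S (s t) = 0" using p(2) t by (simp add: S_def poly_pcompose rhom_0[OF s(1)] algebra_simps)
  obtain n' where n': "n = Suc n'" using d0 by (cases n) (auto simp: n_def)
  have degsp: "degree (map_poly s p) \<le> n" unfolding n_def by (intro degree_le) (auto simp: coeff_map_poly rhom_0[OF s(1)] coeff_eq_0)
  have "coeff S n = 0"
    using coeff_pcompose_linear_top(1)[of p n' B A] n' p(3)
    by (simp add: S_def n_def coeff_map_poly rhom_0[OF s(1)] rhom_1[OF s(1)])
  moreover have "degree S \<le> n" unfolding S_def using degsp A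
    by (intro degree_diff_le) (auto simp: degree_pcompose_linear n_def)
  ultimately have "S = 0 \<or> degree S < n" using d0 by (metis eq_zero_or_degree_less)
  define S' where "S' = S \<circ>\<^sub>p [:- B / A, 1 / A:]"
  have "s t = poly [:- B / A, 1 / A:] t" using A t by (simp add: field_simps)
  hence "poly S' t = 0" using St by (simp add: S'_def poly_pcompose)
  moreover have "polyover K S'" unfolding S'_def using K A pS by (intro polyover_intros subfld_intros)
  moreover have "degree S' = degree S" unfolding S'_def using A by (intro degree_pcompose_linear) simp
  ultimately have "S' = 0" using \<open>S = 0 \<or> degree S < n\<close> p(4)[of S'] by (auto simp: n_def S'_def)
  hence "S = 0" using pcompose_linear_inverse[OF A(2), of S B] by (metis S'_def pcompose_0)
  thus ?thesis using that[of p] p d0 by (auto simp: S_def n_def)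
qed

lemma trace_lemma:
  fixes t :: "'a::field_char_0"
  assumes K: "subfld K" and s: "rhom s" "\<And>x. x \<in> K \<Longrightarrow> s x \<in> K"
    and A: "A \<in> K" "A \<noteq> 0" "B \<in> K" and t: "t = A * s t + B" and alg: "\<not> transc K t"
  shows "\<exists>b\<in>K. b = A * s b + B"
  using algebraic_affine_minpoly[OF assms] affine_average[OF K _ _ _ s(1) A(2)] by metis

text \<open>For \<open>B = 0\<close> the constant coefficients are compared instead of the second
  ones: \<open>b\<close> is the norm of \<open>t\<close> up to sign and \<open>n\<close> is the
  degree of \<open>t\<close>.\<close>

lemma norm_lemma:
  fixes t :: "'a::field_char_0"
  assumes K: "subfld K" and s: "rhom s" "\<And>x. x \<in> K \<Longrightarrow> s x \<in> K"
    and A: "A \<in> K" "A \<noteq> 0" and t: "t = A * s t" "t \<noteq> 0" and alg: "\<not> transc K t"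
  shows "\<exists>n b. n \<noteq> 0 \<and> b \<in> K \<and> b \<noteq> 0 \<and> b = A ^ n * s b"
proof -
  have "t = A * s t + 0" using t by simp
  from algebraic_affine_minpoly[OF K s A subfld_0[OF K] this alg] obtain p where p:
    "polyover K p" "poly p t = 0" "lead_coeff p = 1" "degree p \<noteq> 0"
    "\<And>q. polyover K q \<Longrightarrow> poly q t = 0 \<Longrightarrow> degree q < degree p \<Longrightarrow> q = 0"
    "p \<circ>\<^sub>p [:0, A:] = smult (A ^ degree p) (map_poly s p)" by metis
  define b where "b = coeff p 0"
  have "b \<noteq> 0"
  proof
    assume "b = 0"
    obtain a q where aq: "p = pCons a q" by (cases p) auto
    have "a = 0" using \<open>b = 0\<close> aq by (simp add: b_def)
    hence "poly q t = 0" using p(2) t(2) aq by simp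
    moreover have "polyover K q" using p(1) unfolding polyover_def aq by (metis coeff_pCons_Suc)
    moreover have "degree q < degree p" using aq p(4) by (auto split: if_splits)
    ultimately have "q = 0" by (intro p(5))
    thus False using p(4) aq by simp
  qed
  moreover have "b = A ^ degree p * s b"
    using arg_cong[OF p(6), of "\<lambda>q. coeff q 0"] coeff_pcompose_0[of p "[:0, A:]"]
    by (simp add: b_def coeff_map_poly rhom_0[OF s(1)] poly_0_coeff_0)
  ultimately show ?thesis using p(1,4) unfolding b_def by (blast intro: polyoverD)
qed

text \<open>A denominator \<open>D\<close> of least degree behaves like a minimal polynomial. Since
  the inhomogeneous term is polynomial in \<open>s t\<close>, both the affine substitute of
  \<open>D\<close> and its twist by \<open>s\<close> are denominators in terms of
  \<open>s t\<close>, and minimality makes them agree up to a constant. If \<open>D\<close> were not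
  constant, the mean of its roots would be a solution in \<open>K\<close>, which \<open>no\<close>
  excludes.\<close>

lemma denominator_lemma:
  fixes t :: "'a::field_char_0"
  assumes K: "subfld K" and s: "rhom s" "\<And>x. x \<in> K \<Longrightarrow> s x \<in> K"
    and A: "A \<in> K" "A \<noteq> 0" "B \<in> K" and t: "t = A * s t + B" and tr: "transc K t"
    and no: "\<And>b. b \<in> K \<Longrightarrow> b \<noteq> A * s b + B"
    and r: "r \<in> adjoin K t" and A': "A' \<in> K" "A' \<noteq> 0" and \<beta>: "polyover K \<beta>"
    and eq: "r = A' * s r + poly \<beta> (s t)"
  shows "\<exists>p. polyover K p \<and> r = poly p t"
proof -
  define Q where "Q = (\<lambda>D. \<exists>N. polyover K N \<and> poly D t * r = poly N t)"
  have Qsm: "Q (smult c D)" if QD: "Q D" and cK: "c \<in> K" for c D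
  proof -
    obtain N where "polyover K N" "poly D t * r = poly N t" using QD by (auto simp: Q_def)
    thus ?thesis unfolding Q_def using cK K by (intro exI[of _ "smult c N"]) (auto simp: polyover_smult mult.assoc)
  qed
  have "\<exists>D. D \<noteq> 0 \<and> polyover K D \<and> Q D"
  proof -
    obtain p q where "polyover K p" "polyover K q" "poly q t \<noteq> 0" "r = poly p t / poly q t" using r by (rule adjoinE)
    thus ?thesis unfolding Q_def by (intro exI[of _ q]) auto
  qed
  from minimal_monic[OF K this Qsm] obtain D where D: "polyover K D" "Q D" "lead_coeff D = 1"
    "\<And>E. polyover K E \<Longrightarrow> Q E \<Longrightarrow> degree E < degree D \<Longrightarrow> E = 0" by metis
  obtain N where N: "polyover K N" "poly D t * r = poly N t"
    using D(2)[unfolded Q_def] by (elim exE conjE)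
  define n where "n = degree D"
  show ?thesis
  proof (cases "n = 0")
    case True
    then obtain c where "D = [:c:]" unfolding n_def by (rule degree_eq_zeroE)
    hence "D = 1" using D(3) by simp
    thus ?thesis using N by auto
  next
    case False
    define Y where "Y = s t"
    define D1 where "D1 = D \<circ>\<^sub>p [:B, A:]"
    define N1 where "N1 = N \<circ>\<^sub>p [:B, A:]"
    have tY: "poly (u \<circ>\<^sub>p [:B, A:]) Y = poly u t" for u
      using t by (simp add: poly_pcompose Y_def algebra_simps)
    have sY: "poly (map_poly s u) Y = s (poly u t)" for u
      unfolding Y_def using pev_rhom[OF s(1), of "\<lambda>x. x" t u] by (simp add: pev_def)
    have e1: "poly D1 Y * r = poly N1 Y" using N by (simp add: D1_def N1_def tY)
    have e2: "poly (map_poly s D) Y * s r = poly (map_poly s N) Y"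
      unfolding sY using arg_cong[OF N(2), of s] by (simp add: rhom_mult[OF s(1)])
    have sr: "s r = (r - poly \<beta> Y) / A'" using eq A'(2) by (simp add: Y_def field_simps)
    define S where "S = D1 - smult (A ^ n) (map_poly s D)"
    have sD: "polyover K (map_poly s D)" "polyover K (map_poly s N)" using s D N by (auto intro!: polyover_map simp: rhom_0)
    have pS: "polyover K S" unfolding S_def D1_def using K A D sD by (intro polyover_intros subfld_intros)
    define N4 where "N4 = N1 - smult (A ^ n) (smult A' (map_poly s N) + map_poly s D * \<beta>)"
    have "poly (map_poly s D) Y * r = A' * poly (map_poly s N) Y + poly (map_poly s D) Y * poly \<beta> Y"
      using e2 A'(2) unfolding sr by (simp add: field_simps)
    note e4 = this
    have "poly S Y * r = poly D1 Y * r - A ^ n * (poly (map_poly s D) Y * r)" by (simp add: S_def algebra_simps)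
    also have "\<dots> = poly N4 Y" unfolding e1 e4 by (simp add: N4_def algebra_simps)
    finally have e3: "poly S Y * r = poly N4 Y" .
    have pN4: "polyover K N4" unfolding N4_def N1_def using K A A' D N sD \<beta> by (intro polyover_intros subfld_intros)
    define S' where "S' = S \<circ>\<^sub>p [:- B / A, 1 / A:]"
    have Yt: "Y = poly [:- B / A, 1 / A:] t" using A t by (simp add: field_simps Y_def)
    have "Q S'" unfolding Q_def
      using e3 pN4 K A by (intro exI[of _ "N4 \<circ>\<^sub>p [:- B / A, 1 / A:]"])
        (auto simp: S'_def poly_pcompose Yt intro!: polyover_intros subfld_intros)
    moreover have "polyover K S'" unfolding S'_def using K A pS by (intro polyover_intros subfld_intros)
    moreover have "degree S' = degree S" unfolding S'_def using A by (intro degree_pcompose_linear) simp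
    moreover have "S = 0 \<or> degree S < n"
    proof -
      obtain n' where n': "n = Suc n'" using False by (cases n) auto
      have "coeff S n = 0"
        using coeff_pcompose_linear_top(1)[of D n' B A] n' D(3)
        by (simp add: S_def D1_def n_def coeff_map_poly rhom_0[OF s(1)] rhom_1[OF s(1)])
      moreover have "degree (map_poly s D) \<le> n" unfolding n_def by (intro degree_le) (auto simp: coeff_map_poly rhom_0[OF s(1)] coeff_eq_0)
      hence "degree S \<le> n" unfolding S_def using A
        by (intro degree_diff_le) (auto simp: D1_def degree_pcompose_linear n_def)
      ultimately show ?thesis using False by (metis eq_zero_or_degree_less)
    qed
    ultimately have "S' = 0" using D(4)[of S'] by (auto simp: n_def S'_def)
    hence "S = 0" using pcompose_linear_inverse[OF A(2), of S B] by (metis S'_def pcompose_0)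
    hence "D \<circ>\<^sub>p [:B, A:] = smult (A ^ degree D) (map_poly s D)" by (simp add: S_def D1_def n_def)
    from affine_average[OF K D(1,3) False[unfolded n_def] s(1) A(2) this] no show ?thesis by blast
  qed
qed

text \<open>\<open>inverse r\<close> satisfies an equation of the same kind, so both are polynomials
  in \<open>t\<close>; polynomials with product 1 are constants.\<close>

lemma unit_lemma:
  fixes t :: "'a::field_char_0"
  assumes K: "subfld K" and s: "rhom s" "\<And>x. x \<in> K \<Longrightarrow> s x \<in> K"
    and A: "A \<in> K" "A \<noteq> 0" "B \<in> K" and t: "t = A * s t + B" and tr: "transc K t"
    and no: "\<And>b. b \<in> K \<Longrightarrow> b \<noteq> A * s b + B"
    and r: "r \<in> adjoin K t" "r \<noteq> 0" and c: "c \<in> K" "c \<noteq> 0" and eq: "r = c * s r"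
  shows "r \<in> K"
proof -
  have "r = c * s r + poly 0 (s t)" using eq by simp
  from denominator_lemma[OF K s A t tr no r(1) c polyover_0[OF K] this] obtain p where p: "polyover K p" "r = poly p t" by blast
  have "inverse r = inverse c * s (inverse r) + poly 0 (s t)"
    unfolding rhom_inverse[OF s(1)] using arg_cong[OF eq, of inverse, unfolded inverse_mult_distrib] by simp
  from denominator_lemma[OF K s A t tr no subfld_inverse[OF subfld_adjoin[OF K] r(1)] subfld_inverse[OF K c(1)] _ polyover_0[OF K] this]
  obtain q where q: "polyover K q" "inverse r = poly q t" using c by auto
  have "poly (p * q - 1) t = 0" using r(2) by (simp flip: p(2) q(2))
  moreover have "polyover K (p * q - 1)" using K p q by (intro polyover_intros)
  ultimately have "p * q = 1" using tr by (auto simp: transc_def)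
  hence "degree p = 0" by (metis degree_1 degree_mult_eq_0 mult_zero_left mult_zero_right zero_neq_one)
  then obtain a where "p = [:a:]" by (rule degree_eq_zeroE)
  thus ?thesis using p polyoverD[of K p 0] by simp
qed

section \<open>Semi-invariant binary forms\<close>

text \<open>
  The action of \<open>x \<mapsto> m - w/x\<close> on binary forms of degree \<open>d\<close>, see \<open>poly_mob_field\<close>.
\<close>

definition mob :: "'a::comm_ring_1 \<Rightarrow> 'a \<Rightarrow> nat \<Rightarrow> 'a poly \<Rightarrow> 'a poly" where
  "mob m w d h = (\<Sum>i\<le>d. smult (coeff h i) ([:- w, m:] ^ i * monom 1 (d - i)))"

lemma poly_mob: "poly (mob m w d h) y = (\<Sum>i\<le>d. coeff h i * ((m * y - w) ^ i * y ^ (d - i)))"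
  by (simp add: mob_def poly_sum poly_monom mult.commute)

lemma poly_mob_field:
  fixes y :: "'a::field"
  assumes "y \<noteq> 0" "degree h \<le> d"
  shows "poly (mob m w d h) y = y ^ d * poly h (m - w / y)"
proof -
  have "poly h (m - w / y) = (\<Sum>i\<le>d. coeff h i * (m - w / y) ^ i)"
    using assms(2) pev_sum[OF rhom_id, of h d "m - w / y"] by (simp add: pev_def)
  hence "y ^ d * poly h (m - w / y) = (\<Sum>i\<le>d. y ^ d * (coeff h i * (m - w / y) ^ i))" by (simp add: sum_distrib_left)
  also have "\<dots> = (\<Sum>i\<le>d. coeff h i * ((m * y - w) ^ i * y ^ (d - i)))"
  proof (intro sum.cong refl)
    fix i assume "i \<in> {..d}"
    hence "y ^ d = y ^ i * y ^ (d - i)" by (simp flip: power_add)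
    moreover have "m * y - w = y * (m - w / y)" using assms(1) by (simp add: field_simps)
    hence "(m * y - w) ^ i = y ^ i * (m - w / y) ^ i" by (simp only: power_mult_distrib)
    ultimately show "y ^ d * (coeff h i * (m - w / y) ^ i) = coeff h i * ((m * y - w) ^ i * y ^ (d - i))"
      by (simp add: mult_ac)
  qed
  finally show ?thesis by (simp add: poly_mob)
qed

lemma map_poly_mob:
  assumes "rhom f" shows "map_poly f (mob m w d h) = mob (f m) (f w) d (map_poly f h)"
proof -
  note F = map_poly_rhom[OF assms] and f0 = rhom_0[OF assms]
  have "map_poly f (smult c p) = smult (f c) (map_poly f p)" for c p
    by (rule poly_eqI) (simp add: coeff_map_poly f0 rhom_mult[OF assms])
  thus ?thesis
    by (simp add: mob_def rhom_sum[OF F] rhom_mult[OF F] rhom_power[OF F] map_poly_pCons map_poly_monom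
        f0 coeff_map_poly rhom_uminus[OF assms] rhom_1[OF assms])
qed

lemma degree_mob: "degree (mob m w d h) \<le> d"
  unfolding mob_def
proof (rule degree_sum_le)
  fix i assume "i \<in> {..d}"
  have "degree ([:- w, m:] ^ i * monom 1 (d - i)) \<le> i + (d - i)"
    by (intro order_trans[OF degree_mult_le] add_mono degree_linear_power_le degree_monom_le)
  thus "degree (smult (coeff h i) ([:- w, m:] ^ i * monom 1 (d - i))) \<le> d"
    using \<open>i \<in> {..d}\<close> degree_smult_le le_trans by fastforce
qed simp

lemma coeff_mob_0: "coeff (mob m w d h) 0 = coeff h d * (- w) ^ d"
proof -
  have "coeff (mob m w d h) 0 = poly (mob m w d h) 0" by (simp add: poly_0_coeff_0)
  also have "\<dots> = (\<Sum>i\<le>d. if i = d then coeff h i * (- w) ^ i else 0)"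
    unfolding poly_mob by (intro sum.cong) (auto simp: power_0_left)
  finally show ?thesis by simp
qed

lemma mob_smult: "mob m w d (smult c h) = smult c (mob m w d h)"
  by (rule poly_eqI) (simp add: mob_def coeff_sum sum_distrib_left mult.assoc)

lemma mob_2: "mob m w 2 [:g, b, a:] = [:a * w\<^sup>2, - (2 * a * m + b) * w, a * m\<^sup>2 + b * m + g:]"
  by (simp add: mob_def eval_nat_numeral monom_Suc algebra_simps)

text \<open>Identities between transformed forms are checked away from the finitely many points
  where the transformation has a pole.\<close>

lemma poly_eqI_cofinite:
  fixes p q :: "'a::field_char_0 poly"
  assumes "finite S" "\<And>x. x \<notin> S \<Longrightarrow> poly p x = poly q x"
  shows "p = q"
proof (rule ccontr)
  assume "p \<noteq> q"
  hence "finite {x. poly (p - q) x = 0}" by (intro poly_roots_finite) simp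
  moreover have "- S \<subseteq> {x. poly (p - q) x = 0}" using assms(2) by auto
  ultimately have "finite (- S)" using finite_subset by blast
  thus False using assms(1) infinite_UNIV_char_0[where 'a = 'a] by simp
qed

section \<open>Quadratic semi-invariants over the rational polynomials\<close>

definition zm :: "rat poly" where "zm = [:1, 1, 1:]"
definition zw :: "rat poly" where "zw = monom 1 4"
definition sg :: "rat poly \<Rightarrow> rat poly" where "sg p = p \<circ>\<^sub>p monom 1 4"

lemma rhom_sg: "rhom sg"
  by (rule rhomI) (simp_all add: sg_def pcompose_add pcompose_mult one_pCons)

lemma degree_sg: "degree (sg p) = 4 * degree p"
  by (simp add: sg_def degree_pcompose degree_monom_eq)

lemma sg_eq_0_iff [simp]: "sg p = 0 \<longleftrightarrow> p = 0"
proof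
  assume "sg p = 0"
  hence "degree p = 0" using degree_sg[of p] by simp
  then obtain c where "p = [:c:]" by (rule degree_eq_zeroE)
  thus "p = 0" using \<open>sg p = 0\<close> by (simp add: sg_def)
qed (simp add: sg_def)

lemma pev_sg: "rhom h \<Longrightarrow> pev h x (sg p) = pev h (x ^ 4) p"
proof (induction p)
  case (pCons a p)
  have "pev h x (monom 1 4) = x ^ 4"
    using pCons.prems by (simp add: pev_def map_poly_monom poly_monom rhom_0 rhom_1)
  with pCons show ?case
    by (simp add: sg_def pcompose_pCons pev_pCons rhom_simps[OF rhom_pev[OF pCons.prems]] rhom_0 pev_const)
qed (simp add: sg_def)

lemma dvd_monom_imp_monom:
  fixes c :: "'a::field poly"
  assumes "c dvd monom 1 n"
  shows "\<exists>a k. a \<noteq> 0 \<and> c = monom a k"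
  using assms
proof (induction n arbitrary: c)
  case 0
  hence "c dvd 1" by (simp add: monom_0 one_pCons)
  then obtain a where "c = [:a:]" "a \<noteq> 0" by (auto simp: is_unit_poly_iff dvd_field_iff)
  thus ?case by (intro exI[of _ a] exI[of _ 0]) (simp add: monom_0)
next
  case (Suc n)
  then obtain g where g: "monom 1 (Suc n) = c * g" by (elim dvdE)
  have *: "coeff c 0 * coeff g 0 = 0"
    using arg_cong[OF g, of "\<lambda>p. coeff p 0"] by (simp add: coeff_mult_0)
  show ?case
  proof (cases "coeff c 0 = 0")
    case True
    then obtain c' where c': "c = pCons 0 c'" by (cases c) auto
    hence "monom 1 n = c' * g" using g by (simp add: monom_Suc)
    hence "c' dvd monom 1 n" by simp
    then obtain a k where "a \<noteq> 0" "c' = monom a k" using Suc.IH by blast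
    thus ?thesis using c' by (intro exI[of _ a] exI[of _ "Suc k"]) (simp add: monom_Suc)
  next
    case False
    hence "coeff g 0 = 0" using * by simp
    then obtain g' where g': "g = pCons 0 g'" by (cases g) auto
    hence "monom 1 n = c * g'" using g by (simp add: monom_Suc)
    thus ?thesis using Suc.IH[of c] by simp
  qed
qed

text \<open>Compare degrees, which \<open>sg\<close> multiplies by 4. If
  \<open>degree \<alpha> + 2\<close> exceeds \<open>degree \<beta>\<close>, the first two equations
  give \<open>4 * G = 4 * b + 2\<close>, impossible modulo 4; otherwise the second forces
  \<open>degree \<beta>\<close> to be at most 1 although it is at least 2.\<close>

lemma no_semiinvariant_quadratic:
  fixes \<alpha> \<beta> \<gamma> :: "rat poly"
  assumes c: "c \<noteq> 0" and e0: "\<alpha> * zw\<^sup>2 = monom c k * sg \<gamma>"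
    and e1: "- (2 * \<alpha> * zm + \<beta>) * zw = monom c k * sg \<beta>"
    and e2: "\<alpha> * zm\<^sup>2 + \<beta> * zm + \<gamma> = monom c k * sg \<alpha>"
  shows "\<alpha> = 0" "\<beta> = 0" "\<gamma> = 0"
proof -
  have z: "zw \<noteq> 0" "degree zw = 4" "zm \<noteq> 0" "degree zm = 2" "monom c k \<noteq> 0" "degree (monom c k) = k"
    using c by (simp_all add: zw_def zm_def degree_monom_eq)
  show a0: "\<alpha> = 0"
  proof (rule ccontr)
    assume a: "\<alpha> \<noteq> 0"
    hence g: "\<gamma> \<noteq> 0" using e0 z by (auto simp: rhom_0[OF rhom_sg])
    define G b where "G = degree \<gamma>" and "b = degree \<beta>"
    have dega: "degree \<alpha> + 8 = k + 4 * G"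
      using arg_cong[OF e0, of degree] a g z by (simp add: degree_mult_eq degree_power_eq degree_sg G_def)
    have degam: "degree (2 * \<alpha> * zm) = degree \<alpha> + 2" using a z by (simp add: degree_mult_eq)
    have b: "\<beta> \<noteq> 0"
    proof
      assume "\<beta> = 0"
      hence "2 * \<alpha> * zm * zw = 0" using e1 by (simp add: sg_def)
      thus False using a z by simp
    qed
    have degr: "degree (monom c k * sg \<beta>) = k + 4 * b" using b z by (simp add: degree_mult_eq degree_sg b_def)
    have nz: "2 * \<alpha> * zm + \<beta> \<noteq> 0"
    proof
      assume "2 * \<alpha> * zm + \<beta> = 0"
      hence "monom c k * sg \<beta> = 0" using e1 by (metis minus_zero mult_zero_left)
      thus False using b z by simp
    qed
    have degl: "degree (2 * \<alpha> * zm + \<beta>) + 4 = k + 4 * b"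
    proof -
      define v where "v = 2 * \<alpha> * zm + \<beta>"
      have "v \<noteq> 0" using nz by (simp add: v_def)
      hence "degree (- v * zw) = degree v + 4" using z by (simp add: degree_mult_eq)
      thus ?thesis using arg_cong[OF e1, of degree] by (simp add: degr v_def[symmetric])
    qed
    show False
    proof (cases "degree \<alpha> + 2 > b")
      case True
      hence "degree (2 * \<alpha> * zm + \<beta>) = degree \<alpha> + 2" using degam by (simp add: degree_add_eq_left b_def)
      hence "4 * G = 4 * b + 2" using degl dega by linarith
      thus False by presburger
    next
      case False
      have "degree (2 * \<alpha> * zm + \<beta>) \<le> b" using False degam by (intro degree_add_le) (auto simp: b_def)
      thus False using False dega degl by linarith
    qed
  qed
  show "\<gamma> = 0" using e0 a0 z by simp
  thus "\<beta> = 0" using e2 a0 z by (simp add: sg_def)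
qed

lemma coeff_map_sg: "coeff (map_poly sg h) i = sg (coeff h i)"
  by (simp add: coeff_map_poly rhom_0[OF rhom_sg])

text \<open>After division by the content a Bezout identity holds for the coefficients; its image
  under \<open>sg\<close> writes the multiplier as a polynomial \<open>c\<close>. The identity also
  prevents the form from vanishing at any specialisation of \<open>z\<close>.\<close>

lemma semiinvariant_primitive:
  fixes h :: "rat poly poly"
  assumes h: "h \<noteq> 0" "degree h \<le> d" and e: "e \<noteq> 0" and eq: "smult e (mob zm zw d h) = smult x (map_poly sg h)"
  obtains h' c a where "h' \<noteq> 0" "degree h' \<le> d" "(\<Sum>i\<le>d. a i * coeff h' i) = 1"
    "mob zm zw d h' = smult c (map_poly sg h')"
proof -
  have nz: "\<exists>i\<in>{..d}. coeff h i \<noteq> 0" using h by (intro bexI[of _ "degree h"]) auto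
  obtain g a q where g: "g \<noteq> 0" "polyover UNIV g" "\<And>i. i \<in> {..d} \<Longrightarrow> polyover UNIV (a i)" "\<And>i. i \<in> {..d} \<Longrightarrow> polyover UNIV (q i)"
    "\<And>i. i \<in> {..d} \<Longrightarrow> coeff h i = g * q i" "(\<Sum>i\<in>{..d}. a i * q i) = 1"
    by (rule polyover_bezout[OF subfld_UNIV finite_atMost _ nz]) (simp add: polyover_def, rule that)
  define h' where "h' = (\<Sum>i\<le>d. monom (q i) i)"
  have ch: "coeff h' i = (if i \<le> d then q i else 0)" for i
    by (simp add: h'_def coeff_sum coeff_monom)
  have hh: "h = smult g h'"
    using h(2) g(5) by (intro poly_eqI) (auto simp: ch coeff_eq_0)
  have h0: "h' \<noteq> 0" using hh h by auto
  have dh: "degree h' \<le> d" by (intro degree_le) (simp add: ch)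
  have bez: "(\<Sum>i\<le>d. a i * coeff h' i) = 1" using g(6) by (simp add: ch)
  have eq': "smult (e * g) (mob zm zw d h') = smult (x * sg g) (map_poly sg h')"
  proof -
    have "map_poly sg h = smult (sg g) (map_poly sg h')"
      unfolding hh by (rule poly_eqI) (simp add: coeff_map_sg rhom_mult[OF rhom_sg])
    thus ?thesis using eq by (simp add: hh mob_smult)
  qed
  define c where "c = (\<Sum>i\<le>d. sg (a i) * coeff (mob zm zw d h') i)"
  have "e * g * c = (\<Sum>i\<le>d. sg (a i) * coeff (smult (e * g) (mob zm zw d h')) i)"
    by (simp add: c_def sum_distrib_left mult_ac)
  also have "\<dots> = (\<Sum>i\<le>d. x * sg g * sg (a i * coeff h' i))"
    unfolding eq' by (intro sum.cong refl) (simp add: coeff_map_sg rhom_mult[OF rhom_sg])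
  also have "\<dots> = x * sg g * sg (\<Sum>i\<le>d. a i * coeff h' i)"
    by (simp add: rhom_sum[OF rhom_sg] sum_distrib_left)
  also have "\<dots> = x * sg g" by (simp add: bez rhom_1[OF rhom_sg])
  finally have "smult (e * g) (mob zm zw d h') = smult (e * g) (smult c (map_poly sg h'))" by (simp add: eq')
  hence "smult (e * g) (mob zm zw d h' - smult c (map_poly sg h')) = 0" by (simp add: smult_diff_right)
  hence "mob zm zw d h' = smult c (map_poly sg h')" using e g(1) by simp
  with that h0 dh bez show ?thesis by blast
qed

text \<open>On quadratic forms the transformation is invertible up to the factor
  \<open>zw\<^sup>2\<close>. So \<open>c\<close> divides \<open>zw\<^sup>2\<close> times every
  coefficient, hence by primitivity \<open>zw\<^sup>2\<close> itself; being a monomial, it falls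
  under the degree argument.\<close>

lemma no_semiinvariant_2:
  fixes h :: "rat poly poly"
  assumes h: "h \<noteq> 0" "degree h \<le> 2" and e: "e \<noteq> 0" and eq: "smult e (mob zm zw 2 h) = smult x (map_poly sg h)"
  shows False
proof -
  obtain h' c a where h': "h' \<noteq> 0" "degree h' \<le> 2" "(\<Sum>i\<le>2. a i * coeff h' i) = 1"
    "mob zm zw 2 h' = smult c (map_poly sg h')"
    by (rule semiinvariant_primitive[OF assms]) (rule that)
  define \<alpha> \<beta> \<gamma> where "\<alpha> = coeff h' 2" and "\<beta> = coeff h' 1" and "\<gamma> = coeff h' 0"
  have hh: "h' = [:\<gamma>, \<beta>, \<alpha>:]"
  proof (rule poly_eqI)
    fix i
    consider "i = 0" | "i = 1" | "i = 2" | "i > (2::nat)" by linarith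
    thus "coeff h' i = coeff [:\<gamma>, \<beta>, \<alpha>:] i"
      by cases (use h'(2) in \<open>auto simp: \<alpha>_def \<beta>_def \<gamma>_def coeff_eq_0 coeff_pCons numeral_2_eq_2 split: nat.splits\<close>)
  qed
  have eqs: "\<alpha> * zw\<^sup>2 = c * sg \<gamma>" "- (2 * \<alpha> * zm + \<beta>) * zw = c * sg \<beta>" "\<alpha> * zm\<^sup>2 + \<beta> * zm + \<gamma> = c * sg \<alpha>"
  proof -
    have "[:\<alpha> * zw\<^sup>2, - (2 * \<alpha> * zm + \<beta>) * zw, \<alpha> * zm\<^sup>2 + \<beta> * zm + \<gamma>:] = smult c [:sg \<gamma>, sg \<beta>, sg \<alpha>:]"
      using h'(4) unfolding hh mob_2 by (simp add: map_poly_pCons rhom_0[OF rhom_sg])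
    thus "\<alpha> * zw\<^sup>2 = c * sg \<gamma>" "- (2 * \<alpha> * zm + \<beta>) * zw = c * sg \<beta>" "\<alpha> * zm\<^sup>2 + \<beta> * zm + \<gamma> = c * sg \<alpha>" by simp_all
  qed
  have d0: "c dvd zw\<^sup>2 * \<alpha>" using eqs(1) by (metis dvd_triv_left mult.commute)
  have "zw\<^sup>2 * \<beta> = - zw * (- (2 * \<alpha> * zm + \<beta>) * zw) - 2 * zm * (zw\<^sup>2 * \<alpha>)" by (simp add: algebra_simps power2_eq_square)
  hence "zw\<^sup>2 * \<beta> = - zw * (c * sg \<beta>) - 2 * zm * (zw\<^sup>2 * \<alpha>)" by (simp only: eqs(2))
  hence d1: "c dvd zw\<^sup>2 * \<beta>" using dvd_diff[OF dvd_mult[OF dvd_triv_left] dvd_mult[OF d0]] by metis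
  have "zw\<^sup>2 * \<gamma> = zw\<^sup>2 * (\<alpha> * zm\<^sup>2 + \<beta> * zm + \<gamma>) - zm * (zw\<^sup>2 * \<beta>) - zm\<^sup>2 * (zw\<^sup>2 * \<alpha>)" by (simp add: algebra_simps)
  hence "zw\<^sup>2 * \<gamma> = zw\<^sup>2 * (c * sg \<alpha>) - zm * (zw\<^sup>2 * \<beta>) - zm\<^sup>2 * (zw\<^sup>2 * \<alpha>)" by (simp only: eqs(3))
  hence d2: "c dvd zw\<^sup>2 * \<gamma>"
    using dvd_diff[OF dvd_diff[OF dvd_mult[OF dvd_triv_left] dvd_mult[OF d1]] dvd_mult[OF d0]] by metis
  have "zw\<^sup>2 = a 0 * (zw\<^sup>2 * \<gamma>) + a 1 * (zw\<^sup>2 * \<beta>) + a 2 * (zw\<^sup>2 * \<alpha>)"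
  proof -
    have "zw\<^sup>2 * (\<Sum>i\<le>2. a i * coeff h' i) = zw\<^sup>2" by (simp add: h'(3))
    thus ?thesis by (simp add: \<alpha>_def \<beta>_def \<gamma>_def numeral_2_eq_2 algebra_simps)
  qed
  hence "c dvd zw\<^sup>2" using dvd_add[OF dvd_add[OF dvd_mult[OF d2] dvd_mult[OF d1]] dvd_mult[OF d0], of "a 0" "a 1" "a 2"] by simp
  hence "c dvd monom 1 8" by (simp add: zw_def monom_power)
  then obtain b k where bk: "b \<noteq> 0" "c = monom b k" using dvd_monom_imp_monom by blast
  have "\<alpha> = 0" "\<beta> = 0" "\<gamma> = 0" using no_semiinvariant_quadratic[OF bk(1)] eqs unfolding bk(2) by blast+
  thus False using h'(1) hh by simp
qed

text \<open>Every positive power is \<open>a + b * sqrt 5\<close> with positive rational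
  \<open>a\<close> and \<open>b\<close>; positivity rules out cancellation in the recursion.\<close>

lemma golden_power_irrational:
  assumes "((3 + sqrt 5) / 2) ^ n \<in> \<rat>" shows "n = 0"
proof (rule ccontr)
  assume "n \<noteq> 0"
  then obtain k where k: "n = Suc k" by (cases n) auto
  have "\<exists>a b. a > 0 \<and> b > 0 \<and> a \<in> \<rat> \<and> b \<in> \<rat> \<and> ((3 + sqrt 5) / 2) ^ Suc k = a + b * sqrt 5" for k
  proof (induction k)
    case 0
    show ?case by (intro exI[of _ "3 / 2"] exI[of _ "1 / 2"]) auto
  next
    case (Suc k)
    then obtain a b where ab: "a > 0" "b > 0" "a \<in> \<rat>" "b \<in> \<rat>" "((3 + sqrt 5) / 2) ^ Suc k = a + b * sqrt 5" by blast
    have "((3 + sqrt 5) / 2) ^ Suc (Suc k) = (3 + sqrt 5) / 2 * (a + b * sqrt 5)" using ab(5) by simp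
    also have "\<dots> = (3 * a + 5 * b) / 2 + (a + 3 * b) / 2 * sqrt 5"
      by (simp add: field_simps)
    finally show ?case using ab
      by (intro exI[of _ "(3 * a + 5 * b) / 2"] exI[of _ "(a + 3 * b) / 2"]) auto
  qed
  then obtain a b where ab: "a > 0" "b > 0" "a \<in> \<rat>" "b \<in> \<rat>" "((3 + sqrt 5) / 2) ^ n = a + b * sqrt 5" using k by blast
  have "sqrt 5 = (((3 + sqrt 5) / 2) ^ n - a) / b" using ab by simp
  hence "sqrt 5 \<in> \<rat>" using ab assms by (metis Rats_diff Rats_divide)
  moreover have "algebraic_int (sqrt 5)"
    by (intro algebraic_int_sqrt) simp
  ultimately have "sqrt 5 \<in> \<int>" by (simp add: rational_algebraic_int_is_int)
  then obtain j :: int where j: "sqrt 5 = of_int j" by (elim Ints_cases)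
  hence "real_of_int (j\<^sup>2) = 5" by (metis of_int_power real_sqrt_pow2 zero_le_numeral)
  hence "j\<^sup>2 = 5" by linarith
  hence "\<bar>j\<bar> * \<bar>j\<bar> = 5" by (simp add: power2_eq_square)
  moreover have "\<bar>j\<bar> \<le> 2 \<or> \<bar>j\<bar> \<ge> 3" by linarith
  moreover have "\<bar>j\<bar> * \<bar>j\<bar> \<le> 2 * 2" if "\<bar>j\<bar> \<le> 2" using that by (intro mult_mono) auto
  moreover have "3 * 3 \<le> \<bar>j\<bar> * \<bar>j\<bar>" if "\<bar>j\<bar> \<ge> 3" using that by (intro mult_mono) auto
  ultimately show False by linarith
qed

lemma of_real_of_rat_eq: "complex_of_real (real_of_rat c) = of_rat c"
  by (cases c) (simp add: of_rat_rat)

text \<open>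
  At \<open>z = 1\<close> the Moebius transformation is \<open>x \<mapsto> 3 - 1/x\<close> with fixed points \<open>(3 \<plusminus> \<surd>5)/2\<close>. In the
  coordinate that moves these to \<open>0\<close> and \<open>\<infinity>\<close> it is multiplication by a number none of whose positive powers is
  rational, so a semi-invariant form is a monomial there.
\<close>

lemma semiinvariant_at_1:
  fixes h :: "complex poly"
  assumes h: "h \<noteq> 0" "degree h \<le> d" and eq: "mob 3 1 d h = smult (of_rat c) h"
  obtains a s where "d = 2 * a" "s \<noteq> 0" "h = smult s ([:1, -3, 1:] ^ a)"
proof -
  define r r1 r2 where "r = (3 + sqrt 5) / 2" and "r1 = complex_of_real r" and "r2 = complex_of_real ((3 - sqrt 5) / 2)"
  have real: "(3 + x) / 2 * ((3 - x) / 2) = (9 - x\<^sup>2) / 4" "(3 + x) / 2 + (3 - x) / 2 = 3" for x :: real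
    by (simp_all add: field_simps power2_eq_square)
  have sq5: "(sqrt 5)\<^sup>2 = 5" "sqrt 5 > 0" by simp_all
  have "r * ((3 - sqrt 5) / 2) = 1" unfolding r_def real(1) sq5(1) by simp
  hence prod: "r1 * r2 = 1" unfolding r1_def r2_def of_real_mult[symmetric] by simp
  have "r + (3 - sqrt 5) / 2 = 3" unfolding r_def by (rule real(2))
  hence sum: "r1 + r2 = 3" unfolding r1_def r2_def of_real_add[symmetric] by (simp only: of_real_numeral)
  have r1: "r1 * r1 = 3 * r1 - 1"
  proof -
    have "r1 * r1 = r1 * (r1 + r2) - r1 * r2" by (simp only: distrib_left add_diff_cancel_right')
    also have "\<dots> = 3 * r1 - 1" unfolding sum prod by (simp only: mult.commute)
    finally show ?thesis .
  qed
  have r2: "r2 * r2 = 3 * r2 - 1"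
  proof -
    have "r2 * r2 = r2 * (r1 + r2) - r1 * r2" by (simp only: distrib_left mult.commute[of r1 r2] add_diff_cancel_left')
    also have "\<dots> = 3 * r2 - 1" unfolding sum prod by (simp only: mult.commute)
    finally show ?thesis .
  qed
  have "1 < (3 + x) / 2" if "x > 0" for x :: real using that by simp
  from this[OF sq5(2)] have rpos: "r > 1" by (simp only: r_def)
  have r10: "r1 \<noteq> 0" "r2 \<noteq> 0" using prod by auto
  have "(3 + x) / 2 \<noteq> (3 - x) / 2" if "x > 0" for x :: real using that by simp
  from this[OF sq5(2)] have r12: "r1 \<noteq> r2" unfolding r1_def r2_def r_def of_real_eq_iff .
  \<comment> \<open>The form in the coordinate \<open>t\<close> with
    \<open>x = (r1 * t + r2) / (t + 1)\<close>, which places \<open>r2\<close> at 0 and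
    \<open>r1\<close> at infinity. As \<open>r1 * r2 = 1\<close>, the transformation becomes
    multiplication by \<open>r1 / r2 = r1\<^sup>2\<close>.\<close>
  define q where "q = (\<Sum>i\<le>d. smult (coeff h i) ([:r2, r1:] ^ i * [:1, 1:] ^ (d - i)))"
  have pq: "poly q t = (t + 1) ^ d * poly h ((r1 * t + r2) / (t + 1))" if "t \<noteq> -1" for t
  proof -
    have t1: "t + 1 \<noteq> 0" using that by (metis add_eq_0_iff2)
    have "poly h ((r1 * t + r2) / (t + 1)) = (\<Sum>i\<le>d. coeff h i * ((r1 * t + r2) / (t + 1)) ^ i)"
      using h(2) pev_sum[OF rhom_id, of h d "(r1 * t + r2) / (t + 1)"] by (simp add: pev_def)
    hence "(t + 1) ^ d * poly h ((r1 * t + r2) / (t + 1)) = (\<Sum>i\<le>d. (t + 1) ^ d * (coeff h i * ((r1 * t + r2) / (t + 1)) ^ i))"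
      by (simp add: sum_distrib_left)
    also have "\<dots> = (\<Sum>i\<le>d. coeff h i * ((r1 * t + r2) ^ i * (t + 1) ^ (d - i)))"
    proof (intro sum.cong refl)
      fix i assume "i \<in> {..d}"
      hence "(t + 1) ^ d = (t + 1) ^ i * (t + 1) ^ (d - i)" by (simp flip: power_add)
      thus "(t + 1) ^ d * (coeff h i * ((r1 * t + r2) / (t + 1)) ^ i) = coeff h i * ((r1 * t + r2) ^ i * (t + 1) ^ (d - i))"
        using t1 by (simp add: power_divide mult_ac)
    qed
    finally show ?thesis by (simp add: q_def poly_sum add.commute mult.commute)
  qed
  have qeq: "q \<circ>\<^sub>p [:0, r1\<^sup>2:] = smult (of_rat c * r1 ^ d) q"
  proof (rule poly_eqI_cofinite[of "{-1, - r2 / r1, - 1 / r1\<^sup>2}"])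
    fix t assume t: "t \<notin> {-1, - r2 / r1, - 1 / r1\<^sup>2}"
    have t1: "t + 1 \<noteq> 0" using t by (auto simp: add_eq_0_iff2)
    have t2: "r1 * t + r2 \<noteq> 0"
    proof
      assume "r1 * t + r2 = 0"
      hence "r1 * t = - r2" by (simp add: add_eq_0_iff2)
      hence "t = - r2 / r1" using r10 by (simp add: field_simps)
      thus False using t by simp
    qed
    have t3: "r1\<^sup>2 * t + 1 = r1 * (r1 * t + r2)" using prod by (simp add: algebra_simps power2_eq_square)
    have t3': "r1\<^sup>2 * t \<noteq> - 1"
    proof
      assume "r1\<^sup>2 * t = - 1"
      hence "r1 * (r1 * t + r2) = 0" using t3 by simp
      thus False using t2 r10 by simp
    qed
    define x where "x = (r1 * t + r2) / (t + 1)"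
    have x0: "x \<noteq> 0" using t1 t2 by (simp add: x_def)
    have x3: "(r1 * (r1\<^sup>2 * t) + r2) / (r1\<^sup>2 * t + 1) = 3 - 1 / x"
    proof -
      have "r1 * (r1\<^sup>2 * t) + r2 = r1 * ((r1 * r1) * t + r2 * r2)" using prod by (simp add: algebra_simps power2_eq_square)
      also have "\<dots> = r1 * (3 * (r1 * t + r2) - (t + 1))" unfolding r1 r2 by (simp add: algebra_simps)
      finally have "(r1 * (r1\<^sup>2 * t) + r2) / (r1\<^sup>2 * t + 1) = (3 * (r1 * t + r2) - (t + 1)) / (r1 * t + r2)"
        unfolding t3 using r10 by simp
      also have "\<dots> = 3 - 1 / x"
      proof -
        have "(3 * A - B) / A = 3 - 1 / (A / B)" if "A \<noteq> 0" for A B :: complex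
          using that by (simp add: diff_divide_distrib)
        from this[OF t2] show ?thesis by (simp only: x_def)
      qed
      finally show ?thesis .
    qed
    have "poly (q \<circ>\<^sub>p [:0, r1\<^sup>2:]) t = poly q (r1\<^sup>2 * t)" by (simp add: poly_pcompose mult.commute)
    also have "\<dots> = (r1\<^sup>2 * t + 1) ^ d * poly h (3 - 1 / x)" using pq[OF t3'] x3 by simp
    also have "(r1\<^sup>2 * t + 1) ^ d = r1 ^ d * ((t + 1) ^ d * x ^ d)"
    proof -
      have "r1 * t + r2 = (t + 1) * x" using t1 by (simp add: x_def)
      thus ?thesis unfolding t3 by (simp only: power_mult_distrib)
    qed
    also have "r1 ^ d * ((t + 1) ^ d * x ^ d) * poly h (3 - 1 / x) = r1 ^ d * (t + 1) ^ d * poly (mob 3 1 d h) x"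
      using poly_mob_field[OF x0 h(2), of 3 1] by (simp add: mult_ac)
    also have "\<dots> = poly (smult (of_rat c * r1 ^ d) q) t"
      unfolding eq using pq[of t] t by (simp add: x_def mult_ac)
    finally show "poly (q \<circ>\<^sub>p [:0, r1\<^sup>2:]) t = poly (smult (of_rat c * r1 ^ d) q) t" .
  qed simp
  have hx: "poly h x = poly q ((x - r2) / (r1 - x)) * ((r1 - x) / (r1 - r2)) ^ d" if x: "x \<noteq> r1" for x
  proof -
    define t where "t = (x - r2) / (r1 - x)"
    have rx: "r1 - x \<noteq> 0" using x by simp
    have t1: "t + 1 = (r1 - r2) / (r1 - x)" using rx by (simp add: t_def field_simps)
    hence t10: "t + 1 \<noteq> 0" using rx r12 by simp
    hence "t \<noteq> -1" by auto
    from pq[OF this] have "poly q t = (t + 1) ^ d * poly h ((r1 * t + r2) / (t + 1))" .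
    also have "(r1 * t + r2) / (t + 1) = x"
    proof -
      have "r1 * t + r2 = (r1 * (x - r2) + r2 * (r1 - x)) / (r1 - x)" using rx by (simp add: t_def add_divide_distrib)
      also have "\<dots> = x * (r1 - r2) / (r1 - x)" by (simp add: algebra_simps)
      finally show ?thesis unfolding t1 using rx r12 by simp
    qed
    finally have "poly h x = poly q t / (t + 1) ^ d" using t10 by simp
    also have "\<dots> = poly q t * ((r1 - x) / (r1 - r2)) ^ d" unfolding t1 using rx r12 by (simp add: power_divide)
    finally show ?thesis by (simp add: t_def)
  qed
  have "q \<noteq> 0"
  proof
    assume "q = 0"
    have "h = 0" by (rule poly_eqI_cofinite[of "{r1}"]) (use hx \<open>q = 0\<close> in auto)
    thus False using h by simp
  qed
  then obtain a where a: "coeff q a \<noteq> 0" by (metis leading_coeff_0_iff)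
  have cq: "coeff q j * r1 ^ (2 * j) = of_rat c * r1 ^ d * coeff q j" for j
    using arg_cong[OF qeq, of "\<lambda>p. coeff p j"] by (simp only: coeff_pcompose_linear coeff_smult power_mult mult.commute[of "coeff q j" "_ ^ j"])
  have ca: "r1 ^ (2 * a) = of_rat c * r1 ^ d" using cq[of a] a by simp
  have creal: "r ^ (2 * a) = real_of_rat c * r ^ d"
  proof -
    have "complex_of_real (r ^ (2 * a)) = complex_of_real (real_of_rat c * r ^ d)"
      using ca unfolding r1_def by (simp add: of_real_of_rat_eq)
    thus ?thesis by (simp only: of_real_eq_iff)
  qed
  have d: "d = 2 * a"
  proof (rule linorder_cases[of d "2 * a"])
    assume "d < 2 * a"
    hence "r ^ (2 * a) = r ^ (2 * a - d) * r ^ d" by (simp flip: power_add)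
    hence "r ^ (2 * a - d) = real_of_rat c" using creal rpos by simp
    hence "r ^ (2 * a - d) \<in> \<rat>" by simp
    hence "2 * a - d = 0" using golden_power_irrational unfolding r_def by blast
    thus ?thesis using \<open>d < 2 * a\<close> by simp
  next
    assume "2 * a < d"
    hence "r ^ d = r ^ (d - 2 * a) * r ^ (2 * a)" by (simp flip: power_add)
    hence "real_of_rat c * r ^ (d - 2 * a) = 1" using creal rpos by (simp add: mult.commute)
    hence "r ^ (d - 2 * a) = real_of_rat (inverse c)" by (simp add: of_rat_inverse inverse_unique)
    hence "r ^ (d - 2 * a) \<in> \<rat>" by simp
    hence "d - 2 * a = 0" using golden_power_irrational unfolding r_def by blast
    thus ?thesis using \<open>2 * a < d\<close> by simp
  qed
  have other: "coeff q j = 0" if "j \<noteq> a" for j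
  proof (rule ccontr)
    assume "coeff q j \<noteq> 0"
    hence "r1 ^ (2 * j) = r1 ^ (2 * a)" using cq[of j] ca by simp
    hence "r ^ (2 * j) = r ^ (2 * a)" unfolding r1_def by (metis of_real_eq_iff of_real_power)
    hence "2 * j = 2 * a" using rpos by (simp only: power_inject_exp)
    thus False using that by simp
  qed
  have qm: "q = monom (coeff q a) a" by (rule poly_eqI) (use other in \<open>auto simp: coeff_monom\<close>)
  define s where "s = coeff q a * (-1) ^ a / (r1 - r2) ^ d"
  have "h = smult s ([:1, -3, 1:] ^ a)"
  proof (rule poly_eqI_cofinite[of "{r1}"])
    fix x assume "x \<notin> {r1}"
    hence x: "x \<noteq> r1" "r1 - x \<noteq> 0" by auto
    have e: "(x - r2) * (r1 - x) = - (x * x - 3 * x + 1)"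
    proof -
      have "(x - r2) * (r1 - x) = (r1 + r2) * x - x * x - r1 * r2" by (simp add: algebra_simps)
      thus ?thesis by (simp add: sum prod)
    qed
    have "poly h x = coeff q a * ((x - r2) / (r1 - x)) ^ a * ((r1 - x) / (r1 - r2)) ^ d"
      unfolding hx[OF x(1)] by (subst qm) (simp add: poly_monom)
    also have "((r1 - x) / (r1 - r2)) ^ d = (r1 - x) ^ a * (r1 - x) ^ a / (r1 - r2) ^ d"
      unfolding power_divide by (simp add: d mult_2 power_add)
    also have "coeff q a * ((x - r2) / (r1 - x)) ^ a * ((r1 - x) ^ a * (r1 - x) ^ a / (r1 - r2) ^ d) =
       coeff q a / (r1 - r2) ^ d * ((x - r2) * (r1 - x)) ^ a"
      using x(2) by (simp add: power_divide power_mult_distrib mult_ac)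
    also have "\<dots> = s * (x * x - 3 * x + 1) ^ a"
      unfolding e power_minus[of "x * x - 3 * x + 1"] s_def by simp
    finally show "poly h x = poly (smult s ([:1, -3, 1:] ^ a)) x" by (simp add: algebra_simps)
  qed simp
  moreover have "s \<noteq> 0" using a r12 by (simp add: s_def)
  ultimately show ?thesis using that d by blast
qed

lemma mob_inverse:
  fixes w :: "'a::field"
  assumes "w \<noteq> 0" "degree h \<le> d" "x \<noteq> m"
  shows "poly h x = ((m - x) / w) ^ d * poly (mob m w d h) (w / (m - x))"
proof -
  have mx: "m - x \<noteq> 0" using assms(3) by simp
  hence "poly (mob m w d h) (w / (m - x)) = (w / (m - x)) ^ d * poly h x"
    using assms(1,2) by (subst poly_mob_field) auto
  hence "((m - x) / w) ^ d * poly (mob m w d h) (w / (m - x)) = (((m - x) / w) * (w / (m - x))) ^ d * poly h x"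
    by (simp only: power_mult_distrib mult.assoc)
  thus ?thesis using mx assms(1) by simp
qed

lemma mob_eq_0:
  fixes w :: "'a::field_char_0"
  assumes "w \<noteq> 0" "degree h \<le> d" "mob m w d h = 0"
  shows "h = 0"
  by (rule poly_eqI_cofinite[of "{m}"]) (use mob_inverse[OF assms(1,2)] assms(3) in auto)

text \<open>The inverse transformation carries an a-th power of a quadratic form to another such
  power; this lifts the shape of the form from \<open>\<xi> ^ 4\<close> to
  \<open>\<xi>\<close>.\<close>

lemma semiinvariant_step:
  fixes h :: "'a::field_char_0 poly"
  assumes w: "w \<noteq> 0" and h: "degree h \<le> 2 * a" and eq: "mob m w (2 * a) h = smult s ([:\<gamma>, \<beta>, \<alpha>:] ^ a)"
  shows "h = smult (s / w ^ (2 * a)) ([:\<gamma> * m\<^sup>2 + \<beta> * w * m + \<alpha> * w\<^sup>2, - (2 * m * \<gamma> + \<beta> * w), \<gamma>:] ^ a)"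
proof (rule poly_eqI_cofinite[of "{m}"])
  fix x assume "x \<notin> {m}"
  hence x: "x \<noteq> m" "m - x \<noteq> 0" by auto
  define y where "y = w / (m - x)"
  have "poly h x = ((m - x) / w) ^ (2 * a) * (s * (\<gamma> + y * (\<beta> + y * \<alpha>)) ^ a)"
    unfolding mob_inverse[OF w h x(1)] eq by (simp add: y_def)
  also have "\<dots> = s / w ^ (2 * a) * ((m - x)\<^sup>2 * (\<gamma> + y * (\<beta> + y * \<alpha>))) ^ a"
    by (simp add: power_divide power_mult power_mult_distrib)
  also have "(m - x)\<^sup>2 * (\<gamma> + y * (\<beta> + y * \<alpha>)) = \<gamma> * (m - x)\<^sup>2 + \<beta> * w * (m - x) + \<alpha> * w\<^sup>2"
  proof -
    have e: "(m - x) * y = w" using x(2) by (simp add: y_def)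
    have "(m - x)\<^sup>2 * (\<gamma> + y * (\<beta> + y * \<alpha>)) = \<gamma> * (m - x)\<^sup>2 + \<beta> * ((m - x) * y) * (m - x) + \<alpha> * ((m - x) * y)\<^sup>2"
      by (simp add: power2_eq_square algebra_simps)
    thus ?thesis by (simp only: e)
  qed
  also have "\<dots> = poly [:\<gamma> * m\<^sup>2 + \<beta> * w * m + \<alpha> * w\<^sup>2, - (2 * m * \<gamma> + \<beta> * w), \<gamma>:] x"
    by (simp add: power2_eq_square algebra_simps)
  finally show "poly h x = poly (smult (s / w ^ (2 * a)) ([:\<gamma> * m\<^sup>2 + \<beta> * w * m + \<alpha> * w\<^sup>2, - (2 * m * \<gamma> + \<beta> * w), \<gamma>:] ^ a)) x"
    by simp
qed simp

text \<open>The expansion at infinity of the power of a quadratic polynomial. The third identity is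
  doubled so that the binomial coefficient needs no division; for \<open>b = 0\<close> the truncated
  exponent \<open>b - 1\<close> occurs beside the factor \<open>of_nat b = 0\<close>.\<close>

lemma coeff_quadratic_power:
  fixes \<alpha> \<beta> \<gamma> :: "'a::comm_ring_1"
  defines "q \<equiv> [:\<gamma>, \<beta>, \<alpha>:]"
  shows "coeff (q ^ Suc b) (2 * b + 2) = \<alpha> ^ Suc b"
    "coeff (q ^ Suc b) (2 * b + 1) = of_nat (Suc b) * \<alpha> ^ b * \<beta>"
    "2 * coeff (q ^ Suc b) (2 * b) = 2 * of_nat (Suc b) * \<alpha> ^ b * \<gamma> + of_nat (Suc b) * of_nat b * \<alpha> ^ (b - 1) * \<beta>\<^sup>2"
proof (induction b)
  case 0
  { case 1 show ?case by (simp add: q_def numeral_2_eq_2) }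
  { case 2 show ?case by (simp add: q_def) }
  { case 3 show ?case by (simp add: q_def) }
next
  case (Suc b)
  have dq: "degree (q ^ Suc b) \<le> 2 * b + 2"
  proof -
    have "degree (q ^ Suc b) \<le> degree q * Suc b" by (rule degree_power_le)
    also have "\<dots> \<le> 2 * Suc b"
    proof (rule mult_le_mono1)
      show "degree q \<le> 2" unfolding q_def by (intro order_trans[OF degree_pCons_le]) (simp add: order_trans[OF degree_pCons_le])
    qed
    finally show ?thesis by simp
  qed
  have z: "coeff (q ^ Suc b) j = 0" if "j > 2 * b + 2" for j using dq that by (intro coeff_eq_0) simp
  have c: "coeff (q ^ Suc (Suc b)) (Suc (Suc j)) = \<gamma> * coeff (q ^ Suc b) (Suc (Suc j)) + \<beta> * coeff (q ^ Suc b) (Suc j) + \<alpha> * coeff (q ^ Suc b) j" for j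
    unfolding power_Suc[of q "Suc b"] by (subst (1) q_def) (simp add: coeff_pCons del: power_Suc)
  { case 1 show ?case using c[of "2 * b + 2"] Suc(1) z by simp }
  { case 2 show ?case using c[of "2 * b + 1"] Suc(1,2) z by (simp add: algebra_simps) }
  { case 3
    have "2 * coeff (q ^ Suc (Suc b)) (2 * Suc b) = 2 * \<gamma> * \<alpha> ^ Suc b + 2 * \<beta> * (of_nat (Suc b) * \<alpha> ^ b * \<beta>) + \<alpha> * (2 * coeff (q ^ Suc b) (2 * b))"
      using c[of "2 * b"] Suc(1,2) by (simp add: algebra_simps del: power_Suc of_nat_Suc)
    also have "\<alpha> * (2 * coeff (q ^ Suc b) (2 * b)) = 2 * of_nat (Suc b) * \<alpha> ^ Suc b * \<gamma> + of_nat (Suc b) * of_nat b * \<alpha> ^ b * \<beta>\<^sup>2"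
      unfolding Suc(3) by (cases b) (simp_all add: algebra_simps)
    finally show ?case by (simp add: algebra_simps power2_eq_square) }
qed

lemma rat_poly_eq_0_at_roots_of_unity:
  fixes p :: "rat poly"
  assumes "\<And>n \<xi> :: complex. \<xi> ^ (4 ^ n) = 1 \<Longrightarrow> pev of_rat \<xi> p = 0"
  shows "p = 0"
proof (rule ccontr)
  assume "p \<noteq> 0"
  define P where "P = (map_poly of_rat p :: complex poly)"
  have P: "P \<noteq> 0" using \<open>p \<noteq> 0\<close> unfolding P_def by (subst map_poly_eq_0_iff) auto
  define n where "n = degree P"
  have "{\<xi>. \<xi> ^ (4 ^ n) = 1} \<subseteq> {x. poly P x = 0}" using assms by (auto simp: P_def pev_def)
  hence "card {\<xi>::complex. \<xi> ^ (4 ^ n) = 1} \<le> card {x. poly P x = 0}" by (intro card_mono poly_roots_finite P)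
  also have "\<dots> \<le> n" unfolding n_def by (rule card_poly_roots_bound[OF P])
  also have "card {\<xi>::complex. \<xi> ^ (4 ^ n) = 1} = 4 ^ n" by (rule card_roots_unity_eq) simp
  finally have "4 ^ n \<le> n" .
  moreover have "n < 2 ^ n" "(2::nat) ^ n \<le> 4 ^ n" by (auto simp: less_exp power_mono)
  ultimately show False by linarith
qed

text \<open>
  The specialisations of \<open>h\<close> at \<open>4\<^sup>n\<close>-th roots of unity are constant multiples of \<open>a\<close>-th powers of quadratic forms, with
  \<open>d = 2 a\<close>. Such a form is proportional to an expression in the three leading coefficients of its power;
  applied to \<open>h\<close> this expression yields a semi-invariant quadratic form.
\<close>

lemma no_semiinvariant:
  fixes h :: "rat poly poly"
  assumes h: "h \<noteq> 0" "degree h \<le> d" and d: "d \<noteq> 0" and e: "e \<noteq> 0"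
    and eq: "smult e (mob zm zw d h) = smult x (map_poly sg h)"
  shows False
proof -
  obtain h' c a0 where h': "h' \<noteq> 0" "degree h' \<le> d" "(\<Sum>i\<le>d. a0 i * coeff h' i) = 1"
    "mob zm zw d h' = smult c (map_poly sg h')"
    by (rule semiinvariant_primitive[OF h e eq]) (rule that)
  define E where "E = (\<lambda>\<xi>::complex. pev of_rat \<xi> :: rat poly \<Rightarrow> complex)"
  have E: "rhom (E \<xi>)" for \<xi> unfolding E_def by (rule rhom_pev[OF rhom_of_rat])
  note E0 = rhom_0[OF E]
  have Ezm: "E \<xi> zm = \<xi>\<^sup>2 + \<xi> + 1" for \<xi>
    by (simp add: E_def zm_def pev_pCons power2_eq_square algebra_simps)
  have Ezw: "E \<xi> zw = \<xi> ^ 4" for \<xi>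
    by (simp add: E_def zw_def pev_def map_poly_monom poly_monom)
  have Esg: "E \<xi> (sg p) = E (\<xi> ^ 4) p" for \<xi> p by (simp add: E_def pev_sg rhom_of_rat)
  define H where "H = (\<lambda>\<xi>. map_poly (E \<xi>) h')"
  have cH: "coeff (H \<xi>) i = E \<xi> (coeff h' i)" for \<xi> i by (simp add: H_def coeff_map_poly E0)
  \<comment> \<open>The Bezout identity survives specialisation; this is why the form was made
    primitive.\<close>
  have Hnz: "H \<xi> \<noteq> 0" for \<xi>
  proof
    assume "H \<xi> = 0"
    hence "E \<xi> (coeff h' i) = 0" for i using cH[of \<xi> i] by simp
    hence "E \<xi> (\<Sum>i\<le>d. a0 i * coeff h' i) = 0" by (simp add: rhom_sum[OF E] rhom_mult[OF E])
    thus False by (simp add: h'(3) rhom_1[OF E])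
  qed
  have dH: "degree (H \<xi>) \<le> d" for \<xi> using h'(2) by (intro degree_le) (auto simp: cH coeff_eq_0 E0)
  have rel: "mob (\<xi>\<^sup>2 + \<xi> + 1) (\<xi> ^ 4) d (H \<xi>) = smult (E \<xi> c) (H (\<xi> ^ 4))" for \<xi>
  proof -
    have "mob (\<xi>\<^sup>2 + \<xi> + 1) (\<xi> ^ 4) d (H \<xi>) = map_poly (E \<xi>) (smult c (map_poly sg h'))"
      unfolding h'(4)[symmetric] map_poly_mob[OF E] by (simp add: Ezm Ezw H_def)
    also have "\<dots> = smult (E \<xi> c) (H (\<xi> ^ 4))"
      by (rule poly_eqI) (simp add: coeff_map_poly E0 cH rhom_mult[OF E] rhom_0[OF rhom_sg] Esg)
    finally show ?thesis .
  qed
  have cnz: "E \<xi> c \<noteq> 0" if "\<xi> \<noteq> 0" for \<xi>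
  proof
    assume "E \<xi> c = 0"
    hence "mob (\<xi>\<^sup>2 + \<xi> + 1) (\<xi> ^ 4) d (H \<xi>) = 0" using rel by simp
    from mob_eq_0[OF _ dH this] Hnz that show False by simp
  qed
  have "mob 3 1 d (H 1) = smult (of_rat (poly c 1)) (H 1)"
  proof -
    have "E 1 c = of_rat (poly c 1)"
      using pev_rhom[OF rhom_of_rat[where 'a = complex], of "\<lambda>x. x" 1 c] by (simp add: E_def pev_def)
    thus ?thesis using rel[of 1] by simp
  qed
  then obtain a s where a: "d = 2 * a" "s \<noteq> 0" "H 1 = smult s ([:1, -3, 1:] ^ a)"
    by (rule semiinvariant_at_1[OF Hnz dH]) (rule that)
  obtain b where b: "a = Suc b" using a(1) d by (cases a) auto
  \<comment> \<open>The quadratic form at \<open>\<xi>\<close> in terms of that at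
    \<open>\<xi> ^ 4\<close>, as in \<open>semiinvariant_step\<close>.\<close>
  define step where "step = (\<lambda>(\<xi>::complex) (\<gamma>, \<beta>, \<alpha>). (\<gamma> * (\<xi>\<^sup>2 + \<xi> + 1)\<^sup>2 + \<beta> * \<xi> ^ 4 * (\<xi>\<^sup>2 + \<xi> + 1) + \<alpha> * (\<xi> ^ 4)\<^sup>2,
     - (2 * (\<xi>\<^sup>2 + \<xi> + 1) * \<gamma> + \<beta> * \<xi> ^ 4), \<gamma>))"
  define qp where "qp = (\<lambda>(\<gamma>::complex, \<beta>, \<alpha>). [:\<gamma>, \<beta>, \<alpha>:])"
  have nxt: "\<exists>s'. s' \<noteq> 0 \<and> H \<xi> = smult s' (qp (step \<xi> t) ^ a)" if "\<xi> \<noteq> 0" "s \<noteq> 0" "H (\<xi> ^ 4) = smult s (qp t ^ a)" for \<xi> s t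
  proof -
    obtain \<gamma> \<beta> \<alpha> where t: "t = (\<gamma>, \<beta>, \<alpha>)" by (cases t) auto
    have "mob (\<xi>\<^sup>2 + \<xi> + 1) (\<xi> ^ 4) (2 * a) (H \<xi>) = smult (E \<xi> c * s) ([:\<gamma>, \<beta>, \<alpha>:] ^ a)"
      using rel[of \<xi>] that(3) by (simp add: a(1) t qp_def)
    from semiinvariant_step[OF _ _ this] dH[of \<xi>] that(1)
    have "H \<xi> = smult (E \<xi> c * s / (\<xi> ^ 4) ^ (2 * a)) (qp (step \<xi> t) ^ a)"
      by (simp add: a(1) t qp_def step_def)
    moreover have "E \<xi> c * s / (\<xi> ^ 4) ^ (2 * a) \<noteq> 0" using that cnz by simp
    ultimately show ?thesis by blast
  qed
  have pow: "\<exists>s t. s \<noteq> 0 \<and> H \<xi> = smult s (qp t ^ a)" if "\<xi> ^ (4 ^ n) = 1" for n \<xi>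
    using that
  proof (induction n arbitrary: \<xi>)
    case 0
    hence "H \<xi> = smult s (qp (1, -3, 1) ^ a)" using a(3) by (simp add: qp_def)
    thus ?case using a(2) by blast
  next
    case (Suc n)
    have "(\<xi> ^ 4) ^ (4 ^ n) = 1" using Suc.prems by (simp flip: power_mult)
    from Suc.IH[OF this] obtain s t where "s \<noteq> 0" "H (\<xi> ^ 4) = smult s (qp t ^ a)" by blast
    moreover have "\<xi> \<noteq> 0" using Suc.prems by (auto simp: power_0_left)
    ultimately show ?case using nxt by blast
  qed
  define h0 h1 h2 where "h0 = coeff h' (2 * b + 2)" and "h1 = coeff h' (2 * b + 1)" and "h2 = coeff h' (2 * b)"
  define A where "A = (of_nat a :: rat poly)"
  \<comment> \<open>Solving \<open>coeff_quadratic_power\<close> for the quadratic form, up to the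
    common factor \<open>l\<close> found below, expresses it through the three leading coefficients
    of its power.\<close>
  define Q where "Q = [:2 * A * h0 * h2 - (A - 1) * h1\<^sup>2, 2 * A * h0 * h1, 2 * A\<^sup>2 * h0\<^sup>2:]"
  have Qxi: "\<exists>l. map_poly (E \<xi>) Q = smult l (qp t)" if H: "H \<xi> = smult s (qp t ^ a)" for \<xi> s t
  proof -
    obtain \<gamma> \<beta> \<alpha> where t: "t = (\<gamma>, \<beta>, \<alpha>)" by (cases t) auto
    define n where "n = (of_nat a :: complex)"
    have n1: "of_nat b = n - 1" by (simp add: n_def b)
    have c0: "E \<xi> h0 = s * \<alpha> ^ a" and c1: "E \<xi> h1 = s * (n * \<alpha> ^ b * \<beta>)"
      and c2: "2 * E \<xi> h2 = s * (2 * n * \<alpha> ^ b * \<gamma> + n * (n - 1) * \<alpha> ^ (b - 1) * \<beta>\<^sup>2)"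
      using coeff_quadratic_power[of \<gamma> \<beta> \<alpha> b] unfolding h0_def h1_def h2_def cH[symmetric] H
      by (simp_all add: t qp_def b[symmetric] n_def[symmetric] n1 del: power_Suc mult_numeral_left_semiring_numeral of_nat_Suc)
    have EA: "E \<xi> A = n" by (simp add: A_def n_def rhom_of_nat[OF E])
    define l where "l = 2 * n\<^sup>2 * s\<^sup>2 * \<alpha> ^ a * \<alpha> ^ b"
    have q0: "E \<xi> (2 * A * h0 * h2 - (A - 1) * h1\<^sup>2) = l * \<gamma>"
    proof -
      have "E \<xi> (2 * A * h0 * h2 - (A - 1) * h1\<^sup>2) = n * E \<xi> h0 * (2 * E \<xi> h2) - (n - 1) * (E \<xi> h1)\<^sup>2"
        by (simp add: rhom_simps[OF E] EA)
      also have "\<dots> = n * (s * \<alpha> ^ a) * (s * (2 * n * \<alpha> ^ b * \<gamma> + n * (n - 1) * \<alpha> ^ (b - 1) * \<beta>\<^sup>2)) - (n - 1) * (s * (n * \<alpha> ^ b * \<beta>))\<^sup>2"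
        unfolding c0 c1 c2 ..
      also have "\<dots> = l * \<gamma> + (n - 1) * n\<^sup>2 * s\<^sup>2 * \<beta>\<^sup>2 * (\<alpha> ^ a * \<alpha> ^ (b - 1) - \<alpha> ^ b * \<alpha> ^ b)"
        by (simp add: l_def power2_eq_square algebra_simps)
      also have "(n - 1) * n\<^sup>2 * s\<^sup>2 * \<beta>\<^sup>2 * (\<alpha> ^ a * \<alpha> ^ (b - 1) - \<alpha> ^ b * \<alpha> ^ b) = 0"
        unfolding n1[symmetric] by (cases b) (simp_all add: b)
      finally show ?thesis by simp
    qed
    have q1: "E \<xi> (2 * A * h0 * h1) = l * \<beta>"
      by (simp add: rhom_simps[OF E] EA c0 c1 l_def power2_eq_square)
    have q2: "E \<xi> (2 * A\<^sup>2 * h0\<^sup>2) = l * \<alpha>"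
      by (simp add: rhom_simps[OF E] EA c0 l_def power2_eq_square b)
    have "map_poly (E \<xi>) Q = smult l (qp t)"
      unfolding Q_def t qp_def using q0 q1 q2 by (simp add: map_poly_pCons E0 del: mult_numeral_left_semiring_numeral)
    thus ?thesis by blast
  qed
  have A0: "A \<noteq> 0" unfolding A_def b by (rule of_nat_neq_0)
  have h00: "h0 \<noteq> 0"
  proof
    assume "h0 = 0"
    hence "coeff (H 1) (2 * b + 2) = 0" using cH[of 1 "2 * b + 2"] by (simp add: h0_def E0)
    moreover have "coeff (H 1) (2 * b + 2) = s * 1 ^ Suc b"
      unfolding a(3) coeff_smult b coeff_quadratic_power(1) ..
    ultimately show False using a(2) by simp
  qed
  have Q0: "Q \<noteq> 0" using A0 h00 by (simp add: Q_def)
  have dQ: "degree Q \<le> 2" unfolding Q_def by (intro order_trans[OF degree_pCons_le]) (simp add: order_trans[OF degree_pCons_le])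
  define MQ SQ where "MQ = mob zm zw 2 Q" and "SQ = map_poly sg Q"
  \<comment> \<open>The factors of proportionality depend on \<open>\<xi>\<close> in an unknown way,
    but the 2 by 2 minors are polynomials in \<open>z\<close>, so infinitely many zeros make them
    vanish.\<close>
  have cross: "coeff MQ i * coeff SQ j = coeff MQ j * coeff SQ i" for i j
  proof -
    have "coeff MQ i * coeff SQ j - coeff MQ j * coeff SQ i = 0"
    proof (rule rat_poly_eq_0_at_roots_of_unity)
      fix n and \<xi> :: complex assume x: "\<xi> ^ (4 ^ n) = 1"
      have x0: "\<xi> \<noteq> 0" using x by (auto simp: power_0_left)
      have "(\<xi> ^ 4) ^ (4 ^ n) = (\<xi> ^ (4 ^ n)) ^ 4" by (simp only: mult.commute flip: power_mult)
      hence "(\<xi> ^ 4) ^ (4 ^ n) = 1" using x by simp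
      from pow[OF this] obtain s t where st: "s \<noteq> 0" "H (\<xi> ^ 4) = smult s (qp t ^ a)" by blast
      from nxt[OF x0 st] obtain s' where s': "H \<xi> = smult s' (qp (step \<xi> t) ^ a)" by blast
      obtain l where l: "map_poly (E (\<xi> ^ 4)) Q = smult l (qp t)" using Qxi[OF st(2)] by blast
      obtain l' where l': "map_poly (E \<xi>) Q = smult l' (qp (step \<xi> t))" using Qxi[OF s'] by blast
      have ms: "mob (\<xi>\<^sup>2 + \<xi> + 1) (\<xi> ^ 4) 2 (qp (step \<xi> t)) = smult ((\<xi> ^ 4)\<^sup>2) (qp t)"
        by (cases t) (simp add: qp_def step_def mob_2 algebra_simps power2_eq_square)
      have M: "E \<xi> (coeff MQ i) = l' * (\<xi> ^ 4)\<^sup>2 * coeff (qp t) i" for i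
      proof -
        have "map_poly (E \<xi>) MQ = smult (l' * (\<xi> ^ 4)\<^sup>2) (qp t)"
          unfolding MQ_def map_poly_mob[OF E] Ezm Ezw l' mob_smult ms by simp
        from arg_cong[OF this, of "\<lambda>p. coeff p i"] show ?thesis by (simp only: coeff_map_poly E0 coeff_smult)
      qed
      have S: "E \<xi> (coeff SQ i) = l * coeff (qp t) i" for i
      proof -
        have "E \<xi> (coeff SQ i) = coeff (map_poly (E (\<xi> ^ 4)) Q) i"
          by (simp add: SQ_def coeff_map_sg Esg coeff_map_poly E0)
        thus ?thesis by (simp add: l)
      qed
      have "E \<xi> (coeff MQ i * coeff SQ j - coeff MQ j * coeff SQ i) = 0"
        by (simp add: rhom_simps[OF E] M S)
      thus "pev of_rat \<xi> (coeff MQ i * coeff SQ j - coeff MQ j * coeff SQ i) = 0" by (simp only: E_def)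
    qed
    thus ?thesis by simp
  qed
  obtain j where j: "coeff Q j \<noteq> 0" using Q0 by (metis leading_coeff_0_iff)
  hence sj: "coeff SQ j \<noteq> 0" by (simp add: SQ_def coeff_map_sg)
  have "smult (coeff SQ j) MQ = smult (coeff MQ j) SQ"
    by (rule poly_eqI) (use cross[of _ j] in \<open>simp add: mult.commute\<close>)
  hence "smult (coeff SQ j) (mob zm zw 2 Q) = smult (coeff MQ j) (map_poly sg Q)" by (simp only: MQ_def SQ_def)
  from no_semiinvariant_2[OF Q0 dQ sj this] show False .
qed

section \<open>Laurent series and the field of rational functions\<close>

definition pl :: "rat poly \<Rightarrow> rat fls" where "pl = pev fls_const fls_X"

definition sig :: "rat fls \<Rightarrow> rat fls" where "sig g = fls_compose_power g 4"

text \<open>In contrast to \<open>fls_deriv\<close>, this derivation commutes with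
  \<open>sig\<close> up to the constant 4, with no power of \<open>z\<close>.\<close>

definition theta :: "rat fls \<Rightarrow> rat fls" where "theta g = fls_X * fls_deriv g"

lemma rhom_fls_const: "rhom (fls_const :: rat \<Rightarrow> rat fls)"
  by (rule rhomI) (simp_all add: fls_plus_const fls_const_mult_const)

lemma rhom_pl: "rhom pl"
  unfolding pl_def by (rule rhom_pev[OF rhom_fls_const])

lemma pl_eq: "pl p = fps_to_fls (fps_of_poly p)"
  unfolding pl_def
  by (induction p) (simp_all add: pev_pCons fps_of_poly_pCons fls_times_fps_to_fls)

lemma pl_eq_0_iff [simp]: "pl p = 0 \<longleftrightarrow> p = 0"
  by (simp add: pl_eq fps_of_poly_eq_iff[of _ 0, simplified])

lemma pl_eq_iff: "pl p = pl q \<longleftrightarrow> p = q"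
  using pl_eq_0_iff[of "p - q"] by (simp add: rhom_diff[OF rhom_pl])

lemma rhom_sig: "rhom sig"
  by (rule rhomI) (simp_all add: sig_def)

lemma sig_X: "sig fls_X = fls_X ^ 4"
proof -
  have "fls_X_intpow (int 4) = (fls_X :: rat fls) ^ 4"
    by (simp add: fls_X_power_conv_shift_1)
  thus ?thesis by (simp add: sig_def)
qed

lemma sig_pl: "sig (pl p) = pl (sg p)"
proof -
  have "sig (pl p) = pev (\<lambda>c. sig (fls_const c)) (sig fls_X) p"
    unfolding pl_def by (rule pev_rhom[OF rhom_sig]) simp
  also have "\<dots> = pl (sg p)" by (simp add: sig_X pl_def pev_sg[OF rhom_fls_const]) (simp add: sig_def)
  finally show ?thesis .
qed

lemma fls_nth_theta: "fls_nth (theta g) n = of_int n * fls_nth g n"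
  by (simp add: theta_def fls_X_times_conv_shift)

lemma theta_sig: "theta (sig g) = 4 * sig (theta g)"
proof (rule fls_eqI)
  fix n
  have "4 * u = u + u + u + u" for u :: "rat fls" by (simp add: algebra_simps)
  hence "fls_nth (4 * sig (theta g)) n = 4 * fls_nth (sig (theta g)) n" by simp
  thus "fls_nth (theta (sig g)) n = fls_nth (4 * sig (theta g)) n"
    by (auto simp: fls_nth_theta sig_def fls_nth_compose_power)
qed

lemma theta_mult: "theta (a * b) = a * theta b + theta a * b"
  by (simp add: theta_def algebra_simps)

lemma theta_diff: "theta (a - b) = theta a - theta b"
  by (simp add: theta_def algebra_simps)

lemma theta_pl: "theta (pl p) = pl (pCons 0 (pderiv p))"
  by (simp add: theta_def pl_eq fls_deriv_fps_to_fls fps_of_poly_pderiv fps_of_poly_pCons fls_times_fps_to_fls)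

definition k0 :: "rat fls set" where "k0 = {pl p / pl q | p q. q \<noteq> 0}"

lemma k0I: "q \<noteq> 0 \<Longrightarrow> pl p / pl q \<in> k0"
  by (auto simp: k0_def)

lemma k0E:
  assumes "x \<in> k0" obtains p q where "x = pl p / pl q" "q \<noteq> 0"
  using assms by (auto simp: k0_def)

lemma pl_in_k0: "pl p \<in> k0"
  using k0I[of 1 p] by (simp add: rhom_1[OF rhom_pl])

lemma subfld_k0: "subfld k0"
  unfolding subfld_def
proof (intro conjI ballI)
  show "0 \<in> k0" using pl_in_k0[of 0] by (simp add: rhom_0[OF rhom_pl])
  show "1 \<in> k0" using pl_in_k0[of 1] by (simp add: rhom_1[OF rhom_pl])
  fix x assume "x \<in> k0"
  then obtain p q where x: "x = pl p / pl q" "q \<noteq> 0" by (auto simp: k0_def)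
  show "- x \<in> k0" using k0I[OF x(2), of "- p"] x by (simp add: rhom_uminus[OF rhom_pl])
  show "inverse x \<in> k0"
  proof (cases "p = 0")
    case True thus ?thesis using x pl_in_k0[of 0] by (simp add: rhom_0[OF rhom_pl])
  next
    case False thus ?thesis using k0I[of p q] x by simp
  qed
  fix y assume "y \<in> k0"
  then obtain p' q' where y: "y = pl p' / pl q'" "q' \<noteq> 0" by (auto simp: k0_def)
  have "x + y = pl (p * q' + p' * q) / pl (q * q')"
    using x y by (simp add: rhom_simps[OF rhom_pl] add_frac_eq)
  thus "x + y \<in> k0" using x y k0I[of "q * q'"] by simp
  have "x * y = pl (p * p') / pl (q * q')" using x y by (simp add: rhom_simps[OF rhom_pl])
  thus "x * y \<in> k0" using x y k0I[of "q * q'"] by simp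
qed

lemma sig_k0: "x \<in> k0 \<Longrightarrow> sig x \<in> k0"
  by (auto simp: rhom_divide[OF rhom_sig] sig_pl k0I elim!: k0E)

lemma k0_poly_clear:
  assumes "polyover k0 h"
  shows "\<exists>s h'. s \<noteq> 0 \<and> smult (pl s) h = map_poly pl h'"
  using assms
proof (induction h)
  case 0
  show ?case by (intro exI[of _ 1] exI[of _ 0]) simp
next
  case (pCons a h)
  have ah: "a \<in> k0" "polyover k0 h"
    using pCons.prems polyoverD[OF pCons.prems, of 0] unfolding polyover_def by (auto simp: coeff_pCons split: nat.splits)
  then obtain s h' where sh: "s \<noteq> 0" "smult (pl s) h = map_poly pl h'" using pCons.IH by blast
  obtain p q where pq: "a = pl p / pl q" "q \<noteq> 0" using ah by (auto simp: k0_def)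
  have sm: "map_poly pl (smult q h') = smult (pl q) (map_poly pl h')"
    by (rule poly_eqI) (simp add: coeff_map_poly rhom_simps[OF rhom_pl])
  have "smult (pl (q * s)) (pCons a h) = map_poly pl (pCons (s * p) (smult q h'))"
    using pq sh by (simp add: map_poly_pCons rhom_simps[OF rhom_pl] sm flip: sh(2))
  thus ?case using pq sh by (intro exI[of _ "q * s"] exI[of _ "pCons (s * p) (smult q h')"]) simp
qed

abbreviation Lm :: "rat fls" where "Lm \<equiv> pl zm"
abbreviation Lw :: "rat fls" where "Lw \<equiv> pl zw"

lemma zw_nz [simp]: "zw \<noteq> 0"
  by (simp add: zw_def)

text \<open>The multiplier \<open>c\<close> may be any Laurent series; after clearing denominators a
  nonzero coefficient of the form lets it be replaced by a quotient of polynomials.\<close>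

lemma no_semiinvariant_k0:
  assumes h: "polyover k0 h" "h \<noteq> 0" "degree h \<le> d" and d: "d \<noteq> 0" and eq: "mob Lm Lw d h = smult c (map_poly sig h)"
  shows False
proof -
  obtain s g where sg: "s \<noteq> 0" "smult (pl s) h = map_poly pl g" using k0_poly_clear[OF h(1)] by blast
  have cg: "pl (coeff g i) = pl s * coeff h i" for i
    using arg_cong[OF sg(2), of "\<lambda>p. coeff p i"] by (simp add: coeff_map_poly rhom_0[OF rhom_pl])
  have g0: "g \<noteq> 0"
  proof
    assume "g = 0"
    hence "pl s * coeff h i = 0" for i using cg[of i] by (simp add: rhom_0[OF rhom_pl])
    hence "h = 0" using sg(1) by (intro poly_eqI) simp
    thus False using h by simp
  qed
  have dg: "degree g \<le> d"
  proof (rule degree_le, intro allI impI)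
    fix i assume "d < i"
    hence "coeff h i = 0" using h(3) by (intro coeff_eq_0) simp
    thus "coeff g i = 0" using cg[of i] by simp
  qed
  define MG SG where "MG = mob zm zw d g" and "SG = map_poly sg g"
  have mg: "map_poly pl MG = smult (pl s * c) (map_poly sig h)"
    unfolding MG_def map_poly_mob[OF rhom_pl] sg(2)[symmetric] mob_smult eq by simp
  have sgc: "pl (coeff SG i) = sig (pl s) * sig (coeff h i)" for i
    by (simp add: SG_def coeff_map_sg sig_pl[symmetric] cg rhom_mult[OF rhom_sig])
  have mgc: "pl (coeff MG i) = pl s * c * sig (coeff h i)" for i
    using arg_cong[OF mg, of "\<lambda>p. coeff p i"] by (simp add: coeff_map_poly rhom_0[OF rhom_pl] rhom_0[OF rhom_sig])
  have cross: "coeff SG j * coeff MG i = coeff MG j * coeff SG i" for i j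
  proof -
    have "pl (coeff SG j * coeff MG i) = pl (coeff MG j * coeff SG i)"
      by (simp add: rhom_mult[OF rhom_pl] sgc mgc mult_ac)
    thus ?thesis by (simp only: pl_eq_iff)
  qed
  obtain j where "coeff g j \<noteq> 0" using g0 by (metis leading_coeff_0_iff)
  hence sj: "coeff SG j \<noteq> 0" by (simp add: SG_def coeff_map_sg)
  have "smult (coeff SG j) (mob zm zw d g) = smult (coeff MG j) (map_poly sg g)"
    unfolding MG_def[symmetric] SG_def[symmetric] by (rule poly_eqI) (simp add: cross)
  from no_semiinvariant[OF g0 dg d sj this] show False .
qed

text \<open>The inverse substitution, of \<open>w / (m - x)\<close>, on forms of degree
  \<open>d\<close>. It turns polynomials vanishing at \<open>sig \<kappa>\<close> into polynomials
  vanishing at \<open>\<kappa>\<close>.\<close>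

definition mobi :: "'a::comm_ring_1 \<Rightarrow> 'a \<Rightarrow> nat \<Rightarrow> 'a poly \<Rightarrow> 'a poly" where
  "mobi m w d h = (\<Sum>i\<le>d. smult (coeff h i * w ^ i) ([:m, - 1:] ^ (d - i)))"

lemma poly_mobi:
  fixes x :: "'a::field"
  assumes "x \<noteq> m" "degree h \<le> d"
  shows "poly (mobi m w d h) x = (m - x) ^ d * poly h (w / (m - x))"
proof -
  have mx: "m - x \<noteq> 0" using assms by simp
  have "poly h (w / (m - x)) = (\<Sum>i\<le>d. coeff h i * (w / (m - x)) ^ i)"
    using assms(2) pev_sum[OF rhom_id, of h d "w / (m - x)"] by (simp add: pev_def)
  hence "(m - x) ^ d * poly h (w / (m - x)) = (\<Sum>i\<le>d. (m - x) ^ d * (coeff h i * (w / (m - x)) ^ i))"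
    by (simp add: sum_distrib_left)
  also have "\<dots> = (\<Sum>i\<le>d. coeff h i * w ^ i * (m - x) ^ (d - i))"
  proof (intro sum.cong refl)
    fix i assume "i \<in> {..d}"
    hence "(m - x) ^ d = (m - x) ^ i * (m - x) ^ (d - i)" by (simp flip: power_add)
    thus "(m - x) ^ d * (coeff h i * (w / (m - x)) ^ i) = coeff h i * w ^ i * (m - x) ^ (d - i)"
      using mx by (simp add: power_divide)
  qed
  finally show ?thesis by (simp add: mobi_def poly_sum)
qed

lemma degree_mobi: "degree (mobi m w d h) \<le> d"
  unfolding mobi_def
proof (rule degree_sum_le)
  fix i assume "i \<in> {..d}"
  have "degree ([:m, - 1:] ^ (d - i)) \<le> d" using degree_linear_power_le[of m "-1" "d - i"] by simp
  thus "degree (smult (coeff h i * w ^ i) ([:m, - 1:] ^ (d - i))) \<le> d" using degree_smult_le le_trans by blast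
qed simp

lemma mobi_eq_0:
  fixes w :: "'a::field_char_0"
  assumes "w \<noteq> 0" "degree h \<le> d" "mobi m w d h = 0"
  shows "h = 0"
proof (rule poly_eqI_cofinite[of "{0}"])
  fix y :: 'a assume "y \<notin> {0}"
  hence y: "y \<noteq> 0" by simp
  have "m - w / y \<noteq> m" using y assms(1) by simp
  from poly_mobi[OF this assms(2), of w] have "(w / y) ^ d * poly h y = 0" using assms(1,3) y by simp
  thus "poly h y = poly 0 y" using y assms(1) by simp
qed simp

lemma polyover_mob: "subfld K \<Longrightarrow> m \<in> K \<Longrightarrow> w \<in> K \<Longrightarrow> polyover K h \<Longrightarrow> polyover K (mob m w d h)"
  unfolding mob_def by (intro polyover_intros) (auto intro!: polyover_intros subfld_intros simp: polyoverD)

lemma polyover_mobi: "subfld K \<Longrightarrow> m \<in> K \<Longrightarrow> w \<in> K \<Longrightarrow> polyover K h \<Longrightarrow> polyover K (mobi m w d h)"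
  unfolding mobi_def by (intro polyover_intros) (auto intro!: polyover_intros subfld_intros simp: polyoverD)

text \<open>Formal and actual degree may differ; raising the former costs a power of the variable.
  This lets numerator and denominator share one formal degree and absorbs stray monomials.\<close>

lemma mob_add:
  assumes "degree h \<le> d" shows "mob m w (d + i) h = monom 1 i * mob m w d h"
proof -
  have "mob m w (d + i) h = (\<Sum>j\<le>d. smult (coeff h j) ([:- w, m:] ^ j * monom 1 (d + i - j)))"
    unfolding mob_def using assms by (intro sum.mono_neutral_right) (auto simp: coeff_eq_0)
  also have "\<dots> = (\<Sum>j\<le>d. monom 1 i * smult (coeff h j) ([:- w, m:] ^ j * monom 1 (d - j)))"
  proof (intro sum.cong refl)
    fix j assume "j \<in> {..d}"
    hence "monom 1 (d + i - j) = monom (1::'a) i * monom 1 (d - j)" by (simp add: mult_monom add.commute)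
    thus "smult (coeff h j) ([:- w, m:] ^ j * monom 1 (d + i - j)) = monom 1 i * smult (coeff h j) ([:- w, m:] ^ j * monom 1 (d - j))"
      by (simp add: mult_ac)
  qed
  finally show ?thesis by (simp add: mob_def sum_distrib_left)
qed

lemma dvd_monom_mult_cancel:
  fixes p q :: "'a::field poly"
  assumes "coeff p 0 \<noteq> 0" "p dvd monom 1 k * q"
  shows "p dvd q"
  using assms(2)
proof (induction k)
  case 0 thus ?case by (simp add: monom_0 one_pCons[symmetric])
next
  case (Suc k)
  then obtain g where g: "monom 1 (Suc k) * q = p * g" by (elim dvdE)
  have "coeff (p * g) 0 = 0" unfolding g[symmetric] by (simp add: monom_Suc)
  hence "coeff p 0 * coeff g 0 = 0" by (simp add: coeff_mult_0)
  hence "coeff g 0 = 0" using assms(1) by simp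
  then obtain g' where "g = pCons 0 g'" by (cases g) auto
  hence "pCons 0 (monom 1 k * q) = pCons 0 (p * g')" using g by (simp add: monom_Suc)
  hence "monom 1 k * q = p * g'" by simp
  thus ?case using Suc.IH by simp
qed

lemma transc_poly_eq:
  assumes "subfld K" "transc K t" "polyover K p" "polyover K q" "poly p t = poly q t"
  shows "p = q"
proof -
  have "polyover K (p - q)" using assms by (intro polyover_intros)
  moreover have "poly (p - q) t = 0" using assms by simp
  ultimately have "p - q = 0" using assms(2) unfolding transc_def by blast
  thus ?thesis by simp
qed

lemma sig_poly: "sig (poly p x) = poly (map_poly sig p) (sig x)"
  by (induction p) (simp_all add: rhom_simps[OF rhom_sig] map_poly_pCons)

lemma polyover_map_sig: "polyover k0 p \<Longrightarrow> polyover k0 (map_poly sig p)"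
  by (rule polyover_map) (auto simp: sig_k0 rhom_0[OF rhom_sig])

lemma degree_map_sig [simp]: "degree (map_poly sig p) = degree p"
  by (rule degree_map_poly) (simp add: rhom_eq_0_iff[OF rhom_sig])

lemma coeff_map_sig [simp]: "coeff (map_poly sig p) i = sig (coeff p i)"
  by (simp add: coeff_map_poly rhom_0[OF rhom_sig])

lemma map_sig_eq_0_iff [simp]: "map_poly sig p = 0 \<longleftrightarrow> p = 0"
  by (auto simp: poly_eq_iff rhom_eq_0_iff[OF rhom_sig])

text \<open>Degrees leave only \<open>degree e \<le> 1\<close>. If a linear \<open>e\<close> had
  nonzero constant term, \<open>sg e\<close> would be prime to \<open>z\<close> and would therefore
  divide \<open>e\<close>, which has smaller degree.\<close>

lemma sg_dvd_imp_dvd_X: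
  fixes e :: "rat poly"
  assumes e: "e \<noteq> 0" and dvd: "sg e dvd zw * e"
  shows "e dvd [:0, 1:]"
proof -
  have "zw * e \<noteq> 0" using e by simp
  from dvd_imp_degree_le[OF dvd this] have "4 * degree e \<le> 4 + degree e"
    using e by (simp add: degree_sg degree_mult_eq) (simp add: zw_def degree_monom_eq)
  hence "degree e = 0 \<or> degree e = 1" by linarith
  thus ?thesis
  proof
    assume "degree e = 0"
    hence "is_unit e" using e by (simp add: is_unit_iff_degree)
    thus ?thesis using unit_imp_dvd by blast
  next
    assume d: "degree e = 1"
    then obtain a b where ab: "e = [:a, b:]" "b \<noteq> 0" by (rule degree1_coeffs)
    have "a = 0"
    proof (rule ccontr)
      assume a: "a \<noteq> 0"
      have "coeff (sg e) 0 \<noteq> 0" using a by (simp add: sg_def ab pcompose_pCons coeff_monom_mult)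
      from dvd_monom_mult_cancel[OF this dvd[unfolded zw_def]] have "degree (sg e) \<le> degree e"
        using e by (rule dvd_imp_degree_le)
      thus False using d by (simp add: degree_sg)
    qed
    hence "[:0, 1:] = e * [:1 / b:]" using ab by simp
    thus ?thesis by (metis dvd_triv_left)
  qed
qed

text \<open>The unknowns are those of \<open>no_quadratic_solution\<close> multiplied by
  \<open>z\<close>. If \<open>C2\<close> is nonzero, degrees force \<open>degree C2 = 1\<close>, and
  the coefficient of \<open>z^5\<close> in \<open>e3\<close> gives \<open>q = 4 * q\<close> for its
  leading coefficient \<open>q\<close>. If \<open>C2 = 0\<close>, it remains that \<open>zm\<close>
  does not divide \<open>z^2 + 2 z^3\<close>.\<close>

lemma no_quadratic_solution_poly:
  fixes C0 C1 C2 :: "rat poly"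
  assumes e1: "zw\<^sup>2 * C2 = 4 * [:0, 1:] * sg C0"
    and e2: "- (C1 + 2 * C2 * zm) * zw = (4 * sg C1 - 4 * zw) * [:0, 1:]"
    and e3: "C0 + C1 * zm + C2 * zm\<^sup>2 = (4 * sg C2 + [:0, 1, 2:]) * [:0, 1:]"
  shows False
proof -
  have dw: "degree zw = 4" by (simp add: zw_def degree_monom_eq)
  have dm: "degree zm = 2" by (simp add: zm_def)
  have zm0: "zm \<noteq> 0" by (simp add: zm_def)
  have d4: "degree (4 * p) = degree p" for p :: "rat poly"
    using degree_smult_eq[of 4 p] by (simp add: numeral_poly)
  have d2: "degree (2 * p) = degree p" for p :: "rat poly"
    using degree_smult_eq[of 2 p] by (simp add: numeral_poly)
  have dX: "degree (p * [:0, 1:]) = Suc (degree p)" if "p \<noteq> 0" for p :: "rat poly"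
    using that by (simp add: degree_mult_eq)
  have C20: "C2 = 0"
  proof (rule ccontr)
    assume C2: "C2 \<noteq> 0"
    hence C0: "C0 \<noteq> 0" using e1 by (auto simp: rhom_0[OF rhom_sg])
    have "degree (zw\<^sup>2 * C2) = 8 + degree C2" using C2 by (simp add: degree_mult_eq degree_power_eq dw)
    moreover have "4 * [:0, 1:] * sg C0 = (4 * sg C0) * [:0, 1:]" by (simp only: mult_ac)
    hence "degree (4 * [:0, 1:] * sg C0) = Suc (4 * degree C0)" using C0 by (simp only: dX d4 degree_sg) (simp add: dX d4 degree_sg)
    ultimately have c02: "8 + degree C2 = Suc (4 * degree C0)" using e1 by simp
    hence c2: "degree C2 \<ge> 1" by presburger
    have dT: "degree [:0, 1, 2 :: rat:] = 2" by simp
    have t1: "degree (4 * sg C2 + [:0, 1, 2:]) = 4 * degree C2"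
      using c2 by (subst degree_add_eq_left) (auto simp: d4 degree_sg)
    hence t2: "4 * sg C2 + [:0, 1, 2:] \<noteq> 0" using c2 by (metis degree_0 mult_is_0 not_one_le_zero zero_neq_numeral)
    have r3: "degree (C0 + C1 * zm + C2 * zm\<^sup>2) = Suc (4 * degree C2)"
      unfolding e3 dX[OF t2] t1 ..
    have l3: "degree (C0 + C1 * zm + C2 * zm\<^sup>2) \<le> max (max (degree C0) (degree C1 + 2)) (degree C2 + 4)"
    proof -
      have "degree (C1 * zm) \<le> degree C1 + 2" using degree_mult_le[of C1 zm] by (simp add: dm)
      moreover have "degree (C2 * zm\<^sup>2) = degree C2 + 4" using C2 zm0 by (simp add: degree_mult_eq degree_power_eq dm)
      ultimately show ?thesis
        using degree_add_le_max[of "C0 + C1 * zm" "C2 * zm\<^sup>2"] degree_add_le_max[of C0 "C1 * zm"] by linarith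
    qed
    have c1: "degree C1 \<le> 1 \<or> 4 * degree C1 \<le> degree C2 + 5"
    proof (cases "degree C1 \<le> 1")
      case False
      have t1: "degree (4 * sg C1 - 4 * zw) = 4 * degree C1"
        unfolding diff_conv_add_uminus using False by (subst degree_add_eq_left) (auto simp: d4 degree_sg dw)
      hence t2: "4 * sg C1 - 4 * zw \<noteq> 0" using False by (metis degree_0 mult_is_0 not_le zero_le_one zero_neq_numeral)
      have "degree ((4 * sg C1 - 4 * zw) * [:0, 1:]) = Suc (4 * degree C1)" unfolding dX[OF t2] t1 ..
      hence "Suc (4 * degree C1) = degree (- (C1 + 2 * C2 * zm) * zw)" by (simp only: e2)
      also have "\<dots> \<le> degree (- (C1 + 2 * C2 * zm)) + 4" using degree_mult_le[of "- (C1 + 2 * C2 * zm)" zw] by (simp add: dw)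
      also have "\<dots> \<le> max (degree C1) (degree C2 + 2) + 4"
      proof -
        have "degree (2 * C2 * zm) \<le> degree C2 + 2" using degree_mult_le[of "2 * C2" zm] by (simp add: dm d2)
        thus ?thesis using degree_add_le_max[of C1 "2 * C2 * zm"] unfolding degree_minus by linarith
      qed
      finally show ?thesis using False by linarith
    qed simp
    have "degree C2 = 1" using c02 c2 r3 l3 c1 by linarith
    with c02 r3 l3 c1 have deg: "degree C2 = 1" "degree C0 = 2" "degree C1 \<le> 1" by linarith+
    obtain p q where pq: "C2 = [:p, q:]" "q \<noteq> 0" using deg(1) by (rule degree1_coeffs)
    have "coeff (C0 + C1 * zm + C2 * zm\<^sup>2) 5 = q"
    proof -
      have "coeff C0 5 = 0" using deg by (intro coeff_eq_0) simp
      moreover have "coeff (C1 * zm) 5 = 0" using deg degree_mult_le[of C1 zm] by (intro coeff_eq_0) (simp add: dm)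
      moreover have "coeff (C2 * zm\<^sup>2) 5 = q"
        by (simp add: pq zm_def power2_eq_square numeral_eq_Suc)
      ultimately show ?thesis by simp
    qed
    moreover have "coeff ((4 * sg C2 + [:0, 1, 2:]) * [:0, 1:]) 5 = 4 * q"
    proof -
      have "4 * sg C2 = [:4 * p, 0, 0, 0, 4 * q:]"
        by (simp add: pq sg_def pcompose_pCons monom_altdef numeral_poly numeral_eq_Suc)
      thus ?thesis by (simp add: numeral_eq_Suc)
    qed
    ultimately show False using e3 pq(2) by simp
  qed
  hence C00: "C0 = 0" using e1 by simp
  have eq: "C1 * zm = [:0, 0, 1, 2:]" using e3 C20 C00 by (simp add: rhom_0[OF rhom_sg])
  hence "C1 \<noteq> 0" by auto
  hence "degree C1 + 2 = 3" using arg_cong[OF eq, of degree] zm0 by (simp add: degree_mult_eq dm)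
  hence "degree C1 = 1" by simp
  then obtain a b where "C1 = [:a, b:]" by (rule degree1_coeffs)
  thus False using eq by (auto simp: zm_def)
qed

lemma pl_X: "pl [:0, 1:] = fls_X"
  by (simp add: pl_def pev_X[OF rhom_fls_const])

text \<open>The equations compare coefficients for a solution \<open>b0 + b1 x + b2 x^2\<close> of
  the equation satisfied by \<open>theta \<kappa>\<close>. For the reduced common denominator
  \<open>e\<close> they imply that \<open>sg e\<close> divides \<open>zw * e\<close>, hence
  \<open>e\<close> divides \<open>z\<close>.\<close>

lemma no_quadratic_solution:
  assumes b: "b0 \<in> k0" "b1 \<in> k0" "b2 \<in> k0"
    and e1: "Lw * b2 = 4 * sig b0"
    and e2: "- (b1 + 2 * b2 * Lm) = 4 * sig b1 - 4"
    and e3: "b0 + b1 * Lm + b2 * Lm\<^sup>2 = 4 * Lw * sig b2 + pl [:0, 1, 2:]"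
  shows False
proof -
  note h = rhom_simps[OF rhom_pl]
  define b where "b = (\<lambda>i::nat. if i = 0 then b0 else if i = 1 then b1 else b2)"
  have "\<exists>p q. b i = pl p / pl q \<and> q \<noteq> 0" for i using b by (auto simp: b_def elim!: k0E)
  then obtain P Q where PQ: "\<And>i. b i = pl (P i) / pl (Q i)" "\<And>i. Q i \<noteq> 0" by metis
  \<comment> \<open>Index 3 carries the common denominator, so that one Bezout identity for four
    polynomials brings all three fractions to lowest terms together.\<close>
  define G where "G = (\<lambda>i. if i = 3 then \<Prod>j<3. Q j else P i * (\<Prod>j\<in>{..<3} - {i}. Q j))"
  have G3: "G 3 \<noteq> 0" using PQ(2) by (simp add: G_def)
  have bG: "b i * pl (G 3) = pl (G i)" if "i < 3" for i
  proof -
    have "G 3 = Q i * (\<Prod>j\<in>{..<3} - {i}. Q j)" using that by (simp add: G_def prod.remove)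
    thus ?thesis using that PQ(2)[of i] by (simp add: PQ(1) h G_def)
  qed
  have pG: "polyover UNIV (G i)" for i by (simp add: polyover_def)
  have nzG: "\<exists>i\<in>{..3}. G i \<noteq> 0" using G3 by auto
  obtain g a C where g: "g \<noteq> 0" "\<And>i. i \<in> {..3} \<Longrightarrow> G i = g * C i" "(\<Sum>i\<le>3. a i * C i) = 1"
    by (rule polyover_bezout[OF subfld_UNIV finite_atMost pG nzG]) blast
  define e where "e = C 3"
  have e0: "e \<noteq> 0" using G3 g(2)[of 3] by (auto simp: e_def)
  have be: "b i * pl e = pl (C i)" if "i < 3" for i
    using bG[OF that] g(1) g(2)[of i] g(2)[of 3] that by (simp add: e_def h)
  have sbe: "sig (b i) * pl (sg e) = pl (sg (C i))" if "i < 3" for i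
    using arg_cong[OF be[OF that], of sig] by (simp add: rhom_mult[OF rhom_sig] sig_pl)
  have b012: "b 0 = b0" "b 1 = b1" "b 2 = b2" by (simp_all add: b_def)
  have be': "b0 * pl e = pl (C 0)" "b1 * pl e = pl (C 1)" "b2 * pl e = pl (C 2)"
    using be[of 0, unfolded b012] be[of 1, unfolded b012] be[of 2, unfolded b012] by simp_all
  note sbe' = sbe[of 0, unfolded b012] sbe[of 1, unfolded b012] sbe[of 2, unfolded b012]
  have dvd4: "p dvd q" if "p * r = 4 * q" for p q r :: "rat poly"
  proof -
    have "q = p * smult (1 / 4) r" using that by (simp add: numeral_poly)
    thus ?thesis by (rule dvdI)
  qed
  have d0: "sg e dvd e * sg (C 0)"
  proof (rule dvd4)
    have "pl (sg e * (zw * C 2)) = Lw * b2 * pl e * pl (sg e)" using be'(3) by (simp add: h mult_ac)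
    also have "\<dots> = pl (4 * (e * sg (C 0)))" unfolding e1 using sbe'(1) by (simp add: h mult_ac)
    finally show "sg e * (zw * C 2) = 4 * (e * sg (C 0))" by (simp only: pl_eq_iff)
  qed
  have d1: "sg e dvd e * sg (C 1)"
  proof (rule dvd4)
    have "pl (sg e * (4 * e - (C 1 + 2 * C 2 * zm))) = (4 - (b1 + 2 * b2 * Lm)) * pl e * pl (sg e)"
      using be' by (simp add: h algebra_simps)
    also have "4 - (b1 + 2 * b2 * Lm) = 4 * sig b1" using e2 by (simp add: algebra_simps)
    also have "4 * sig b1 * pl e * pl (sg e) = pl (4 * (e * sg (C 1)))" using sbe'(2) by (simp add: h mult_ac)
    finally show "sg e * (4 * e - (C 1 + 2 * C 2 * zm)) = 4 * (e * sg (C 1))" by (simp only: pl_eq_iff)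
  qed
  have d2: "sg e dvd zw * e * sg (C 2)"
  proof (rule dvd4)
    obtain T :: "rat poly" where T: "T = [:0, 1, 2:]" by blast
    have "pl (sg e * (C 0 + C 1 * zm + C 2 * zm\<^sup>2 - [:0, 1, 2:] * e)) =
        (pl (C 0) + pl (C 1) * Lm + pl (C 2) * Lm\<^sup>2 - pl [:0, 1, 2:] * pl e) * pl (sg e)"
      unfolding T[symmetric] by (simp add: h algebra_simps)
    also have "\<dots> = (b0 + b1 * Lm + b2 * Lm\<^sup>2 - pl [:0, 1, 2:]) * pl e * pl (sg e)"
      unfolding be'[symmetric] by (simp add: algebra_simps)
    also have "\<dots> = 4 * Lw * (sig b2 * pl (sg e)) * pl e" unfolding e3 by (simp add: algebra_simps)
    also have "\<dots> = pl (4 * (zw * e * sg (C 2)))" unfolding sbe'(3)[simplified] by (simp add: h mult_ac)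
    finally show "sg e * (C 0 + C 1 * zm + C 2 * zm\<^sup>2 - [:0, 1, 2:] * e) = 4 * (zw * e * sg (C 2))" by (simp only: pl_eq_iff)
  qed
  have dvd: "sg e dvd zw * e"
  proof -
    have "zw * e = zw * e * sg (\<Sum>i\<le>3. a i * C i)" by (simp add: g(3) rhom_1[OF rhom_sg])
    also have "\<dots> = sg (a 0) * (zw * (e * sg (C 0))) + sg (a 1) * (zw * (e * sg (C 1))) + sg (a 2) * (zw * e * sg (C 2)) + sg (a 3) * zw * e * sg e"
      by (simp add: rhom_simps[OF rhom_sg] numeral_eq_Suc e_def algebra_simps)
    finally have eq: "zw * e = sg (a 0) * (zw * (e * sg (C 0))) + sg (a 1) * (zw * (e * sg (C 1))) + sg (a 2) * (zw * e * sg (C 2)) + sg (a 3) * zw * e * sg e" .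
    have "sg e dvd \<dots>" by (intro dvd_add dvd_mult[OF dvd_mult[OF d0]] dvd_mult[OF dvd_mult[OF d1]] dvd_mult[OF d2] dvd_triv_right)
    thus ?thesis by (simp only: eq[symmetric])
  qed
  obtain e' where e': "[:0, 1:] = e * e'" using sg_dvd_imp_dvd_X[OF e0 dvd] by (elim dvdE)
  define X where "X = pl [:0, 1:]"
  have X4: "X ^ 4 = Lw" unfolding X_def zw_def by (simp add: monom_altdef h)
  have X0: "X \<noteq> 0" by (simp add: X_def)
  have Lw0: "Lw \<noteq> 0" by simp
  have sX: "sig X = Lw" unfolding X_def sig_pl by (simp add: sg_def zw_def pcompose_pCons)
  define E where "E = (\<lambda>i. C i * e')"
  have bX: "b i * X = pl (E i)" if "i < 3" for i
    unfolding X_def e' E_def using be[OF that] by (simp add: h mult.assoc[symmetric])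
  have sbX: "sig (b i) * Lw = pl (sg (E i))" if "i < 3" for i
    using arg_cong[OF bX[OF that], of sig] by (simp add: rhom_mult[OF rhom_sig] sig_pl sX)
  have E: "b0 = pl (E 0) / X" "b1 = pl (E 1) / X" "b2 = pl (E 2) / X"
    using bX[of 0, unfolded b012] bX[of 1, unfolded b012] bX[of 2, unfolded b012] X0 by (simp_all add: eq_divide_eq)
  have sE: "sig b0 = pl (sg (E 0)) / Lw" "sig b1 = pl (sg (E 1)) / Lw" "sig b2 = pl (sg (E 2)) / Lw"
    using sbX[of 0, unfolded b012] sbX[of 1, unfolded b012] sbX[of 2, unfolded b012] Lw0 by (simp_all add: eq_divide_eq)
  show False
  proof (rule no_quadratic_solution_poly)
    have "Lw\<^sup>2 * pl (E 2) = 4 * X * pl (sg (E 0))"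
    proof -
      have "Lw\<^sup>2 * pl (E 2) = Lw * X * (Lw * b2)" unfolding E using X0 by (simp add: power2_eq_square)
      also have "\<dots> = 4 * X * pl (sg (E 0))" unfolding e1 sE using Lw0 by simp
      finally show ?thesis .
    qed
    hence "pl (zw\<^sup>2 * E 2) = pl (4 * [:0, 1:] * sg (E 0))" by (simp only: h X_def)
    thus "zw\<^sup>2 * E 2 = 4 * [:0, 1:] * sg (E 0)" by (simp only: pl_eq_iff)
    have "- (pl (E 1) + 2 * pl (E 2) * Lm) * Lw = (4 * pl (sg (E 1)) - 4 * Lw) * X"
    proof -
      have "- (pl (E 1) + 2 * pl (E 2) * Lm) * Lw = - (b1 + 2 * b2 * Lm) * X * Lw"
        unfolding E using X0 by (simp add: field_simps)
      also have "\<dots> = (4 * pl (sg (E 1)) - 4 * Lw) * X" unfolding e2 sE using Lw0 by (simp add: field_simps)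
      finally show ?thesis .
    qed
    hence "pl (- (E 1 + 2 * E 2 * zm) * zw) = pl ((4 * sg (E 1) - 4 * zw) * [:0, 1:])" by (simp only: h X_def)
    thus "- (E 1 + 2 * E 2 * zm) * zw = (4 * sg (E 1) - 4 * zw) * [:0, 1:]" by (simp only: pl_eq_iff)
    have "pl (E 0) + pl (E 1) * Lm + pl (E 2) * Lm\<^sup>2 = (4 * pl (sg (E 2)) + pl [:0, 1, 2:]) * X"
    proof -
      have "pl (E 0) + pl (E 1) * Lm + pl (E 2) * Lm\<^sup>2 = (b0 + b1 * Lm + b2 * Lm\<^sup>2) * X"
        unfolding E using X0 by (simp add: field_simps)
      also have "\<dots> = (4 * pl (sg (E 2)) + pl [:0, 1, 2:]) * X" unfolding e3 sE using Lw0 by simp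
      finally show ?thesis .
    qed
    hence "pl (E 0 + E 1 * zm + E 2 * zm\<^sup>2) = pl ((4 * sg (E 2) + [:0, 1, 2:]) * [:0, 1:])" by (simp only: h X_def)
    thus "E 0 + E 1 * zm + E 2 * zm\<^sup>2 = (4 * sg (E 2) + [:0, 1, 2:]) * [:0, 1:]" by (simp only: pl_eq_iff)
  qed
qed

section \<open>Transcendence of the Moebius solution\<close>

locale moebius_tower =
  fixes \<kappa> :: "rat fls"
  assumes keq: "\<kappa> = Lm - Lw / sig \<kappa>" and k_nz: "\<kappa> \<noteq> 0"
begin

abbreviation y where "y \<equiv> sig \<kappa>"

definition k1 where "k1 = adjoin k0 \<kappa>"

lemma y_nz: "y \<noteq> 0"
  using k_nz by (simp add: rhom_eq_0_iff[OF rhom_sig])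

lemma Lw_nz: "Lw \<noteq> 0"
  by simp

lemma k_neq_Lm: "\<kappa> \<noteq> Lm"
proof
  assume "\<kappa> = Lm"
  hence "Lw / y = 0" using keq by simp
  thus False using y_nz by simp
qed

lemma y_eq: "Lw / (Lm - \<kappa>) = y"
proof -
  have "Lm - \<kappa> = Lw / y" by (subst keq) simp
  thus ?thesis using y_nz by simp
qed

lemma mob_eval: "degree p \<le> e \<Longrightarrow> poly (mob Lm Lw e p) y = y ^ e * poly p \<kappa>"
  using poly_mob_field[OF y_nz, of p e Lm Lw] unfolding keq[symmetric] .

lemma mobi_eval: "degree p \<le> e \<Longrightarrow> poly (mobi Lm Lw e p) \<kappa> = (Lm - \<kappa>) ^ e * poly p y"
  using poly_mobi[OF k_neq_Lm, of p e Lw] unfolding y_eq .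

text \<open>The transform and the twist of a minimal polynomial \<open>p\<close> both vanish at
  \<open>y\<close>. Cancelling their leading terms and transforming back gives a polynomial of
  smaller degree vanishing at \<open>\<kappa>\<close>, hence zero; so \<open>p\<close> would be
  semi-invariant.\<close>

lemma transc_k: "transc k0 \<kappa>"
proof (rule ccontr)
  assume "\<not> transc k0 \<kappa>"
  hence "\<exists>p. p \<noteq> 0 \<and> polyover k0 p \<and> poly p \<kappa> = 0" by (auto simp: transc_def)
  from minimal_monic[OF subfld_k0 this] obtain p where p: "polyover k0 p" "poly p \<kappa> = 0" "lead_coeff p = 1"
    "\<And>q. polyover k0 q \<Longrightarrow> poly q \<kappa> = 0 \<Longrightarrow> degree q < degree p \<Longrightarrow> q = 0" by auto
  have "degree p \<noteq> 0"
  proof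
    assume "degree p = 0"
    then obtain c where "p = [:c:]" by (rule degree_eq_zeroE)
    thus False using p by simp
  qed
  then obtain d where d: "degree p = Suc d" by (cases "degree p") auto
  define P1 P2 where "P1 = mob Lm Lw (Suc d) p" and "P2 = map_poly sig p"
  define c where "c = coeff P1 (Suc d)"
  define S where "S = P1 - smult c P2"
  have P1: "polyover k0 P1" unfolding P1_def by (intro polyover_mob subfld_k0 pl_in_k0 p)
  have P2: "polyover k0 P2" unfolding P2_def by (intro polyover_map_sig p)
  have S: "polyover k0 S" unfolding S_def using P1 P2
    by (intro polyover_intros subfld_k0) (simp_all add: c_def polyoverD)
  have "poly P1 y = 0" using mob_eval[of p "Suc d"] p(2) d by (simp add: P1_def)
  moreover have "poly P2 y = 0" unfolding P2_def sig_poly[symmetric] p(2) by (rule rhom_0[OF rhom_sig])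
  ultimately have Sy: "poly S y = 0" by (simp add: S_def)
  have "coeff P2 (Suc d) = 1" using p(3) d by (simp add: P2_def rhom_1[OF rhom_sig])
  hence "coeff S (Suc d) = 0" by (simp add: S_def c_def)
  moreover have "degree S \<le> Suc d" unfolding S_def P1_def P2_def
    by (intro degree_diff_le degree_mob order.trans[OF degree_smult_le]) (simp add: d)
  ultimately have dS: "degree S \<le> d" by (metis eq_zero_or_degree_less degree_0 le_0_eq less_Suc_eq_le zero_le)
  have "mobi Lm Lw d S = 0"
  proof (rule p(4))
    show "polyover k0 (mobi Lm Lw d S)" by (intro polyover_mobi subfld_k0 pl_in_k0 S)
    show "poly (mobi Lm Lw d S) \<kappa> = 0" using mobi_eval[OF dS] Sy by simp
    show "degree (mobi Lm Lw d S) < degree p" using degree_mobi[of Lm Lw d S] d by simp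
  qed
  hence "S = 0" using mobi_eq_0[OF Lw_nz dS] by blast
  hence "mob Lm Lw (Suc d) p = smult c (map_poly sig p)" by (simp add: S_def P1_def P2_def)
  moreover have "p \<noteq> 0" using p(3) by auto
  ultimately show False using no_semiinvariant_k0[OF p(1), of "Suc d" c] d by simp
qed

lemma transc_y: "transc k0 y"
  unfolding transc_def
proof (intro allI impI)
  fix p assume p: "polyover k0 p" "poly p y = 0"
  have "poly (mobi Lm Lw (degree p) p) \<kappa> = 0" using mobi_eval[of p "degree p"] p by simp
  moreover have "polyover k0 (mobi Lm Lw (degree p) p)" by (intro polyover_mobi subfld_k0 pl_in_k0 p)
  ultimately have "mobi Lm Lw (degree p) p = 0" using transc_k unfolding transc_def by blast
  thus "p = 0" using mobi_eq_0[OF Lw_nz order.refl] by blast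
qed

lemma y_poly_eq: "polyover k0 p \<Longrightarrow> polyover k0 q \<Longrightarrow> poly p y = poly q y \<Longrightarrow> p = q"
  by (rule transc_poly_eq[OF subfld_k0 transc_y])

lemma subfld_k1: "subfld k1"
  unfolding k1_def by (rule subfld_adjoin[OF subfld_k0])

lemma k0_k1: "x \<in> k0 \<Longrightarrow> x \<in> k1"
  unfolding k1_def using subset_adjoin[OF subfld_k0] by blast

lemma k_in_k1: "\<kappa> \<in> k1"
  unfolding k1_def by (rule self_in_adjoin[OF subfld_k0])

lemma y_in_k1: "y \<in> k1"
  unfolding y_eq[symmetric] by (intro subfld_intros subfld_k1 k_in_k1 k0_k1 pl_in_k0)

lemma sig_k1: "x \<in> k1 \<Longrightarrow> sig x \<in> k1"
  using rhom_adjoin_closed[OF subfld_k0 rhom_sig sig_k0 y_in_k1[unfolded k1_def]] unfolding k1_def by blast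

text \<open>For the reduced denominator \<open>D\<close> of \<open>r\<close>, the equation written
  in \<open>y\<close> shows that the transform \<open>MD\<close> and the twist \<open>SD\<close>
  divide each other up to powers of \<open>y\<close>. Thus \<open>D\<close>, as a form of suitable
  degree, is semi-invariant, and that degree must be 0.\<close>

lemma denominator_trivial:
  assumes r: "r \<in> k1" and c: "c \<in> k0" "c \<noteq> 0" and q: "polyover k0 q"
    and eq: "y ^ n1 * r = c * y ^ n2 * sig r + poly q y"
  shows "\<exists>p. polyover k0 p \<and> r = poly p \<kappa>"
proof -
  obtain N D a b where ND: "polyover k0 N" "polyover k0 D" "polyover k0 a" "polyover k0 b"
    "a * D + b * N = 1" "poly D \<kappa> \<noteq> 0" "poly D \<kappa> * r = poly N \<kappa>"
    using coprime_representation[OF subfld_k0 r[unfolded k1_def]] by blast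
  note po = polyover_mob[OF subfld_k0 pl_in_k0 pl_in_k0] polyover_map_sig polyover_monom polyover_mult
    polyover_smult polyover_add subfld_k0 subfld_1
  define n where "n = degree D"
  define i where "i = degree N"
  define f where "f = max (degree a) (degree b)"
  define MD where "MD = mob Lm Lw n D"
  define MD' where "MD' = mob Lm Lw (n + i) D"
  define MN where "MN = mob Lm Lw (n + i) N"
  define SD SN where "SD = map_poly sig D" and "SN = map_poly sig N"
  have MD': "MD' = monom 1 i * MD" unfolding MD'_def MD_def by (rule mob_add) (simp add: n_def)
  have D0: "D \<noteq> 0" using ND(6) by auto
  have SD0: "SD \<noteq> 0" using D0 by (simp add: SD_def)
  \<comment> \<open>\<open>y\<close> does not divide \<open>MD\<close>: its constant coefficient is
    the leading one of \<open>D\<close> times a power of \<open>- Lw\<close>. Hence powers of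
    \<open>y\<close> cancel from divisibilities by \<open>MD\<close>.\<close>
  have "coeff D n \<noteq> 0" using D0 by (simp add: n_def)
  hence MD0: "coeff MD 0 \<noteq> 0" unfolding MD_def coeff_mob_0 using Lw_nz by simp
  have pol: "polyover k0 MD" "polyover k0 MD'" "polyover k0 MN" "polyover k0 SD" "polyover k0 SN"
    unfolding MD_def MD'_def MN_def SD_def SN_def by (intro po ND)+
  have evMD: "poly MD' y = y ^ (n + i) * poly D \<kappa>" unfolding MD'_def by (rule mob_eval) (simp add: n_def)
  have evMN: "poly MN y = y ^ (n + i) * poly N \<kappa>" unfolding MN_def by (rule mob_eval) (simp add: i_def)
  have MDr: "poly MD' y * r = poly MN y" unfolding evMD evMN ND(7)[symmetric] by (simp only: mult_ac)
  have SDr: "poly SD y * sig r = poly SN y"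
    unfolding SD_def SN_def sig_poly[symmetric] ND(7)[symmetric] by (simp add: rhom_mult[OF rhom_sig])
  have main: "monom 1 n1 * MN * SD = smult c (monom 1 n2 * SN * MD') + q * MD' * SD"
  proof (rule y_poly_eq)
    show "polyover k0 (monom 1 n1 * MN * SD)" by (intro po pol)
    show "polyover k0 (smult c (monom 1 n2 * SN * MD') + q * MD' * SD)" by (intro po pol c q)
    have "poly (monom 1 n1 * MN * SD) y = y ^ n1 * r * poly MD' y * poly SD y"
      by (simp add: poly_monom MDr[symmetric] mult_ac)
    also have "\<dots> = poly (smult c (monom 1 n2 * SN * MD') + q * MD' * SD) y"
      unfolding eq by (simp add: poly_monom SDr[symmetric] algebra_simps)
    finally show "poly (monom 1 n1 * MN * SD) y = poly (smult c (monom 1 n2 * SN * MD') + q * MD' * SD) y" .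
  qed
  define Ma Mb where "Ma = mob Lm Lw f a" and "Mb = mob Lm Lw f b"
  have bez: "Ma * MD' + Mb * MN = monom 1 (f + (n + i))"
  proof (rule y_poly_eq)
    show "polyover k0 (Ma * MD' + Mb * MN)" unfolding Ma_def Mb_def by (intro po pol ND)
    show "polyover k0 (monom 1 (f + (n + i)))" by (intro po)
    have "poly Ma y = y ^ f * poly a \<kappa>" "poly Mb y = y ^ f * poly b \<kappa>"
      unfolding Ma_def Mb_def by (rule mob_eval, simp add: f_def)+
    hence "poly (Ma * MD' + Mb * MN) y = y ^ (f + (n + i)) * poly (a * D + b * N) \<kappa>"
      by (simp add: evMD evMN power_add algebra_simps)
    thus "poly (Ma * MD' + Mb * MN) y = poly (monom 1 (f + (n + i))) y" by (simp add: ND(5) poly_monom)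
  qed
  have bez2: "map_poly sig a * SD + map_poly sig b * SN = 1"
    using arg_cong[OF ND(5), of "map_poly sig"] unfolding SD_def SN_def
    by (simp add: rhom_simps[OF map_poly_rhom[OF rhom_sig]])
  have MDdvd: "MD dvd MD'" by (simp add: MD')
  have "MD dvd monom 1 n1 * MN * SD" unfolding main
    by (rule dvd_add[OF dvd_smult[OF dvd_mult[OF MDdvd]] dvd_mult2[OF dvd_mult[OF MDdvd]]])
  moreover have "monom 1 (n1 + (f + (n + i))) * SD = Mb * (monom 1 n1 * MN * SD) + Ma * monom 1 n1 * SD * MD'"
  proof -
    have "monom 1 (n1 + (f + (n + i))) * SD = monom 1 n1 * (Ma * MD' + Mb * MN) * SD"
      unfolding bez by (simp add: mult_monom)
    thus ?thesis by (simp add: algebra_simps)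
  qed
  ultimately have "MD dvd monom 1 (n1 + (f + (n + i))) * SD"
    by (simp only: dvd_add[OF dvd_mult dvd_mult[OF MDdvd]])
  from dvd_monom_mult_cancel[OF MD0 this] have "MD dvd SD" .
  then obtain g where g: "SD = MD * g" by (elim dvdE)
  have SDdvd: "SD dvd monom 1 n2 * SN * MD'"
  proof -
    have "smult c (monom 1 n2 * SN * MD') = SD * (monom 1 n1 * MN - q * MD')"
      using main by (simp add: algebra_simps)
    hence "SD dvd smult c (monom 1 n2 * SN * MD')" by simp
    thus ?thesis using c(2) by (simp add: dvd_smult_iff)
  qed
  have "SD dvd monom 1 n2 * MD'"
  proof -
    have "monom 1 n2 * MD' = monom 1 n2 * MD' * (map_poly sig a * SD + map_poly sig b * SN)" unfolding bez2 by simp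
    also have "\<dots> = monom 1 n2 * MD' * map_poly sig a * SD + map_poly sig b * (monom 1 n2 * SN * MD')"
      by (simp add: algebra_simps)
    finally have eq': "monom 1 n2 * MD' = monom 1 n2 * MD' * map_poly sig a * SD + map_poly sig b * (monom 1 n2 * SN * MD')" .
    show ?thesis by (subst eq') (rule dvd_add[OF dvd_triv_right dvd_mult[OF SDdvd]])
  qed
  moreover have "monom 1 n2 * MD' = MD * monom 1 (n2 + i)"
  proof -
    have "monom (1 :: rat fls) (n2 + i) = monom 1 n2 * monom 1 i" by (simp add: mult_monom)
    thus ?thesis unfolding MD' by (simp only: mult_ac)
  qed
  ultimately have "MD * g dvd MD * monom 1 (n2 + i)" unfolding g by simp
  moreover have MDnz: "MD \<noteq> 0" using MD0 by auto
  ultimately have "g dvd monom 1 (n2 + i)" by simp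
  then obtain \<alpha> k where \<alpha>: "\<alpha> \<noteq> 0" "g = monom \<alpha> k" using dvd_monom_imp_monom by blast
  \<comment> \<open>The remaining power of \<open>y\<close> is absorbed by viewing \<open>D\<close>
    as a form of degree \<open>n + k\<close>.\<close>
  have "mob Lm Lw (n + k) D = monom 1 k * MD" unfolding MD_def by (rule mob_add) (simp add: n_def)
  also have "\<dots> = smult (1 / \<alpha>) (map_poly sig D)"
  proof -
    have "monom \<alpha> k = smult \<alpha> (monom 1 k)" by (simp add: smult_monom)
    hence "SD = smult \<alpha> (monom 1 k * MD)" unfolding g \<alpha>(2) by (simp add: mult.commute)
    thus ?thesis using \<alpha>(1) by (simp add: SD_def)
  qed
  finally have semi: "mob Lm Lw (n + k) D = smult (1 / \<alpha>) (map_poly sig D)" .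
  have "n + k = 0"
  proof (rule ccontr)
    assume nk: "n + k \<noteq> 0"
    show False by (rule no_semiinvariant_k0[OF ND(2) D0 _ nk semi]) (simp add: n_def)
  qed
  hence "degree D = 0" by (simp add: n_def)
  then obtain \<delta> where \<delta>: "D = [:\<delta>:]" by (rule degree_eq_zeroE)
  have "\<delta> \<noteq> 0" "\<delta> \<in> k0" using D0 \<delta> polyoverD[OF ND(2), of 0] by auto
  hence "polyover k0 (smult (1 / \<delta>) N)" by (intro polyover_smult subfld_k0 ND subfld_divide subfld_1)
  moreover have "r = poly (smult (1 / \<delta>) N) \<kappa>" using ND(7) \<open>\<delta> \<noteq> 0\<close> by (simp add: \<delta> field_simps)
  ultimately show ?thesis by blast
qed

text \<open>Both \<open>b\<close> and \<open>inverse b\<close> are polynomials in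
  \<open>\<kappa>\<close>, so \<open>b\<close> lies in \<open>k0\<close>; then the powers of the
  transcendental \<open>y\<close> on the two sides must agree.\<close>

lemma no_multiplicative_solution:
  assumes b: "b \<in> k1" "b \<noteq> 0" and c: "c \<in> k0" "c \<noteq> 0" and eq: "y ^ n1 * b = c * y ^ n2 * sig b"
  shows "n1 = n2"
proof -
  have eq1: "y ^ n1 * b = c * y ^ n2 * sig b + poly 0 y" using eq by simp
  obtain p where p: "polyover k0 p" "b = poly p \<kappa>"
    using denominator_trivial[OF b(1) c polyover_0[OF subfld_k0] eq1] by blast
  have sb: "sig b \<noteq> 0" using b by (simp add: rhom_eq_0_iff[OF rhom_sig])
  have ic: "inverse c \<in> k0" "inverse c \<noteq> 0" using c by (simp_all add: subfld_inverse[OF subfld_k0])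
  have "y ^ n2 * inverse b = inverse c * y ^ n1 * sig (inverse b) + poly 0 y"
    unfolding rhom_inverse[OF rhom_sig] using eq b sb c y_nz by (simp add: field_simps)
  from denominator_trivial[OF subfld_inverse[OF subfld_k1 b(1)] ic polyover_0[OF subfld_k0] this]
  obtain p' where p': "polyover k0 p'" "inverse b = poly p' \<kappa>" by blast
  have "p * p' = 1"
  proof (rule transc_poly_eq[OF subfld_k0 transc_k])
    show "polyover k0 (p * p')" "polyover k0 1" using p p' by (simp_all add: polyover_intros subfld_k0)
    show "poly (p * p') \<kappa> = poly 1 \<kappa>" using b by (simp flip: p(2) p'(2))
  qed
  hence "is_unit p" by (metis dvd_triv_left)
  then obtain a where a: "p = [:a:]" by (metis is_unit_polyE)
  have bk: "b \<in> k0" using p polyoverD[OF p(1), of 0] by (simp add: a)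
  have "monom b n1 = monom (c * sig b) n2"
  proof (rule y_poly_eq)
    show "polyover k0 (monom b n1)" "polyover k0 (monom (c * sig b) n2)"
      using bk c by (auto intro!: polyover_monom subfld_k0 subfld_mult sig_k0)
    show "poly (monom b n1) y = poly (monom (c * sig b) n2) y" using eq by (simp add: poly_monom mult_ac)
  qed
  thus ?thesis using b by (metis degree_monom_eq monom_eq_0_iff)
qed

text \<open>Applying \<open>theta\<close> to \<open>\<kappa> = Lm - Lw / y\<close> gives
  \<open>theta \<kappa> = A2 * sig (theta \<kappa>) + B2\<close>, because
  \<open>theta y = 4 * sig (theta \<kappa>)\<close>; \<open>pl [:0, 1, 2:]\<close> is
  \<open>theta Lm\<close>.\<close>

definition "A2 = 4 * Lw / y\<^sup>2"
definition "B2 = pl [:0, 1, 2:] - 4 * Lw / y"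

lemma A2_nz: "A2 \<noteq> 0"
  using y_nz by (simp add: A2_def)

lemma four_in: "subfld K \<Longrightarrow> 4 \<in> K"
  by (rule subfld_numeral)

lemma A2_in_k1: "A2 \<in> k1" and B2_in_k1: "B2 \<in> k1"
  unfolding A2_def B2_def
  by (intro subfld_divide subfld_diff subfld_mult subfld_power four_in y_in_k1 k0_k1 pl_in_k0 subfld_k1)+

text \<open>A solution is a polynomial in \<open>\<kappa>\<close>; its degree is at most 2, and its
  coefficients satisfy the system of \<open>no_quadratic_solution\<close>.\<close>

lemma no_solution_in_k1:
  assumes b: "b \<in> k1" and eq: "b = A2 * sig b + B2"
  shows False
proof -
  define q where "q = [:0, - 4 * Lw, pl [:0, 1, 2:]:]"
  have c: "4 * Lw \<in> k0" "4 * Lw \<noteq> 0" by (simp_all add: subfld_intros subfld_k0 pl_in_k0)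
  have q: "polyover k0 q" unfolding q_def using c
    by (auto intro!: polyover_pCons subfld_0 subfld_uminus subfld_k0 pl_in_k0 polyover_0)
  have eq0: "y\<^sup>2 * b = 4 * Lw * sig b + poly q y"
  proof -
    have "y\<^sup>2 * b = y\<^sup>2 * (A2 * sig b + B2)" using eq by simp
    also have "\<dots> = 4 * Lw * sig b + poly q y"
      using y_nz by (simp add: A2_def B2_def q_def field_simps power2_eq_square)
    finally show ?thesis .
  qed
  hence eq1: "y ^ 2 * b = 4 * Lw * y ^ 0 * sig b + poly q y" by simp
  obtain p where p: "polyover k0 p" "b = poly p \<kappa>" using denominator_trivial[OF b c q eq1] by blast
  define n where "n = degree p"
  have mev: "poly (mob Lm Lw n p) y = y ^ n * b" unfolding p(2) by (rule mob_eval) (simp add: n_def)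
  have sp: "sig b = poly (map_poly sig p) y" unfolding p(2) sig_poly ..
  \<comment> \<open>For \<open>n > 2\<close> the power \<open>y ^ (n - 2)\<close> would divide the
    transform of \<open>p\<close>, whose constant coefficient is the leading one of \<open>p\<close>
    times a power of \<open>- Lw\<close>.\<close>
  have deg: "n \<le> 2"
  proof (rule ccontr)
    assume n2: "\<not> n \<le> 2"
    then obtain k where k: "n = Suc (k + 2)" by (metis add_Suc less_imp_Suc_add not_le add.commute)
    have "monom 1 2 * mob Lm Lw n p = monom 1 2 * (monom 1 (Suc k) * (smult (4 * Lw) (map_poly sig p) + q))"
    proof (rule y_poly_eq)
      show "polyover k0 (monom 1 2 * mob Lm Lw n p)"
        by (intro polyover_mult polyover_monom polyover_mob subfld_k0 pl_in_k0 subfld_1 p)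
      show "polyover k0 (monom 1 2 * (monom 1 (Suc k) * (smult (4 * Lw) (map_poly sig p) + q)))"
        by (intro polyover_mult polyover_monom polyover_add polyover_smult polyover_map_sig subfld_k0 subfld_1 p c q)
      have "poly (monom 1 2 * mob Lm Lw n p) y = y ^ n * (y\<^sup>2 * b)"
        by (simp add: mev poly_monom mult_ac)
      also have "\<dots> = poly (monom 1 2 * (monom 1 (Suc k) * (smult (4 * Lw) (map_poly sig p) + q))) y"
        unfolding eq0 sp k by (simp add: poly_monom power_add algebra_simps power2_eq_square)
      finally show "poly (monom 1 2 * mob Lm Lw n p) y = poly (monom 1 2 * (monom 1 (Suc k) * (smult (4 * Lw) (map_poly sig p) + q))) y" .
    qed
    hence "mob Lm Lw n p = monom 1 (Suc k) * (smult (4 * Lw) (map_poly sig p) + q)" by simp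
    hence "coeff (mob Lm Lw n p) 0 = 0" by (simp add: coeff_mult_0)
    hence "coeff p n = 0" unfolding coeff_mob_0 by simp
    hence "p = 0" by (simp add: n_def)
    thus False using n2 by (simp add: n_def)
  qed
  define b0 b1 b2 where "b0 = coeff p 0" and "b1 = coeff p 1" and "b2 = coeff p 2"
  have pb: "p = [:b0, b1, b2:]"
  proof (rule poly_eqI)
    fix i
    show "coeff p i = coeff [:b0, b1, b2:] i"
    proof (cases "i \<le> 2")
      case True
      hence "i = 0 \<or> i = 1 \<or> i = 2" by linarith
      thus ?thesis by (auto simp: b0_def b1_def b2_def numeral_2_eq_2)
    next
      case False
      hence "coeff p i = 0" using deg by (intro coeff_eq_0) (simp add: n_def)
      moreover have "coeff [:b0, b1, b2:] i = 0" using False by (intro coeff_eq_0) simp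
      ultimately show ?thesis by simp
    qed
  qed
  have bk: "b0 \<in> k0" "b1 \<in> k0" "b2 \<in> k0" by (simp_all add: b0_def b1_def b2_def polyoverD p)
  have "mob Lm Lw 2 p = smult (4 * Lw) (map_poly sig p) + q"
  proof (rule y_poly_eq)
    show "polyover k0 (mob Lm Lw 2 p)" by (intro polyover_mob subfld_k0 pl_in_k0 p)
    show "polyover k0 (smult (4 * Lw) (map_poly sig p) + q)"
      by (intro polyover_add polyover_smult polyover_map_sig subfld_k0 p c q)
    show "poly (mob Lm Lw 2 p) y = poly (smult (4 * Lw) (map_poly sig p) + q) y"
      using mob_eval[of p 2] deg eq0 sp p(2) by (simp add: n_def)
  qed
  hence "[:b2 * Lw\<^sup>2, - (2 * b2 * Lm + b1) * Lw, b2 * Lm\<^sup>2 + b1 * Lm + b0:] =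
     [:4 * Lw * sig b0, 4 * Lw * sig b1 - 4 * Lw, 4 * Lw * sig b2 + pl [:0, 1, 2:]:]"
    unfolding pb mob_2 by (simp add: q_def map_poly_pCons rhom_0[OF rhom_sig])
  hence E: "b2 * Lw\<^sup>2 = 4 * Lw * sig b0" "- (2 * b2 * Lm + b1) * Lw = 4 * Lw * sig b1 - 4 * Lw"
    "b2 * Lm\<^sup>2 + b1 * Lm + b0 = 4 * Lw * sig b2 + pl [:0, 1, 2:]" by (simp_all only: pCons_eq_iff)
  show False
  proof (rule no_quadratic_solution[OF bk])
    have "Lw * (Lw * b2) = Lw * (4 * sig b0)" using E(1) by (simp add: power2_eq_square mult_ac)
    thus "Lw * b2 = 4 * sig b0" using Lw_nz by (metis mult_cancel_left)
    have "Lw * (- (b1 + 2 * b2 * Lm)) = Lw * (4 * sig b1 - 4)" using E(2) by (simp add: algebra_simps)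
    thus "- (b1 + 2 * b2 * Lm) = 4 * sig b1 - 4" using Lw_nz by (metis mult_cancel_left)
    show "b0 + b1 * Lm + b2 * Lm\<^sup>2 = 4 * Lw * sig b2 + pl [:0, 1, 2:]" using E(3) by (simp add: add_ac)
  qed
qed

text \<open>This is the equation of the linear coefficient in \<open>no_solution_in_k2\<close>. For
  \<open>b\<close> of degree \<open>n\<close> in \<open>\<kappa>\<close>, after multiplication by
  \<open>y ^ n\<close>, the left side has degree at most \<open>n\<close> in \<open>y\<close> and
  the right side \<open>2 * n + 2\<close>.\<close>

lemma no_solution_coefficient_1:
  assumes b: "b \<in> k1" and eq: "Lw * b = y\<^sup>2 * sig b + y"
  shows False
proof -
  have c: "1 / Lw \<in> k0" "1 / Lw \<noteq> 0" by (simp_all add: subfld_intros subfld_k0 pl_in_k0)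
  have q: "polyover k0 [:0, 1 / Lw:]" using c by (intro polyover_pCons subfld_0 subfld_k0 polyover_0)
  have eq1: "y ^ 0 * b = 1 / Lw * y ^ 2 * sig b + poly [:0, 1 / Lw:] y" using eq Lw_nz by (simp add: field_simps)
  obtain p where p: "polyover k0 p" "b = poly p \<kappa>" using denominator_trivial[OF b c q eq1] by blast
  define n where "n = degree p"
  have mev: "poly (mob Lm Lw n p) y = y ^ n * b" unfolding p(2) by (rule mob_eval) (simp add: n_def)
  have sp: "sig b = poly (map_poly sig p) y" unfolding p(2) sig_poly ..
  have p0: "p \<noteq> 0" using eq y_nz p(2) by (auto simp: rhom_0[OF rhom_sig])
  have e: "smult Lw (mob Lm Lw n p) = monom 1 (n + 2) * map_poly sig p + monom 1 (n + 1)"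
  proof (rule y_poly_eq)
    show "polyover k0 (smult Lw (mob Lm Lw n p))" by (intro polyover_smult polyover_mob subfld_k0 pl_in_k0 p)
    show "polyover k0 (monom 1 (n + 2) * map_poly sig p + monom 1 (n + 1))"
      by (intro polyover_add polyover_mult polyover_monom polyover_map_sig subfld_k0 subfld_1 p)
    have "poly (smult Lw (mob Lm Lw n p)) y = y ^ n * (Lw * b)"
      by (simp add: mev mult_ac)
    also have "\<dots> = poly (monom 1 (n + 2) * map_poly sig p + monom 1 (n + 1)) y"
      unfolding eq sp by (simp add: poly_monom power_add algebra_simps power2_eq_square)
    finally show "poly (smult Lw (mob Lm Lw n p)) y = poly (monom 1 (n + 2) * map_poly sig p + monom 1 (n + 1)) y" .
  qed
  have "coeff (smult Lw (mob Lm Lw n p)) (n + (n + 2)) = 0"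
    using degree_mob[of Lm Lw n p] by (simp add: coeff_eq_0)
  moreover have "coeff (monom 1 (n + 2) * map_poly sig p + monom 1 (n + 1)) (n + (n + 2)) = sig (coeff p n)"
    by (simp add: coeff_monom_mult)
  ultimately have "sig (coeff p n) = 0" using e by simp
  thus False using p0 by (simp add: rhom_eq_0_iff[OF rhom_sig] n_def)
qed

end

section \<open>The tower of transcendental extensions\<close>

locale mahler_tower = moebius_tower +
  fixes W :: "rat fls"
  assumes Weq: "W = sig \<kappa> * sig W" and W_nz: "W \<noteq> 0"
begin

definition "\<kappa>1 = theta \<kappa>"
text \<open>The logarithmic derivative turns the multiplicative equation
  \<open>W = y * sig W\<close> into the additive one \<open>l = 4 * sig l + B3\<close>.\<close>

definition "l = theta W / W"
definition "k2 = adjoin k1 \<kappa>1"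
definition "B3 = 4 * sig \<kappa>1 / y"
definition "k3 = adjoin k2 l"

lemma kappa1_eq: "\<kappa>1 = A2 * sig \<kappa>1 + B2"
proof -
  have ky: "\<kappa> * y = Lm * y - Lw" by (subst keq) (simp add: y_nz field_simps)
  have tm: "theta Lm = pl [:0, 1, 2:]" unfolding theta_pl by (simp add: zm_def pderiv_pCons)
  have tw: "theta Lw = 4 * Lw"
  proof -
    have "pCons 0 (pderiv zw) = 4 * zw" by (simp add: zw_def pderiv_monom numeral_poly smult_monom flip: monom_Suc)
    thus ?thesis unfolding theta_pl by (simp only: rhom_simps[OF rhom_pl])
  qed
  have ty: "theta y = 4 * sig \<kappa>1" by (simp add: theta_sig \<kappa>1_def)
  have mk: "Lm - \<kappa> = Lw / y" by (subst keq) simp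
  have "theta (\<kappa> * y) = theta (Lm * y - Lw)" by (simp only: ky)
  hence "\<kappa>1 * y = pl [:0, 1, 2:] * y + (Lm - \<kappa>) * theta y - 4 * Lw"
    by (simp add: theta_mult theta_diff tm tw \<kappa>1_def algebra_simps)
  hence "\<kappa>1 * y = pl [:0, 1, 2:] * y + Lw / y * (4 * sig \<kappa>1) - 4 * Lw" by (simp only: mk ty)
  thus ?thesis using y_nz by (simp add: A2_def B2_def field_simps power2_eq_square)
qed

lemma l_eq: "l = 4 * sig l + B3"
proof -
  have sW: "sig W \<noteq> 0" using W_nz by (simp add: rhom_eq_0_iff[OF rhom_sig])
  have "theta W = theta (y * sig W)" by (subst Weq) (rule refl)
  also have "\<dots> = y * (4 * sig (theta W)) + 4 * sig \<kappa>1 * sig W"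
    by (simp add: theta_mult theta_sig \<kappa>1_def)
  finally have tW: "theta W = y * (4 * sig (theta W)) + 4 * sig \<kappa>1 * sig W" .
  have "l = (y * (4 * sig (theta W)) + 4 * sig \<kappa>1 * sig W) / (y * sig W)"
    unfolding l_def using tW Weq by simp
  also have "\<dots> = 4 * sig l + B3"
    unfolding l_def B3_def rhom_divide[OF rhom_sig] using sW y_nz by (simp add: field_simps)
  finally show ?thesis .
qed

lemma transc_kappa1: "transc k1 \<kappa>1"
proof (rule ccontr)
  assume "\<not> transc k1 \<kappa>1"
  from trace_lemma[OF subfld_k1 rhom_sig sig_k1 A2_in_k1 A2_nz B2_in_k1 kappa1_eq this]
  show False using no_solution_in_k1 by blast
qed

lemma subfld_k2: "subfld k2"
  unfolding k2_def by (rule subfld_adjoin[OF subfld_k1])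

lemma k1_k2: "x \<in> k1 \<Longrightarrow> x \<in> k2"
  unfolding k2_def using subset_adjoin[OF subfld_k1] by blast

lemma kappa1_in_k2: "\<kappa>1 \<in> k2"
  unfolding k2_def by (rule self_in_adjoin[OF subfld_k1])

lemma sig_kappa1: "sig \<kappa>1 = (\<kappa>1 - B2) / A2"
  using kappa1_eq A2_nz by (simp add: field_simps)

lemma sig_kappa1_in_k2: "sig \<kappa>1 \<in> k2"
  unfolding sig_kappa1 by (intro subfld_divide subfld_diff subfld_k2 kappa1_in_k2 k1_k2 A2_in_k1 B2_in_k1)

lemma sig_k2: "x \<in> k2 \<Longrightarrow> sig x \<in> k2"
  using rhom_adjoin_closed[OF subfld_k1 rhom_sig sig_k1 sig_kappa1_in_k2[unfolded k2_def]] unfolding k2_def by blast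

lemma B3_in_k2: "B3 \<in> k2"
  unfolding B3_def by (intro subfld_divide subfld_mult four_in subfld_k2 sig_kappa1_in_k2 k1_k2 y_in_k1)

text \<open>A solution is a polynomial \<open>p\<close> in \<open>\<kappa>1\<close>, and the
  inhomogeneous term is linear in \<open>sig \<kappa>1\<close>. In degree at least 2 the leading
  coefficient therefore solves a homogeneous equation with the factor \<open>y ^ (2 * n)\<close>;
  otherwise the linear coefficient meets \<open>no_solution_coefficient_1\<close>.\<close>

lemma no_solution_in_k2:
  assumes b: "b \<in> k2" and eq: "b = 4 * sig b + B3"
  shows False
proof -
  have \<beta>: "polyover k1 [:0, 4 / y:]"
    by (intro polyover_pCons subfld_0 subfld_divide four_in subfld_k1 y_in_k1 polyover_0)
  have eq': "b = 4 * sig b + poly [:0, 4 / y:] (sig \<kappa>1)" using eq by (simp add: B3_def mult.commute)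
  have no2: "b \<noteq> A2 * sig b + B2" if "b \<in> k1" for b using no_solution_in_k1[OF that] by blast
  obtain p where p: "polyover k1 p" "b = poly p \<kappa>1"
    using denominator_lemma[OF subfld_k1 rhom_sig sig_k1 A2_in_k1 A2_nz B2_in_k1 kappa1_eq transc_kappa1 no2
        b[unfolded k2_def] four_in[OF subfld_k1] _ \<beta> eq'] by auto
  have ts: "transc k1 (sig \<kappa>1)"
    by (rule transc_affine[OF subfld_k1 transc_kappa1 A2_in_k1 A2_nz B2_in_k1 kappa1_eq])
  have peq: "p \<circ>\<^sub>p [:B2, A2:] = smult 4 (map_poly sig p) + [:0, 4 / y:]"
  proof (rule transc_poly_eq[OF subfld_k1 ts])
    show "polyover k1 (p \<circ>\<^sub>p [:B2, A2:])"
      by (intro polyover_pcompose polyover_pCons polyover_0 subfld_k1 p A2_in_k1 B2_in_k1)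
    have "polyover k1 (map_poly sig p)" by (rule polyover_map) (auto simp: sig_k1 rhom_0[OF rhom_sig] p(1))
    thus "polyover k1 (smult 4 (map_poly sig p) + [:0, 4 / y:])"
      by (intro polyover_add polyover_smult four_in subfld_k1 \<beta>)
    have "poly (p \<circ>\<^sub>p [:B2, A2:]) (sig \<kappa>1) = poly p (A2 * sig \<kappa>1 + B2)"
      by (simp add: poly_pcompose add.commute mult.commute)
    also have "\<dots> = b" unfolding p(2) kappa1_eq[symmetric] ..
    also have "\<dots> = poly (smult 4 (map_poly sig p) + [:0, 4 / y:]) (sig \<kappa>1)"
      by (subst eq') (simp add: p(2) sig_poly)
    finally show "poly (p \<circ>\<^sub>p [:B2, A2:]) (sig \<kappa>1) = poly (smult 4 (map_poly sig p) + [:0, 4 / y:]) (sig \<kappa>1)" .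
  qed
  show False
  proof (cases "degree p \<le> 1")
    case True
    define p0 p1 where "p0 = coeff p 0" and "p1 = coeff p 1"
    have pp: "p = [:p0, p1:]"
    proof (rule poly_eqI)
      fix i :: nat
      have "i = 0 \<or> i = 1 \<or> i > 1" by auto
      then consider "i = 0" | "i = 1" | "i > 1" by blast
      thus "coeff p i = coeff [:p0, p1:] i"
      proof cases
        case 3
        hence "coeff p i = 0" using True by (intro coeff_eq_0) simp
        moreover have "coeff [:p0, p1:] i = 0" using 3 by (intro coeff_eq_0) simp
        ultimately show ?thesis by simp
      qed (simp_all add: p0_def p1_def)
    qed
    have p1k: "p1 \<in> k1" by (simp add: p1_def polyoverD p)
    have "coeff (p \<circ>\<^sub>p [:B2, A2:]) 1 = p1 * A2" by (simp add: pp pcompose_pCons mult.commute)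
    hence "p1 * A2 = 4 * sig p1 + 4 / y" unfolding peq by (simp add: p1_def)
    hence "4 * (Lw * p1) = 4 * (y\<^sup>2 * sig p1 + y)" using y_nz by (simp add: A2_def field_simps power2_eq_square)
    hence "Lw * p1 = y\<^sup>2 * sig p1 + y" by (metis mult_cancel_left zero_neq_numeral)
    thus False by (rule no_solution_coefficient_1[OF p1k])
  next
    case False
    define n where "n = degree p"
    define a where "a = coeff p n"
    obtain k where k: "n = Suc k" using False by (cases n) (auto simp: n_def)
    have "coeff (p \<circ>\<^sub>p [:B2, A2:]) n = a * A2 ^ n"
      using coeff_pcompose_linear_top(1)[of p k B2 A2] k by (simp add: n_def a_def)
    moreover have "coeff [:0, 4 / y:] n = 0" using False by (intro coeff_eq_0) (simp add: n_def)
    ultimately have an: "a * A2 ^ n = 4 * sig a" unfolding peq by (simp add: a_def)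
    have "(A2 * y\<^sup>2) ^ n = (4 * Lw) ^ n" using y_nz by (simp add: A2_def)
    hence "a * (4 * Lw) ^ n = a * A2 ^ n * (y\<^sup>2) ^ n" by (simp only: power_mult_distrib mult.assoc)
    hence an': "a * (4 * Lw) ^ n = 4 * y ^ (2 * n) * sig a" unfolding an power_mult[of y 2 n] by (simp only: mult_ac)
    define c where "c = 4 / (4 * Lw) ^ n"
    have c: "c \<in> k0" "c \<noteq> 0"
      unfolding c_def by (intro subfld_divide subfld_power subfld_mult four_in subfld_k0 pl_in_k0) (simp add: Lw_nz)
    have L4: "(4 * Lw) ^ n \<noteq> 0" by simp
    have "y ^ 0 * a = c * y ^ (2 * n) * sig a" using an' L4 unfolding c_def by (simp add: field_simps)
    moreover have "a \<noteq> 0" using False by (auto simp: a_def n_def)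
    moreover have "a \<in> k1" by (simp add: a_def polyoverD p)
    ultimately have "0 = 2 * n" using no_multiplicative_solution c by blast
    thus False using k by simp
  qed
qed

lemma transc_l: "transc k2 l"
proof (rule ccontr)
  assume tr: "\<not> transc k2 l"
  have "(4 :: rat fls) \<noteq> 0" by simp
  from trace_lemma[OF subfld_k2 rhom_sig sig_k2 four_in[OF subfld_k2] this B3_in_k2 l_eq tr]
  show False using no_solution_in_k2 by blast
qed

lemma subfld_k3: "subfld k3"
  unfolding k3_def by (rule subfld_adjoin[OF subfld_k2])

lemma k2_k3: "x \<in> k2 \<Longrightarrow> x \<in> k3"
  unfolding k3_def using subset_adjoin[OF subfld_k2] by blast

lemma l_in_k3: "l \<in> k3"
  unfolding k3_def by (rule self_in_adjoin[OF subfld_k2])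

lemma sig_l_in_k3: "sig l \<in> k3"
proof -
  have "sig l = (l - B3) / 4" using l_eq by (simp add: field_simps)
  thus ?thesis by (simp only: subfld_divide[OF subfld_k3] subfld_diff[OF subfld_k3] l_in_k3 k2_k3[OF B3_in_k2] four_in[OF subfld_k3])
qed

lemma sig_k3: "x \<in> k3 \<Longrightarrow> sig x \<in> k3"
  using rhom_adjoin_closed[OF subfld_k2 rhom_sig sig_k2 sig_l_in_k3[unfolded k3_def]] unfolding k3_def by blast

text \<open>The norm of an algebraic \<open>W\<close> gives a nonzero \<open>b\<close> in
  \<open>k3\<close> with \<open>b = y ^ n * sig b\<close>. Such a \<open>b\<close> can involve
  neither \<open>l\<close> nor \<open>\<kappa>1\<close> by \<open>unit_lemma\<close>, so it lies in
  \<open>k1\<close>, where it is excluded.\<close>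

lemma transc_W: "transc k3 W"
proof (rule ccontr)
  assume tr: "\<not> transc k3 W"
  have y3: "y \<in> k3" by (intro k2_k3 k1_k2 y_in_k1)
  have four: "(4 :: rat fls) \<noteq> 0" by simp
  obtain n b where b: "n \<noteq> 0" "b \<in> k3" "b \<noteq> 0" "b = y ^ n * sig b"
    using norm_lemma[OF subfld_k3 rhom_sig sig_k3 y3 y_nz Weq W_nz tr] by blast
  have yn: "y ^ n \<in> k1" "y ^ n \<noteq> 0" using y_nz by (simp_all add: subfld_power[OF subfld_k1 y_in_k1])
  have no4: "b \<noteq> 4 * sig b + B3" if "b \<in> k2" for b using no_solution_in_k2[OF that] by blast
  have no2: "b \<noteq> A2 * sig b + B2" if "b \<in> k1" for b using no_solution_in_k1[OF that] by blast
  have "b \<in> k2"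
    by (rule unit_lemma[OF subfld_k2 rhom_sig sig_k2 four_in[OF subfld_k2] four B3_in_k2 l_eq transc_l no4
          b(2)[unfolded k3_def] b(3) k1_k2[OF yn(1)] yn(2) b(4)])
  have "b \<in> k1"
    by (rule unit_lemma[OF subfld_k1 rhom_sig sig_k1 A2_in_k1 A2_nz B2_in_k1 kappa1_eq transc_kappa1 no2
          \<open>b \<in> k2\<close>[unfolded k2_def] b(3) yn b(4)])
  have "y ^ 0 * b = 1 * y ^ n * sig b" using b(4) by simp
  from no_multiplicative_solution[OF \<open>b \<in> k1\<close> b(3) subfld_1[OF subfld_k0] one_neq_zero this] b(1) show False by simp
qed

end

section \<open>Functional independence\<close>

definition tup4 :: "'a \<Rightarrow> 'a \<Rightarrow> 'a \<Rightarrow> 'a \<Rightarrow> nat \<Rightarrow> 'a" where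
  "tup4 a b c d i = (if i = 0 then a else if i = 1 then b else if i = 2 then c else d)"

lemma tup4_map: "h (tup4 a b c d i) = tup4 (h a) (h b) (h c) (h d) i"
  by (simp add: tup4_def)

lemma ev4_closed:
  assumes "\<And>a b. a \<in> S \<Longrightarrow> b \<in> S \<Longrightarrow> a + b \<in> S \<and> a * b \<in> S" "rhom h" "\<And>c. h c \<in> S" "z \<in> S" "\<And>i. x i \<in> S"
  shows "ev4 h z x p \<in> S"
  using ev4_partial_rhom[where e = "\<lambda>x. x" and S = S and h = h and h' = h and z = z and x = x and p = p] assms by auto

lemma fls_const_in_k0: "fls_const c \<in> k0"
proof -
  have "pl [:c:] = fls_const c" by (simp add: pl_def pev_const)
  thus ?thesis using pl_in_k0[of "[:c:]"] by simp
qed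

lemma fls_X_in_k0: "fls_X \<in> k0"
  using pl_in_k0[of "[:0, 1:]"] by (simp add: pl_X)

text \<open>A polynomial relation over \<open>K\<close> satisfied by a transcendental element is an
  identity, so any Laurent series \<open>s\<close> may take its place.\<close>

lemma transc_specialise:
  assumes K: "subfld K" "k0 \<subseteq> K" and t: "transc K t" and L: "\<And>i. polyover K (L i)"
    and eq: "ev4 fls_const fls_X (\<lambda>i. poly (L i) t) p = 0"
  shows "ev4 fls_const fls_X (\<lambda>i. poly (L i) s) p = 0"
proof -
  have h: "rhom (\<lambda>c. [:fls_const c :: rat fls:])" by (rule rhom_comp[OF rhom_pCons rhom_fls_const])
  define Q where "Q = ev4 (\<lambda>c. [:fls_const c :: rat fls:]) [:fls_X:] L p"
  have ev: "poly Q u = ev4 fls_const fls_X (\<lambda>i. poly (L i) u) p" for u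
    unfolding Q_def by (subst ev4_rhom[OF rhom_poly h]) simp
  have "Q \<in> Collect (polyover K)" unfolding Q_def
  proof (rule ev4_closed[OF _ h])
    show "[:fls_const c:] \<in> Collect (polyover K)" for c
      using K fls_const_in_k0[of c] by (auto intro!: polyover_pCons polyover_0)
    show "[:fls_X:] \<in> Collect (polyover K)" using K fls_X_in_k0 by (auto intro!: polyover_pCons polyover_0)
  qed (auto simp: L polyover_add polyover_mult K)
  hence "Q = 0" using t eq unfolding transc_def ev[symmetric] by blast
  thus ?thesis using ev[of s] by simp
qed

context mahler_tower
begin

text \<open>The arguments are the four functions written in the generators of the tower. Replacing
  \<open>W\<close>, \<open>l\<close>, \<open>\<kappa>1\<close>, \<open>\<kappa>\<close> in this
  order, each transcendental over a field containing all that is still fixed, reaches every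
  quadruple of rational constants with nonzero second entry.\<close>

lemma relation_trivial:
  assumes eq: "ev4 fls_const fls_X (tup4 (\<kappa> * W) W ((\<kappa>1 + \<kappa> * l) * W / fls_X) (l * W / (4 * fls_X ^ 4))) p = 0"
  shows "p = 0"
proof -
  define X where "X = (fls_X :: rat fls)"
  define E where "E = (\<lambda>a b c d. ev4 fls_const fls_X (tup4 a b c d) p)"
  have X0: "X \<noteq> 0" "X \<in> k0" by (simp_all add: X_def fls_X_in_k0)
  have E0: "E (\<kappa> * W) W ((\<kappa>1 + \<kappa> * l) * W / X) (l * W / (4 * X ^ 4)) = 0" using eq unfolding E_def X_def .
  have step: "E (poly a s) (poly b s) (poly c s) (poly d s) = 0"
    if "subfld K" "k0 \<subseteq> K" "transc K t" "polyover K a" "polyover K b" "polyover K c" "polyover K d"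
      "E (poly a t) (poly b t) (poly c t) (poly d t) = 0" for K t a b c d s
  proof -
    have "polyover K (tup4 a b c d i)" for i using that by (simp add: tup4_def)
    moreover have "(\<lambda>i. poly (tup4 a b c d i) u) = tup4 (poly a u) (poly b u) (poly c u) (poly d u)" for u
      by (rule ext) (rule tup4_map)
    ultimately show ?thesis using transc_specialise[OF that(1-3), of "tup4 a b c d" p s] that(8) by (simp add: E_def)
  qed
  have sub: "k0 \<subseteq> k1" "k0 \<subseteq> k2" "k0 \<subseteq> k3" using k0_k1 k1_k2 k2_k3 by auto
  note pc = polyover_pCons polyover_0 subfld_0
  have E1: "E (\<kappa> * w') w' ((\<kappa>1 + \<kappa> * l) / X * w') (l / (4 * X ^ 4) * w') = 0" for w'
  proof -
    have "E (poly [:0, \<kappa>:] w') (poly [:0, 1:] w') (poly [:0, (\<kappa>1 + \<kappa> * l) / X:] w') (poly [:0, l / (4 * X ^ 4):] w') = 0"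
    proof (rule step[OF subfld_k3 sub(3) transc_W])
      have m: "\<kappa> \<in> k3" "\<kappa>1 \<in> k3" "X \<in> k3" using k_in_k1 kappa1_in_k2 k1_k2 k2_k3 X0 sub by auto
      show "polyover k3 [:0, \<kappa>:]" "polyover k3 [:0, 1:]" "polyover k3 [:0, (\<kappa>1 + \<kappa> * l) / X:]" "polyover k3 [:0, l / (4 * X ^ 4):]"
        using m l_in_k3 subfld_k3 by (auto intro!: pc subfld_1 subfld_divide subfld_add subfld_mult subfld_power subfld_numeral)
      show "E (poly [:0, \<kappa>:] W) (poly [:0, 1:] W) (poly [:0, (\<kappa>1 + \<kappa> * l) / X:] W) (poly [:0, l / (4 * X ^ 4):] W) = 0"
        using E0 by (simp add: mult.commute)
    qed
    thus ?thesis by (simp add: mult.commute)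
  qed
  have E2: "E (\<kappa> * w') w' ((\<kappa>1 + \<kappa> * l') / X * w') (l' / (4 * X ^ 4) * w') = 0" if w: "w' \<in> k0" for w' l'
  proof -
    have "E (poly [:\<kappa> * w':] l') (poly [:w':] l') (poly [:\<kappa>1 / X * w', \<kappa> / X * w':] l') (poly [:0, w' / (4 * X ^ 4):] l') = 0"
    proof (rule step[OF subfld_k2 sub(2) transc_l])
      have m: "\<kappa> \<in> k2" "X \<in> k2" "w' \<in> k2" using k_in_k1 k1_k2 X0 sub w by auto
      show "polyover k2 [:\<kappa> * w':]" "polyover k2 [:w':]" "polyover k2 [:\<kappa>1 / X * w', \<kappa> / X * w':]" "polyover k2 [:0, w' / (4 * X ^ 4):]"
        using m kappa1_in_k2 subfld_k2 by (auto intro!: pc subfld_1 subfld_divide subfld_add subfld_mult subfld_power subfld_numeral)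
      show "E (poly [:\<kappa> * w':] l) (poly [:w':] l) (poly [:\<kappa>1 / X * w', \<kappa> / X * w':] l) (poly [:0, w' / (4 * X ^ 4):] l) = 0"
        using E1[of w'] by (simp add: algebra_simps add_divide_distrib)
    qed
    thus ?thesis by (simp add: algebra_simps add_divide_distrib)
  qed
  have E3: "E (\<kappa> * w') w' ((v + \<kappa> * l') / X * w') (l' / (4 * X ^ 4) * w') = 0" if w: "w' \<in> k0" "l' \<in> k0" for w' l' v
  proof -
    have "E (poly [:\<kappa> * w':] v) (poly [:w':] v) (poly [:\<kappa> * l' / X * w', w' / X:] v) (poly [:l' / (4 * X ^ 4) * w':] v) = 0"
    proof (rule step[OF subfld_k1 sub(1) transc_kappa1])
      have m: "X \<in> k1" "w' \<in> k1" "l' \<in> k1" using X0 sub w by auto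
      show "polyover k1 [:\<kappa> * w':]" "polyover k1 [:w':]" "polyover k1 [:\<kappa> * l' / X * w', w' / X:]" "polyover k1 [:l' / (4 * X ^ 4) * w':]"
        using m k_in_k1 subfld_k1 by (auto intro!: pc subfld_1 subfld_divide subfld_add subfld_mult subfld_power subfld_numeral)
      show "E (poly [:\<kappa> * w':] \<kappa>1) (poly [:w':] \<kappa>1) (poly [:\<kappa> * l' / X * w', w' / X:] \<kappa>1) (poly [:l' / (4 * X ^ 4) * w':] \<kappa>1) = 0"
        using E2[of w' l'] w by (simp add: algebra_simps add_divide_distrib)
    qed
    thus ?thesis by (simp add: algebra_simps add_divide_distrib)
  qed
  have E4: "E (u * w') w' ((v + u * l') / X * w') (l' / (4 * X ^ 4) * w') = 0"
    if w: "w' \<in> k0" "l' \<in> k0" "v \<in> k0" for w' l' v u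
  proof -
    have "E (poly [:0, w':] u) (poly [:w':] u) (poly [:v / X * w', l' / X * w':] u) (poly [:l' / (4 * X ^ 4) * w':] u) = 0"
    proof (rule step[OF subfld_k0 subset_refl transc_k])
      show "polyover k0 [:0, w':]" "polyover k0 [:w':]" "polyover k0 [:v / X * w', l' / X * w':]" "polyover k0 [:l' / (4 * X ^ 4) * w':]"
        using X0 w subfld_k0 by (auto intro!: pc subfld_1 subfld_divide subfld_add subfld_mult subfld_power subfld_numeral)
      show "E (poly [:0, w':] \<kappa>) (poly [:w':] \<kappa>) (poly [:v / X * w', l' / X * w':] \<kappa>) (poly [:l' / (4 * X ^ 4) * w':] \<kappa>) = 0"
        using E3[of w' l' v] w by (simp add: algebra_simps add_divide_distrib)
    qed
    thus ?thesis by (simp add: algebra_simps add_divide_distrib)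
  qed
  have sp: "pl (spec4 x p) = E (fls_const (x 0)) (fls_const (x 1)) (fls_const (x 2)) (fls_const (x 3))" for x
  proof -
    have "pl (spec4 x p) = ev4 fls_const (pl [:0, 1:]) (\<lambda>i. fls_const (x i)) p"
      unfolding spec4_def by (subst ev4_rhom[OF rhom_pl rhom_pCons]) (simp add: pl_def pev_const)
    also have "ev4 fls_const (pl [:0, 1:]) (\<lambda>i. fls_const (x i)) p = E (fls_const (x 0)) (fls_const (x 1)) (fls_const (x 2)) (fls_const (x 3))"
      unfolding E_def ev4_def pl_X by (simp add: tup4_def)
    finally show ?thesis .
  qed
  have zero: "spec4 x p = 0" if x1: "x 1 \<noteq> 0" for x
  proof -
    define a where "a = (\<lambda>i. fls_const (x i))"
    have a0: "a i \<in> k0" for i by (simp add: a_def fls_const_in_k0)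
    have a1: "a 1 \<noteq> 0" using x1 by (simp add: a_def)
    \<comment> \<open>Prescribed values of the four functions are solved for the generators.\<close>
    define u where "u = a 0 / a 1"
    define l' where "l' = 4 * X ^ 4 * a 3 / a 1"
    define v where "v = X * a 2 / a 1 - u * l'"
    have in0: "u \<in> k0" "l' \<in> k0" unfolding u_def l'_def
      by (intro subfld_divide subfld_mult subfld_power subfld_numeral a0 X0 subfld_k0)+
    have "v \<in> k0" unfolding v_def
      by (intro subfld_diff subfld_divide subfld_mult a0 X0 subfld_k0 in0)
    from E4[OF a0 in0(2) this, of u 1]
    have "E (u * a 1) (a 1) ((v + u * l') / X * a 1) (l' / (4 * X ^ 4) * a 1) = 0" .
    moreover have "u * a 1 = a 0" using a1 by (simp add: u_def)
    moreover have "(v + u * l') / X * a 1 = a 2" using a1 X0 by (simp add: v_def)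
    moreover have "l' / (4 * X ^ 4) * a 1 = a 3" using a1 X0 by (simp add: l'_def)
    ultimately have "E (a 0) (a 1) (a 2) (a 3) = 0" by (simp only:)
    hence "pl (spec4 x p) = 0" unfolding sp a_def .
    thus ?thesis by simp
  qed
  \<comment> \<open>The factor \<open>zvar 1\<close> covers the constants with
    \<open>x 1 = 0\<close>, which the generators do not reach.\<close>
  have "spec4 x (p * zvar 1) = 0" for x
  proof -
    have "spec4 x (p * zvar 1) = spec4 x p * [:x 1:]"
      unfolding spec4_def rhom_mult[OF rhom_ev4[OF rhom_pCons]] by (simp add: ev4_zvar[OF rhom_pCons])
    thus ?thesis using zero[of x] by (cases "x 1 = 0") simp_all
  qed
  hence "p * zvar 1 = 0" using ex_spec4_nonzero by blast
  moreover have "zvar 1 \<noteq> 0" by (simp add: zvar_def)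
  ultimately show ?thesis by simp
qed

end

section \<open>Power series under substitution of a power of the variable\<close>

lemma sums_compose_X_power:
  assumes "k > 0"
  shows "(\<lambda>n. of_rat (fps_nth (g oo fps_X ^ k) n) * z ^ n) sums s \<longleftrightarrow> (\<lambda>n. of_rat (fps_nth g n) * (z ^ k) ^ n) sums (s :: complex)"
proof -
  have "strict_mono (\<lambda>n::nat. k * n)" using assms by (intro strict_monoI) simp
  moreover have "of_rat (fps_nth (g oo fps_X ^ k) n) * z ^ n = 0" if "n \<notin> range (\<lambda>n. k * n)" for n
    using that assms by (auto simp: fps_nth_compose_X_power elim!: dvdE)
  ultimately have "(\<lambda>n. of_rat (fps_nth (g oo fps_X ^ k) (k * n)) * z ^ (k * n)) sums s \<longleftrightarrow>
      (\<lambda>n. of_rat (fps_nth (g oo fps_X ^ k) n) * z ^ n) sums s"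
    by (rule sums_mono_reindex)
  thus ?thesis using assms by (simp add: fps_nth_compose_X_power power_mult)
qed

lemma conv1_sums: assumes "conv1 g" "norm z < 1" shows "(\<lambda>n. of_rat (fps_nth g n) * z ^ n) sums fev g z"
proof -
  have "ereal (norm z) < fps_conv_radius (cfps g)" using assms unfolding conv1_def
    by (metis ereal_less(3) less_le_trans less_ereal.simps(1) one_ereal_def)
  from sums_eval_fps[OF this] show ?thesis by (simp add: fev_def)
qed

lemma conv1_compose_X_power:
  assumes g: "conv1 g" and k: "k > 0" shows "conv1 (g oo fps_X ^ k)"
  unfolding conv1_def fps_conv_radius_def
proof (rule conv_radius_geI_ex')
  fix r :: real assume r: "0 < r" "ereal r < 1"
  have "norm ((of_real r :: complex) ^ k) < 1" using r k by (simp add: norm_power power_less_one_iff)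
  from conv1_sums[OF g this] have "(\<lambda>n. of_rat (fps_nth (g oo fps_X ^ k) n) * (of_real r :: complex) ^ n) sums fev g (of_real r ^ k)"
    by (simp only: sums_compose_X_power[OF k])
  thus "summable (\<lambda>n. fps_nth (cfps (g oo fps_X ^ k)) n * of_real r ^ n)" by (simp add: sums_iff)
qed

lemma fev_compose_X_power:
  assumes g: "conv1 g" and k: "k > 0" and z: "norm z < 1" shows "fev (g oo fps_X ^ k) z = fev g (z ^ k)"
proof -
  have "norm (z ^ k) < 1" using z k by (simp add: norm_power power_less_one_iff)
  from conv1_sums[OF g this] have "(\<lambda>n. of_rat (fps_nth (g oo fps_X ^ k) n) * z ^ n) sums fev g (z ^ k)"
    by (simp only: sums_compose_X_power[OF k])
  with conv1_sums[OF conv1_compose_X_power[OF g k] z] show ?thesis by (rule sums_unique2)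
qed

lemma conv1_deriv: assumes "conv1 g" shows "conv1 (fps_deriv g)"
proof -
  have "cfps (fps_deriv g) = fps_deriv (cfps g)" by (simp add: fps_eq_iff of_rat_mult of_rat_add)
  thus ?thesis using assms fps_conv_radius_deriv[of "cfps g"] by (simp add: conv1_def)
qed

definition rfps :: "int fps \<Rightarrow> rat fps" where
  "rfps F = Abs_fps (\<lambda>n. of_int (fps_nth F n))"

lemma rhom_rfps: "rhom rfps"
  by (rule rhomI) (simp_all add: fps_eq_iff rfps_def fps_mult_nth fps_one_nth)

lemma rfps_compose: "k > 0 \<Longrightarrow> rfps (F oo fps_X ^ k) = rfps F oo fps_X ^ k"
  by (simp add: fps_eq_iff rfps_def fps_nth_compose_X_power)

lemma rfps_X: "rfps fps_X = fps_X"
  by (simp add: fps_eq_iff rfps_def fps_X_def)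

lemma compose_X_power_twice: "(g oo fps_X ^ 4) oo fps_X ^ 4 = g oo fps_X ^ 16" for g :: "rat fps"
  by (rule fps_ext) (auto simp: fps_nth_compose_X_power div_mult2_eq[of _ 4 4, simplified] elim!: dvdE)

section \<open>Algebraic independence of the values\<close>

lemma rhom_fps_to_fls: "rhom (fps_to_fls :: rat fps \<Rightarrow> rat fls)"
  by (rule rhomI) (simp_all add: fls_times_fps_to_fls)

lemma functional_independence:
  fixes R :: "rat fps"
  assumes R0: "fps_nth R 0 = 1"
    and R: "R = (1 + fps_X + fps_X ^ 2) * (R oo fps_X ^ 4) - fps_X ^ 4 * (R oo fps_X ^ 16)"
    and p: "ev4 fps_const fps_X (tup4 R (R oo fps_X ^ 4) (fps_deriv R) (fps_deriv R oo fps_X ^ 4)) p = 0"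
  shows "p = 0"
proof -
  note h = rhom_simps[OF rhom_fps_to_fls]
  define G where "G = fps_to_fls R"
  define W where "W = sig G"
  define \<kappa> where "\<kappa> = G / W"
  have R_nz: "R \<noteq> 0" using R0 by auto
  have G_nz: "G \<noteq> 0" using R_nz by (simp add: G_def)
  have W_nz: "W \<noteq> 0" using G_nz by (simp add: W_def rhom_eq_0_iff[OF rhom_sig])
  have sW_nz: "sig W \<noteq> 0" using W_nz by (simp add: rhom_eq_0_iff[OF rhom_sig])
  have W: "W = fps_to_fls (R oo fps_X ^ 4)" by (simp add: W_def G_def sig_def fls_compose_power_fps_to_fls)
  have sW: "sig W = fps_to_fls (R oo fps_X ^ 16)"
    unfolding W sig_def by (simp add: fls_compose_power_fps_to_fls compose_X_power_twice)
  have Lm: "Lm = fps_to_fls (1 + fps_X + fps_X ^ 2)"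
    unfolding pl_eq zm_def by (simp add: fps_of_poly_pCons algebra_simps power2_eq_square)
  have Lw: "Lw = fps_to_fls (fps_X ^ 4)"
    unfolding pl_eq zw_def by (simp add: fps_of_poly_monom)
  have GW: "G = Lm * W - Lw * sig W"
    unfolding Lm Lw sW unfolding W G_def h(4)[symmetric] h(6)[symmetric] using R by simp
  have sk: "sig \<kappa> = W / sig W" by (simp add: \<kappa>_def rhom_divide[OF rhom_sig] W_def)
  interpret mahler_tower \<kappa> W
  proof
    have "\<kappa> = (Lm * W - Lw * sig W) / W" unfolding \<kappa>_def GW[symmetric] ..
    also have "\<dots> = Lm - Lw / (W / sig W)" using W_nz sW_nz by (simp add: diff_divide_distrib)
    finally show "\<kappa> = Lm - Lw / sig \<kappa>" unfolding sk .
    show "\<kappa> \<noteq> 0" using G_nz W_nz by (simp add: \<kappa>_def)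
    show "W = sig \<kappa> * sig W" using sW_nz by (simp add: sk)
    show "W \<noteq> 0" by (rule W_nz)
  qed
  define D where "D = fps_to_fls (fps_deriv R)"
  have D: "D = fls_deriv G" by (simp add: D_def G_def fls_deriv_fps_to_fls)
  have sD: "sig D = fps_to_fls (fps_deriv R oo fps_X ^ 4)"
    by (simp add: D_def sig_def fls_compose_power_fps_to_fls)
  have GkW: "G = \<kappa> * W" using W_nz by (simp add: \<kappa>_def)
  have tW: "theta W = l * W" using W_nz by (simp add: l_def)
  have XD: "fls_X * D = (\<kappa>1 + \<kappa> * l) * W"
  proof -
    have "fls_X * D = theta G" by (simp only: theta_def D)
    also have "\<dots> = theta (\<kappa> * W)" by (simp only: GkW[symmetric])
    also have "\<dots> = (\<kappa>1 + \<kappa> * l) * W" unfolding theta_mult tW \<kappa>1_def by (simp add: algebra_simps)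
    finally show ?thesis .
  qed
  have XsD: "4 * fls_X ^ 4 * sig D = l * W"
  proof -
    have "l * W = 4 * sig (theta G)" unfolding tW[symmetric] unfolding W_def theta_sig ..
    also have "\<dots> = 4 * sig (fls_X * D)" by (simp only: theta_def D)
    also have "\<dots> = 4 * fls_X ^ 4 * sig D" unfolding rhom_mult[OF rhom_sig] sig_X by (simp only: mult_ac)
    finally show ?thesis ..
  qed
  have X0: "(fls_X :: rat fls) \<noteq> 0" by simp
  have X4: "4 * (fls_X :: rat fls) ^ 4 \<noteq> 0" by simp
  have g2: "D = (\<kappa>1 + \<kappa> * l) * W / fls_X" unfolding XD[symmetric] using X0 by (metis nonzero_mult_div_cancel_left)
  have g3: "sig D = l * W / (4 * fls_X ^ 4)" unfolding XsD[symmetric] using X4 by (metis nonzero_mult_div_cancel_left)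
  have "ev4 fls_const fls_X (tup4 G W D (sig D)) p = 0"
  proof -
    have "fps_to_fls (ev4 fps_const fps_X (tup4 R (R oo fps_X ^ 4) (fps_deriv R) (fps_deriv R oo fps_X ^ 4)) p) =
       ev4 fls_const fls_X (tup4 G W D (sig D)) p"
      unfolding ev4_rhom[OF rhom_fps_to_fls rhom_fps_const] tup4_map G_def[symmetric] W[symmetric] D_def[symmetric] sD[symmetric]
      by simp
    thus ?thesis using p by simp
  qed
  thus ?thesis unfolding g3 unfolding g2 unfolding GkW by (rule relation_trivial)
qed

text \<open>The last function is the derivative of \<open>F\<close> taken at \<open>z^4\<close>, not
  the derivative of the composition. The third row is the differentiated functional equation; its
  last entry comes from \<open>z^4\<close> times \<open>16 z^15\<close>.\<close>

definition system_matrix :: "nat \<Rightarrow> nat \<Rightarrow> int poly" where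
  "system_matrix = tup4 (tup4 [:1, 1, 1:] (- monom 1 4) 0 0) (tup4 1 0 0 0)
     (tup4 [:1, 2:] (- monom 4 3) (monom 4 3 * [:1, 1, 1:]) (- monom 16 19)) (tup4 0 0 1 0)"

lemma pev_monom: "rhom h \<Longrightarrow> pev h x (monom a n) = h a * x ^ n"
  by (induction n) (simp_all add: monom_0 monom_Suc pev_pCons rhom_0 mult_ac)

lemma less_4_cases: "i < 4 \<Longrightarrow> i = 0 \<or> i = 1 \<or> i = 2 \<or> i = (3::nat)"
  by linarith

lemma system_matrix_sum:
  fixes z :: complex
  shows "(\<Sum>j<4. pev of_int z (system_matrix i j) * x j) =
    tup4 ((1 + z + z\<^sup>2) * x 0 - z ^ 4 * x 1) (x 0)
      ((1 + 2 * z) * x 0 - 4 * z ^ 3 * x 1 + 4 * z ^ 3 * (1 + z + z\<^sup>2) * x 2 - 16 * z ^ 19 * x 3) (x 2) i"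
proof -
  note hp = rhom_simps[OF rhom_pev[OF rhom_of_int]]
  have sum4: "(\<Sum>j<4. g j) = g 0 + g 1 + g 2 + g 3" for g :: "nat \<Rightarrow> complex"
    by (simp add: numeral_eq_Suc)
  show ?thesis unfolding sum4
    by (simp add: system_matrix_def tup4_def hp pev_monom[OF rhom_of_int] pev_pCons algebra_simps power2_eq_square)
qed

lemma fev_functional_equations:
  fixes R :: "rat fps"
  assumes c: "conv1 R"
    and R: "R = (1 + fps_X + fps_X ^ 2) * (R oo fps_X ^ 4) - fps_X ^ 4 * (R oo fps_X ^ 16)"
    and z: "norm z < 1"
  shows "fev R z = (1 + z + z\<^sup>2) * fev R (z ^ 4) - z ^ 4 * fev (R oo fps_X ^ 4) (z ^ 4)" (is ?A)
    and "fev (fps_deriv R) z = (1 + 2 * z) * fev R (z ^ 4) - 4 * z ^ 3 * fev (R oo fps_X ^ 4) (z ^ 4)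
      + 4 * z ^ 3 * (1 + z + z\<^sup>2) * fev (fps_deriv R) (z ^ 4) - 16 * z ^ 19 * fev (fps_deriv R oo fps_X ^ 4) (z ^ 4)" (is ?B)
proof -
  have z4: "norm (z ^ 4) < 1" using z by (simp add: norm_power power_less_one_iff)
  define R4 D where "R4 = R oo fps_X ^ 4" and "D = fps_deriv R"
  have c4: "conv1 R4" unfolding R4_def by (rule conv1_compose_X_power[OF c]) simp
  have cD: "conv1 D" unfolding D_def by (rule conv1_deriv[OF c])
  have cD4: "conv1 (D oo fps_X ^ 4)" by (rule conv1_compose_X_power[OF cD]) simp
  have ring: "conv1 (fps_const q)" "conv1 fps_X" for q by (rule conv1_const conv1_X)+
  have cXn: "conv1 (fps_X ^ n) \<and> fev (fps_X ^ n) z = z ^ n" for n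
  proof (induction n)
    case 0
    show ?case using conv1_const[of 1] fev_const[of 1 z] by (simp add: fps_const_1_eq_1)
  next
    case (Suc n)
    thus ?case using conv1_ring[OF ring(2) _ z] by (simp add: fev_def cfps_X)
  qed
  \<comment> \<open>Both functional equations are expanded into sums of terms of this shape, so that
    convergence and value can be read off term by term.\<close>
  have tm: "conv1 (fps_const q * fps_X ^ n * (g oo fps_X ^ 4)) \<and>
      fev (fps_const q * fps_X ^ n * (g oo fps_X ^ 4)) z = of_rat q * z ^ n * fev g (z ^ 4)" if "conv1 g" for q n g
  proof -
    have g4: "conv1 (g oo fps_X ^ 4)" "fev (g oo fps_X ^ 4) z = fev g (z ^ 4)"
      using that z by (simp_all add: conv1_compose_X_power fev_compose_X_power)
    have a: "conv1 (fps_const q * fps_X ^ n)" "fev (fps_const q * fps_X ^ n) z = of_rat q * z ^ n"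
      using conv1_ring[OF ring(1) conjunct1[OF cXn] z] cXn by (simp_all add: fev_const)
    show ?thesis using conv1_ring[OF a(1) g4(1) z] a g4 by simp
  qed
  have plus: "conv1 (a + b) \<and> fev (a + b) z = u + v" if "conv1 a \<and> fev a z = u" "conv1 b \<and> fev b z = v" for a b u v
    using conv1_ring[of a b z] that z by auto
  have R16: "R oo fps_X ^ 16 = R4 oo fps_X ^ 4" by (simp add: R4_def compose_X_power_twice)
  have "R = fps_const 1 * fps_X ^ 0 * R4 + fps_const 1 * fps_X ^ 1 * R4 + fps_const 1 * fps_X ^ 2 * R4
      + fps_const (- 1) * fps_X ^ 4 * (R4 oo fps_X ^ 4)"
    by (subst R) (simp add: R16 R4_def[symmetric] algebra_simps fps_const_1_eq_1 flip: fps_const_neg)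
  hence Req: "R = fps_const 1 * fps_X ^ 0 * (R oo fps_X ^ 4) + fps_const 1 * fps_X ^ 1 * (R oo fps_X ^ 4)
      + fps_const 1 * fps_X ^ 2 * (R oo fps_X ^ 4) + fps_const (- 1) * fps_X ^ 4 * (R4 oo fps_X ^ 4)"
    unfolding R4_def .
  have "fev R z = of_rat 1 * z ^ 0 * fev R (z ^ 4) + of_rat 1 * z ^ 1 * fev R (z ^ 4) + of_rat 1 * z ^ 2 * fev R (z ^ 4)
      + of_rat (- 1) * z ^ 4 * fev R4 (z ^ 4)"
    by (subst Req) (rule conjunct2[OF plus[OF plus[OF plus[OF tm[OF c] tm[OF c]] tm[OF c]] tm[OF c4]]])
  thus ?A by (simp add: R4_def algebra_simps)
  have dX: "fps_deriv (g oo fps_X ^ 4) = fps_const 4 * fps_X ^ 3 * (fps_deriv g oo fps_X ^ 4)" for g :: "rat fps"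
    by (subst fps_compose_deriv) (simp_all add: fps_deriv_power mult_ac numeral_fps_const)
  have dR4: "fps_deriv R4 = fps_const 4 * fps_X ^ 3 * (D oo fps_X ^ 4)" unfolding R4_def D_def by (rule dX)
  have dR16: "fps_deriv (R4 oo fps_X ^ 4) = fps_const 16 * fps_X ^ 15 * ((D oo fps_X ^ 4) oo fps_X ^ 4)"
  proof -
    have "fps_deriv R4 oo fps_X ^ 4 = fps_const 4 * fps_X ^ 12 * ((D oo fps_X ^ 4) oo fps_X ^ 4)"
      unfolding dR4 by (simp add: fps_compose_mult_distrib fps_X_power_compose flip: power_mult)
    hence "fps_deriv (R4 oo fps_X ^ 4) = (fps_const 4 * fps_const 4) * (fps_X ^ 3 * fps_X ^ 12) * ((D oo fps_X ^ 4) oo fps_X ^ 4)"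
      unfolding dX by (simp only: mult_ac)
    thus ?thesis by (simp flip: power_add)
  qed
  have "D = fps_deriv ((1 + fps_X + fps_X ^ 2) * R4 - fps_X ^ 4 * (R4 oo fps_X ^ 4))"
    using R unfolding D_def R16 R4_def[symmetric] by simp
  also have "\<dots> = (1 + 2 * fps_X) * R4 + (1 + fps_X + fps_X ^ 2) * fps_deriv R4
      - (4 * fps_X ^ 3) * (R4 oo fps_X ^ 4) - fps_X ^ 4 * fps_deriv (R4 oo fps_X ^ 4)"
    by (simp add: fps_deriv_power numeral_fps_const algebra_simps)
  also have "\<dots> = fps_const 1 * fps_X ^ 0 * (R oo fps_X ^ 4) + fps_const 2 * fps_X ^ 1 * (R oo fps_X ^ 4)
      + fps_const 4 * fps_X ^ 3 * (D oo fps_X ^ 4) + fps_const 4 * fps_X ^ 4 * (D oo fps_X ^ 4)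
      + fps_const 4 * fps_X ^ 5 * (D oo fps_X ^ 4) + fps_const (- 4) * fps_X ^ 3 * (R4 oo fps_X ^ 4)
      + fps_const (- 16) * fps_X ^ 19 * ((D oo fps_X ^ 4) oo fps_X ^ 4)"
    unfolding dR16 dR4 R4_def[symmetric]
    by (simp add: numeral_fps_const algebra_simps numeral_eq_Suc flip: fps_const_neg)
  finally have Deq: "D = fps_const 1 * fps_X ^ 0 * (R oo fps_X ^ 4) + fps_const 2 * fps_X ^ 1 * (R oo fps_X ^ 4)
      + fps_const 4 * fps_X ^ 3 * (D oo fps_X ^ 4) + fps_const 4 * fps_X ^ 4 * (D oo fps_X ^ 4)
      + fps_const 4 * fps_X ^ 5 * (D oo fps_X ^ 4) + fps_const (- 4) * fps_X ^ 3 * (R4 oo fps_X ^ 4)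
      + fps_const (- 16) * fps_X ^ 19 * ((D oo fps_X ^ 4) oo fps_X ^ 4)" .
  have "fev D z = of_rat 1 * z ^ 0 * fev R (z ^ 4) + of_rat 2 * z ^ 1 * fev R (z ^ 4)
      + of_rat 4 * z ^ 3 * fev D (z ^ 4) + of_rat 4 * z ^ 4 * fev D (z ^ 4)
      + of_rat 4 * z ^ 5 * fev D (z ^ 4) + of_rat (- 4) * z ^ 3 * fev R4 (z ^ 4)
      + of_rat (- 16) * z ^ 19 * fev (D oo fps_X ^ 4) (z ^ 4)"
    by (subst Deq) (rule conjunct2[OF plus[OF plus[OF plus[OF plus[OF plus[OF plus[OF tm[OF c] tm[OF c]] tm[OF cD]] tm[OF cD]] tm[OF cD]] tm[OF c4]] tm[OF cD4]]])
  thus ?B by (simp add: R4_def D_def algebra_simps power2_eq_square numeral_eq_Suc of_rat_minus)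
qed

lemma rfps_functional_equation:
  fixes F :: "int fps"
  assumes "F = (1 + fps_X + fps_X ^ 2) * (F oo fps_X ^ 4) - fps_X ^ 4 * (F oo fps_X ^ 16)"
  shows "rfps F = (1 + fps_X + fps_X ^ 2) * (rfps F oo fps_X ^ 4) - fps_X ^ 4 * (rfps F oo fps_X ^ 16)"
  using arg_cong[OF assms, of rfps] by (simp add: rhom_simps[OF rhom_rfps] rfps_compose rfps_X)

theorem theorem1p2:
  fixes F :: "int fps" and f :: "complex fps" and \<alpha> :: complex
  assumes "fps_nth F 0 = 1"
    and "F = (1 + fps_X + fps_X ^ 2) * (F oo fps_X ^ 4) - fps_X ^ 4 * (F oo fps_X ^ 16)"
    and "f = complex_fps_of_int_fps F"
    and "algebraic \<alpha>" and "\<alpha> \<noteq> 0" and "norm \<alpha> < 1"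
  shows "algebraically_independent_over_rat
           [eval_fps f \<alpha>, eval_fps f (\<alpha> ^ 4),
            eval_fps (fps_deriv f) \<alpha>, eval_fps (fps_deriv f) (\<alpha> ^ 4)]"
proof -
  define R where "R = rfps F"
  define D where "D = fps_deriv R"
  have f: "f = cfps R" by (simp add: assms(3) R_def complex_fps_of_int_fps_def cfps_def rfps_def)
  have f': "fps_deriv f = cfps D" by (simp add: f D_def fps_eq_iff of_rat_mult of_rat_add)
  have R0: "fps_nth R 0 = 1" using assms(1) by (simp add: R_def rfps_def)
  have Req: "R = (1 + fps_X + fps_X ^ 2) * (R oo fps_X ^ 4) - fps_X ^ 4 * (R oo fps_X ^ 16)"
    unfolding R_def by (rule rfps_functional_equation[OF assms(2)])
  have c: "conv1 R" using functional_equation_conv_radius[OF assms(1,2)] unfolding conv1_def f[symmetric] assms(3) .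
  have cD: "conv1 D" unfolding D_def by (rule conv1_deriv[OF c])
  have c4: "conv1 (R oo fps_X ^ 4)" "conv1 (D oo fps_X ^ 4)" by (simp_all add: conv1_compose_X_power c cD)
  define g where "g = tup4 R (R oo fps_X ^ 4) D (D oo fps_X ^ 4)"
  interpret mahler_system \<alpha> system_matrix g
  proof
    show "algebraic \<alpha>" "\<alpha> \<noteq> 0" "norm \<alpha> < 1" by (fact assms)+
    show "conv1 (g i)" for i using c cD c4 by (simp add: g_def tup4_def)
    show "fev (g i) z = (\<Sum>j<4. pev of_int z (system_matrix i j) * fev (g j) (z ^ 4))" if "i < 4" "norm z < 1" for i z
      unfolding system_matrix_sum
      using fev_functional_equations[OF c Req that(2)] fev_compose_X_power[OF c _ that(2), of 4] fev_compose_X_power[OF cD _ that(2), of 4]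
      by (simp add: g_def tup4_def D_def[symmetric])
    show "\<exists>x. \<forall>i<4. (\<Sum>j<4. pev of_int z (system_matrix i j) * x j) = (t i :: complex)" if z: "z \<noteq> 0" for z t
    proof -
      \<comment> \<open>Rows 1 and 3 give \<open>x 0\<close> and \<open>x 2\<close>; rows 0 and 2
        then determine \<open>x 1\<close> and \<open>x 3\<close> by division by \<open>z ^ 4\<close>
        and \<open>16 * z ^ 19\<close>.\<close>
      define x1 where "x1 = ((1 + z + z\<^sup>2) * t 1 - t 0) / z ^ 4"
      define x3 where "x3 = ((1 + 2 * z) * t 1 - 4 * z ^ 3 * x1 + 4 * z ^ 3 * (1 + z + z\<^sup>2) * t 3 - t 2) / (16 * z ^ 19)"
      have "z ^ 4 * x1 = (1 + z + z\<^sup>2) * t 1 - t 0" using z by (simp add: x1_def)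
      moreover have "16 * z ^ 19 * x3 = (1 + 2 * z) * t 1 - 4 * z ^ 3 * x1 + 4 * z ^ 3 * (1 + z + z\<^sup>2) * t 3 - t 2"
        using z by (simp add: x3_def)
      ultimately have "(\<Sum>j<4. pev of_int z (system_matrix i j) * tup4 (t 1) x1 (t 3) x3 j) = t i" if "i < 4" for i
        unfolding system_matrix_sum using less_4_cases[OF that] by (auto simp: tup4_def)
      thus ?thesis by blast
    qed
    show "p = 0" if "ev4 fps_const fps_X g p = 0" for p
      using functional_independence[OF R0 Req] that by (simp add: g_def D_def)
  qed
  have ev: "[eval_fps f \<alpha>, eval_fps f (\<alpha> ^ 4), eval_fps (fps_deriv f) \<alpha>, eval_fps (fps_deriv f) (\<alpha> ^ 4)] ! i = fev (g i) \<alpha>"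
    if "i \<in> {..<4}" for i
    using less_4_cases[of i] that fev_compose_X_power[OF c _ assms(6), of 4] fev_compose_X_power[OF cD _ assms(6), of 4]
    by (auto simp: g_def tup4_def f' fev_def) (simp_all add: f)
  show ?thesis unfolding algebraically_independent_over_rat_def
  proof (intro allI impI)
    fix P :: rat_mpoly
    assume P: "rat_mpoly_vars P \<subseteq> {..<length [eval_fps f \<alpha>, eval_fps f (\<alpha> ^ 4), eval_fps (fps_deriv f) \<alpha>, eval_fps (fps_deriv f) (\<alpha> ^ 4)]}"
      and ev0: "rat_mpoly_eval P (\<lambda>i. [eval_fps f \<alpha>, eval_fps f (\<alpha> ^ 4), eval_fps (fps_deriv f) \<alpha>, eval_fps (fps_deriv f) (\<alpha> ^ 4)] ! i) = 0"
    have P4: "rat_mpoly_vars P \<subseteq> {..<4}" using P by (simp add: numeral_eq_Suc)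
    have "rat_mpoly_eval P (\<lambda>i. fev (g i) \<alpha>) = 0" using ev0 rat_mpoly_eval_cong[OF P4 ev] by simp
    thus "P = 0" by (rule values_algebraically_independent[OF P4])
  qed
qed

end
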